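(* Let $q,q'\in\widehat{Q}$. Then there is an isomorphism of vector spaces $$\mathrm{Hom}_{\mathcal{C}}(X_q,X_{q'})\cong\Pi_{\widehat{Q}}(q,q').$$
   Context: Work over $\mathbb{C}$. $G\subset \mathrm{SU}(2)$ is a finite subgroup containing $-I$. $V=\mathbb{C}^2$ is the tautological representation. $I$ is the set of isomorphism classes of irreducible complex representations of $G$; $X_i$ is the representation corresponding to $i\in I$; its parity $p(i)\in\mathbb{Z}/2$ is defined by: $-I$ acts on $X_i$ by $(-1)^{p(i)}$. $n(i,j)=\dim \mathrm{Hom}_G(X_i,X_j\otimes V)$ is the number of edges between $i$ and $j$ in the McKay graph $Q$ with vertex set $I$. $G$ acts on $\mathbb{P}^1=\mathbb{P}(V^* )$, and each $\mathcal{O}(n)$ has its standard equivariant structure, with $\Gamma(\mathcal{O}(n))=S^nV$ for $n\ge 0$. $\mathcal{C}$ is the category of $G$-equivariant coherent sheaves on $\mathbb{P}^1$ on which $-I$ acts (through the equivariant structure) as the identity. $\widehat{Q}$ is the quiver with vertex set $\{(i,n): i\in I,\ n\in\mathbb{Z},\ n\equiv p(i)\pmod 2\}$; for $q=(i,n)$ put $X_q=X_i(n)=\mathcal{O}(n)\otimes_{\mathbb{C}}X_i\in\mathcal{C}$ and $q(2)=(i,n+2)$. For $q=(i,n)$, $q'=(j,n+1)$, the edges $q\to q'$ are the elements of a fixed basis of $\mathrm{Hom}_{\mathcal{C}}(X_q,X_{q'})\cong\mathrm{Hom}_G(X_i,X_j\otimes V)$ (so there are $n(i,j)$ of them); there are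 no other edges. $\mathrm{Path}_{\widehat{Q}}(q,q')$ is the vector space spanned by paths from $q$ to $q'$, and $\mathrm{Path}_{\widehat{Q}}=\bigoplus_{q,q'}\mathrm{Path}_{\widehat{Q}}(q,q')$ is the path algebra; in particular, for $q=(i,n)$ and $q'=(j,n+1)$, $\mathrm{Path}_{\widehat{Q}}(q,q')$ is identified with $\mathrm{Hom}_{\mathcal{C}}(X_q,X_{q'})$. There is a perfect pairing $\mathrm{Hom}_G(X_i,X_j\otimes V)\otimes\mathrm{Hom}_G(X_j,X_i\otimes V)\to\mathbb{C}$ sending $\varphi\otimes\psi$ to the scalar by which the composition $X_i\xrightarrow{\varphi}X_j\otimes V\xrightarrow{\psi\otimes 1}X_i\otimes V^{\otimes 2}\xrightarrow{1\otimes ev}X_i$ acts, where $ev\colon V^{\otimes 2}\to\mathbb{C}$ is a nonzero $\mathrm{SU}(2)$-invariant pairing (unique up to a constant); it identifies $\mathrm{Hom}_{\mathcal{C}}(X_i(n),X_j(n+1))$ with the dual of $\mathrm{Hom}_{\mathcal{C}}(X_j(n+1),X_i(n+2))$. For $q=(i,n)$ let $\theta_q\in\mathrm{Path}_{\widehat{Q}}(q,q(2))$ be $\theta_q=\sum_{q'}\sum_k e^k e_k$ (path $e_k$ followed by $e^k$), where $q'$ runs over the vertices $(j,n+1)$ with $j$ adjacent to $i$, and $\{e_k\}$, $\{e^k\}$ are dual bases of $\mathrm{Hom}_{\mathcal{C}}(X_q,X_{q'})$ and $\mathrm{Hom}_{\mathcal{C}}(X_{q'},X_{q(2)})$ with respect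 to this pairing. Finally $\Pi_{\widehat{Q}}=\mathrm{Path}_{\widehat{Q}}/(\theta_q)_{q\in\widehat{Q}}$ is the quotient by the two-sided ideal generated by all $\theta_q$, and $\Pi_{\widehat{Q}}(q,q')$ is the image of $\mathrm{Path}_{\widehat{Q}}(q,q')$ in it. *)

theory Defs
  imports
    "HOL-Algebra.AbelCoset"
    "HOL-Library.Poly_Mapping"
    "Jordan_Normal_Form.VS_Connect"
    "Jordan_Normal_Form.Schur_Decomposition"
    "Graph_Theory.Arc_Walk"
begin

section \<open>Representations\<close>

definition GL :: "nat \<Rightarrow> complex mat monoid" where
  "GL d = units_of (ring_mat TYPE(complex) d ())"

definition SU2 :: "complex mat set" where
  "SU2 = {A \<in> carrier_mat 2 2. A * mat_adjoint A = 1\<^sub>m 2 \<and> det A = 1}"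

text \<open>A representation of a matrix group \<open>G\<close> on the column vectors \<open>carrier_vec d\<close> is a function
  on matrices of which only the values on \<open>G\<close> matter.\<close>

definition is_rep :: "complex mat set \<Rightarrow> nat \<Rightarrow> (complex mat \<Rightarrow> complex mat) \<Rightarrow> bool" where
  "is_rep G d \<rho> \<longleftrightarrow> \<rho> \<in> hom ((GL 2)\<lparr>carrier := G\<rparr>) (GL d)"

definition irreducible_rep :: "complex mat set \<Rightarrow> nat \<Rightarrow> (complex mat \<Rightarrow> complex mat) \<Rightarrow> bool" where
  "irreducible_rep G d \<rho> \<longleftrightarrow> is_rep G d \<rho> \<and> d \<noteq> 0 \<and>
     (\<forall>W. VectorSpace.subspace class_ring W (module_vec TYPE(complex) d) \<and>
          (\<forall>g\<in>G. \<forall>w\<in>W. \<rho> g *\<^sub>v w \<in> W)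
        \<longrightarrow> W = {0\<^sub>v d} \<or> W = carrier_vec d)"

definition Hom_G :: "complex mat set \<Rightarrow> nat \<Rightarrow> (complex mat \<Rightarrow> complex mat) \<Rightarrow>
    nat \<Rightarrow> (complex mat \<Rightarrow> complex mat) \<Rightarrow> (complex, complex mat) module" where
  "Hom_G G d \<rho> d' \<rho>' = (module_mat TYPE(complex) d' d)
     \<lparr>carrier := {T \<in> carrier_mat d' d. \<forall>g\<in>G. T * \<rho> g = \<rho>' g * T}\<rparr>"

definition rep_iso :: "complex mat set \<Rightarrow> nat \<Rightarrow> (complex mat \<Rightarrow> complex mat) \<Rightarrow>
    nat \<Rightarrow> (complex mat \<Rightarrow> complex mat) \<Rightarrow> bool" where
  "rep_iso G d \<rho> d' \<rho>' \<longleftrightarrow> (\<exists>T \<in> carrier (Hom_G G d \<rho> d' \<rho>'). invertible_mat T)"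

text \<open>The Kronecker product, i.e. the matrix of \<open>A \<otimes> B\<close> in the lexicographically ordered bases
  of the tensor products. It is strictly associative.\<close>

definition kron :: "complex mat \<Rightarrow> complex mat \<Rightarrow> complex mat" where
  "kron A B = mat (dim_row A * dim_row B) (dim_col A * dim_col B)
     (\<lambda>(i, j). A $$ (i div dim_row B, j div dim_col B) * B $$ (i mod dim_row B, j mod dim_col B))"


section \<open>Equivariant sheaves on the projective line\<close>

text \<open>The projective line is \<open>\<P>(V\<^sup>*)\<close>, the set of lines in the dual of \<open>V = \<complex>\<^sup>2\<close>. A functional
  \<open>\<xi>\<close> is given by its vector of coordinates in the dual basis. A subset of \<open>\<P>(V\<^sup>*)\<close> is represented
  by its preimage in \<open>V\<^sup>* - {0}\<close>, and a section of \<open>\<O>(n)\<close> over it by a function on that preimage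
  which is homogeneous of degree \<open>n\<close>; the linear coordinates, that is the elements of \<open>V\<close>, are
  thus global sections of \<open>\<O>(1)\<close>.\<close>

definition homog_poly :: "nat \<Rightarrow> (complex vec \<Rightarrow> complex) \<Rightarrow> bool" where
  "homog_poly a p \<longleftrightarrow>
     (\<exists>c. \<forall>\<xi>\<in>carrier_vec 2. p \<xi> = (\<Sum>k\<le>a. c k * (\<xi> $ 0) ^ k * (\<xi> $ 1) ^ (a - k)))"

definition zariski_open :: "complex vec set \<Rightarrow> bool" where
  "zariski_open U \<longleftrightarrow> (\<exists>S. (\<forall>p\<in>S. \<exists>a. homog_poly a p) \<and>
     U = {\<xi> \<in> carrier_vec 2 - {0\<^sub>v 2}. \<exists>p\<in>S. p \<xi> \<noteq> 0})"

text \<open>Sections are extended by zero outside \<open>U\<close>, so that they are determined by their values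
  on \<open>U\<close>. The structure sheaf is \<open>\<O>(0)\<close>.\<close>

definition O_sections :: "int \<Rightarrow> complex vec set \<Rightarrow> (complex vec \<Rightarrow> complex) set" where
  "O_sections n U = {f. (\<forall>\<xi>. \<xi> \<notin> U \<longrightarrow> f \<xi> = 0) \<and>
     (\<forall>\<xi>\<in>U. \<exists>W a b p r. zariski_open W \<and> \<xi> \<in> W \<and> W \<subseteq> U \<and>
        homog_poly a p \<and> homog_poly b r \<and> int a - int b = n \<and>
        (\<forall>\<eta>\<in>W. r \<eta> \<noteq> 0 \<and> f \<eta> = p \<eta> / r \<eta>))}"

text \<open>Sections of \<open>\<O>(n) \<otimes> X\<close> for \<open>X = \<complex>\<^sup>d\<close>.\<close>

type_synonym sheaf_sec = "complex vec \<Rightarrow> complex vec"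

definition sections :: "int \<Rightarrow> nat \<Rightarrow> complex vec set \<Rightarrow> sheaf_sec set" where
  "sections n d U = {s. (\<forall>\<xi>. s \<xi> \<in> carrier_vec d) \<and> (\<forall>k<d. (\<lambda>\<xi>. s \<xi> $ k) \<in> O_sections n U)}"

definition res_sec :: "nat \<Rightarrow> complex vec set \<Rightarrow> sheaf_sec \<Rightarrow> sheaf_sec" where
  "res_sec d W s = (\<lambda>\<xi>. if \<xi> \<in> W then s \<xi> else 0\<^sub>v d)"

text \<open>\<open>G\<close> acts on \<open>V\<^sup>*\<close> by \<open>g \<xi> = \<xi> \<circ> g\<^sup>-\<^sup>1\<close>, so \<open>g\<^sup>-\<^sup>1 \<xi> = \<xi> \<circ> g\<close> has the coordinate vector
  \<open>transpose_mat g *\<^sub>v \<xi>\<close>. Then \<open>act_open g U\<close> is \<open>g U\<close>, and the equivariant structure of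
  \<open>\<O>(n) \<otimes> X\<close> sends the section \<open>s\<close> over \<open>U\<close> to the section \<open>\<xi> \<mapsto> g (s (g\<^sup>-\<^sup>1 \<xi>))\<close> over \<open>g U\<close>.\<close>

definition act_open :: "complex mat \<Rightarrow> complex vec set \<Rightarrow> complex vec set" where
  "act_open g U = {\<xi> \<in> carrier_vec 2. transpose_mat g *\<^sub>v \<xi> \<in> U}"

definition act_sec :: "nat \<Rightarrow> (complex mat \<Rightarrow> complex mat) \<Rightarrow> complex mat \<Rightarrow> sheaf_sec \<Rightarrow> sheaf_sec" where
  "act_sec d \<rho> g s =
     (\<lambda>\<xi>. if \<xi> \<in> carrier_vec 2 then \<rho> g *\<^sub>v s (transpose_mat g *\<^sub>v \<xi>) else 0\<^sub>v d)"

type_synonym sheaf_mor = "complex vec set \<Rightarrow> sheaf_sec \<Rightarrow> sheaf_sec"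

text \<open>Morphisms \<open>\<O>(n) \<otimes> X \<rightarrow> \<O>(n') \<otimes> X'\<close> of \<open>G\<close>-equivariant \<open>\<O>\<close>-modules: families of \<open>\<O>(U)\<close>-linear
  maps on sections that are compatible with restriction and with the action of \<open>G\<close>. The category of
  equivariant coherent sheaves on which \<open>-1\<close> acts trivially is a full subcategory of all
  equivariant \<open>\<O>\<close>-modules, so between two of its objects these are all the morphisms.
  The last condition fixes the irrelevant values outside the domain.\<close>

definition equivariant_morphism :: "complex mat set \<Rightarrow>
    int \<Rightarrow> nat \<Rightarrow> (complex mat \<Rightarrow> complex mat) \<Rightarrow>
    int \<Rightarrow> nat \<Rightarrow> (complex mat \<Rightarrow> complex mat) \<Rightarrow> sheaf_mor \<Rightarrow> bool" where
  "equivariant_morphism G n d \<rho> n' d' \<rho>' \<phi> \<longleftrightarrow>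
     (\<forall>U. zariski_open U \<longrightarrow>
        (\<forall>s\<in>sections n d U.
           \<phi> U s \<in> sections n' d' U \<and>
           (\<forall>t\<in>sections n d U. \<phi> U (\<lambda>\<xi>. s \<xi> + t \<xi>) = (\<lambda>\<xi>. \<phi> U s \<xi> + \<phi> U t \<xi>)) \<and>
           (\<forall>f\<in>O_sections 0 U. \<phi> U (\<lambda>\<xi>. f \<xi> \<cdot>\<^sub>v s \<xi>) = (\<lambda>\<xi>. f \<xi> \<cdot>\<^sub>v \<phi> U s \<xi>)) \<and>
           (\<forall>W. zariski_open W \<and> W \<subseteq> U \<longrightarrow> \<phi> W (res_sec d W s) = res_sec d' W (\<phi> U s)) \<and>
           (\<forall>g\<in>G. \<phi> (act_open g U) (act_sec d \<rho> g s) = act_sec d' \<rho>' g (\<phi> U s)))) \<and>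
     (\<forall>U s. \<not> (zariski_open U \<and> s \<in> sections n d U) \<longrightarrow> \<phi> U s = (\<lambda>_. 0\<^sub>v d'))"

definition Hom_eq :: "complex mat set \<Rightarrow>
    int \<Rightarrow> nat \<Rightarrow> (complex mat \<Rightarrow> complex mat) \<Rightarrow>
    int \<Rightarrow> nat \<Rightarrow> (complex mat \<Rightarrow> complex mat) \<Rightarrow> (complex, sheaf_mor) module" where
  "Hom_eq G n d \<rho> n' d' \<rho>' = \<lparr>
     carrier = {\<phi>. equivariant_morphism G n d \<rho> n' d' \<rho>' \<phi>},
     monoid.mult = undefined,
     one = undefined,
     zero = (\<lambda>U s \<xi>. 0\<^sub>v d'),
     add = (\<lambda>\<phi> \<psi> U s \<xi>. \<phi> U s \<xi> + \<psi> U s \<xi>),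
     module.smult = (\<lambda>c \<phi> U s \<xi>. c \<cdot>\<^sub>v \<phi> U s \<xi>)\<rparr>"


section \<open>The McKay graph and the quiver\<close>

text \<open>\<open>I\<close> indexes the isomorphism classes of irreducible representations of \<open>G\<close>, and \<open>X\<^sub>i\<close>
  is \<open>\<complex>\<^sup>d\<close> with \<open>d = dg i\<close> and the action \<open>\<rho> i\<close>.\<close>

locale mckay =
  fixes G :: "complex mat set"
    and I :: "'i set"
    and dg :: "'i \<Rightarrow> nat"
    and \<rho> :: "'i \<Rightarrow> complex mat \<Rightarrow> complex mat"
  assumes finite_G: "finite G"
    and subgroup_G: "subgroup G (GL 2)"
    and G_SU2: "G \<subseteq> SU2"
    and minus_one: "- 1\<^sub>m 2 \<in> G"
    and irreps: "\<And>i. i \<in> I \<Longrightarrow> irreducible_rep G (dg i) (\<rho> i)"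
    and irreps_complete: "\<And>d \<sigma>. irreducible_rep G d \<sigma> \<Longrightarrow> \<exists>!i. i \<in> I \<and> rep_iso G d \<sigma> (dg i) (\<rho> i)"
begin

definition parity :: "'i \<Rightarrow> nat" where
  "parity i = (THE p. p < 2 \<and> \<rho> i (- 1\<^sub>m 2) = (- 1) ^ p \<cdot>\<^sub>m 1\<^sub>m (dg i))"

text \<open>\<open>Hom\<^sub>G(X\<^sub>i, X\<^sub>j \<otimes> V)\<close> and its dimension \<open>n(i, j)\<close>.\<close>

definition HomV :: "'i \<Rightarrow> 'i \<Rightarrow> (complex, complex mat) module" where
  "HomV i j = Hom_G G (dg i) (\<rho> i) (dg j * 2) (\<lambda>g. kron (\<rho> j g) g)"

definition num_edges :: "'i \<Rightarrow> 'i \<Rightarrow> nat" where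
  "num_edges i j = vectorspace.dim class_ring (HomV i j)"

definition Qhat_verts :: "('i \<times> int) set" where
  "Qhat_verts = {(i, n). i \<in> I \<and> n mod 2 = int (parity i)}"

definition HomC :: "'i \<times> int \<Rightarrow> 'i \<times> int \<Rightarrow> (complex, sheaf_mor) module" where
  "HomC q q' = Hom_eq G (snd q) (dg (fst q)) (\<rho> (fst q)) (snd q') (dg (fst q')) (\<rho> (fst q'))"

text \<open>The isomorphism \<open>Hom\<^sub>G(X\<^sub>i, X\<^sub>j \<otimes> V) \<cong> Hom(X\<^sub>i(n), X\<^sub>j(n+1))\<close>: apply \<open>T\<close> and
  multiply the tensor factor in \<open>V\<close>, as a section of \<open>\<O>(1)\<close>, into \<open>\<O>(n)\<close>. At the point \<open>\<xi>\<close> this is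
  contraction of \<open>V\<close> with the functional \<open>\<xi>\<close>, whose matrix is the row \<open>\<xi>\<close>.\<close>

definition induced_mor :: "'i \<times> int \<Rightarrow> 'i \<times> int \<Rightarrow> complex mat \<Rightarrow> sheaf_mor" where
  "induced_mor q q' T = (\<lambda>U s.
     if zariski_open U \<and> s \<in> sections (snd q) (dg (fst q)) U
     then (\<lambda>\<xi>. if \<xi> \<in> U then (kron (1\<^sub>m (dg (fst q'))) (mat_of_rows 2 [\<xi>]) * T) *\<^sub>v s \<xi>
               else 0\<^sub>v (dg (fst q')))
     else (\<lambda>\<xi>. 0\<^sub>v (dg (fst q'))))"

end

text \<open>The invariant pairing \<open>V \<otimes> V \<rightarrow> \<complex>\<close> is given by its \<open>1 \<times> 4\<close> matrix \<open>ev\<close>; \<open>E q q'\<close> is the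
  fixed basis of the space of morphisms from \<open>X\<^sub>q\<close> to \<open>X\<^sub>q\<^sub>'\<close>.\<close>

locale mckay_quiver = mckay G I dg \<rho>
  for G :: "complex mat set" and I :: "'i set" and dg \<rho> +
  fixes ev :: "complex mat"
    and E :: "'i \<times> int \<Rightarrow> 'i \<times> int \<Rightarrow> sheaf_mor set"
  assumes ev_carrier: "ev \<in> carrier_mat 1 4"
    and ev_nonzero: "ev \<noteq> 0\<^sub>m 1 4"
    and ev_invariant: "\<And>g. g \<in> SU2 \<Longrightarrow> ev * kron g g = ev"
    and E_basis: "\<And>q q'. q \<in> Qhat_verts \<Longrightarrow> q' \<in> Qhat_verts \<Longrightarrow> snd q' = snd q + 1 \<Longrightarrow>
      vectorspace.basis class_ring (HomC q q') (E q q')"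
begin

text \<open>The scalar by which \<open>(1 \<otimes> ev) (\<psi> \<otimes> 1) \<phi>\<close> acts on \<open>X\<^sub>i\<close>.\<close>

definition pairing :: "'i \<Rightarrow> complex mat \<Rightarrow> complex mat \<Rightarrow> complex" where
  "pairing i \<phi> \<psi> =
     (THE c. kron (1\<^sub>m (dg i)) ev * kron \<psi> (1\<^sub>m 2) * \<phi> = c \<cdot>\<^sub>m 1\<^sub>m (dg i))"

definition shift2 :: "'i \<times> int \<Rightarrow> 'i \<times> int" where
  "shift2 q = (fst q, snd q + 2)"

definition pairingC :: "'i \<times> int \<Rightarrow> 'i \<times> int \<Rightarrow> sheaf_mor \<Rightarrow> sheaf_mor \<Rightarrow> complex" where
  "pairingC q q' a b = pairing (fst q)
     (the_inv_into (carrier (HomV (fst q) (fst q'))) (induced_mor q q') a)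
     (the_inv_into (carrier (HomV (fst q') (fst q))) (induced_mor q' (shift2 q)) b)"

definition Qhat :: "('i \<times> int, ('i \<times> int) \<times> sheaf_mor \<times> ('i \<times> int)) pre_digraph" where
  "Qhat = \<lparr>verts = Qhat_verts,
     arcs = {(q, e, q'). q \<in> Qhat_verts \<and> q' \<in> Qhat_verts \<and> snd q' = snd q + 1 \<and> e \<in> E q q'},
     tail = fst,
     head = snd \<circ> snd\<rparr>"

end

type_synonym 'v qpath = "'v \<times> ('v \<times> sheaf_mor \<times> 'v) list \<times> 'v"

context mckay_quiver
begin

text \<open>A path is the triple of its start, its list of arcs in the order of travel, and its end;
  in particular there is a trivial path at every vertex.\<close>

definition paths :: "'i \<times> int \<Rightarrow> 'i \<times> int \<Rightarrow> ('i \<times> int) qpath set" where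
  "paths q q' = {(q, p, q') | p. pre_digraph.awalk Qhat q p q'}"

text \<open>In the product \<open>y x\<close> of two paths, \<open>x\<close> is travelled first. The quiver has infinitely many
  vertices, so the algebra has no unit.\<close>

definition path_mult ::
    "(('i \<times> int) qpath \<Rightarrow>\<^sub>0 complex) \<Rightarrow> (('i \<times> int) qpath \<Rightarrow>\<^sub>0 complex) \<Rightarrow>
     (('i \<times> int) qpath \<Rightarrow>\<^sub>0 complex)" where
  "path_mult b a =
     (\<Sum>(y, x) \<in> Poly_Mapping.keys b \<times> Poly_Mapping.keys a.
        if snd (snd x) = fst y
        then Poly_Mapping.single (fst x, fst (snd x) @ fst (snd y), snd (snd y))
               (Poly_Mapping.lookup b y * Poly_Mapping.lookup a x)
        else 0)"

definition path_algebra :: "(complex, ('i \<times> int) qpath \<Rightarrow>\<^sub>0 complex) module" where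
  "path_algebra = \<lparr>
     carrier = {a. Poly_Mapping.keys a \<subseteq> (\<Union>q. \<Union>q'. paths q q')},
     monoid.mult = path_mult,
     one = undefined,
     zero = 0,
     add = (+),
     module.smult = (\<lambda>c. Poly_Mapping.map ((*) c))\<rparr>"

definition Path :: "'i \<times> int \<Rightarrow> 'i \<times> int \<Rightarrow> (('i \<times> int) qpath \<Rightarrow>\<^sub>0 complex) set" where
  "Path q q' = {a. Poly_Mapping.keys a \<subseteq> paths q q'}"

text \<open>The identification of the morphisms \<open>X\<^sub>q \<rightarrow> X\<^sub>q\<^sub>'\<close> with \<open>Path q q'\<close> for \<open>q' = (j, n + 1)\<close>:
  expand in the basis \<open>E q q'\<close>.\<close>

definition as_path :: "'i \<times> int \<Rightarrow> 'i \<times> int \<Rightarrow> sheaf_mor \<Rightarrow> (('i \<times> int) qpath \<Rightarrow>\<^sub>0 complex)" where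
  "as_path q q' \<phi> =
     (let c = (SOME c. \<phi> = module.lincomb (HomC q q') c (E q q'))
      in \<Sum>e\<in>E q q'. Poly_Mapping.single (q, [(q, e, q')], q') (c e))"

definition dual_elem :: "'i \<times> int \<Rightarrow> 'i \<times> int \<Rightarrow> sheaf_mor \<Rightarrow> sheaf_mor" where
  "dual_elem q q' e = (THE b. b \<in> carrier (HomC q' (shift2 q)) \<and>
     (\<forall>e'\<in>E q q'. pairingC q q' e' b = (if e' = e then 1 else 0)))"

text \<open>The sum of \<open>e\<^sup>k e\<^sub>k\<close> does not depend on the choice of the dual bases; here the basis of the
  first space is \<open>E q q'\<close>.\<close>

definition \<theta> :: "'i \<times> int \<Rightarrow> (('i \<times> int) qpath \<Rightarrow>\<^sub>0 complex)" where
  "\<theta> q = (\<Sum>q' | q' \<in> Qhat_verts \<and> snd q' = snd q + 1 \<and> num_edges (fst q) (fst q') \<noteq> 0.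
            \<Sum>e\<in>E q q'. path_mult (as_path q' (shift2 q) (dual_elem q q' e)) (as_path q q' e))"

definition two_sided_ideal :: "(('i \<times> int) qpath \<Rightarrow>\<^sub>0 complex) set \<Rightarrow> bool" where
  "two_sided_ideal J \<longleftrightarrow> VectorSpace.subspace class_ring J path_algebra \<and>
     (\<forall>a\<in>carrier path_algebra. \<forall>x\<in>J. path_mult a x \<in> J \<and> path_mult x a \<in> J)"

definition preproj_ideal :: "(('i \<times> int) qpath \<Rightarrow>\<^sub>0 complex) set" where
  "preproj_ideal = two_sided_ideal hull (\<theta> ` Qhat_verts)"

text \<open>The image of \<open>Path q q'\<close> in the quotient of the path algebra by the ideal, with the vector
  space operations of the quotient: its elements are cosets.\<close>

definition Pi_Qhat ::
    "'i \<times> int \<Rightarrow> 'i \<times> int \<Rightarrow> (complex, (('i \<times> int) qpath \<Rightarrow>\<^sub>0 complex) set) module" where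
  "Pi_Qhat q q' = \<lparr>
     carrier = (\<lambda>a. preproj_ideal +>\<^bsub>path_algebra\<^esub> a) ` Path q q',
     monoid.mult = undefined,
     one = undefined,
     zero = preproj_ideal,
     add = (<+>\<^bsub>path_algebra\<^esub>),
     module.smult = (\<lambda>c A. \<Union>a\<in>A. preproj_ideal +>\<^bsub>path_algebra\<^esub> (c \<odot>\<^bsub>path_algebra\<^esub> a))\<rparr>"

end

end

theory Submission
  imports Defs "HOL-Library.Function_Algebras" "Jordan_Normal_Form.Spectral_Radius"
begin

text \<open>Morphisms \<open>X\<^sub>q \<rightarrow> X\<^sub>q\<^sub>'\<close> are equivariant matrices of binary forms of degree \<open>n' - n\<close>.
  Complete reducibility of \<open>X\<^sub>i \<otimes> V\<^sup>*\<close> turns the Koszul resolution on the projective line into an exact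
  sequence \<open>0 \<rightarrow> Hom(X\<^sub>i(n+2), X) \<rightarrow> \<Oplus> Hom(X\<^sub>k(n+1), X) \<rightarrow> Hom(X\<^sub>i(n), X)\<close>, the sum running over the
  arrows out of \<open>(i, n)\<close>, whose last map is onto unless \<open>X = X\<^sub>j(n)\<close>. Evaluate a path as the composite
  of its arrows, each multiplied by the dimension of the representation at its target; the dual
  arrows are dual with respect to traces normalised by dimension, so without these factors \<open>\<theta>\<close> would
  not evaluate to zero. Induction on the length with the exact sequence shows that evaluation is onto
  and that its kernel is the ideal generated by the \<open>\<theta>\<close>: the map from the first term accounts
  exactly for the left multiples of \<open>\<theta>\<close>.\<close>

section \<open>Finitely supported matrices\<close>

text \<open>The Hom spaces consist of families of maps over all Zariski open sets, so the geometry
  is eliminated at the start: a global section of \<open>O(N)\<close> is a form because denominators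
  cancel, and a morphism is determined by its values on frames over two charts. Exactness of the
  Koszul sequence is a statement about pairs of forms, proved entrywise without the group; averaging
  over \<open>G\<close> makes it equivariant, since averaging commutes with multiplication by an
  equivariant matrix. Complete reducibility enters as a finite resolution of the identity, and this
  is also where finiteness of the set of arrows at a vertex comes from.

  The weights can be computed. Let \<open>i\<close> be a vertex and \<open>k\<close> a neighbour.
  The dual pencils natural for the exact sequence are normalised by an identity on
  \<open>X_k\<close>, the given pairing by a scalar on \<open>X_i\<close>, so the dual basis is
  \<open>dg i / (lam * dg k)\<close> times the dual pencils. The weights \<open>dg k\<close> and
  \<open>dg i\<close> of the two arrows turn this into \<open>dg i * dg i / lam\<close>, the same
  for every summand of \<open>\<theta>\<close>.\<close>

text \<open>Matrices of all sizes are embedded into the ring of finitely supported infinite matrices, so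
  that products of matrices of different sizes live in one type and sums need no dimension.\<close>

typedef fmat = "{f :: nat \<Rightarrow> nat \<Rightarrow> complex. \<exists>N. \<forall>i j. N \<le> i \<or> N \<le> j \<longrightarrow> f i j = 0}"
  morphisms ent Abs_fmat
  by (rule exI[of _ "\<lambda>_ _. 0"]) auto

lemma fmat_eqI: "(\<And>i j. ent A i j = ent B i j) \<Longrightarrow> A = B"
  by (metis ent_inject ext)

lemma ent_bound: "\<exists>N. \<forall>i j. N \<le> i \<or> N \<le> j \<longrightarrow> ent A i j = 0"
  using ent[of A] by auto

lemma ent_Abs: "(\<And>i j. N \<le> i \<or> N \<le> j \<Longrightarrow> f i j = 0) \<Longrightarrow> ent (Abs_fmat f) = f"
  by (rule Abs_fmat_inverse) auto

instantiation fmat :: ab_group_add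
begin

definition "0 = Abs_fmat (\<lambda>_ _. 0)"
definition "A + B = Abs_fmat (\<lambda>i j. ent A i j + ent B i j)"
definition "- A = Abs_fmat (\<lambda>i j. - ent A i j)"
definition "A - B = Abs_fmat (\<lambda>i j. ent A i j - ent B i j)"

lemma ent_zero [simp]: "ent 0 i j = 0"
  unfolding zero_fmat_def by (subst ent_Abs[of 0]) auto

lemma ent_add [simp]: "ent (A + B) i j = ent A i j + ent B i j"
proof -
  obtain N M where "\<forall>i j. N \<le> i \<or> N \<le> j \<longrightarrow> ent A i j = 0" "\<forall>i j. M \<le> i \<or> M \<le> j \<longrightarrow> ent B i j = 0"
    using ent_bound by metis
  then show ?thesis
    unfolding plus_fmat_def by (subst ent_Abs[of "max N M"]) auto
qed

lemma ent_uminus [simp]: "ent (- A) i j = - ent A i j"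
proof -
  obtain N where "\<forall>i j. N \<le> i \<or> N \<le> j \<longrightarrow> ent A i j = 0"
    using ent_bound by metis
  then show ?thesis
    unfolding uminus_fmat_def by (subst ent_Abs[of N]) auto
qed

lemma ent_minus [simp]: "ent (A - B) i j = ent A i j - ent B i j"
proof -
  obtain N M where "\<forall>i j. N \<le> i \<or> N \<le> j \<longrightarrow> ent A i j = 0" "\<forall>i j. M \<le> i \<or> M \<le> j \<longrightarrow> ent B i j = 0"
    using ent_bound by metis
  then show ?thesis
    unfolding minus_fmat_def by (subst ent_Abs[of "max N M"]) auto
qed

instance
  by standard (rule fmat_eqI, simp)+

end

instantiation fmat :: ring
begin

text \<open>Summing over the support of a row keeps the sum finite without choosing a size;
  \<open>ent_mult\<close> replaces the support by any bound for the row.\<close>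

definition "A * B = Abs_fmat (\<lambda>i j. \<Sum>k | ent A i k \<noteq> 0. ent A i k * ent B k j)"

lemma ent_mult:
  assumes "\<And>k. N \<le> k \<Longrightarrow> ent A i k = 0"
  shows "ent (A * B) i j = (\<Sum>k<N. ent A i k * ent B k j)"
proof -
  obtain N0 M0 where b: "\<forall>i j. N0 \<le> i \<or> N0 \<le> j \<longrightarrow> ent A i j = 0" "\<forall>i j. M0 \<le> i \<or> M0 \<le> j \<longrightarrow> ent B i j = 0"
    using ent_bound by metis
  have "ent (A * B) = (\<lambda>i j. \<Sum>k | ent A i k \<noteq> 0. ent A i k * ent B k j)"
    unfolding times_fmat_def using b by (subst ent_Abs[of "max N0 M0"]) auto
  moreover have "{k. ent A i k \<noteq> 0} \<subseteq> {..<N}"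
    using assms by (metis (mono_tags) lessThan_iff linorder_not_le mem_Collect_eq subsetI)
  then have "(\<Sum>k | ent A i k \<noteq> 0. ent A i k * ent B k j) = (\<Sum>k<N. ent A i k * ent B k j)"
    by (rule sum.mono_neutral_left[rotated]) auto
  ultimately show ?thesis by simp
qed

instance
proof
  fix A B C :: fmat
  obtain N where A: "\<forall>i j. N \<le> i \<or> N \<le> j \<longrightarrow> ent A i j = 0"
    using ent_bound by metis
  obtain M where B: "\<forall>i j. M \<le> i \<or> M \<le> j \<longrightarrow> ent B i j = 0"
    using ent_bound by metis
  obtain K where "\<forall>i j. K \<le> i \<or> K \<le> j \<longrightarrow> ent (A * B) i j = 0"
    using ent_bound by metis
  then have 1: "\<forall>i j. max K M \<le> i \<or> max K M \<le> j \<longrightarrow> ent (A * B) i j = 0" by simp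
  have 2: "\<forall>i j. max K M \<le> i \<or> max K M \<le> j \<longrightarrow> ent B i j = 0" using B by simp
  define L where "L = max K M"
  have e1: "ent (A * B) i j = (\<Sum>k<N. ent A i k * ent B k j)" for i j and B :: fmat
    using A by (intro ent_mult) simp
  have e2: "ent (A * B * C) i j = (\<Sum>l<L. ent (A * B) i l * ent C l j)" for i j
    using 1 unfolding L_def by (intro ent_mult) blast
  have e3: "ent (B * C) i j = (\<Sum>l<L. ent B i l * ent C l j)" for i j
    using 2 unfolding L_def by (intro ent_mult) blast
  show "A * B * C = A * (B * C)"
  proof (rule fmat_eqI)
    fix i j
    have "ent (A * B * C) i j = (\<Sum>l<L. \<Sum>k<N. ent A i k * ent B k l * ent C l j)"
      by (simp only: e2 e1 sum_distrib_right)
    also have "\<dots> = (\<Sum>k<N. \<Sum>l<L. ent A i k * ent B k l * ent C l j)"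
      by (rule sum.swap)
    also have "\<dots> = ent (A * (B * C)) i j"
      by (simp only: e1 e3 sum_distrib_left mult.assoc)
    finally show "ent (A * B * C) i j = ent (A * (B * C)) i j" .
  qed
  show "A * (B + C) = A * B + A * C"
    by (rule fmat_eqI) (simp add: e1 distrib_left sum.distrib)
  define K' where "K' = max N M"
  have e4: "ent (A * C) i j = (\<Sum>k<K'. ent A i k * ent C k j)"
    "ent (B * C) i j = (\<Sum>k<K'. ent B i k * ent C k j)"
    "ent ((A + B) * C) i j = (\<Sum>k<K'. ent (A + B) i k * ent C k j)" for i j
    by (rule ent_mult, use A B in \<open>simp add: K'_def\<close>)+
  show "(A + B) * C = A * C + B * C"
    by (rule fmat_eqI) (simp add: e4 distrib_right sum.distrib)
qed

end

lemma ent_sum [simp]: "ent (\<Sum>x\<in>S. f x) i j = (\<Sum>x\<in>S. ent (f x) i j)"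
  by (induction S rule: infinite_finite_induct) auto

lemma sum_fun_apply [simp]: "(\<Sum>x\<in>S. f x) y = (\<Sum>x\<in>S. f x y)"
  for f :: "'a \<Rightarrow> 'b \<Rightarrow> 'c :: comm_monoid_add"
  by (induction S rule: infinite_finite_induct) auto

definition fsc :: "complex \<Rightarrow> fmat \<Rightarrow> fmat" (infixr \<open>*\<^sub>F\<close> 75) where
  "c *\<^sub>F A = Abs_fmat (\<lambda>i j. c * ent A i j)"

lemma ent_fsc [simp]: "ent (c *\<^sub>F A) i j = c * ent A i j"
proof -
  obtain N where "\<forall>i j. N \<le> i \<or> N \<le> j \<longrightarrow> ent A i j = 0"
    using ent_bound by metis
  then show ?thesis
    unfolding fsc_def by (subst ent_Abs[of N]) auto
qed

interpretation fsc: vector_space fsc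
  by unfold_locales (auto intro!: fmat_eqI simp: algebra_simps)

lemma fsc_mult_left [simp]: "(c *\<^sub>F A) * B = c *\<^sub>F (A * B)"
proof -
  obtain N where "\<forall>i j. N \<le> i \<or> N \<le> j \<longrightarrow> ent A i j = 0"
    using ent_bound by metis
  then show ?thesis
    by (intro fmat_eqI) (simp add: ent_mult[of N] sum_distrib_left mult_ac)
qed

lemma fsc_mult_right [simp]: "A * (c *\<^sub>F B) = c *\<^sub>F (A * B)"
proof -
  obtain N where "\<forall>i j. N \<le> i \<or> N \<le> j \<longrightarrow> ent A i j = 0"
    using ent_bound by metis
  then show ?thesis
    by (intro fmat_eqI) (simp add: ent_mult[of N] sum_distrib_left mult_ac)
qed

definition fits :: "nat \<Rightarrow> nat \<Rightarrow> fmat \<Rightarrow> bool" where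
  "fits n m A \<longleftrightarrow> (\<forall>i j. n \<le> i \<or> m \<le> j \<longrightarrow> ent A i j = 0)"

definition mk :: "nat \<Rightarrow> nat \<Rightarrow> (nat \<Rightarrow> nat \<Rightarrow> complex) \<Rightarrow> fmat" where
  "mk n m f = Abs_fmat (\<lambda>i j. if i < n \<and> j < m then f i j else 0)"

lemma ent_mk [simp]: "ent (mk n m f) i j = (if i < n \<and> j < m then f i j else 0)"
  unfolding mk_def by (subst ent_Abs[of "max n m"]) auto

lemma fits_mk [simp]: "fits n m (mk n m f)"
  by (simp add: fits_def)

lemma fits_zero [simp]: "fits n m 0"
  by (simp add: fits_def)

lemma fits_add [intro]: "fits n m A \<Longrightarrow> fits n m B \<Longrightarrow> fits n m (A + B)"
  by (auto simp: fits_def)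

lemma fits_diff [intro]: "fits n m A \<Longrightarrow> fits n m B \<Longrightarrow> fits n m (A - B)"
  by (auto simp: fits_def)

lemma fits_uminus [intro]: "fits n m A \<Longrightarrow> fits n m (- A)"
  by (auto simp: fits_def)

lemma fits_fsc [intro]: "fits n m A \<Longrightarrow> fits n m (c *\<^sub>F A)"
  by (auto simp: fits_def)

lemma fits_sum [intro]: "(\<And>x. x \<in> S \<Longrightarrow> fits n m (f x)) \<Longrightarrow> fits n m (\<Sum>x\<in>S. f x)"
  by (auto simp: fits_def)

lemma ent_mult_fits: "fits n m A \<Longrightarrow> ent (A * B) i j = (\<Sum>k<m. ent A i k * ent B k j)"
  by (rule ent_mult) (auto simp: fits_def)

lemma fits_mult [intro]: "fits n m A \<Longrightarrow> fits m k B \<Longrightarrow> fits n k (A * B)"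
  unfolding fits_def by (auto simp: ent_mult_fits[of n m A] fits_def)

text \<open>\<open>fmat\<close> is a ring without unit: \<open>fid n\<close> acts as the identity
  only on matrices that fit, which is why sizes reappear in the hypotheses of
  \<open>fid_mult\<close> and \<open>mult_fid\<close>.\<close>

definition fid :: "nat \<Rightarrow> fmat" where
  "fid n = mk n n (\<lambda>i j. if i = j then 1 else 0)"

lemma fits_fid [simp]: "fits n n (fid n)"
  by (simp add: fid_def)

lemma ent_fid [simp]: "ent (fid n) i j = (if i = j \<and> i < n then 1 else 0)"
  by (auto simp: fid_def)

lemma fid_mult:
  assumes "fits n m A"
  shows "fid n * A = A"
proof (rule fmat_eqI)
  fix i j
  have "ent (fid n * A) i j = (\<Sum>k<n. if k = i then ent A k j else 0)"
    by (subst ent_mult_fits[OF fits_fid]) (rule sum.cong, auto)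
  also have "\<dots> = ent A i j"
    using assms by (auto simp: fits_def)
  finally show "ent (fid n * A) i j = ent A i j" .
qed

lemma mult_fid:
  assumes "fits n m A"
  shows "A * fid m = A"
proof (rule fmat_eqI)
  fix i j
  have "ent (A * fid m) i j = (\<Sum>k<m. if k = j then ent A i k else 0)"
    by (subst ent_mult_fits[OF assms]) (rule sum.cong, auto)
  also have "\<dots> = ent A i j"
    using assms by (auto simp: fits_def)
  finally show "ent (A * fid m) i j = ent A i j" .
qed

definition emb :: "complex mat \<Rightarrow> fmat" where
  "emb A = mk (dim_row A) (dim_col A) (\<lambda>i j. A $$ (i, j))"

definition unemb :: "nat \<Rightarrow> nat \<Rightarrow> fmat \<Rightarrow> complex mat" where
  "unemb n m A = mat n m (\<lambda>(i, j). ent A i j)"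

lemma fits_emb: "A \<in> carrier_mat n m \<Longrightarrow> fits n m (emb A)"
  by (auto simp: emb_def)

lemma unemb_carrier [simp]: "unemb n m A \<in> carrier_mat n m"
  by (simp add: unemb_def)

lemma unemb_dim [simp]: "dim_row (unemb n m A) = n" "dim_col (unemb n m A) = m"
  by (simp_all add: unemb_def)

lemma emb_unemb: "fits n m A \<Longrightarrow> emb (unemb n m A) = A"
  by (rule fmat_eqI) (auto simp: emb_def unemb_def fits_def)

lemma unemb_emb: "A \<in> carrier_mat n m \<Longrightarrow> unemb n m (emb A) = A"
  by (auto simp: emb_def unemb_def)

lemma emb_inject: "A \<in> carrier_mat n m \<Longrightarrow> B \<in> carrier_mat n m \<Longrightarrow> emb A = emb B \<longleftrightarrow> A = B"
  by (metis unemb_emb)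

lemma emb_mult:
  assumes "A \<in> carrier_mat n m" "B \<in> carrier_mat m k"
  shows "emb (A * B) = emb A * emb B"
proof (rule fmat_eqI)
  fix i j
  show "ent (emb (A * B)) i j = ent (emb A * emb B) i j"
    using assms by (auto simp: emb_def ent_mult_fits[OF fits_mk] scalar_prod_def
        atLeast0LessThan intro!: sum.cong)
qed

lemma emb_smult: "emb (c \<cdot>\<^sub>m A) = c *\<^sub>F emb A"
  by (rule fmat_eqI) (auto simp: emb_def)

lemma emb_zero [simp]: "emb (0\<^sub>m n m) = 0"
  by (rule fmat_eqI) (auto simp: emb_def)

lemma emb_one [simp]: "emb (1\<^sub>m n) = fid n"
  by (rule fmat_eqI) (auto simp: emb_def)

lemma unemb_mult: "fits n m A \<Longrightarrow> fits m k B \<Longrightarrow> unemb n k (A * B) = unemb n m A * unemb m k B"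
  by (rule emb_inject[THEN iffD1, of _ n k])
    (auto simp: emb_unemb fits_mult emb_mult[of _ n m _ k] mult_carrier_mat[of _ n m _ k])

lemma unemb_fid [simp]: "unemb n n (fid n) = 1\<^sub>m n"
  by (rule eq_matI) (auto simp: unemb_def)

definition ftr :: "nat \<Rightarrow> fmat \<Rightarrow> complex" where
  "ftr n A = (\<Sum>i<n. ent A i i)"

lemma ftr_mult:
  assumes "fits n m A" "fits m n B"
  shows "ftr n (A * B) = ftr m (B * A)"
proof -
  have "ftr n (A * B) = (\<Sum>i<n. \<Sum>k<m. ent A i k * ent B k i)"
    by (simp add: ftr_def ent_mult_fits[OF assms(1)])
  also have "\<dots> = (\<Sum>k<m. \<Sum>i<n. ent B k i * ent A i k)"
    by (subst sum.swap) (simp add: mult.commute)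
  finally show ?thesis
    by (simp add: ftr_def ent_mult_fits[OF assms(2)])
qed

lemma ftr_fid [simp]: "ftr n (fid n) = of_nat n"
  by (simp add: ftr_def)

lemma ftr_fsc [simp]: "ftr n (c *\<^sub>F A) = c * ftr n A"
  by (simp add: ftr_def sum_distrib_left)

lemma ftr_diff: "ftr n (A - B) = ftr n A - ftr n B"
  by (simp add: ftr_def sum_subtractf)

lemma ftr_zero [simp]: "ftr n 0 = 0"
  by (simp add: ftr_def)

section \<open>Homogeneous polynomials and sections of the twisting sheaves\<close>

definition PV :: "complex vec set" where
  "PV = carrier_vec 2 - {0\<^sub>v 2}"

definition v2 :: "complex \<Rightarrow> complex \<Rightarrow> complex vec" where
  "v2 x y = vec 2 (\<lambda>i. if i = 0 then x else y)"

lemma v2_simps [simp]: "v2 x y \<in> carrier_vec 2" "v2 x y $ 0 = x" "v2 x y $ Suc 0 = y" "v2 x y $ 1 = y"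
  by (simp_all add: v2_def)

lemma vec2_eq_iff: "\<xi> \<in> carrier_vec 2 \<Longrightarrow> \<eta> \<in> carrier_vec 2 \<Longrightarrow> \<xi> = \<eta> \<longleftrightarrow> \<xi> $ 0 = \<eta> $ 0 \<and> \<xi> $ 1 = \<eta> $ 1"
  by (auto simp: less_2_cases_iff intro!: eq_vecI)

lemma PV_iff: "\<xi> \<in> PV \<longleftrightarrow> \<xi> \<in> carrier_vec 2 \<and> (\<xi> $ 0 \<noteq> 0 \<or> \<xi> $ 1 \<noteq> 0)"
  by (auto simp: PV_def vec2_eq_iff)

lemma PV_coordE:
  assumes "\<xi> \<in> PV"
  obtains i where "i < 2" "\<xi> $ i \<noteq> 0"
  using assms that[of 0] that[of 1] by (auto simp: PV_iff)

lemma v2_PV [simp]: "v2 x y \<in> PV \<longleftrightarrow> x \<noteq> 0 \<or> y \<noteq> 0"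
  by (simp add: PV_iff)

lemma PV_carrier: "\<xi> \<in> PV \<Longrightarrow> \<xi> \<in> carrier_vec 2"
  by (simp add: PV_def)

section \<open>Binary forms: products, substitutions, restriction to lines\<close>

lemma homog_poly_cong:
  "homog_poly a p \<Longrightarrow> (\<And>\<xi>. \<xi> \<in> carrier_vec 2 \<Longrightarrow> p \<xi> = q \<xi>) \<Longrightarrow> homog_poly a q"
  unfolding homog_poly_def by (elim exE, rule_tac x = c in exI) simp

lemma homog_polyE:
  assumes "homog_poly a p"
  obtains c where "\<forall>\<xi>\<in>carrier_vec 2. p \<xi> = (\<Sum>k\<le>a. c k * (\<xi> $ 0) ^ k * (\<xi> $ 1) ^ (a - k))"
  using assms unfolding homog_poly_def by blast

lemma homog_poly_monom:
  assumes "k \<le> a"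
  shows "homog_poly a (\<lambda>\<xi>. c * (\<xi> $ 0) ^ k * (\<xi> $ 1) ^ (a - k))"
  unfolding homog_poly_def
proof (intro exI ballI)
  fix \<xi> :: "complex vec"
  have "(\<Sum>j\<le>a. (if j = k then c else 0) * (\<xi> $ 0) ^ j * (\<xi> $ 1) ^ (a - j)) =
    (\<Sum>j\<le>a. if j = k then c * (\<xi> $ 0) ^ k * (\<xi> $ 1) ^ (a - k) else 0)"
    by (rule sum.cong) auto
  then show "c * (\<xi> $ 0) ^ k * (\<xi> $ 1) ^ (a - k) =
    (\<Sum>j\<le>a. (if j = k then c else 0) * (\<xi> $ 0) ^ j * (\<xi> $ 1) ^ (a - j))"
    using assms by simp
qed

lemma homog_poly_add:
  assumes "homog_poly a p" "homog_poly a q"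
  shows "homog_poly a (\<lambda>\<xi>. p \<xi> + q \<xi>)"
proof -
  obtain c where "\<forall>\<xi>\<in>carrier_vec 2. p \<xi> = (\<Sum>k\<le>a. c k * (\<xi> $ 0) ^ k * (\<xi> $ 1) ^ (a - k))"
    by (rule homog_polyE[OF assms(1)])
  moreover obtain d where "\<forall>\<xi>\<in>carrier_vec 2. q \<xi> = (\<Sum>k\<le>a. d k * (\<xi> $ 0) ^ k * (\<xi> $ 1) ^ (a - k))"
    by (rule homog_polyE[OF assms(2)])
  ultimately show ?thesis
    unfolding homog_poly_def
    by (intro exI[of _ "\<lambda>k. c k + d k"]) (simp add: distrib_right sum.distrib)
qed

lemma homog_poly_cmult:
  assumes "homog_poly a p"
  shows "homog_poly a (\<lambda>\<xi>. x * p \<xi>)"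
proof -
  obtain c where "\<forall>\<xi>\<in>carrier_vec 2. p \<xi> = (\<Sum>k\<le>a. c k * (\<xi> $ 0) ^ k * (\<xi> $ 1) ^ (a - k))"
    by (rule homog_polyE[OF assms])
  then show ?thesis
    unfolding homog_poly_def
    by (intro exI[of _ "\<lambda>k. x * c k"]) (simp add: sum_distrib_left mult.assoc)
qed

lemma homog_poly_zero [simp]: "homog_poly a (\<lambda>\<xi>. 0)"
  using homog_poly_monom[of 0 a 0] by simp

lemma homog_poly_sum: "(\<And>x. x \<in> S \<Longrightarrow> homog_poly a (p x)) \<Longrightarrow> homog_poly a (\<lambda>\<xi>. \<Sum>x\<in>S. p x \<xi>)"
  by (induction S rule: infinite_finite_induct) (auto intro: homog_poly_add)

lemma homog_poly_diff: "homog_poly a p \<Longrightarrow> homog_poly a q \<Longrightarrow> homog_poly a (\<lambda>\<xi>. p \<xi> - q \<xi>)"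
  using homog_poly_add[of a p "\<lambda>\<xi>. (-1) * q \<xi>"] homog_poly_cmult[of a q "-1"] by simp

lemma homog_poly_const [simp]: "homog_poly 0 (\<lambda>\<xi>. c)"
  using homog_poly_monom[of 0 0 c] by simp

lemma homog_poly_coord: "i < 2 \<Longrightarrow> homog_poly 1 (\<lambda>\<xi>. \<xi> $ i)"
  using homog_poly_monom[of 0 1 1] homog_poly_monom[of 1 1 1] by (auto simp: less_2_cases_iff)

lemma homog_poly_mult:
  assumes "homog_poly a p" "homog_poly b q"
  shows "homog_poly (a + b) (\<lambda>\<xi>. p \<xi> * q \<xi>)"
proof -
  obtain c where c: "\<forall>\<xi>\<in>carrier_vec 2. p \<xi> = (\<Sum>k\<le>a. c k * (\<xi> $ 0) ^ k * (\<xi> $ 1) ^ (a - k))"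
    by (rule homog_polyE[OF assms(1)])
  obtain d where d: "\<forall>\<xi>\<in>carrier_vec 2. q \<xi> = (\<Sum>l\<le>b. d l * (\<xi> $ 0) ^ l * (\<xi> $ 1) ^ (b - l))"
    by (rule homog_polyE[OF assms(2)])
  have "homog_poly (a + b) (\<lambda>\<xi>. \<Sum>k\<le>a. \<Sum>l\<le>b. (c k * d l) * (\<xi> $ 0) ^ (k + l) * (\<xi> $ 1) ^ (a + b - (k + l)))"
    by (intro homog_poly_sum homog_poly_monom) auto
  then show ?thesis
  proof (rule homog_poly_cong)
    fix \<xi> :: "complex vec" assume "\<xi> \<in> carrier_vec 2"
    then have "p \<xi> * q \<xi> = (\<Sum>k\<le>a. \<Sum>l\<le>b. (c k * (\<xi> $ 0) ^ k * (\<xi> $ 1) ^ (a - k)) * (d l * (\<xi> $ 0) ^ l * (\<xi> $ 1) ^ (b - l)))"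
      using c d by (simp add: sum_product)
    also have "\<dots> = (\<Sum>k\<le>a. \<Sum>l\<le>b. (c k * d l) * (\<xi> $ 0) ^ (k + l) * (\<xi> $ 1) ^ (a + b - (k + l)))"
    proof (intro sum.cong refl)
      fix k l assume "k \<in> {..a}" "l \<in> {..b}"
      then have "a + b - (k + l) = (a - k) + (b - l)" by auto
      then show "(c k * (\<xi> $ 0) ^ k * (\<xi> $ 1) ^ (a - k)) * (d l * (\<xi> $ 0) ^ l * (\<xi> $ 1) ^ (b - l)) =
        (c k * d l) * (\<xi> $ 0) ^ (k + l) * (\<xi> $ 1) ^ (a + b - (k + l))"
        by (simp only: power_add) (simp only: mult_ac)
    qed
    finally show "(\<Sum>k\<le>a. \<Sum>l\<le>b. (c k * d l) * (\<xi> $ 0) ^ (k + l) * (\<xi> $ 1) ^ (a + b - (k + l))) = p \<xi> * q \<xi>"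
      by simp
  qed
qed

lemma homog_poly_power: "homog_poly a p \<Longrightarrow> homog_poly (a * n) (\<lambda>\<xi>. p \<xi> ^ n)"
proof (induction n)
  case (Suc n)
  then show ?case using homog_poly_mult[of a p "a * n" "\<lambda>\<xi>. p \<xi> ^ n"] by simp
qed simp

lemma homog_poly_coord_power: "i < 2 \<Longrightarrow> homog_poly n (\<lambda>\<xi>. (\<xi> $ i) ^ n)"
  using homog_poly_power[OF homog_poly_coord, of i n] by simp

lemma transpose_mult_vec2:
  fixes g :: "complex mat"
  assumes "g \<in> carrier_mat 2 2" "\<xi> \<in> carrier_vec 2"
  shows "transpose_mat g *\<^sub>v \<xi> = v2 (g $$ (0,0) * \<xi> $ 0 + g $$ (1,0) * \<xi> $ 1) (g $$ (0,1) * \<xi> $ 0 + g $$ (1,1) * \<xi> $ 1)"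
  using assms by (intro eq_vecI) (auto simp: v2_def scalar_prod_def less_Suc_eq numeral_2_eq_2)

lemma homog_poly_subst:
  fixes g :: "complex mat"
  assumes "homog_poly a p" and g: "g \<in> carrier_mat 2 2"
  shows "homog_poly a (\<lambda>\<xi>. p (transpose_mat g *\<^sub>v \<xi>))"
proof -
  obtain c where c: "\<forall>\<xi>\<in>carrier_vec 2. p \<xi> = (\<Sum>k\<le>a. c k * (\<xi> $ 0) ^ k * (\<xi> $ 1) ^ (a - k))"
    by (rule homog_polyE[OF assms(1)])
  define L where "L = (\<lambda>i (\<xi>::complex vec). g $$ (0,i) * \<xi> $ 0 + g $$ (1,i) * \<xi> $ 1)"
  have L: "homog_poly 1 (L i)" for i
    unfolding L_def by (intro homog_poly_add homog_poly_cmult homog_poly_coord) auto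
  have "homog_poly a (\<lambda>\<xi>. \<Sum>k\<le>a. c k * (L 0 \<xi> ^ k * L 1 \<xi> ^ (a - k)))"
  proof (intro homog_poly_sum homog_poly_cmult)
    fix k assume "k \<in> {..a}"
    then show "homog_poly a (\<lambda>\<xi>. L 0 \<xi> ^ k * L 1 \<xi> ^ (a - k))"
      using homog_poly_mult[OF homog_poly_power[OF L, of k] homog_poly_power[OF L, of "a - k"], of 0 1] by simp
  qed
  then show ?thesis
    by (rule homog_poly_cong) (use g in \<open>simp add: transpose_mult_vec2 c L_def mult.assoc\<close>)
qed

lemma homog_poly_line:
  assumes "homog_poly a p" "\<zeta> \<in> carrier_vec 2" "\<delta> \<in> carrier_vec 2"
  shows "\<exists>P. \<forall>t. poly P t = p (\<zeta> + t \<cdot>\<^sub>v \<delta>)"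
proof -
  obtain c where c: "\<forall>\<xi>\<in>carrier_vec 2. p \<xi> = (\<Sum>k\<le>a. c k * (\<xi> $ 0) ^ k * (\<xi> $ 1) ^ (a - k))"
    by (rule homog_polyE[OF assms(1)])
  show ?thesis
    using assms c
    by (intro exI[of _ "\<Sum>k\<le>a. [:c k:] * [:\<zeta> $ 0, \<delta> $ 0:] ^ k * [:\<zeta> $ 1, \<delta> $ 1:] ^ (a - k)"])
      (simp add: poly_sum mult.assoc)
qed

text \<open>Restriction to the line through a point with \<open>p \<noteq> 0\<close> and a point
  with \<open>q \<noteq> 0\<close> reduces this to the absence of zero divisors among polynomials in
  one variable.\<close>

lemma homog_poly_mult_eq_0:
  assumes p: "homog_poly a p" and q: "homog_poly b q" and 0: "\<And>\<xi>. \<xi> \<in> PV \<Longrightarrow> p \<xi> * q \<xi> = 0"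
  shows "(\<forall>\<xi>\<in>PV. p \<xi> = 0) \<or> (\<forall>\<xi>\<in>PV. q \<xi> = 0)"
proof (rule ccontr)
  assume "\<not> ?thesis"
  then obtain \<zeta> \<eta> where \<zeta>: "\<zeta> \<in> PV" "p \<zeta> \<noteq> 0" and \<eta>: "\<eta> \<in> PV" "q \<eta> \<noteq> 0" by auto
  have car: "\<zeta> \<in> carrier_vec 2" "\<eta> - \<zeta> \<in> carrier_vec 2" "\<eta> \<in> carrier_vec 2"
    using \<zeta> \<eta> by (auto simp: PV_def)
  obtain P where P: "\<And>t. poly P t = p (\<zeta> + t \<cdot>\<^sub>v (\<eta> - \<zeta>))"
    using homog_poly_line[OF p car(1,2)] by auto
  obtain Q where Q: "\<And>t. poly Q t = q (\<zeta> + t \<cdot>\<^sub>v (\<eta> - \<zeta>))"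
    using homog_poly_line[OF q car(1,2)] by auto
  obtain i where i: "i < 2" "\<zeta> $ i \<noteq> 0" using PV_coordE[OF \<zeta>(1)] by blast
  \<comment> \<open>The line may pass through the origin, where the hypothesis says nothing. There
    the coordinate \<open>i\<close> vanishes as well, so the factor \<open>L\<close> restores a
    product that is zero for all \<open>t\<close>; \<open>L\<close> is nonzero since
    \<open>\<zeta> $ i \<noteq> 0\<close>.\<close>
  define L where "L = [:\<zeta> $ i, \<eta> $ i - \<zeta> $ i:]"
  have "poly (P * Q * L) t = 0" for t
  proof (cases "\<zeta> + t \<cdot>\<^sub>v (\<eta> - \<zeta>) \<in> PV")
    case True
    then show ?thesis using 0[OF True] by (simp add: P Q)
  next
    case False
    then have "\<zeta> + t \<cdot>\<^sub>v (\<eta> - \<zeta>) = 0\<^sub>v 2"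
      using car by (auto simp: PV_def)
    then have "(\<zeta> + t \<cdot>\<^sub>v (\<eta> - \<zeta>)) $ i = 0" using i by simp
    then have "poly L t = 0" using i car by (auto simp: L_def)
    then show ?thesis by simp
  qed
  then have "P * Q * L = 0"
    using poly_all_0_iff_0 by blast
  moreover have "L \<noteq> 0" using i by (auto simp: L_def)
  ultimately have "P = 0 \<or> Q = 0" by simp
  moreover have "\<zeta> + 0 \<cdot>\<^sub>v (\<eta> - \<zeta>) = \<zeta>" "\<zeta> + 1 \<cdot>\<^sub>v (\<eta> - \<zeta>) = \<eta>"
    using car by (auto simp: vec2_eq_iff)
  then have "poly P 0 \<noteq> 0" "poly Q 1 \<noteq> 0" unfolding P Q using \<zeta> \<eta> by auto
  ultimately show False by auto
qed

section \<open>Zariski open sets: intersections, basic open sets, density\<close>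

lemma zariski_open_subset: "zariski_open U \<Longrightarrow> U \<subseteq> PV"
  by (auto simp: zariski_open_def PV_def)

lemma zariski_openE:
  assumes "zariski_open U"
  obtains S where "\<forall>p\<in>S. \<exists>a. homog_poly a p" "U = {\<xi> \<in> carrier_vec 2 - {0\<^sub>v 2}. \<exists>p\<in>S. p \<xi> \<noteq> 0}"
  using assms unfolding zariski_open_def by blast

lemma zariski_open_basic:
  assumes "homog_poly a r" shows "zariski_open {\<xi> \<in> PV. r \<xi> \<noteq> 0}"
  unfolding zariski_open_def PV_def using assms by (intro exI[of _ "{r}"]) auto

lemma zariski_open_PV [simp]: "zariski_open PV"
  using zariski_open_basic[OF homog_poly_const[of 1]] by simp

lemma zariski_open_Int:
  assumes "zariski_open U" "zariski_open W"
  shows "zariski_open (U \<inter> W)"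
proof -
  obtain S where S: "\<forall>p\<in>S. \<exists>a. homog_poly a p" "U = {\<xi> \<in> carrier_vec 2 - {0\<^sub>v 2}. \<exists>p\<in>S. p \<xi> \<noteq> 0}"
    by (rule zariski_openE[OF assms(1)])
  obtain T where T: "\<forall>p\<in>T. \<exists>a. homog_poly a p" "W = {\<xi> \<in> carrier_vec 2 - {0\<^sub>v 2}. \<exists>p\<in>T. p \<xi> \<noteq> 0}"
    by (rule zariski_openE[OF assms(2)])
  show ?thesis
    unfolding zariski_open_def
  proof (intro exI conjI)
    show "\<forall>p\<in>(\<lambda>(p, q) \<xi>. p \<xi> * q \<xi>) ` (S \<times> T). \<exists>a. homog_poly a p"
    proof
      fix h assume "h \<in> (\<lambda>(p, q) \<xi>. p \<xi> * q \<xi>) ` (S \<times> T)"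
      then obtain p q where "p \<in> S" "q \<in> T" "h = (\<lambda>\<xi>. p \<xi> * q \<xi>)" by auto
      then show "\<exists>a. homog_poly a h" using S(1) T(1) homog_poly_mult by metis
    qed
    show "U \<inter> W = {\<xi> \<in> carrier_vec 2 - {0\<^sub>v 2}. \<exists>p\<in>(\<lambda>(p, q) \<xi>. p \<xi> * q \<xi>) ` (S \<times> T). p \<xi> \<noteq> 0}"
      using S T by auto
  qed
qed

lemma zariski_open_basic_subset:
  assumes "zariski_open U" "\<xi> \<in> U"
  obtains a p where "homog_poly a p" "p \<xi> \<noteq> 0" "\<And>\<eta>. \<eta> \<in> PV \<Longrightarrow> p \<eta> \<noteq> 0 \<Longrightarrow> \<eta> \<in> U"
  using assms unfolding zariski_open_def PV_def by blast

text \<open>\<open>U\<close> contains a nonempty set where some form \<open>q\<close> is nonzero, so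
  \<open>p * q\<close> vanishes on all of \<open>PV\<close> and one of the two forms is zero
  there.\<close>

lemma homog_poly_eq_0_dense:
  assumes p: "homog_poly a p" and U: "zariski_open U" "U \<noteq> {}" and 0: "\<And>\<xi>. \<xi> \<in> U \<Longrightarrow> p \<xi> = 0" and "\<xi> \<in> PV"
  shows "p \<xi> = 0"
proof -
  obtain \<eta> where \<eta>: "\<eta> \<in> U" using U by auto
  obtain b q where q: "homog_poly b q" "q \<eta> \<noteq> 0" "\<And>\<eta>. \<eta> \<in> PV \<Longrightarrow> q \<eta> \<noteq> 0 \<Longrightarrow> \<eta> \<in> U"
    using zariski_open_basic_subset[OF U(1) \<eta>] by metis
  have "\<eta> \<in> PV" using \<eta> zariski_open_subset[OF U(1)] by auto
  moreover have "p \<zeta> * q \<zeta> = 0" if "\<zeta> \<in> PV" for \<zeta>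
    using 0 q(3) that by (cases "q \<zeta> = 0") auto
  ultimately show ?thesis
    using homog_poly_mult_eq_0[OF p q(1)] q(2) \<open>\<xi> \<in> PV\<close> by blast
qed

lemma zariski_open_Int_nonempty:
  assumes "zariski_open U" "zariski_open W" "U \<noteq> {}" "W \<noteq> {}"
  shows "U \<inter> W \<noteq> {}"
proof
  assume "U \<inter> W = {}"
  obtain \<xi> where \<xi>: "\<xi> \<in> U" using assms by auto
  obtain a p where p: "homog_poly a p" "p \<xi> \<noteq> 0" "\<And>\<eta>. \<eta> \<in> PV \<Longrightarrow> p \<eta> \<noteq> 0 \<Longrightarrow> \<eta> \<in> U"
    using zariski_open_basic_subset[OF assms(1) \<xi>] by metis
  have "p \<zeta> = 0" if "\<zeta> \<in> W" for \<zeta>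
    using that p(3) \<open>U \<inter> W = {}\<close> zariski_open_subset[OF assms(2)] by auto
  then show False
    using homog_poly_eq_0_dense[OF p(1) assms(2,4)] p(2) \<xi> zariski_open_subset[OF assms(1)] by auto
qed

section \<open>Zeros and linear factors of binary forms\<close>

lemma homog_poly_coeff_poly:
  assumes "degree Q \<le> a" "y \<noteq> 0"
  shows "(\<Sum>k\<le>a. coeff Q k * x ^ k * y ^ (a - k)) = y ^ a * poly Q (x / y :: complex)"
proof -
  have "poly Q (x / y) = (\<Sum>k\<le>a. coeff Q k * (x / y) ^ k)"
    unfolding poly_altdef using assms by (intro sum.mono_neutral_left) (auto simp: coeff_eq_0)
  then show ?thesis
    using assms by (auto simp: sum_distrib_left power_divide power_diff intro!: sum.cong)
qed

lemma homog_poly_poly: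
  assumes "homog_poly a p"
  obtains P where "degree P \<le> a" "\<And>\<xi>. \<xi> \<in> carrier_vec 2 \<Longrightarrow> p \<xi> = (\<Sum>k\<le>a. coeff P k * (\<xi> $ 0) ^ k * (\<xi> $ 1) ^ (a - k))"
proof -
  obtain c where c: "\<forall>\<xi>\<in>carrier_vec 2. p \<xi> = (\<Sum>k\<le>a. c k * (\<xi> $ 0) ^ k * (\<xi> $ 1) ^ (a - k))"
    by (rule homog_polyE[OF assms(1)])
  define P where "P = (\<Sum>k\<le>a. monom (c k) k)"
  have "coeff P k = (if k \<le> a then c k else 0)" for k
    by (auto simp: P_def coeff_sum if_distrib sum.delta')
  then show ?thesis
    using c by (intro that[of P]) (auto intro!: degree_le)
qed

text \<open>The dehomogenised polynomial \<open>P\<close> has a root unless it is constant. If it is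
  constant, the form is a multiple of a positive power of the second coordinate and vanishes at
  infinity, the point \<open>v2 1 0\<close>.\<close>

lemma homog_poly_has_zero:
  assumes "homog_poly (Suc b) r"
  shows "\<exists>\<eta>\<in>PV. r \<eta> = 0"
proof -
  obtain P where P: "degree P \<le> Suc b" "\<And>\<xi>. \<xi> \<in> carrier_vec 2 \<Longrightarrow> r \<xi> = (\<Sum>k\<le>Suc b. coeff P k * (\<xi> $ 0) ^ k * (\<xi> $ 1) ^ (Suc b - k))"
    using homog_poly_poly[OF assms] by metis
  show ?thesis
  proof (cases "degree P = 0")
    case True
    then have "coeff P k = 0" if "0 < k" for k using that by (simp add: coeff_eq_0)
    then have "r (v2 1 0) = 0"
      by (auto simp: P power_0_left intro!: sum.neutral)
    then show ?thesis by (intro bexI[of _ "v2 1 0"]) auto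
  next
    case False
    then have "\<not> constant (poly P)" by (simp add: constant_degree)
    then obtain z where "poly P z = 0" using fundamental_theorem_of_algebra by blast
    then have "r (v2 z 1) = 0"
      using homog_poly_coeff_poly[OF P(1), of 1 z] by (simp add: P)
    then show ?thesis by (intro bexI[of _ "v2 z 1"]) auto
  qed
qed

text \<open>The zero is either the point at infinity, and then the top coefficient
  \<open>c (Suc a)\<close> vanishes, or a root of the dehomogenised polynomial, which can be divided
  out. In the second case the identity is clear where the second coordinate is nonzero and extends
  by density.\<close>

lemma homog_poly_factor:
  assumes p: "homog_poly (Suc a) p" and \<eta>: "\<eta> \<in> PV" "p \<eta> = 0"
  obtains p' where "homog_poly a p'" "\<And>\<xi>. \<xi> \<in> PV \<Longrightarrow> p \<xi> = (\<eta> $ 1 * \<xi> $ 0 - \<eta> $ 0 * \<xi> $ 1) * p' \<xi>"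
proof (cases "\<eta> $ 1 = 0")
  case True
  then have 0: "\<eta> $ 0 \<noteq> 0" using \<eta> by (auto simp: PV_iff)
  obtain c where c: "\<forall>\<xi>\<in>carrier_vec 2. p \<xi> = (\<Sum>k\<le>Suc a. c k * (\<xi> $ 0) ^ k * (\<xi> $ 1) ^ (Suc a - k))"
    by (rule homog_polyE[OF p])
  have "p \<eta> = c (Suc a) * (\<eta> $ 0) ^ Suc a"
    using c PV_carrier[OF \<eta>(1)] True by (auto simp: power_0_left intro!: sum.neutral)
  then have "c (Suc a) = 0" using \<eta> 0 by simp
  then have "p \<xi> = (\<eta> $ 1 * \<xi> $ 0 - \<eta> $ 0 * \<xi> $ 1) * (- inverse (\<eta> $ 0) * (\<Sum>k\<le>a. c k * (\<xi> $ 0) ^ k * (\<xi> $ 1) ^ (a - k)))"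
    if "\<xi> \<in> PV" for \<xi>
    using c PV_carrier[OF that] 0 True
    by (auto simp: sum_distrib_left Suc_diff_le intro!: sum.cong)
  moreover have "homog_poly a (\<lambda>\<xi>. - inverse (\<eta> $ 0) * (\<Sum>k\<le>a. c k * (\<xi> $ 0) ^ k * (\<xi> $ 1) ^ (a - k)))"
    by (intro homog_poly_cmult) (auto simp: homog_poly_def)
  ultimately show ?thesis using that by blast
next
  case False
  define t where "t = \<eta> $ 0 / \<eta> $ 1"
  obtain P where P: "degree P \<le> Suc a" "\<And>\<xi>. \<xi> \<in> carrier_vec 2 \<Longrightarrow> p \<xi> = (\<Sum>k\<le>Suc a. coeff P k * (\<xi> $ 0) ^ k * (\<xi> $ 1) ^ (Suc a - k))"
    using homog_poly_poly[OF p] by metis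
  have p_eq: "p \<xi> = (\<xi> $ 1) ^ Suc a * poly P (\<xi> $ 0 / \<xi> $ 1)" if "\<xi> \<in> PV" "\<xi> $ 1 \<noteq> 0" for \<xi>
    using homog_poly_coeff_poly[OF P(1) that(2)] P(2)[OF PV_carrier[OF that(1)]] by simp
  then have "poly P t = 0" using \<eta> False by (simp add: t_def)
  then obtain Q where Q: "P = [:- t, 1:] * Q" by (metis dvd_def poly_eq_0_iff_dvd)
  have degQ: "degree Q \<le> a"
  proof (cases "Q = 0")
    case False
    then have "degree P = 1 + degree Q" unfolding Q by (subst degree_mult_eq) auto
    then show ?thesis using P by simp
  qed simp
  define p' where "p' = (\<lambda>\<xi>. inverse (\<eta> $ 1) * (\<Sum>k\<le>a. coeff Q k * (\<xi> $ 0) ^ k * (\<xi> $ 1) ^ (a - k)))"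
  have p': "homog_poly a p'"
    unfolding p'_def by (intro homog_poly_cmult) (auto simp: homog_poly_def)
  define l where "l = (\<lambda>\<xi>::complex vec. \<eta> $ 1 * \<xi> $ 0 - \<eta> $ 0 * \<xi> $ 1)"
  have l: "homog_poly 1 l"
    unfolding l_def by (intro homog_poly_diff homog_poly_cmult homog_poly_coord) auto
  have lp': "homog_poly (Suc a) (\<lambda>\<xi>. p \<xi> - l \<xi> * p' \<xi>)"
    using homog_poly_diff[OF p homog_poly_mult[OF l p', simplified]] by simp
  have U: "zariski_open {\<xi> \<in> PV. \<xi> $ 1 \<noteq> 0}"
    by (rule zariski_open_basic[OF homog_poly_coord]) simp
  have eq0: "p \<xi> - l \<xi> * p' \<xi> = 0" if "\<xi> \<in> {\<xi> \<in> PV. \<xi> $ 1 \<noteq> 0}" for \<xi>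
    using that False homog_poly_coeff_poly[OF degQ, of "\<xi> $ 1" "\<xi> $ 0"]
    by (simp add: p_eq l_def p'_def Q t_def field_simps)
  have "p \<xi> - l \<xi> * p' \<xi> = 0" if "\<xi> \<in> PV" for \<xi>
  proof (rule homog_poly_eq_0_dense[OF lp' U _ eq0 that])
    show "{\<xi> \<in> PV. \<xi> $ 1 \<noteq> 0} \<noteq> {}"
      using v2_PV[of 0 1] by (metis (mono_tags, lifting) empty_iff mem_Collect_eq v2_simps(4) zero_neq_one)
  qed
  then show ?thesis
    using that[OF p'] by (simp add: l_def)
qed

text \<open>The elements of \<open>S^N V\<close> as functions on \<open>PV\<close>, for every
  integer \<open>N\<close>: below zero the index set is empty and only functions vanishing on
  \<open>PV\<close> remain. Degrees \<open>n' - n\<close> of either sign are thus covered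
  uniformly.\<close>

definition hp :: "int \<Rightarrow> (complex vec \<Rightarrow> complex) \<Rightarrow> bool" where
  "hp N f \<longleftrightarrow> (\<exists>c. \<forall>\<xi>\<in>PV. f \<xi> = (\<Sum>k | int k \<le> N. c k * (\<xi> $ 0) ^ k * (\<xi> $ 1) ^ (nat N - k)))"

lemma hp_int: "hp (int a) f \<longleftrightarrow> (\<exists>p. homog_poly a p \<and> (\<forall>\<xi>\<in>PV. f \<xi> = p \<xi>))" (is "?l \<longleftrightarrow> ?r")
proof
  have *: "{k. int k \<le> int a} = {..a}" by auto
  {
    assume ?l
    then obtain c where "\<forall>\<xi>\<in>PV. f \<xi> = (\<Sum>k\<le>a. c k * (\<xi> $ 0) ^ k * (\<xi> $ 1) ^ (a - k))"
      unfolding hp_def * by auto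
    then show ?r
      by (intro exI[of _ "\<lambda>\<xi>. \<Sum>k\<le>a. c k * (\<xi> $ 0) ^ k * (\<xi> $ 1) ^ (a - k)"]) (auto simp: homog_poly_def)
  next
    assume ?r
    then show ?l unfolding hp_def * homog_poly_def by (auto simp: PV_def)
  }
qed

lemma hp_neg: "N < 0 \<Longrightarrow> hp N f \<longleftrightarrow> (\<forall>\<xi>\<in>PV. f \<xi> = 0)"
proof -
  assume "N < 0"
  then have "{k. int k \<le> N} = {}" by auto
  then show ?thesis by (simp add: hp_def)
qed

lemma hp_cong: "hp N f \<Longrightarrow> (\<And>\<xi>. \<xi> \<in> PV \<Longrightarrow> f \<xi> = g \<xi>) \<Longrightarrow> hp N g"
  unfolding hp_def by (elim exE, rule_tac x = c in exI) simp

text \<open>Near \<open>\<xi>\<close> the section is another fraction \<open>p' / r'\<close>. The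
  form \<open>p' * r - p * r'\<close> vanishes on the common nonempty open set, hence on
  \<open>PV\<close>, so one fraction with its denominator cleared describes \<open>f\<close>
  everywhere.\<close>

lemma section_global_identity:
  assumes f: "f \<in> O_sections N PV" and p: "homog_poly a p" and r: "homog_poly b r" and N: "int a - int b = N"
    and U: "zariski_open U" "U \<noteq> {}" and eq: "\<And>\<xi>. \<xi> \<in> U \<Longrightarrow> f \<xi> * r \<xi> = p \<xi>" and \<xi>: "\<xi> \<in> PV"
  shows "f \<xi> * r \<xi> = p \<xi>"
proof -
  obtain W a' b' p' r' where W: "zariski_open W" "\<xi> \<in> W" and p': "homog_poly a' p'" and r': "homog_poly b' r'"
    and N': "int a' - int b' = N" and f': "\<forall>\<eta>\<in>W. r' \<eta> \<noteq> 0 \<and> f \<eta> = p' \<eta> / r' \<eta>"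
    using f \<xi> unfolding O_sections_def by blast
  have "a' + b = a + b'" using N N' by simp
  then have h: "homog_poly (a + b') (\<lambda>\<eta>. p' \<eta> * r \<eta> - p \<eta> * r' \<eta>)"
    using homog_poly_diff homog_poly_mult[OF p' r] homog_poly_mult[OF p r'] by metis
  have "p' \<xi> * r \<xi> - p \<xi> * r' \<xi> = 0"
  proof (rule homog_poly_eq_0_dense[OF h zariski_open_Int[OF U(1) W(1)] zariski_open_Int_nonempty _ \<xi>])
    fix \<eta> assume "\<eta> \<in> U \<inter> W"
    then show "p' \<eta> * r \<eta> - p \<eta> * r' \<eta> = 0"
      using f' eq[of \<eta>] by (auto simp: field_simps)
  qed (use U W in auto)
  then show ?thesis using f' W by (auto simp: field_simps)
qed

lemma basic_open_nonempty: "\<xi> \<in> PV \<Longrightarrow> r \<xi> \<noteq> 0 \<Longrightarrow> {\<xi> \<in> PV. r \<xi> \<noteq> 0} \<noteq> {}"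
  by auto

text \<open>A zero of the denominator is a zero of the numerator, so a linear factor can be cancelled
  as long as the denominator is not constant.\<close>

lemma section_fraction_hp:
  assumes f: "f \<in> O_sections N PV"
  shows "homog_poly a p \<Longrightarrow> homog_poly b r \<Longrightarrow> int a - int b = N \<Longrightarrow> \<exists>\<xi>\<in>PV. r \<xi> \<noteq> 0 \<Longrightarrow>
    (\<And>\<xi>. \<xi> \<in> PV \<Longrightarrow> f \<xi> * r \<xi> = p \<xi>) \<Longrightarrow> hp N f"
proof (induction b arbitrary: a p r)
  case 0
  then obtain c where c: "\<And>\<xi>. \<xi> \<in> PV \<Longrightarrow> r \<xi> = c" by (auto simp: homog_poly_def PV_def)
  then have "c \<noteq> 0" using 0 by auto
  have "homog_poly a (\<lambda>\<xi>. inverse c * p \<xi>)"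
    by (intro homog_poly_cmult 0)
  moreover have "f \<xi> = inverse c * p \<xi>" if "\<xi> \<in> PV" for \<xi>
    using 0(5)[OF that] c[OF that] \<open>c \<noteq> 0\<close> by (auto simp: field_simps)
  ultimately have "hp (int a) f" unfolding hp_int by blast
  then show ?case using 0 by simp
next
  case (Suc b)
  obtain \<eta> where \<eta>: "\<eta> \<in> PV" "r \<eta> = 0" using homog_poly_has_zero[OF Suc.prems(2)] by auto
  then have p\<eta>: "p \<eta> = 0" using Suc.prems(5)[of \<eta>] by simp
  show ?case
  proof (cases a)
    case 0
    then have p0: "p \<xi> = 0" if "\<xi> \<in> PV" for \<xi>
      using Suc.prems(1) p\<eta> \<eta>(1) that by (auto simp: homog_poly_def PV_def)
    obtain \<zeta> where \<zeta>: "\<zeta> \<in> PV" "r \<zeta> \<noteq> 0" using Suc.prems by auto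
    \<comment> \<open>Here \<open>p\<close> is zero and \<open>N = - Suc b\<close>, so zero over
      \<open>(\<xi> $ i) ^ Suc b\<close> is a fraction of the right degree that agrees with
      \<open>f\<close> wherever \<open>r\<close> is nonzero; the global identity makes
      \<open>f\<close> vanish on both charts.\<close>
    have fz: "f \<xi> * (\<xi> $ i) ^ Suc b = 0" if "\<xi> \<in> PV" "i < 2" for \<xi> i
    proof (rule section_global_identity[OF f homog_poly_zero[of 0] homog_poly_coord_power[OF that(2), of "Suc b"] _
          zariski_open_basic[OF Suc.prems(2)] basic_open_nonempty[of \<zeta> r, OF \<zeta>] _ that(1)])
      fix \<xi> assume "\<xi> \<in> {\<xi> \<in> PV. r \<xi> \<noteq> 0}"
      then show "f \<xi> * (\<xi> $ i) ^ Suc b = 0"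
        using Suc.prems(5)[of \<xi>] p0[of \<xi>] by auto
    qed (use Suc.prems(3) 0 in auto)
    have "f \<xi> = 0" if "\<xi> \<in> PV" for \<xi>
    proof -
      obtain i where i: "i < 2" "\<xi> $ i \<noteq> 0" using PV_coordE[OF \<open>\<xi> \<in> PV\<close>] by blast
      then show ?thesis using fz[OF that i(1)] by simp
    qed
    moreover have "N < 0" using Suc.prems(3) 0 by simp
    ultimately show ?thesis by (simp add: hp_neg)
  next
    case (Suc a')
    define l where "l = (\<lambda>\<xi>::complex vec. \<eta> $ 1 * \<xi> $ 0 - \<eta> $ 0 * \<xi> $ 1)"
    have l: "homog_poly 1 l"
      unfolding l_def by (intro homog_poly_diff homog_poly_cmult homog_poly_coord) auto
    obtain p' where p': "homog_poly a' p'" "\<And>\<xi>. \<xi> \<in> PV \<Longrightarrow> p \<xi> = l \<xi> * p' \<xi>"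
      using homog_poly_factor[OF Suc.prems(1)[unfolded Suc] \<eta>(1) p\<eta>] unfolding l_def by metis
    obtain r' where r': "homog_poly b r'" "\<And>\<xi>. \<xi> \<in> PV \<Longrightarrow> r \<xi> = l \<xi> * r' \<xi>"
      using homog_poly_factor[OF Suc.prems(2) \<eta>] unfolding l_def by metis
    obtain \<zeta> where \<zeta>: "\<zeta> \<in> PV" "r \<zeta> \<noteq> 0" using Suc.prems by auto
    have N': "int a' - int b = N" using Suc Suc.prems(3) by simp
    have "f \<xi> * r' \<xi> = p' \<xi>" if "\<xi> \<in> PV" for \<xi>
    proof (rule section_global_identity[OF f p'(1) r'(1) N' zariski_open_basic[OF l] basic_open_nonempty[of \<zeta>] _ that])
      fix \<xi> assume "\<xi> \<in> {\<xi> \<in> PV. l \<xi> \<noteq> 0}"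
      then show "f \<xi> * r' \<xi> = p' \<xi>"
        using Suc.prems(5)[of \<xi>] p'(2)[of \<xi>] r'(2)[of \<xi>] by auto
    qed (use \<zeta> r'(2)[of \<zeta>] in auto)
    moreover have "\<exists>\<xi>\<in>PV. r' \<xi> \<noteq> 0" using \<zeta> r'(2)[of \<zeta>] by auto
    ultimately show ?thesis using Suc.IH[OF p'(1) r'(1) N'] by blast
  qed
qed

lemma O_sections_PV_hp:
  assumes f: "f \<in> O_sections N PV"
  shows "hp N f"
proof -
  have "v2 1 0 \<in> PV" by simp
  then obtain W a b p r where W: "zariski_open W" "v2 1 0 \<in> W" and p: "homog_poly a p" and r: "homog_poly b r"
    and N: "int a - int b = N" and f': "\<forall>\<eta>\<in>W. r \<eta> \<noteq> 0 \<and> f \<eta> = p \<eta> / r \<eta>"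
    using f unfolding O_sections_def by blast
  have eq: "f \<xi> * r \<xi> = p \<xi>" if "\<xi> \<in> PV" for \<xi>
  proof (rule section_global_identity[OF f p r N W(1) _ _ that])
    show "W \<noteq> {}" using W by auto
  qed (use f' in auto)
  show ?thesis
    by (rule section_fraction_hp[OF f p r N _ eq]) (use W f' in \<open>force\<close>)+
qed

section \<open>Sections over open sets: products, sums, restriction, group action, gluing\<close>

lemma O_sectionsI:
  assumes "\<And>\<xi>. \<xi> \<notin> U \<Longrightarrow> f \<xi> = 0"
    and "\<And>\<xi>. \<xi> \<in> U \<Longrightarrow> \<exists>W a b p r. zariski_open W \<and> \<xi> \<in> W \<and> W \<subseteq> U \<and> homog_poly a p \<and> homog_poly b r \<and>
      int a - int b = n \<and> (\<forall>\<eta>\<in>W. r \<eta> \<noteq> 0 \<and> f \<eta> = p \<eta> / r \<eta>)"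
  shows "f \<in> O_sections n U"
  using assms unfolding O_sections_def by blast

lemma O_sections_off: "f \<in> O_sections n U \<Longrightarrow> \<xi> \<notin> U \<Longrightarrow> f \<xi> = 0"
  by (auto simp: O_sections_def)

lemma O_sections_local:
  assumes "f \<in> O_sections n U" "\<xi> \<in> U"
  obtains W a b p r where "zariski_open W" "\<xi> \<in> W" "W \<subseteq> U" "homog_poly a p" "homog_poly b r"
    "int a - int b = n" "\<And>\<eta>. \<eta> \<in> W \<Longrightarrow> r \<eta> \<noteq> 0" "\<And>\<eta>. \<eta> \<in> W \<Longrightarrow> f \<eta> = p \<eta> / r \<eta>"
  using assms unfolding O_sections_def by blast

lemma O_sections_mult:
  assumes f: "f \<in> O_sections n U" and g: "g \<in> O_sections m U"
  shows "(\<lambda>\<xi>. f \<xi> * g \<xi>) \<in> O_sections (n + m) U"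
proof (rule O_sectionsI)
  fix \<xi> assume "\<xi> \<in> U"
  obtain W a b p r where 1: "zariski_open W" "\<xi> \<in> W" "W \<subseteq> U" "homog_poly a p" "homog_poly b r"
    "int a - int b = n" "\<And>\<eta>. \<eta> \<in> W \<Longrightarrow> r \<eta> \<noteq> 0" "\<And>\<eta>. \<eta> \<in> W \<Longrightarrow> f \<eta> = p \<eta> / r \<eta>"
    using O_sections_local[OF f \<open>\<xi> \<in> U\<close>] by metis
  obtain W' a' b' p' r' where 2: "zariski_open W'" "\<xi> \<in> W'" "W' \<subseteq> U" "homog_poly a' p'" "homog_poly b' r'"
    "int a' - int b' = m" "\<And>\<eta>. \<eta> \<in> W' \<Longrightarrow> r' \<eta> \<noteq> 0" "\<And>\<eta>. \<eta> \<in> W' \<Longrightarrow> g \<eta> = p' \<eta> / r' \<eta>"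
    using O_sections_local[OF g \<open>\<xi> \<in> U\<close>] by metis
  show "\<exists>W a b p r. zariski_open W \<and> \<xi> \<in> W \<and> W \<subseteq> U \<and> homog_poly a p \<and> homog_poly b r \<and>
      int a - int b = n + m \<and> (\<forall>\<eta>\<in>W. r \<eta> \<noteq> 0 \<and> f \<eta> * g \<eta> = p \<eta> / r \<eta>)"
    by (rule exI[of _ "W \<inter> W'"], rule exI[of _ "a + a'"], rule exI[of _ "b + b'"],
        rule exI[of _ "\<lambda>\<eta>. p \<eta> * p' \<eta>"], rule exI[of _ "\<lambda>\<eta>. r \<eta> * r' \<eta>"])
      (use 1 2 in \<open>auto intro!: zariski_open_Int homog_poly_mult\<close>)
qed (use O_sections_off[OF f] in auto)

lemma O_sections_add:
  assumes f: "f \<in> O_sections n U" and g: "g \<in> O_sections n U"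
  shows "(\<lambda>\<xi>. f \<xi> + g \<xi>) \<in> O_sections n U"
proof (rule O_sectionsI)
  fix \<xi> assume "\<xi> \<in> U"
  obtain W a b p r where 1: "zariski_open W" "\<xi> \<in> W" "W \<subseteq> U" "homog_poly a p" "homog_poly b r"
    "int a - int b = n" "\<And>\<eta>. \<eta> \<in> W \<Longrightarrow> r \<eta> \<noteq> 0" "\<And>\<eta>. \<eta> \<in> W \<Longrightarrow> f \<eta> = p \<eta> / r \<eta>"
    using O_sections_local[OF f \<open>\<xi> \<in> U\<close>] by metis
  obtain W' a' b' p' r' where 2: "zariski_open W'" "\<xi> \<in> W'" "W' \<subseteq> U" "homog_poly a' p'" "homog_poly b' r'"
    "int a' - int b' = n" "\<And>\<eta>. \<eta> \<in> W' \<Longrightarrow> r' \<eta> \<noteq> 0" "\<And>\<eta>. \<eta> \<in> W' \<Longrightarrow> g \<eta> = p' \<eta> / r' \<eta>"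
    using O_sections_local[OF g \<open>\<xi> \<in> U\<close>] by metis
  have "a' + b = a + b'" using 1 2 by simp
  then have h: "homog_poly (a + b') (\<lambda>\<eta>. p \<eta> * r' \<eta> + p' \<eta> * r \<eta>)"
    using homog_poly_add homog_poly_mult[OF 1(4) 2(5)] homog_poly_mult[OF 2(4) 1(5)] by metis
  show "\<exists>W a b p r. zariski_open W \<and> \<xi> \<in> W \<and> W \<subseteq> U \<and> homog_poly a p \<and> homog_poly b r \<and>
      int a - int b = n \<and> (\<forall>\<eta>\<in>W. r \<eta> \<noteq> 0 \<and> f \<eta> + g \<eta> = p \<eta> / r \<eta>)"
    by (rule exI[of _ "W \<inter> W'"], rule exI[of _ "a + b'"], rule exI[of _ "b + b'"],
        rule exI[of _ "\<lambda>\<eta>. p \<eta> * r' \<eta> + p' \<eta> * r \<eta>"], rule exI[of _ "\<lambda>\<eta>. r \<eta> * r' \<eta>"])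
      (use 1 2 h in \<open>auto intro!: zariski_open_Int homog_poly_mult simp: field_simps\<close>)
qed (use O_sections_off[OF f] O_sections_off[OF g] in auto)

lemma O_sections_hp:
  assumes f: "hp N f" and U: "zariski_open U"
  shows "(\<lambda>\<xi>. if \<xi> \<in> U then f \<xi> else 0) \<in> O_sections N U"
proof (rule O_sectionsI)
  fix \<xi> assume \<xi>: "\<xi> \<in> U"
  show "\<exists>W a b p r. zariski_open W \<and> \<xi> \<in> W \<and> W \<subseteq> U \<and> homog_poly a p \<and> homog_poly b r \<and>
      int a - int b = N \<and> (\<forall>\<eta>\<in>W. r \<eta> \<noteq> 0 \<and> (if \<eta> \<in> U then f \<eta> else 0) = p \<eta> / r \<eta>)"
  proof (cases "N < 0")
    case True
    obtain i where i: "i < 2" "\<xi> $ i \<noteq> 0" using PV_coordE \<xi> zariski_open_subset[OF U] by blast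
    \<comment> \<open>In negative degree the zero section still has to be written as a fraction of
      degree \<open>N\<close>: zero over the power \<open>- N\<close> of a coordinate that is
      nonzero at \<open>\<xi>\<close>, on a smaller open set.\<close>
    show ?thesis
      by (rule exI[of _ "U \<inter> {\<xi> \<in> PV. \<xi> $ i \<noteq> 0}"], rule exI[of _ 0], rule exI[of _ "nat (- N)"],
          rule exI[of _ "\<lambda>_. 0"], rule exI[of _ "\<lambda>\<xi>. (\<xi> $ i) ^ nat (- N)"])
        (use U True i \<xi> f zariski_open_subset[OF U] in
          \<open>auto simp: hp_neg intro!: zariski_open_Int zariski_open_basic homog_poly_coord homog_poly_coord_power\<close>)
  next
    case False
    then have "hp (int (nat N)) f" using f by simp
    then obtain p where p: "homog_poly (nat N) p" "\<forall>\<xi>\<in>PV. f \<xi> = p \<xi>" unfolding hp_int by auto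
    show ?thesis
      by (rule exI[of _ U], rule exI[of _ "nat N"], rule exI[of _ 0], rule exI[of _ p], rule exI[of _ "\<lambda>_. 1"])
        (use U p \<xi> False zariski_open_subset[OF U] in auto)
  qed
qed auto

lemma O_sections_restrict:
  assumes f: "f \<in> O_sections n U" and W: "zariski_open W" "W \<subseteq> U"
  shows "(\<lambda>\<xi>. if \<xi> \<in> W then f \<xi> else 0) \<in> O_sections n W"
proof (rule O_sectionsI)
  fix \<xi> assume \<xi>: "\<xi> \<in> W"
  then have "\<xi> \<in> U" using W by auto
  obtain W' a b p r where 1: "zariski_open W'" "\<xi> \<in> W'" "W' \<subseteq> U" "homog_poly a p" "homog_poly b r"
    "int a - int b = n" "\<And>\<eta>. \<eta> \<in> W' \<Longrightarrow> r \<eta> \<noteq> 0" "\<And>\<eta>. \<eta> \<in> W' \<Longrightarrow> f \<eta> = p \<eta> / r \<eta>"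
    using O_sections_local[OF f \<open>\<xi> \<in> U\<close>] by metis
  show "\<exists>W' a b p r. zariski_open W' \<and> \<xi> \<in> W' \<and> W' \<subseteq> W \<and> homog_poly a p \<and> homog_poly b r \<and>
      int a - int b = n \<and> (\<forall>\<eta>\<in>W'. r \<eta> \<noteq> 0 \<and> (if \<eta> \<in> W then f \<eta> else 0) = p \<eta> / r \<eta>)"
    by (rule exI[of _ "W' \<inter> W"], rule exI[of _ a], rule exI[of _ b], rule exI[of _ p], rule exI[of _ r])
      (use 1 \<xi> W in \<open>auto intro!: zariski_open_Int\<close>)
qed auto

definition Uc :: "nat \<Rightarrow> complex vec set" where
  "Uc i = {\<xi> \<in> PV. \<xi> $ i \<noteq> 0}"

lemma zariski_open_Uc: "i < 2 \<Longrightarrow> zariski_open (Uc i)"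
  unfolding Uc_def by (rule zariski_open_basic[OF homog_poly_coord])

text \<open>This section trivialises \<open>O(n)\<close> over the chart; a negative exponent moves
  into the denominator.\<close>

lemma O_sections_powi:
  assumes "i < 2"
  shows "(\<lambda>\<xi>. if \<xi> \<in> Uc i then (\<xi> $ i) powi n else 0) \<in> O_sections n (Uc i)"
proof (rule O_sectionsI)
  fix \<xi> assume \<xi>: "\<xi> \<in> Uc i"
  show "\<exists>W a b p r. zariski_open W \<and> \<xi> \<in> W \<and> W \<subseteq> Uc i \<and> homog_poly a p \<and> homog_poly b r \<and>
      int a - int b = n \<and> (\<forall>\<eta>\<in>W. r \<eta> \<noteq> 0 \<and> (if \<eta> \<in> Uc i then (\<eta> $ i) powi n else 0) = p \<eta> / r \<eta>)"
    by (rule exI[of _ "Uc i"], rule exI[of _ "nat n"], rule exI[of _ "nat (- n)"],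
        rule exI[of _ "\<lambda>\<xi>. (\<xi> $ i) ^ nat n"], rule exI[of _ "\<lambda>\<xi>. (\<xi> $ i) ^ nat (- n)"])
      (use assms \<xi> zariski_open_Uc in
        \<open>auto simp: power_int_def Uc_def field_simps intro!: homog_poly_coord_power\<close>)
qed auto

lemma det_mat_2:
  fixes g :: "complex mat"
  assumes "g \<in> carrier_mat 2 2"
  shows "det g = g $$ (0,0) * g $$ (1,1) - g $$ (0,1) * g $$ (1,0)"
  using assms by (subst laplace_expansion_column[of _ 2 0])
    (auto simp: numeral_2_eq_2 cofactor_def mat_delete_def det_single)

lemma transpose_mult_PV:
  assumes g: "g \<in> carrier_mat 2 2" "det g = 1" and \<xi>: "\<xi> \<in> PV"
  shows "transpose_mat g *\<^sub>v \<xi> \<in> PV"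
proof -
  define a b c d x y where abbr: "a = g $$ (0,0)" "b = g $$ (0,1)" "c = g $$ (1,0)" "d = g $$ (1,1)"
    "x = \<xi> $ 0" "y = \<xi> $ 1"
  have det: "a * d - b * c = 1" using g det_mat_2[OF g(1)] by (simp add: abbr)
  have "(a * d - b * c) * x = d * (a * x + c * y) - c * (b * x + d * y)"
    by (simp add: algebra_simps)
  then have x: "x = d * (a * x + c * y) - c * (b * x + d * y)" by (simp add: det)
  have "(a * d - b * c) * y = a * (b * x + d * y) - b * (a * x + c * y)"
    by (simp add: algebra_simps)
  then have y: "y = a * (b * x + d * y) - b * (a * x + c * y)" by (simp add: det)
  have "\<not> (a * x + c * y = 0 \<and> b * x + d * y = 0)"
    using x y \<xi> by (auto simp: PV_iff abbr)
  then show ?thesis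
    using transpose_mult_vec2[OF g(1) PV_carrier[OF \<xi>]] by (auto simp: abbr)
qed

lemma zariski_open_act:
  assumes g: "g \<in> carrier_mat 2 2" "det g = 1" and U: "zariski_open U"
  shows "zariski_open (act_open g U)"
proof -
  obtain S where S: "\<forall>p\<in>S. \<exists>a. homog_poly a p" "U = {\<xi> \<in> carrier_vec 2 - {0\<^sub>v 2}. \<exists>p\<in>S. p \<xi> \<noteq> 0}"
    by (rule zariski_openE[OF U])
  have nz: "\<xi> \<noteq> 0\<^sub>v 2" if "\<xi> \<in> carrier_vec 2" "transpose_mat g *\<^sub>v \<xi> \<noteq> 0\<^sub>v 2" for \<xi>
    using that by (auto simp: transpose_mult_vec2[OF g(1)] vec2_eq_iff)
  have PV: "transpose_mat g *\<^sub>v \<xi> \<in> carrier_vec 2 - {0\<^sub>v 2}" if "\<xi> \<in> carrier_vec 2 - {0\<^sub>v 2}" for \<xi>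
    using transpose_mult_PV[OF g, of \<xi>] that unfolding PV_def by blast
  show ?thesis
    unfolding zariski_open_def
  proof (intro exI conjI)
    show "\<forall>p\<in>(\<lambda>p \<xi>. p (transpose_mat g *\<^sub>v \<xi>)) ` S. \<exists>a. homog_poly a p"
    proof
      fix h assume "h \<in> (\<lambda>p \<xi>. p (transpose_mat g *\<^sub>v \<xi>)) ` S"
      then obtain p where "p \<in> S" "h = (\<lambda>\<xi>. p (transpose_mat g *\<^sub>v \<xi>))" by auto
      then show "\<exists>a. homog_poly a h" using S(1) homog_poly_subst[OF _ g(1)] by metis
    qed
    show "act_open g U = {\<xi> \<in> carrier_vec 2 - {0\<^sub>v 2}. \<exists>p\<in>(\<lambda>p \<xi>. p (transpose_mat g *\<^sub>v \<xi>)) ` S. p \<xi> \<noteq> 0}"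
    proof (rule Set.set_eqI)
      fix \<xi> :: "complex vec"
      show "\<xi> \<in> act_open g U \<longleftrightarrow> \<xi> \<in> {\<xi> \<in> carrier_vec 2 - {0\<^sub>v 2}. \<exists>p\<in>(\<lambda>p \<xi>. p (transpose_mat g *\<^sub>v \<xi>)) ` S. p \<xi> \<noteq> 0}"
      proof (cases "\<xi> \<in> carrier_vec 2 - {0\<^sub>v 2}")
        case True
        then show ?thesis using PV[OF True] by (simp add: act_open_def S(2))
      next
        case False
        then show ?thesis using nz[of \<xi>] by (simp add: act_open_def S(2)) blast
      qed
    qed
  qed
qed

lemma O_sections_act:
  assumes g: "g \<in> carrier_mat 2 2" "det g = 1" and f: "f \<in> O_sections n U"
  shows "(\<lambda>\<xi>. if \<xi> \<in> carrier_vec 2 then f (transpose_mat g *\<^sub>v \<xi>) else 0) \<in> O_sections n (act_open g U)"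
proof (rule O_sectionsI)
  fix \<xi> assume \<xi>: "\<xi> \<in> act_open g U"
  then have \<xi>': "\<xi> \<in> carrier_vec 2" "transpose_mat g *\<^sub>v \<xi> \<in> U" by (auto simp: act_open_def)
  obtain W a b p r where 1: "zariski_open W" "transpose_mat g *\<^sub>v \<xi> \<in> W" "W \<subseteq> U" "homog_poly a p" "homog_poly b r"
    "int a - int b = n" "\<And>\<eta>. \<eta> \<in> W \<Longrightarrow> r \<eta> \<noteq> 0" "\<And>\<eta>. \<eta> \<in> W \<Longrightarrow> f \<eta> = p \<eta> / r \<eta>"
    using O_sections_local[OF f \<xi>'(2)] by metis
  show "\<exists>W a b p r. zariski_open W \<and> \<xi> \<in> W \<and> W \<subseteq> act_open g U \<and> homog_poly a p \<and> homog_poly b r \<and>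
      int a - int b = n \<and> (\<forall>\<eta>\<in>W. r \<eta> \<noteq> 0 \<and> (if \<eta> \<in> carrier_vec 2 then f (transpose_mat g *\<^sub>v \<eta>) else 0) = p \<eta> / r \<eta>)"
    by (rule exI[of _ "act_open g W"], rule exI[of _ a], rule exI[of _ b],
        rule exI[of _ "\<lambda>\<xi>. p (transpose_mat g *\<^sub>v \<xi>)"], rule exI[of _ "\<lambda>\<xi>. r (transpose_mat g *\<^sub>v \<xi>)"])
      (use 1 \<xi>' g(1) zariski_open_act[OF g 1(1)] in \<open>auto intro!: homog_poly_subst simp: act_open_def\<close>)
qed (use O_sections_off[OF f] in \<open>auto simp: act_open_def\<close>)

lemma O_sections_glue:
  assumes 0: "\<And>\<xi>. \<xi> \<notin> PV \<Longrightarrow> f \<xi> = 0"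
    and f: "\<And>i. i < 2 \<Longrightarrow> (\<lambda>\<xi>. if \<xi> \<in> Uc i then f \<xi> else 0) \<in> O_sections n (Uc i)"
  shows "f \<in> O_sections n PV"
proof (rule O_sectionsI)
  fix \<xi> assume \<xi>: "\<xi> \<in> PV"
  obtain i where i: "i < 2" "\<xi> \<in> Uc i" using PV_coordE[OF \<xi>] \<xi> unfolding Uc_def by blast
  obtain W a b p r where 1: "zariski_open W" "\<xi> \<in> W" "W \<subseteq> Uc i" "homog_poly a p" "homog_poly b r"
    "int a - int b = n" "\<And>\<eta>. \<eta> \<in> W \<Longrightarrow> r \<eta> \<noteq> 0" "\<And>\<eta>. \<eta> \<in> W \<Longrightarrow> (if \<eta> \<in> Uc i then f \<eta> else 0) = p \<eta> / r \<eta>"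
    using O_sections_local[OF f[OF i(1)] i(2)] by metis
  show "\<exists>W a b p r. zariski_open W \<and> \<xi> \<in> W \<and> W \<subseteq> PV \<and> homog_poly a p \<and> homog_poly b r \<and>
      int a - int b = n \<and> (\<forall>\<eta>\<in>W. r \<eta> \<noteq> 0 \<and> f \<eta> = p \<eta> / r \<eta>)"
    by (rule exI[of _ W], rule exI[of _ a], rule exI[of _ b], rule exI[of _ p], rule exI[of _ r])
      (use 1 i in \<open>force simp: Uc_def\<close>)
qed (use 0 in auto)

section \<open>Operations on forms of integer degree and the Koszul complex in two variables\<close>

lemma hp_zero [simp]: "hp N (\<lambda>\<xi>. 0)"
  unfolding hp_def by (intro exI[of _ "\<lambda>_. 0"]) simp

lemma hp_add: "hp N f \<Longrightarrow> hp N g \<Longrightarrow> hp N (\<lambda>\<xi>. f \<xi> + g \<xi>)"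
proof -
  assume fg: "hp N f" "hp N g"
  obtain c where "\<forall>\<xi>\<in>PV. f \<xi> = (\<Sum>k | int k \<le> N. c k * (\<xi> $ 0) ^ k * (\<xi> $ 1) ^ (nat N - k))"
    using fg(1) unfolding hp_def by blast
  moreover obtain d where "\<forall>\<xi>\<in>PV. g \<xi> = (\<Sum>k | int k \<le> N. d k * (\<xi> $ 0) ^ k * (\<xi> $ 1) ^ (nat N - k))"
    using fg(2) unfolding hp_def by blast
  ultimately show ?thesis
    unfolding hp_def by (intro exI[of _ "\<lambda>k. c k + d k"]) (simp add: distrib_right sum.distrib)
qed

lemma hp_cmult: "hp N f \<Longrightarrow> hp N (\<lambda>\<xi>. x * f \<xi>)"
proof -
  assume "hp N f"
  then obtain c where "\<forall>\<xi>\<in>PV. f \<xi> = (\<Sum>k | int k \<le> N. c k * (\<xi> $ 0) ^ k * (\<xi> $ 1) ^ (nat N - k))"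
    unfolding hp_def by blast
  then show ?thesis
    unfolding hp_def by (intro exI[of _ "\<lambda>k. x * c k"]) (simp add: sum_distrib_left mult.assoc)
qed

lemma hp_sum: "(\<And>x. x \<in> S \<Longrightarrow> hp N (f x)) \<Longrightarrow> hp N (\<lambda>\<xi>. \<Sum>x\<in>S. f x \<xi>)"
  by (induction S rule: infinite_finite_induct) (auto intro: hp_add)

text \<open>Passing through sections treats all signs of \<open>N\<close> and \<open>M\<close> at
  once; a product with a factor of negative degree may itself have degree at least zero.\<close>

lemma hp_mult: "hp N f \<Longrightarrow> hp M g \<Longrightarrow> hp (N + M) (\<lambda>\<xi>. f \<xi> * g \<xi>)"
proof -
  assume fg: "hp N f" "hp M g"
  have "(\<lambda>\<xi>. (if \<xi> \<in> PV then f \<xi> else 0) * (if \<xi> \<in> PV then g \<xi> else 0)) \<in> O_sections (N + M) PV"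
    by (intro O_sections_mult O_sections_hp fg) simp_all
  from O_sections_PV_hp[OF this] show ?thesis
    by (rule hp_cong) auto
qed

lemma hp_subst:
  assumes f: "hp N f" and g: "g \<in> carrier_mat 2 2" "det g = 1"
  shows "hp N (\<lambda>\<xi>. f (transpose_mat g *\<^sub>v \<xi>))"
proof (cases "N < 0")
  case True
  then show ?thesis using f transpose_mult_PV[OF g] by (simp add: hp_neg)
next
  case False
  then have "hp (int (nat N)) f" using f by simp
  then obtain p where p: "homog_poly (nat N) p" "\<forall>\<xi>\<in>PV. f \<xi> = p \<xi>" unfolding hp_int by auto
  have "hp (int (nat N)) (\<lambda>\<xi>. f (transpose_mat g *\<^sub>v \<xi>))"
    unfolding hp_int
    by (rule exI[of _ "\<lambda>\<xi>. p (transpose_mat g *\<^sub>v \<xi>)"])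
      (use p homog_poly_subst[OF p(1) g(1)] transpose_mult_PV[OF g] in auto)
  then show ?thesis using False by simp
qed

lemma hp_0: "hp 0 f \<Longrightarrow> \<exists>c. \<forall>\<xi>\<in>PV. f \<xi> = c"
  unfolding hp_def by auto

lemma hp_1: "hp 1 f \<Longrightarrow> \<xi> \<in> PV \<Longrightarrow> f \<xi> = \<xi> $ 0 * f (v2 1 0) + \<xi> $ 1 * f (v2 0 1)"
proof -
  assume f: "hp 1 f" and \<xi>: "\<xi> \<in> PV"
  have k: "{k. int k \<le> 1} = {..Suc 0}" by auto
  obtain c where "\<forall>\<xi>\<in>PV. f \<xi> = (\<Sum>k | int k \<le> 1. c k * (\<xi> $ 0) ^ k * (\<xi> $ 1) ^ (nat 1 - k))"
    using f unfolding hp_def by blast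
  then have c: "f \<xi> = c 0 * \<xi> $ 1 + c 1 * \<xi> $ 0" if "\<xi> \<in> PV" for \<xi>
    using that unfolding k by simp
  show ?thesis
    using c[OF \<xi>] c[of "v2 1 0"] c[of "v2 0 1"] by simp
qed

lemma hp_linear: "hp 1 (\<lambda>\<xi>. \<xi> $ 0 * a + \<xi> $ 1 * b)"
proof -
  have "homog_poly 1 (\<lambda>\<xi>. a * \<xi> $ 0 + b * \<xi> $ 1)"
    by (intro homog_poly_add homog_poly_cmult homog_poly_coord) auto
  then have "hp (int 1) (\<lambda>\<xi>. \<xi> $ 0 * a + \<xi> $ 1 * b)"
    unfolding hp_int by (auto simp: mult.commute)
  then show ?thesis by simp
qed

text \<open>Surjectivity of the last Koszul map: every monomial of positive degree contains a
  variable, and in negative degree there is only zero. Constants are the exception, hence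
  \<open>N \<noteq> 0\<close>.\<close>

lemma hp_split:
  assumes "hp N f" "N \<noteq> 0"
  obtains a b where "hp (N - 1) a" "hp (N - 1) b" "\<And>\<xi>. \<xi> \<in> PV \<Longrightarrow> f \<xi> = \<xi> $ 0 * a \<xi> + \<xi> $ 1 * b \<xi>"
proof (cases "N < 0")
  case True
  then show ?thesis using assms that[of "\<lambda>_. 0" "\<lambda>_. 0"] by (simp add: hp_neg)
next
  case False
  define n where "n = nat (N - 1)"
  have N: "N = int (Suc n)" "N - 1 = int n" using False assms by (auto simp: n_def)
  obtain p where p: "homog_poly (Suc n) p" "\<forall>\<xi>\<in>PV. f \<xi> = p \<xi>" using assms unfolding N hp_int by auto
  obtain c where c: "\<forall>\<xi>\<in>carrier_vec 2. p \<xi> = (\<Sum>k\<le>Suc n. c k * (\<xi> $ 0) ^ k * (\<xi> $ 1) ^ (Suc n - k))"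
    by (rule homog_polyE[OF p(1)])
  have "hp (int n) (\<lambda>\<xi>. \<Sum>k\<le>n. c (Suc k) * (\<xi> $ 0) ^ k * (\<xi> $ 1) ^ (n - k))"
    unfolding hp_int homog_poly_def by auto
  moreover have "hp (int n) (\<lambda>\<xi>. c 0 * (\<xi> $ 1) ^ n)"
    unfolding hp_int using homog_poly_monom[of 0 n "c 0"] by (intro exI conjI) auto
  moreover have "f \<xi> = \<xi> $ 0 * (\<Sum>k\<le>n. c (Suc k) * (\<xi> $ 0) ^ k * (\<xi> $ 1) ^ (n - k)) + \<xi> $ 1 * (c 0 * (\<xi> $ 1) ^ n)"
    if "\<xi> \<in> PV" for \<xi>
  proof -
    have "f \<xi> = (\<Sum>k\<le>Suc n. c k * (\<xi> $ 0) ^ k * (\<xi> $ 1) ^ (Suc n - k))"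
      using p(2) c that PV_carrier[OF that] by (simp del: sum.atMost_Suc)
    also have "\<dots> = c 0 * (\<xi> $ 1) ^ Suc n + (\<Sum>k\<le>n. c (Suc k) * (\<xi> $ 0) ^ Suc k * (\<xi> $ 1) ^ (n - k))"
      by (simp add: sum.atMost_Suc_shift del: sum.atMost_Suc)
    finally show ?thesis by (simp add: sum_distrib_left mult_ac)
  qed
  ultimately show ?thesis using that unfolding N(2) by blast
qed

text \<open>Exactness in the middle of the Koszul complex. At \<open>v2 1 0\<close> the relation
  says that \<open>a\<close> vanishes, so the second coordinate divides \<open>a\<close>; cancelling
  it from the relation determines \<open>b\<close>. In degree at most zero both forms are
  zero.\<close>

lemma hp_syzygy:
  assumes a: "hp N a" and b: "hp N b" and 0: "\<And>\<xi>. \<xi> \<in> PV \<Longrightarrow> \<xi> $ 0 * a \<xi> + \<xi> $ 1 * b \<xi> = 0"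
  obtains c where "hp (N - 1) c" "\<And>\<xi>. \<xi> \<in> PV \<Longrightarrow> a \<xi> = \<xi> $ 1 * c \<xi>" "\<And>\<xi>. \<xi> \<in> PV \<Longrightarrow> b \<xi> = - (\<xi> $ 0 * c \<xi>)"
proof (cases "N \<le> 0")
  case True
  have "a \<xi> = 0 \<and> b \<xi> = 0" if "\<xi> \<in> PV" for \<xi>
  proof (cases "N < 0")
    case True
    then show ?thesis using a b that by (simp add: hp_neg)
  next
    case False
    then have "N = 0" using \<open>N \<le> 0\<close> by simp
    then obtain x y where "\<forall>\<xi>\<in>PV. a \<xi> = x" "\<forall>\<xi>\<in>PV. b \<xi> = y" using a b hp_0 by metis
    then show ?thesis using 0[of "v2 1 0"] 0[of "v2 0 1"] that by auto
  qed
  then show ?thesis using that[of "\<lambda>_. 0"] by simp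
next
  case False
  define n where "n = nat (N - 1)"
  have N: "N = int (Suc n)" "N - 1 = int n" using False by (auto simp: n_def)
  obtain p where p: "homog_poly (Suc n) p" "\<forall>\<xi>\<in>PV. a \<xi> = p \<xi>" using a unfolding N hp_int by auto
  have e1: "v2 1 0 \<in> PV" by simp
  have "p (v2 1 0) = 0" using 0[OF e1] p(2) by simp
  from homog_poly_factor[OF p(1) e1 this] obtain p' where p': "homog_poly n p'"
    and "\<And>\<xi>. \<xi> \<in> PV \<Longrightarrow> p \<xi> = (v2 1 0 $ 1 * \<xi> $ 0 - v2 1 0 $ 0 * \<xi> $ 1) * p' \<xi>" by blast
  then have pp': "p \<xi> = - \<xi> $ 1 * p' \<xi>" if "\<xi> \<in> PV" for \<xi> using that by simp
  define c where "c = (\<lambda>\<xi>. -1 * p' \<xi>)"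
  have c: "homog_poly n c" unfolding c_def by (rule homog_poly_cmult[OF p'])
  have ac: "a \<xi> = \<xi> $ 1 * c \<xi>" if "\<xi> \<in> PV" for \<xi>
    using p(2) pp'[OF that] that by (simp add: c_def)
  obtain q where q: "homog_poly (Suc n) q" "\<forall>\<xi>\<in>PV. b \<xi> = q \<xi>" using b unfolding N hp_int by auto
  have x0: "homog_poly 1 (\<lambda>\<xi>::complex vec. \<xi> $ 0)" "homog_poly 1 (\<lambda>\<xi>::complex vec. \<xi> $ 1)"
    using homog_poly_coord[of 0] homog_poly_coord[of 1] by simp_all
  have "homog_poly (Suc n) (\<lambda>\<xi>. q \<xi> + \<xi> $ 0 * c \<xi>)"
    using homog_poly_add[OF q(1) homog_poly_mult[OF x0(1) c, simplified]] by simp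
  from homog_poly_mult_eq_0[OF x0(2) this]
  have "(\<forall>\<xi>\<in>PV. \<xi> $ 1 = 0) \<or> (\<forall>\<xi>\<in>PV. q \<xi> + \<xi> $ 0 * c \<xi> = 0)"
    using 0 ac q(2) by (simp add: algebra_simps)
  moreover have "v2 0 1 \<in> PV" "v2 0 1 $ 1 \<noteq> 0" by simp_all
  ultimately have "q \<xi> + \<xi> $ 0 * c \<xi> = 0" if "\<xi> \<in> PV" for \<xi> using that by blast
  then have bc: "b \<xi> = - (\<xi> $ 0 * c \<xi>)" if "\<xi> \<in> PV" for \<xi>
    using that q(2) by (simp add: eq_neg_iff_add_eq_0)
  have "hp (N - 1) c" unfolding N(2) using hp_int c by blast
  then show ?thesis using that ac bc by blast
qed

section \<open>Equivariant morphisms as matrices of homogeneous polynomials\<close>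

lemma unemb_mult_vec:
  "k < n \<Longrightarrow> v \<in> carrier_vec m \<Longrightarrow> (unemb n m A *\<^sub>v v) $ k = (\<Sum>j<m. ent A k j * v $ j)"
  by (auto simp: unemb_def scalar_prod_def atLeast0LessThan intro!: sum.cong)

lemma unemb_mult_vec_carrier [simp]: "unemb n m A *\<^sub>v v \<in> carrier_vec n"
  by (rule carrier_vecI) simp

lemma O_sections_zero: "zariski_open U \<Longrightarrow> (\<lambda>\<xi>. 0) \<in> O_sections n U"
  using O_sections_hp[OF hp_zero, of U n] by simp

lemma O_sections_sum:
  assumes "zariski_open U" "\<And>x. x \<in> S \<Longrightarrow> f x \<in> O_sections n U"
  shows "(\<lambda>\<xi>. \<Sum>x\<in>S. f x \<xi>) \<in> O_sections n U"
  using assms(2)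
  by (induction S rule: infinite_finite_induct) (auto intro: O_sections_zero[OF assms(1)] O_sections_add)

lemma sections_carrier: "s \<in> sections n d U \<Longrightarrow> s \<xi> \<in> carrier_vec d"
  by (auto simp: sections_def)

lemma sections_coord: "s \<in> sections n d U \<Longrightarrow> k < d \<Longrightarrow> (\<lambda>\<xi>. s \<xi> $ k) \<in> O_sections n U"
  by (auto simp: sections_def)

lemma sections_off:
  assumes s: "s \<in> sections n d U" and \<xi>: "\<xi> \<notin> U"
  shows "s \<xi> = 0\<^sub>v d"
proof (rule eq_vecI)
  fix k assume "k < dim_vec (0\<^sub>v d :: complex vec)"
  then have k: "k < d" by simp
  then show "s \<xi> $ k = 0\<^sub>v d $ k"
    using O_sections_off[OF sections_coord[OF s k] \<xi>] by simp
qed (simp add: carrier_vecD[OF sections_carrier[OF s]])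

lemma smult_zero_vec: "c \<cdot>\<^sub>v 0\<^sub>v n = (0\<^sub>v n :: complex vec)"
  by (rule eq_vecI) auto

lemma sectionsI:
  "(\<And>\<xi>. s \<xi> \<in> carrier_vec d) \<Longrightarrow> (\<And>k. k < d \<Longrightarrow> (\<lambda>\<xi>. s \<xi> $ k) \<in> O_sections n U) \<Longrightarrow> s \<in> sections n d U"
  by (auto simp: sections_def)

lemma sections_add:
  assumes "s \<in> sections n d U" "t \<in> sections n d U"
  shows "(\<lambda>\<xi>. s \<xi> + t \<xi>) \<in> sections n d U"
proof (rule sectionsI)
  fix k assume k: "k < d"
  have "(\<lambda>\<xi>. s \<xi> $ k + t \<xi> $ k) \<in> O_sections n U"
    by (intro O_sections_add sections_coord[OF _ k] assms)
  moreover have "(s \<xi> + t \<xi>) $ k = s \<xi> $ k + t \<xi> $ k" for \<xi>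
    using k sections_carrier[OF assms(2), of \<xi>] by simp
  ultimately show "(\<lambda>\<xi>. (s \<xi> + t \<xi>) $ k) \<in> O_sections n U" by simp
qed (use assms sections_carrier in auto)

lemma sections_smult:
  assumes f: "f \<in> O_sections m U" and s: "s \<in> sections n d U"
  shows "(\<lambda>\<xi>. f \<xi> \<cdot>\<^sub>v s \<xi>) \<in> sections (m + n) d U"
proof (rule sectionsI)
  fix k assume k: "k < d"
  have "(\<lambda>\<xi>. f \<xi> * s \<xi> $ k) \<in> O_sections (m + n) U"
    by (intro O_sections_mult sections_coord[OF _ k] f s)
  moreover have "(f \<xi> \<cdot>\<^sub>v s \<xi>) $ k = f \<xi> * s \<xi> $ k" for \<xi>
    using k sections_carrier[OF s, of \<xi>] by simp
  ultimately show "(\<lambda>\<xi>. (f \<xi> \<cdot>\<^sub>v s \<xi>) $ k) \<in> O_sections (m + n) U" by simp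
qed (use s sections_carrier in auto)

lemma sections_res:
  assumes s: "s \<in> sections n d U" and W: "zariski_open W" "W \<subseteq> U"
  shows "res_sec d W s \<in> sections n d W"
proof (rule sectionsI)
  fix k assume k: "k < d"
  have "(\<lambda>\<xi>. if \<xi> \<in> W then s \<xi> $ k else 0) \<in> O_sections n W"
    by (intro O_sections_restrict[OF _ W] sections_coord[OF s k])
  moreover have "res_sec d W s \<xi> $ k = (if \<xi> \<in> W then s \<xi> $ k else 0)" for \<xi>
    using k by (simp add: res_sec_def)
  ultimately show "(\<lambda>\<xi>. res_sec d W s \<xi> $ k) \<in> O_sections n W" by simp
qed (use s sections_carrier in \<open>auto simp: res_sec_def\<close>)

lemma sections_act:
  assumes g: "g \<in> carrier_mat 2 2" "det g = 1" and \<rho>: "\<rho> g \<in> carrier_mat d d"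
    and U: "zariski_open U" and s: "s \<in> sections n d U"
  shows "act_sec d \<rho> g s \<in> sections n d (act_open g U)"
proof (rule sectionsI)
  fix \<xi> show "act_sec d \<rho> g s \<xi> \<in> carrier_vec d"
    using \<rho> sections_carrier[OF s] by (auto simp: act_sec_def intro: mult_mat_vec_carrier)
next
  fix k assume k: "k < d"
  have "(\<lambda>\<xi>. \<Sum>j<d. (\<rho> g $$ (k, j)) * (if \<xi> \<in> carrier_vec 2 then s (transpose_mat g *\<^sub>v \<xi>) $ j else 0)) \<in> O_sections n (act_open g U)"
  proof (rule O_sections_sum[OF zariski_open_act[OF g U]])
    fix j assume "j \<in> {..<d}"
    then have 1: "(\<lambda>\<xi>. if \<xi> \<in> carrier_vec 2 then s (transpose_mat g *\<^sub>v \<xi>) $ j else 0) \<in> O_sections n (act_open g U)"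
      by (intro O_sections_act[OF g] sections_coord[OF s]) auto
    have "hp 0 (\<lambda>_. \<rho> g $$ (k, j))"
      unfolding hp_def by (intro exI[of _ "\<lambda>_. \<rho> g $$ (k, j)"]) auto
    from O_sections_mult[OF O_sections_hp[OF this zariski_open_act[OF g U]] 1]
    have "(\<lambda>\<xi>. (if \<xi> \<in> act_open g U then \<rho> g $$ (k, j) else 0) * (if \<xi> \<in> carrier_vec 2 then s (transpose_mat g *\<^sub>v \<xi>) $ j else 0)) \<in> O_sections n (act_open g U)"
      by simp
    moreover have "(if \<xi> \<in> act_open g U then \<rho> g $$ (k, j) else 0) * (if \<xi> \<in> carrier_vec 2 then s (transpose_mat g *\<^sub>v \<xi>) $ j else 0) =
        \<rho> g $$ (k, j) * (if \<xi> \<in> carrier_vec 2 then s (transpose_mat g *\<^sub>v \<xi>) $ j else 0)" for \<xi>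
      using O_sections_off[OF 1, of \<xi>] by (cases "\<xi> \<in> act_open g U") auto
    ultimately show "(\<lambda>\<xi>. \<rho> g $$ (k, j) * (if \<xi> \<in> carrier_vec 2 then s (transpose_mat g *\<^sub>v \<xi>) $ j else 0)) \<in> O_sections n (act_open g U)"
      by simp
  qed
  moreover have "act_sec d \<rho> g s \<xi> $ k = (\<Sum>j<d. (\<rho> g $$ (k, j)) * (if \<xi> \<in> carrier_vec 2 then s (transpose_mat g *\<^sub>v \<xi>) $ j else 0))" for \<xi>
  proof (cases "\<xi> \<in> carrier_vec 2")
    case True
    have "s (transpose_mat g *\<^sub>v \<xi>) \<in> carrier_vec d" by (rule sections_carrier[OF s])
    then show ?thesis using True k \<rho>
      by (auto simp: act_sec_def scalar_prod_def atLeast0LessThan intro!: sum.cong)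
  next
    case False
    then show ?thesis using k by (simp add: act_sec_def)
  qed
  ultimately show "(\<lambda>\<xi>. act_sec d \<rho> g s \<xi> $ k) \<in> O_sections n (act_open g U)" by simp
qed

text \<open>The matrices of morphisms. The equation is equivariance read off at the point
  \<open>\<xi>\<close>, and the value zero off \<open>PV\<close> makes the matrix of a morphism
  unique.\<close>

definition HM :: "complex mat set \<Rightarrow> int \<Rightarrow> nat \<Rightarrow> (complex mat \<Rightarrow> complex mat) \<Rightarrow> nat \<Rightarrow>
    (complex mat \<Rightarrow> complex mat) \<Rightarrow> (complex vec \<Rightarrow> fmat) set" where
  "HM G N d \<rho> d' \<rho>' = {M. (\<forall>\<xi>. \<xi> \<notin> PV \<longrightarrow> M \<xi> = 0) \<and> (\<forall>\<xi>. fits d' d (M \<xi>)) \<and>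
     (\<forall>i j. hp N (\<lambda>\<xi>. ent (M \<xi>) i j)) \<and>
     (\<forall>g\<in>G. \<forall>\<xi>\<in>PV. emb (\<rho>' g) * M (transpose_mat g *\<^sub>v \<xi>) = M \<xi> * emb (\<rho> g))}"

definition mor :: "int \<Rightarrow> nat \<Rightarrow> nat \<Rightarrow> (complex vec \<Rightarrow> fmat) \<Rightarrow> sheaf_mor" where
  "mor n d d' M = (\<lambda>U s. if zariski_open U \<and> s \<in> sections n d U
     then (\<lambda>\<xi>. if \<xi> \<in> U then unemb d' d (M \<xi>) *\<^sub>v s \<xi> else 0\<^sub>v d')
     else (\<lambda>\<xi>. 0\<^sub>v d'))"

lemma mor_apply: "zariski_open U \<Longrightarrow> s \<in> sections n d U \<Longrightarrow>
    mor n d d' M U s = (\<lambda>\<xi>. if \<xi> \<in> U then unemb d' d (M \<xi>) *\<^sub>v s \<xi> else 0\<^sub>v d')"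
  by (simp add: mor_def)

lemma mor_section:
  assumes M: "\<And>i j. hp N (\<lambda>\<xi>. ent (M \<xi>) i j)" and U: "zariski_open U" and s: "s \<in> sections n d U"
  shows "mor n d d' M U s \<in> sections (N + n) d' U"
proof (rule sectionsI)
  fix \<xi> show "mor n d d' M U s \<xi> \<in> carrier_vec d'" by (simp add: mor_def)
next
  fix k assume k: "k < d'"
  have "(\<lambda>\<xi>. \<Sum>j<d. (if \<xi> \<in> U then ent (M \<xi>) k j else 0) * s \<xi> $ j) \<in> O_sections (N + n) U"
    by (intro O_sections_sum[OF U] O_sections_mult O_sections_hp[OF M U] sections_coord[OF s]) auto
  moreover have "mor n d d' M U s \<xi> $ k = (\<Sum>j<d. (if \<xi> \<in> U then ent (M \<xi>) k j else 0) * s \<xi> $ j)" for \<xi>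
    using k by (simp add: mor_apply[OF U s] unemb_mult_vec[OF k sections_carrier[OF s]])
  ultimately show "(\<lambda>\<xi>. mor n d d' M U s \<xi> $ k) \<in> O_sections (N + n) U" by simp
qed

lemma mor_equivariant:
  assumes G: "\<And>g. g \<in> G \<Longrightarrow> g \<in> carrier_mat 2 2 \<and> det g = 1"
    and \<rho>: "\<And>g. g \<in> G \<Longrightarrow> \<rho> g \<in> carrier_mat d d" and \<rho>': "\<And>g. g \<in> G \<Longrightarrow> \<rho>' g \<in> carrier_mat d' d'"
    and M: "M \<in> HM G (n' - n) d \<rho> d' \<rho>'"
  shows "equivariant_morphism G n d \<rho> n' d' \<rho>' (mor n d d' M)"
proof -
  have hpM: "hp (n' - n) (\<lambda>\<xi>. ent (M \<xi>) i j)" and fM: "fits d' d (M \<xi>)" for i j \<xi>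
    using M by (auto simp: HM_def)
  have eqM: "\<rho>' g * unemb d' d (M (transpose_mat g *\<^sub>v \<xi>)) = unemb d' d (M \<xi>) * \<rho> g" if "g \<in> G" "\<xi> \<in> PV" for g \<xi>
  proof (rule emb_inject[THEN iffD1])
    show "\<rho>' g * unemb d' d (M (transpose_mat g *\<^sub>v \<xi>)) \<in> carrier_mat d' d" "unemb d' d (M \<xi>) * \<rho> g \<in> carrier_mat d' d"
      using \<rho>[OF that(1)] \<rho>'[OF that(1)] by (auto intro: mult_carrier_mat[of _ d' d' _ d] mult_carrier_mat[of _ d' d _ d])
    show "emb (\<rho>' g * unemb d' d (M (transpose_mat g *\<^sub>v \<xi>))) = emb (unemb d' d (M \<xi>) * \<rho> g)"
      using M that \<rho>[OF that(1)] \<rho>'[OF that(1)]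
      by (simp add: emb_mult[of _ d' d' _ d] emb_mult[of _ d' d _ d] emb_unemb fM HM_def)
  qed
  show ?thesis
    unfolding equivariant_morphism_def
  proof (intro conjI allI impI ballI)
    fix U s assume U: "zariski_open U" and s: "s \<in> sections n d U"
    show "mor n d d' M U s \<in> sections n' d' U"
      using mor_section[OF hpM U s] by simp
    show "mor n d d' M U (\<lambda>\<xi>. s \<xi> + t \<xi>) = (\<lambda>\<xi>. mor n d d' M U s \<xi> + mor n d d' M U t \<xi>)"
      if t: "t \<in> sections n d U" for t
    proof
      fix \<xi>
      have "unemb d' d (M \<xi>) *\<^sub>v (s \<xi> + t \<xi>) = unemb d' d (M \<xi>) *\<^sub>v s \<xi> + unemb d' d (M \<xi>) *\<^sub>v t \<xi>"
        by (rule mult_add_distrib_mat_vec[of _ d' d]) (auto intro: sections_carrier[OF s] sections_carrier[OF t])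
      then show "mor n d d' M U (\<lambda>\<xi>. s \<xi> + t \<xi>) \<xi> = mor n d d' M U s \<xi> + mor n d d' M U t \<xi>"
        by (simp add: mor_apply[OF U] s t sections_add)
    qed
    show "mor n d d' M U (\<lambda>\<xi>. f \<xi> \<cdot>\<^sub>v s \<xi>) = (\<lambda>\<xi>. f \<xi> \<cdot>\<^sub>v mor n d d' M U s \<xi>)"
      if f: "f \<in> O_sections 0 U" for f
    proof
      fix \<xi>
      have "unemb d' d (M \<xi>) *\<^sub>v (f \<xi> \<cdot>\<^sub>v s \<xi>) = f \<xi> \<cdot>\<^sub>v (unemb d' d (M \<xi>) *\<^sub>v s \<xi>)"
        by (rule mult_mat_vec[of _ d' d]) (auto intro: sections_carrier[OF s])
      moreover have "(\<lambda>\<xi>. f \<xi> \<cdot>\<^sub>v s \<xi>) \<in> sections n d U"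
        using sections_smult[OF f s] by simp
      ultimately show "mor n d d' M U (\<lambda>\<xi>. f \<xi> \<cdot>\<^sub>v s \<xi>) \<xi> = f \<xi> \<cdot>\<^sub>v mor n d d' M U s \<xi>"
        by (simp add: mor_apply[OF U] s smult_zero_vec)
    qed
    show "mor n d d' M W (res_sec d W s) = res_sec d' W (mor n d d' M U s)"
      if W: "zariski_open W \<and> W \<subseteq> U" for W
      using W sections_res[OF s, of W] by (intro ext) (auto simp: mor_apply U s res_sec_def)
    show "mor n d d' M (act_open g U) (act_sec d \<rho> g s) = act_sec d' \<rho>' g (mor n d d' M U s)"
      if g: "g \<in> G" for g
    proof
      fix \<xi>
      have o: "zariski_open (act_open g U)" and a: "act_sec d \<rho> g s \<in> sections n d (act_open g U)"
        using G[OF g] zariski_open_act[OF _ _ U] sections_act[where \<rho> = \<rho>, OF _ _ \<rho>[OF g] U s] by auto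
      have z: "\<rho>' g *\<^sub>v 0\<^sub>v d' = 0\<^sub>v d'"
        using \<rho>'[OF g] by (intro eq_vecI) (auto simp: scalar_prod_def)
      have e1: "mor n d d' M (act_open g U) (act_sec d \<rho> g s) \<xi> =
          (if \<xi> \<in> act_open g U then unemb d' d (M \<xi>) *\<^sub>v act_sec d \<rho> g s \<xi> else 0\<^sub>v d')"
        by (simp only: mor_apply[OF o a])
      have e2: "act_sec d' \<rho>' g (mor n d d' M U s) \<xi> = (if \<xi> \<in> carrier_vec 2 then \<rho>' g *\<^sub>v
          (if transpose_mat g *\<^sub>v \<xi> \<in> U then unemb d' d (M (transpose_mat g *\<^sub>v \<xi>)) *\<^sub>v s (transpose_mat g *\<^sub>v \<xi>) else 0\<^sub>v d') else 0\<^sub>v d')"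
        by (simp only: act_sec_def mor_apply[OF U s])
      have e3: "act_sec d \<rho> g s \<xi> = (if \<xi> \<in> carrier_vec 2 then \<rho> g *\<^sub>v s (transpose_mat g *\<^sub>v \<xi>) else 0\<^sub>v d)"
        by (simp only: act_sec_def)
      show "mor n d d' M (act_open g U) (act_sec d \<rho> g s) \<xi> = act_sec d' \<rho>' g (mor n d d' M U s) \<xi>"
      proof (cases "\<xi> \<in> act_open g U")
        case True
        then have \<xi>: "\<xi> \<in> PV" "\<xi> \<in> carrier_vec 2" "transpose_mat g *\<^sub>v \<xi> \<in> U"
          using zariski_open_subset[OF o] by (auto simp: act_open_def)
        have sc: "s (transpose_mat g *\<^sub>v \<xi>) \<in> carrier_vec d" by (rule sections_carrier[OF s])
        have "unemb d' d (M \<xi>) *\<^sub>v (\<rho> g *\<^sub>v s (transpose_mat g *\<^sub>v \<xi>)) =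
            (unemb d' d (M \<xi>) * \<rho> g) *\<^sub>v s (transpose_mat g *\<^sub>v \<xi>)"
          by (rule assoc_mult_mat_vec[of _ d' d _ d, symmetric]) (use \<rho>[OF g] sc in auto)
        also have "\<dots> = \<rho>' g *\<^sub>v (unemb d' d (M (transpose_mat g *\<^sub>v \<xi>)) *\<^sub>v s (transpose_mat g *\<^sub>v \<xi>))"
          unfolding eqM[OF g \<xi>(1), symmetric]
          by (rule assoc_mult_mat_vec[of _ d' d' _ d]) (use \<rho>'[OF g] sc in auto)
        finally show ?thesis
          unfolding e1 e2 e3 using True \<xi> by simp
      next
        case False
        then show ?thesis
          unfolding e1 e2 using z by (auto simp: act_open_def)
      qed
    qed
  next
    fix U s assume "\<not> (zariski_open U \<and> s \<in> sections n d U)"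
    then show "mor n d d' M U s = (\<lambda>_. 0\<^sub>v d')"
      by (auto simp: mor_def)
  qed
qed

text \<open>The basis vector \<open>j\<close> times the trivialising section of \<open>O(n)\<close>:
  for \<open>j < d\<close> these form a frame of \<open>O(n) \<otimes> X\<close> over the
  chart.\<close>

definition e_sec :: "int \<Rightarrow> nat \<Rightarrow> nat \<Rightarrow> nat \<Rightarrow> sheaf_sec" where
  "e_sec n d i j = (\<lambda>\<xi>. if \<xi> \<in> Uc i then (\<xi> $ i) powi n \<cdot>\<^sub>v unit_vec d j else 0\<^sub>v d)"

lemma e_sec_section:
  assumes i: "i < 2"
  shows "e_sec n d i j \<in> sections n d (Uc i)"
proof (rule sectionsI)
  fix k assume k: "k < d"
  have "e_sec n d i j \<xi> $ k = (if j = k then (if \<xi> \<in> Uc i then (\<xi> $ i) powi n else 0) else 0)" for \<xi>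
    using k by (auto simp: e_sec_def unit_vec_def)
  then show "(\<lambda>\<xi>. e_sec n d i j \<xi> $ k) \<in> O_sections n (Uc i)"
    using O_sections_powi[OF i, of n] O_sections_zero[OF zariski_open_Uc[OF i]] by (cases "j = k") auto
qed (auto simp: e_sec_def)

lemma mor_inject:
  assumes M: "\<And>\<xi>. \<xi> \<notin> PV \<Longrightarrow> M \<xi> = 0" "\<And>\<xi>. fits d' d (M \<xi>)"
    and M': "\<And>\<xi>. \<xi> \<notin> PV \<Longrightarrow> M' \<xi> = 0" "\<And>\<xi>. fits d' d (M' \<xi>)"
    and eq: "mor n d d' M = mor n d d' M'"
  shows "M = M'"
proof
  fix \<xi>
  show "M \<xi> = M' \<xi>"
  proof (cases "\<xi> \<in> PV")
    case True
    obtain i where i: "i < 2" "\<xi> $ i \<noteq> 0" using PV_coordE[OF True] by blast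
    then have \<xi>: "\<xi> \<in> Uc i" using True by (simp add: Uc_def)
    have col: "(unemb d' d A *\<^sub>v e_sec n d i j \<xi>) $ k = ent A k j * (\<xi> $ i) powi n" if "k < d'" "j < d" for A k j
    proof -
      have "(unemb d' d A *\<^sub>v e_sec n d i j \<xi>) $ k = (\<Sum>l<d. if l = j then ent A k j * (\<xi> $ i) powi n else 0)"
        by (subst unemb_mult_vec[OF that(1) sections_carrier[OF e_sec_section[OF i(1)]]])
          (rule sum.cong, use \<xi> that in \<open>auto simp: e_sec_def\<close>)
      then show ?thesis using that by simp
    qed
    have "ent (M \<xi>) k j = ent (M' \<xi>) k j" for k j
    proof (cases "k < d' \<and> j < d")
      case True
      have "mor n d d' M (Uc i) (e_sec n d i j) \<xi> $ k = mor n d d' M' (Uc i) (e_sec n d i j) \<xi> $ k"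
        by (simp add: eq)
      then show ?thesis
        using True \<xi> i col by (simp add: mor_apply[OF zariski_open_Uc[OF i(1)] e_sec_section[OF i(1)]])
    next
      case False
      then show ?thesis using M(2)[of \<xi>] M'(2)[of \<xi>] unfolding fits_def by (metis not_less)
    qed
    then show ?thesis by (rule fmat_eqI)
  qed (simp add: M M')
qed

lemma equivariant_morphismD:
  assumes "equivariant_morphism G n d \<rho> n' d' \<rho>' \<phi>" "zariski_open U" "s \<in> sections n d U"
  shows "\<phi> U s \<in> sections n' d' U"
    "t \<in> sections n d U \<Longrightarrow> \<phi> U (\<lambda>\<xi>. s \<xi> + t \<xi>) = (\<lambda>\<xi>. \<phi> U s \<xi> + \<phi> U t \<xi>)"
    "f \<in> O_sections 0 U \<Longrightarrow> \<phi> U (\<lambda>\<xi>. f \<xi> \<cdot>\<^sub>v s \<xi>) = (\<lambda>\<xi>. f \<xi> \<cdot>\<^sub>v \<phi> U s \<xi>)"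
    "zariski_open W \<Longrightarrow> W \<subseteq> U \<Longrightarrow> \<phi> W (res_sec d W s) = res_sec d' W (\<phi> U s)"
    "g \<in> G \<Longrightarrow> \<phi> (act_open g U) (act_sec d \<rho> g s) = act_sec d' \<rho>' g (\<phi> U s)"
  using assms unfolding equivariant_morphism_def by blast+

text \<open>The generators of \<open>\<O>(n) \<otimes> X\<close> over the two standard charts determine a morphism, because
  morphisms are \<open>\<O>\<close>-linear and compatible with restriction.\<close>

lemma equivariant_morphism_local:
  assumes \<phi>: "equivariant_morphism G n d \<rho> n' d' \<rho>' \<phi>" and i: "i < 2" and U: "zariski_open U"
    and s: "s \<in> sections n d U" and \<xi>: "\<xi> \<in> U" "\<xi> $ i \<noteq> 0" and k: "k < d'"
  shows "\<phi> U s \<xi> $ k = (\<Sum>j<d. \<phi> (Uc i) (e_sec n d i j) \<xi> $ k * (\<xi> $ i) powi (- n) * s \<xi> $ j)"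
proof -
  define W where "W = U \<inter> Uc i"
  have W: "zariski_open W" "W \<subseteq> U" "W \<subseteq> Uc i"
    unfolding W_def using zariski_open_Int[OF U zariski_open_Uc[OF i]] by auto
  have \<xi>W: "\<xi> \<in> W" using \<xi> zariski_open_subset[OF U] by (auto simp: W_def Uc_def)
  \<comment> \<open>The coordinates of \<open>s\<close> in the frame over \<open>W\<close>: dividing
    by the generator of degree \<open>n\<close> leaves functions of degree zero, over which
    \<open>\<phi>\<close> is linear.\<close>
  define f where "f = (\<lambda>j \<xi>. (if \<xi> \<in> W then (if \<xi> \<in> Uc i then (\<xi> $ i) powi (- n) else 0) else 0) * res_sec d W s \<xi> $ j)"
  have f: "f j \<in> O_sections 0 W" if "j < d" for j
    unfolding f_def
    using O_sections_mult[OF O_sections_restrict[OF O_sections_powi[OF i, of "- n"] W(1,3)] sections_coord[OF sections_res[OF s W(1,2)] that]]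
    by simp
  define E where "E = (\<lambda>j. res_sec d W (e_sec n d i j))"
  have E: "E j \<in> sections n d W" for j
    unfolding E_def by (rule sections_res[OF e_sec_section[OF i] W(1,3)])
  have fE: "(\<lambda>\<xi>. f j \<xi> \<cdot>\<^sub>v E j \<xi>) \<in> sections n d W" if "j < d" for j
    using sections_smult[OF f[OF that] E] by simp
  \<comment> \<open>Partial sums of the frame expansion. Additivity of \<open>\<phi>\<close>
    concerns two sections at a time, so the expansion is built up by induction on
    \<open>m\<close>.\<close>
  define S where "S = (\<lambda>m \<xi>. vec d (\<lambda>j. if j < m then res_sec d W s \<xi> $ j else 0))"
  have S_Suc: "S (Suc m) = (\<lambda>\<xi>. S m \<xi> + f m \<xi> \<cdot>\<^sub>v E m \<xi>)" if "m < d" for m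
  proof
    fix \<eta>
    show "S (Suc m) \<eta> = S m \<eta> + f m \<eta> \<cdot>\<^sub>v E m \<eta>"
    proof (rule eq_vecI)
      fix l assume "l < dim_vec (S m \<eta> + f m \<eta> \<cdot>\<^sub>v E m \<eta>)"
      then have l: "l < d" by (simp add: carrier_vecD[OF sections_carrier[OF E]])
      show "S (Suc m) \<eta> $ l = (S m \<eta> + f m \<eta> \<cdot>\<^sub>v E m \<eta>) $ l"
      proof (cases "\<eta> \<in> W")
        case True
        then have "\<eta> \<in> Uc i" "\<eta> $ i \<noteq> 0" using W(3) by (auto simp: Uc_def)
        then show ?thesis using True l that
          by (auto simp: S_def E_def f_def e_sec_def res_sec_def unit_vec_def power_int_minus less_Suc_eq)
      next
        case False
        then show ?thesis using l by (auto simp: S_def E_def f_def res_sec_def)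
      qed
    qed (simp add: S_def carrier_vecD[OF sections_carrier[OF E]])
  qed
  \<comment> \<open>The zero section is written as a multiple of a section, so that linearity over
    functions shows that \<open>\<phi>\<close> preserves it.\<close>
  have S_0: "S 0 = (\<lambda>\<xi>. 0 \<cdot>\<^sub>v E 0 \<xi>)"
    by (rule ext, rule eq_vecI) (simp_all add: S_def carrier_vecD[OF sections_carrier[OF E]])
  have S_sec: "S m \<in> sections n d W \<and> \<phi> W (S m) \<xi> $ k = (\<Sum>j<m. f j \<xi> * \<phi> W (E j) \<xi> $ k)" if "m \<le> d" for m
    using that
  proof (induction m)
    case 0
    have 0: "(\<lambda>_. 0) \<in> O_sections 0 W" by (rule O_sections_zero[OF W(1)])
    have "\<phi> W (S 0) = (\<lambda>\<xi>. 0 \<cdot>\<^sub>v \<phi> W (E 0) \<xi>)"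
      unfolding S_0 by (rule equivariant_morphismD(3)[OF \<phi> W(1) E 0])
    moreover have "\<phi> W (E 0) \<xi> \<in> carrier_vec d'"
      by (rule sections_carrier[OF equivariant_morphismD(1)[OF \<phi> W(1) E]])
    moreover have "S 0 \<in> sections n d W"
      unfolding S_0 using sections_smult[OF 0 E[of 0]] by simp
    ultimately show ?case using k by simp
  next
    case (Suc m)
    then have m: "m < d" and IH: "S m \<in> sections n d W" "\<phi> W (S m) \<xi> $ k = (\<Sum>j<m. f j \<xi> * \<phi> W (E j) \<xi> $ k)"
      by auto
    have "\<phi> W (S (Suc m)) \<xi> = \<phi> W (S m) \<xi> + f m \<xi> \<cdot>\<^sub>v \<phi> W (E m) \<xi>"
      unfolding S_Suc[OF m] equivariant_morphismD(2)[OF \<phi> W(1) IH(1) fE[OF m]] equivariant_morphismD(3)[OF \<phi> W(1) E f[OF m]] ..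
    moreover have "\<phi> W (E m) \<xi> \<in> carrier_vec d'" "\<phi> W (S m) \<xi> \<in> carrier_vec d'"
      by (rule sections_carrier[OF equivariant_morphismD(1)[OF \<phi> W(1)]], rule E IH)+
    moreover have "S (Suc m) \<in> sections n d W"
      unfolding S_Suc[OF m] by (rule sections_add[OF IH(1) fE[OF m]])
    ultimately show ?case using k IH by simp
  qed
  have "S d = res_sec d W s"
  proof
    fix \<eta>
    have "res_sec d W s \<eta> \<in> carrier_vec d" by (rule sections_carrier[OF sections_res[OF s W(1,2)]])
    then show "S d \<eta> = res_sec d W s \<eta>"
      by (intro eq_vecI) (auto simp: S_def)
  qed
  then have Sd: "\<phi> W (S d) = res_sec d' W (\<phi> U s)"
    using equivariant_morphismD(4)[OF \<phi> U s W(1,2)] by simp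
  have "\<phi> U s \<xi> $ k = \<phi> W (S d) \<xi> $ k"
    unfolding Sd using \<xi>W by (simp add: res_sec_def)
  also have "\<dots> = (\<Sum>j<d. f j \<xi> * \<phi> W (E j) \<xi> $ k)"
    using S_sec by simp
  also have "\<dots> = (\<Sum>j<d. \<phi> (Uc i) (e_sec n d i j) \<xi> $ k * (\<xi> $ i) powi (- n) * s \<xi> $ j)"
  proof (rule sum.cong)
    fix j assume "j \<in> {..<d}"
    have "\<phi> W (E j) \<xi> = \<phi> (Uc i) (e_sec n d i j) \<xi>"
      unfolding E_def equivariant_morphismD(4)[OF \<phi> zariski_open_Uc[OF i] e_sec_section[OF i] W(1,3)]
      using \<xi>W by (simp add: res_sec_def)
    then show "f j \<xi> * \<phi> W (E j) \<xi> $ k = \<phi> (Uc i) (e_sec n d i j) \<xi> $ k * (\<xi> $ i) powi (- n) * s \<xi> $ j"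
      using \<xi>W W by (auto simp: f_def res_sec_def)
  qed simp
  finally show ?thesis .
qed

lemma mult_mat_unit_vec:
  fixes A :: "complex mat"
  assumes "A \<in> carrier_mat n m" "j < m"
  shows "A *\<^sub>v unit_vec m j = col A j"
  using assms by (intro eq_vecI) (auto simp: scalar_prod_right_unit[of _ m])

text \<open>The entries are the values of \<open>\<phi>\<close> on the frame, divided by the
  generator of \<open>O(n)\<close>. Both charts give the same entries because \<open>\<phi>\<close>
  is determined locally, so they glue to global sections of degree \<open>n' - n\<close>, which are
  forms. Equivariance is tested on frame sections, one for each column.\<close>

lemma mor_surj:
  assumes G: "\<And>g. g \<in> G \<Longrightarrow> g \<in> carrier_mat 2 2 \<and> det g = 1"
    and \<rho>: "\<And>g. g \<in> G \<Longrightarrow> \<rho> g \<in> carrier_mat d d" and \<rho>': "\<And>g. g \<in> G \<Longrightarrow> \<rho>' g \<in> carrier_mat d' d'"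
    and \<phi>: "equivariant_morphism G n d \<rho> n' d' \<rho>' \<phi>"
  shows "\<exists>M \<in> HM G (n' - n) d \<rho> d' \<rho>'. \<phi> = mor n d d' M"
proof -
  define m where "m = (\<lambda>i k j \<xi>. \<phi> (Uc i) (e_sec n d i j) \<xi> $ k * (\<xi> $ i) powi (- n))"
  \<comment> \<open>A chart containing the point; \<open>ent_M\<close> shows that any other choice
    gives the same entries.\<close>
  define c where "c = (\<lambda>\<xi>::complex vec. if \<xi> $ 0 \<noteq> 0 then 0 else 1::nat)"
  define M where "M = (\<lambda>\<xi>. if \<xi> \<in> PV then mk d' d (\<lambda>k j. m (c \<xi>) k j \<xi>) else 0)"
  have c: "c \<xi> < 2" "\<xi> \<in> PV \<Longrightarrow> \<xi> $ c \<xi> \<noteq> 0" for \<xi>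
    by (auto simp: c_def PV_iff)
  have local: "\<phi> U s \<xi> = unemb d' d (M \<xi>) *\<^sub>v s \<xi>" if U: "zariski_open U" and s: "s \<in> sections n d U" and \<xi>: "\<xi> \<in> U" for U s \<xi>
  proof (rule eq_vecI)
    have PV: "\<xi> \<in> PV" using \<xi> zariski_open_subset[OF U] by auto
    show "dim_vec (\<phi> U s \<xi>) = dim_vec (unemb d' d (M \<xi>) *\<^sub>v s \<xi>)"
      using sections_carrier[OF equivariant_morphismD(1)[OF \<phi> U s], of \<xi>] unemb_mult_vec_carrier[of d' d "M \<xi>" "s \<xi>"] by simp
    fix k assume "k < dim_vec (unemb d' d (M \<xi>) *\<^sub>v s \<xi>)"
    then have k: "k < d'" using unemb_mult_vec_carrier[of d' d "M \<xi>" "s \<xi>"] by simp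
    show "\<phi> U s \<xi> $ k = (unemb d' d (M \<xi>) *\<^sub>v s \<xi>) $ k"
      unfolding unemb_mult_vec[OF k sections_carrier[OF s]] equivariant_morphism_local[OF \<phi> c(1) U s \<xi> c(2)[OF PV] k]
      using k PV by (intro sum.cong) (auto simp: M_def m_def)
  qed
  have ent_M: "ent (M \<xi>) k j = m i k j \<xi>" if "i < 2" "\<xi> \<in> Uc i" "k < d'" "j < d" for i k j \<xi>
  proof -
    have nz: "\<xi> $ i \<noteq> 0" using that by (simp add: Uc_def)
    have "\<phi> (Uc i) (e_sec n d i j) \<xi> $ k = (\<Sum>l<d. ent (M \<xi>) k l * e_sec n d i j \<xi> $ l)"
      unfolding local[OF zariski_open_Uc[OF that(1)] e_sec_section[OF that(1)] that(2)]
      by (rule unemb_mult_vec[OF that(3) sections_carrier[OF e_sec_section[OF that(1)]]])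
    also have "\<dots> = (\<Sum>l<d. if l = j then ent (M \<xi>) k j * (\<xi> $ i) powi n else 0)"
      by (rule sum.cong) (use that in \<open>auto simp: e_sec_def\<close>)
    also have "\<dots> = ent (M \<xi>) k j * (\<xi> $ i) powi n"
      using that by simp
    finally show ?thesis
      using nz by (simp add: m_def power_int_minus)
  qed
  have hpM: "hp (n' - n) (\<lambda>\<xi>. ent (M \<xi>) k j)" for k j
  proof (cases "k < d' \<and> j < d")
    case True
    have "(\<lambda>\<xi>. ent (M \<xi>) k j) \<in> O_sections (n' - n) PV"
    proof (rule O_sections_glue)
      fix i :: nat assume i: "i < 2"
      have "(\<lambda>\<xi>. \<phi> (Uc i) (e_sec n d i j) \<xi> $ k * (if \<xi> \<in> Uc i then (\<xi> $ i) powi (- n) else 0)) \<in> O_sections (n' + - n) (Uc i)"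
        by (intro O_sections_mult O_sections_powi[OF i] sections_coord[OF equivariant_morphismD(1)[OF \<phi> zariski_open_Uc[OF i] e_sec_section[OF i]]])
          (use True in simp)
      moreover have "\<phi> (Uc i) (e_sec n d i j) \<xi> $ k * (if \<xi> \<in> Uc i then (\<xi> $ i) powi (- n) else 0) = (if \<xi> \<in> Uc i then ent (M \<xi>) k j else 0)" for \<xi>
        using True ent_M[OF i] by (simp add: m_def)
      ultimately show "(\<lambda>\<xi>. if \<xi> \<in> Uc i then ent (M \<xi>) k j else 0) \<in> O_sections (n' - n) (Uc i)"
        by simp
    qed (simp add: M_def)
    then show ?thesis by (rule O_sections_PV_hp)
  next
    case False
    then have "ent (M \<xi>) k j = 0" for \<xi> by (auto simp: M_def)
    then show ?thesis by simp
  qed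
  have fM: "fits d' d (M \<xi>)" for \<xi> by (simp add: M_def)
  have eqM: "emb (\<rho>' g) * M (transpose_mat g *\<^sub>v \<xi>) = M \<xi> * emb (\<rho> g)" if g: "g \<in> G" and \<xi>: "\<xi> \<in> PV" for g \<xi>
  proof -
    define \<eta> where "\<eta> = transpose_mat g *\<^sub>v \<xi>"
    have \<eta>: "\<eta> \<in> PV" unfolding \<eta>_def using transpose_mult_PV G[OF g] \<xi> by blast
    obtain i where i: "i < 2" "\<eta> $ i \<noteq> 0" using PV_coordE[OF \<eta>] by blast
    have \<eta>U: "\<eta> \<in> Uc i" using i \<eta> by (simp add: Uc_def)
    have \<xi>U: "\<xi> \<in> act_open g (Uc i)" using \<eta>U PV_carrier[OF \<xi>] by (simp add: act_open_def \<eta>_def)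
    have o: "zariski_open (act_open g (Uc i))" using zariski_open_act zariski_open_Uc[OF i(1)] G[OF g] by blast
    have A: "unemb d' d (M \<xi>) * \<rho> g \<in> carrier_mat d' d" and B: "\<rho>' g * unemb d' d (M \<eta>) \<in> carrier_mat d' d"
      using \<rho>[OF g] \<rho>'[OF g] by (auto intro: mult_carrier_mat[of _ d' d _ d] mult_carrier_mat[of _ d' d' _ d])
    have "(unemb d' d (M \<xi>) * \<rho> g) *\<^sub>v unit_vec d j = (\<rho>' g * unemb d' d (M \<eta>)) *\<^sub>v unit_vec d j" if "j < d" for j
    proof -
      define x where "x = (\<eta> $ i) powi n"
      have x: "x \<noteq> 0" using i by (simp add: x_def)
      define s where "s = e_sec n d i j"
      have s: "s \<in> sections n d (Uc i)" unfolding s_def by (rule e_sec_section[OF i(1)])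
      have a: "act_sec d \<rho> g s \<in> sections n d (act_open g (Uc i))"
        using sections_act[where \<rho> = \<rho>, OF _ _ \<rho>[OF g] zariski_open_Uc[OF i(1)] s] G[OF g] by blast
      have s\<eta>: "s \<eta> = x \<cdot>\<^sub>v unit_vec d j" using \<eta>U by (simp add: s_def e_sec_def x_def)
      have "\<phi> (act_open g (Uc i)) (act_sec d \<rho> g s) \<xi> = act_sec d' \<rho>' g (\<phi> (Uc i) s) \<xi>"
        using equivariant_morphismD(5)[OF \<phi> zariski_open_Uc[OF i(1)] s g] by simp
      then have "unemb d' d (M \<xi>) *\<^sub>v (\<rho> g *\<^sub>v s \<eta>) = \<rho>' g *\<^sub>v (unemb d' d (M \<eta>) *\<^sub>v s \<eta>)"
        using PV_carrier[OF \<xi>] local[OF zariski_open_Uc[OF i(1)] s \<eta>U]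
        unfolding local[OF o a \<xi>U] by (simp add: act_sec_def \<eta>_def)
      then have "(unemb d' d (M \<xi>) * \<rho> g) *\<^sub>v s \<eta> = (\<rho>' g * unemb d' d (M \<eta>)) *\<^sub>v s \<eta>"
        using \<rho>[OF g] \<rho>'[OF g] sections_carrier[OF s, of \<eta>]
        by (simp add: assoc_mult_mat_vec[of _ d' d _ d] assoc_mult_mat_vec[of _ d' d' _ d])
      then have "x \<cdot>\<^sub>v ((unemb d' d (M \<xi>) * \<rho> g) *\<^sub>v unit_vec d j) = x \<cdot>\<^sub>v ((\<rho>' g * unemb d' d (M \<eta>)) *\<^sub>v unit_vec d j)"
        unfolding s\<eta> by (simp add: mult_mat_vec[OF A] mult_mat_vec[OF B])
      then have "inverse x \<cdot>\<^sub>v (x \<cdot>\<^sub>v ((unemb d' d (M \<xi>) * \<rho> g) *\<^sub>v unit_vec d j)) = inverse x \<cdot>\<^sub>v (x \<cdot>\<^sub>v ((\<rho>' g * unemb d' d (M \<eta>)) *\<^sub>v unit_vec d j))"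
        by simp
      then show ?thesis using x by (simp add: smult_smult_assoc)
    qed
    then have "col (unemb d' d (M \<xi>) * \<rho> g) j = col (\<rho>' g * unemb d' d (M \<eta>)) j" if "j < d" for j
      using that mult_mat_unit_vec[OF A that] mult_mat_unit_vec[OF B that] by simp
    then have "unemb d' d (M \<xi>) * \<rho> g = \<rho>' g * unemb d' d (M \<eta>)"
      by (intro mat_col_eqI) (use A B in auto)
    then have "emb (unemb d' d (M \<xi>) * \<rho> g) = emb (\<rho>' g * unemb d' d (M \<eta>))" by simp
    then show ?thesis
      using \<rho>[OF g] \<rho>'[OF g] by (simp add: emb_mult[of _ d' d' _ d] emb_mult[of _ d' d _ d] emb_unemb fM \<eta>_def)
  qed
  have "M \<in> HM G (n' - n) d \<rho> d' \<rho>'"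
    using hpM fM eqM by (auto simp: HM_def M_def)
  moreover have "\<phi> = mor n d d' M"
  proof (intro ext)
    fix U s \<xi>
    show "\<phi> U s \<xi> = mor n d d' M U s \<xi>"
    proof (cases "zariski_open U \<and> s \<in> sections n d U")
      case True
      then show ?thesis
        using local[of U s \<xi>] sections_off[OF equivariant_morphismD(1)[OF \<phi>], of U s \<xi>] by (simp add: mor_apply)
    next
      case False
      then have "\<phi> U s = (\<lambda>_. 0\<^sub>v d')" using \<phi> unfolding equivariant_morphism_def by blast
      then show ?thesis using False by (auto simp: mor_def)
    qed
  qed
  ultimately show ?thesis by blast
qed

lemma mor_add: "mor n d d' (M + M') = (\<lambda>U s \<xi>. mor n d d' M U s \<xi> + mor n d d' M' U s \<xi>)"
proof (intro ext)
  fix U s \<xi>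
  show "mor n d d' (M + M') U s \<xi> = mor n d d' M U s \<xi> + mor n d d' M' U s \<xi>"
  proof (cases "zariski_open U \<and> s \<in> sections n d U \<and> \<xi> \<in> U")
    case True
    then have s: "s \<xi> \<in> carrier_vec d" using sections_carrier by blast
    have "unemb d' d (M \<xi> + M' \<xi>) *\<^sub>v s \<xi> = unemb d' d (M \<xi>) *\<^sub>v s \<xi> + unemb d' d (M' \<xi>) *\<^sub>v s \<xi>"
    proof (rule eq_vecI)
      fix k assume "k < dim_vec (unemb d' d (M \<xi>) *\<^sub>v s \<xi> + unemb d' d (M' \<xi>) *\<^sub>v s \<xi>)"
      then have "k < d'" by (simp add: unemb_def)
      then show "(unemb d' d (M \<xi> + M' \<xi>) *\<^sub>v s \<xi>) $ k = (unemb d' d (M \<xi>) *\<^sub>v s \<xi> + unemb d' d (M' \<xi>) *\<^sub>v s \<xi>) $ k"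
        using unemb_mult_vec[OF _ s, of k d'] unemb_mult_vec_carrier[of d' d "M' \<xi>" "s \<xi>"]
        by (simp add: distrib_right sum.distrib carrier_vecD)
    qed (simp add: unemb_def)
    then show ?thesis using True by (simp add: mor_apply)
  qed (auto simp: mor_def)
qed

lemma mor_smult: "mor n d d' (\<lambda>\<xi>. c *\<^sub>F M \<xi>) = (\<lambda>U s \<xi>. c \<cdot>\<^sub>v mor n d d' M U s \<xi>)"
proof (intro ext)
  fix U s \<xi>
  show "mor n d d' (\<lambda>\<xi>. c *\<^sub>F M \<xi>) U s \<xi> = c \<cdot>\<^sub>v mor n d d' M U s \<xi>"
  proof (cases "zariski_open U \<and> s \<in> sections n d U \<and> \<xi> \<in> U")
    case True
    then have s: "s \<xi> \<in> carrier_vec d" using sections_carrier by blast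
    have "unemb d' d (c *\<^sub>F M \<xi>) *\<^sub>v s \<xi> = c \<cdot>\<^sub>v (unemb d' d (M \<xi>) *\<^sub>v s \<xi>)"
    proof (rule eq_vecI)
      fix k assume "k < dim_vec (c \<cdot>\<^sub>v (unemb d' d (M \<xi>) *\<^sub>v s \<xi>))"
      then have "k < d'" by (simp add: unemb_def)
      then show "(unemb d' d (c *\<^sub>F M \<xi>) *\<^sub>v s \<xi>) $ k = (c \<cdot>\<^sub>v (unemb d' d (M \<xi>) *\<^sub>v s \<xi>)) $ k"
        using unemb_mult_vec[OF _ s, of k d'] unemb_mult_vec_carrier[of d' d "M \<xi>" "s \<xi>"]
        by (simp add: sum_distrib_left mult.assoc carrier_vecD)
    qed (simp add: unemb_def)
    then show ?thesis using True by (simp add: mor_apply)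
  qed (auto simp: mor_def)
qed

lemma mor_zero: "mor n d d' 0 = (\<lambda>U s \<xi>. 0\<^sub>v d')"
proof (intro ext)
  fix U s \<xi>
  have "unemb d' d 0 *\<^sub>v v = 0\<^sub>v d'" if "v \<in> carrier_vec d" for v
    by (rule eq_vecI) (use unemb_mult_vec[OF _ that, of _ d' 0] in \<open>auto simp: unemb_def\<close>)
  then show "mor n d d' 0 U s \<xi> = 0\<^sub>v d'"
    by (auto simp: mor_def sections_carrier)
qed

section \<open>Complete reducibility and Schur's lemma\<close>

lemma subspace_vecD:
  assumes "VectorSpace.subspace class_ring W (module_vec TYPE(complex) d)"
  shows "W \<subseteq> carrier_vec d" "0\<^sub>v d \<in> W" "v \<in> W \<Longrightarrow> w \<in> W \<Longrightarrow> v + w \<in> W" "v \<in> W \<Longrightarrow> c \<cdot>\<^sub>v v \<in> W"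
proof -
  interpret submodule class_ring W "module_vec TYPE(complex) d"
    using assms by (rule VectorSpace.subspace.submod)
  show "W \<subseteq> carrier_vec d" "0\<^sub>v d \<in> W" "v \<in> W \<Longrightarrow> w \<in> W \<Longrightarrow> v + w \<in> W" "v \<in> W \<Longrightarrow> c \<cdot>\<^sub>v v \<in> W"
    using subset zero_closed m_closed[of v w] smult_closed[of c v] by (auto simp: module_vec_simps)
qed

lemma subspace_vecI:
  assumes "W \<subseteq> carrier_vec d" "0\<^sub>v d \<in> W" "\<And>v w. v \<in> W \<Longrightarrow> w \<in> W \<Longrightarrow> v + w \<in> W" "\<And>c v. v \<in> W \<Longrightarrow> c \<cdot>\<^sub>v v \<in> W"
  shows "VectorSpace.subspace class_ring W (module_vec TYPE(complex) d)"
proof -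
  interpret vec_space "TYPE(complex)" d .
  show ?thesis
    unfolding VectorSpace.subspace_def
    by (auto intro!: submodule.intro vectorspace_axioms module_axioms simp: assms(2-4) module_vec_simps)
      (use assms(1) in auto)
qed

lemma mat_eq_by_vec:
  fixes A B :: "complex mat"
  assumes A: "A \<in> carrier_mat n m" and B: "B \<in> carrier_mat n m"
    and eq: "\<And>v. v \<in> carrier_vec m \<Longrightarrow> A *\<^sub>v v = B *\<^sub>v v"
  shows "A = B"
proof (rule mat_col_eqI)
  fix j assume "j < dim_col B"
  then have "j < m" using B by simp
  then show "col A j = col B j"
    using eq[of "unit_vec m j"] mult_mat_unit_vec[OF A] mult_mat_unit_vec[OF B] by simp
qed (use A B in auto)

text \<open>The columns of \<open>\<iota>\<close> are an orthogonal basis of \<open>W\<close>, so a left inverse is given by the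
  rescaled adjoint.\<close>

lemma subspace_split:
  assumes W: "VectorSpace.subspace class_ring W (module_vec TYPE(complex) d)"
  obtains r \<iota> \<pi> where "\<iota> \<in> carrier_mat d r" "\<pi> \<in> carrier_mat r d" "\<pi> * \<iota> = 1\<^sub>m r"
    "\<forall>x\<in>carrier_vec r. \<iota> *\<^sub>v x \<in> W" "\<forall>w\<in>W. \<iota> *\<^sub>v (\<pi> *\<^sub>v w) = w"
proof -
  interpret cof_vec_space d "TYPE(complex)" .
  note sub = subspace_vecD[OF W]
  \<comment> \<open>A maximal independent subset of \<open>W\<close> exists because independent sets
    have at most \<open>d\<close> elements; maximality makes \<open>W\<close> lie in its
    span.\<close>
  have "\<exists>A. finite A \<and> maximal A (\<lambda>S. S \<subseteq> W \<and> lin_indpt S)"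
  proof (rule maximal_exists[where N = dim and B = "{}"])
    fix A :: "complex vec set" assume A: "A \<subseteq> W \<and> lin_indpt A"
    then have "A \<subseteq> carrier_vec d" using sub(1) by blast
    then show "finite A \<and> card A \<le> dim"
      using li_le_dim[OF fin_dim, of A] A by simp
  next
    show "{} \<subseteq> W \<and> lin_indpt {}" by (simp add: lin_dep_def)
  qed
  then obtain A where fA: "finite A" and mA: "maximal A (\<lambda>S. S \<subseteq> W \<and> lin_indpt S)" by (elim exE conjE)
  have A: "finite A" "A \<subseteq> W" "lin_indpt A"
    using fA mA by (simp_all add: maximal_def)
  have max: "B = A" if "A \<subseteq> B" "B \<subseteq> W" "lin_indpt B" for B
    using mA that unfolding maximal_def by (elim conjE allE[of _ B] impE) simp_all
  have Ac: "A \<subseteq> carrier_vec d" using A sub(1) by auto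
  have W_span: "w \<in> span A" if w: "w \<in> W" for w
  proof (cases "w \<in> A")
    case True
    then show ?thesis using in_own_span[OF Ac] by auto
  next
    case False
    have "lin_dep (A \<union> {w})"
    proof (rule ccontr)
      assume "lin_indpt (A \<union> {w})"
      moreover have "A \<union> {w} \<subseteq> W" using A(2) w by simp
      ultimately have "A \<union> {w} = A" by (intro max) blast+
      then show False using False by blast
    qed
    then show ?thesis
      using lin_dep_iff_in_span[of A w] Ac A(3) w sub(1) False by auto
  qed
  obtain ws where ws: "set ws = A" "distinct ws" using finite_distinct_list[OF A(1)] by auto
  define us where "us = gram_schmidt d ws"
  have gs: "span (set ws) = span (set us)" "corthogonal us" "set us \<subseteq> carrier_vec d"
    using gram_schmidt_result[of ws us] ws Ac A(3) by (auto simp: us_def)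
  define r where "r = length us"
  define \<iota> where "\<iota> = mat_of_cols d us"
  define \<pi> where "\<pi> = mat r d (\<lambda>(i, j). conjugate (us ! i $ j) / (us ! i \<bullet>c us ! i))"
  have \<iota>: "\<iota> \<in> carrier_mat d r" by (simp add: \<iota>_def r_def)
  have \<pi>: "\<pi> \<in> carrier_mat r d" by (simp add: \<pi>_def)
  have usd: "us ! i \<in> carrier_vec d" if "i < r" for i using gs(3) that by (auto simp: r_def)
  have \<pi>\<iota>: "\<pi> * \<iota> = 1\<^sub>m r"
  proof (rule eq_matI)
    fix i k assume "i < dim_row (1\<^sub>m r :: complex mat)" "k < dim_col (1\<^sub>m r :: complex mat)"
    then have ik: "i < r" "k < r" by auto
    have "(\<pi> * \<iota>) $$ (i, k) = (\<Sum>j<d. conjugate (us ! i $ j) / (us ! i \<bullet>c us ! i) * us ! k $ j)"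
      using ik \<pi> \<iota> by (auto simp: scalar_prod_def \<pi>_def \<iota>_def r_def mat_of_cols_def atLeast0LessThan intro!: sum.cong)
    also have "\<dots> = (us ! k \<bullet>c us ! i) / (us ! i \<bullet>c us ! i)"
      using usd[OF ik(1)] usd[OF ik(2)]
      by (auto simp: scalar_prod_def sum_divide_distrib atLeast0LessThan intro!: sum.cong)
    also have "\<dots> = 1\<^sub>m r $$ (i, k)"
      using ik corthogonalD[OF gs(2), of k i] corthogonalD[OF gs(2), of i i] by (auto simp: r_def)
    finally show "(\<pi> * \<iota>) $$ (i, k) = 1\<^sub>m r $$ (i, k)" .
  qed (use \<pi> \<iota> in auto)
  have span_W: "span A \<subseteq> W"
  proof
    fix v assume "v \<in> span A"
    then obtain a where v: "v = lincomb a A"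
      using finite_in_span[OF A(1) Ac] by auto
    have "lincomb a B \<in> W" if "B \<subseteq> A" "finite B" for B
      using that(2,1)
    proof (induction B rule: finite_induct)
      case empty
      then show ?case using sub(2) by (simp add: lincomb_def)
    next
      case (insert x B)
      have "lincomb a (insert x B) = a x \<cdot>\<^sub>v x + lincomb a B"
        using lincomb_insert2[OF insert.hyps(1) _ _ insert.hyps(2), of a] insert.prems Ac by (auto simp: module_vec_simps)
      then show ?case using insert A(2) sub(3,4) by auto
    qed
    then show "v \<in> W" using v A(1) by auto
  qed
  have list: "v \<in> span A \<longleftrightarrow> (\<exists>c. v = \<iota> *\<^sub>v vec r c)" for v
  proof -
    have "\<forall>w\<in>set us. dim_vec w = d" using gs(3) by (auto simp: carrier_vecD)
    then have "lincomb_list c us = \<iota> *\<^sub>v vec r c" for c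
      unfolding \<iota>_def r_def by (rule lincomb_list_as_mat_mult)
    then show ?thesis
      unfolding ws(1)[symmetric] gs(1) span_list_as_span[OF gs(3), symmetric] span_list_def by simp
  qed
  show ?thesis
  proof (rule that[OF \<iota> \<pi> \<pi>\<iota>]; intro ballI)
    fix x :: "complex vec" assume x: "x \<in> carrier_vec r"
    then have "vec r (\<lambda>i. x $ i) = x" by auto
    then have "\<iota> *\<^sub>v x \<in> span A" unfolding list by (intro exI[of _ "\<lambda>i. x $ i"]) simp
    then show "\<iota> *\<^sub>v x \<in> W" using span_W by blast
  next
    fix w assume "w \<in> W"
    then obtain c where w: "w = \<iota> *\<^sub>v vec r c" using W_span[OF \<open>w \<in> W\<close>] unfolding list by blast
    have "\<pi> *\<^sub>v w = vec r c"
      unfolding w using assoc_mult_mat_vec[OF \<pi> \<iota>, of "vec r c"] \<pi>\<iota> by simp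
    then show "\<iota> *\<^sub>v (\<pi> *\<^sub>v w) = w" by (simp add: w)
  qed
qed

section \<open>Matrix representations of the group and averaging over it\<close>

lemma carrier_GL: "carrier (GL d) \<subseteq> carrier_mat d d"
  by (auto simp: GL_def units_of_def Units_def ring_mat_def)

lemma mult_GL [simp]: "monoid.mult (GL d) = (*)" "one (GL d) = 1\<^sub>m d"
  by (simp_all add: GL_def units_of_def ring_mat_def)

lemma group_GL: "group (GL d)"
proof -
  interpret ring "ring_mat TYPE(complex) d ()" by (rule ring_mat)
  show ?thesis unfolding GL_def by (rule units_group)
qed

context mckay
begin

lemma G_mat: "g \<in> G \<Longrightarrow> g \<in> carrier_mat 2 2" "g \<in> G \<Longrightarrow> det g = 1"
  using G_SU2 by (auto simp: SU2_def)

lemma G_mult: "g \<in> G \<Longrightarrow> h \<in> G \<Longrightarrow> g * h \<in> G"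
  using subgroup.m_closed[OF subgroup_G] by simp

lemma G_one: "1\<^sub>m 2 \<in> G"
  using subgroup.one_closed[OF subgroup_G] by simp

definition gi :: "complex mat \<Rightarrow> complex mat" where
  "gi g = inv\<^bsub>GL 2\<^esub> g"

lemma gi_G: "g \<in> G \<Longrightarrow> gi g \<in> G"
  using subgroup.m_inv_closed[OF subgroup_G] by (simp add: gi_def)

lemma gi_mult: "g \<in> G \<Longrightarrow> g * gi g = 1\<^sub>m 2" "g \<in> G \<Longrightarrow> gi g * g = 1\<^sub>m 2"
  using group.r_inv[OF group_GL, of g 2] group.l_inv[OF group_GL, of g 2] subgroup.subset[OF subgroup_G]
  by (auto simp: gi_def)

lemma gi_prod: "g \<in> G \<Longrightarrow> h \<in> G \<Longrightarrow> gi (g * h) = gi h * gi g"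
  using group.inv_mult_group[OF group_GL, of g 2 h] subgroup.subset[OF subgroup_G]
  by (auto simp: gi_def)

lemma is_rep_iff: "is_rep G d \<sigma> \<longleftrightarrow> (\<forall>g\<in>G. \<sigma> g \<in> carrier_mat d d) \<and>
    (\<forall>g\<in>G. \<forall>h\<in>G. \<sigma> (g * h) = \<sigma> g * \<sigma> h) \<and> \<sigma> (1\<^sub>m 2) = 1\<^sub>m d" (is "?l \<longleftrightarrow> ?r")
proof
  assume l: ?l
  have G: "group ((GL 2)\<lparr>carrier := G\<rparr>)"
    by (rule subgroup.subgroup_is_group[OF subgroup_G group_GL])
  have "group_hom ((GL 2)\<lparr>carrier := G\<rparr>) (GL d) \<sigma>"
    using l G group_GL[of d] by (auto simp: is_rep_def group_hom_def group_hom_axioms_def)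
  from group_hom.hom_one[OF this] have "\<sigma> (1\<^sub>m 2) = 1\<^sub>m d" by simp
  then show ?r using l carrier_GL[of d] by (auto simp: is_rep_def hom_def Pi_def)
next
  assume r: ?r
  have "\<sigma> g \<in> carrier (GL d)" if "g \<in> G" for g
  proof -
    have "\<sigma> (gi g) * \<sigma> g = 1\<^sub>m d" "\<sigma> g * \<sigma> (gi g) = 1\<^sub>m d"
      using r gi_G[OF that] gi_mult[OF that] that by metis+
    then show ?thesis
      using r that gi_G[OF that] by (auto simp: GL_def units_of_def Units_def ring_mat_def)
  qed
  then show ?l using r by (auto simp: is_rep_def hom_def)
qed

lemma rep_carrier: "is_rep G d \<sigma> \<Longrightarrow> g \<in> G \<Longrightarrow> \<sigma> g \<in> carrier_mat d d"
  by (simp add: is_rep_iff)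

lemma rep_fits: "is_rep G d \<sigma> \<Longrightarrow> g \<in> G \<Longrightarrow> fits d d (emb (\<sigma> g))"
  by (rule fits_emb[OF rep_carrier])

lemma rep_mult: "is_rep G d \<sigma> \<Longrightarrow> g \<in> G \<Longrightarrow> h \<in> G \<Longrightarrow> emb (\<sigma> (g * h)) = emb (\<sigma> g) * emb (\<sigma> h)"
  by (simp add: is_rep_iff emb_mult[of _ d d _ d])

lemma rep_inv:
  assumes "is_rep G d \<sigma>" "g \<in> G"
  shows "emb (\<sigma> g) * emb (\<sigma> (gi g)) = fid d" "emb (\<sigma> (gi g)) * emb (\<sigma> g) = fid d"
  using assms rep_mult[OF assms(1), of g "gi g"] rep_mult[OF assms(1), of "gi g" g] gi_G[of g] gi_mult[of g]
  by (auto simp: is_rep_iff)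

text \<open>The Reynolds operator for the action \<open>\<psi> \<mapsto> \<sigma>' g * \<psi> (g^-1
  \<xi>) * \<sigma> (g^-1)\<close> on matrix-valued functions; for constant \<open>\<psi>\<close> it
  is the usual averaging of linear maps.\<close>

definition avg :: "(complex mat \<Rightarrow> complex mat) \<Rightarrow> (complex mat \<Rightarrow> complex mat) \<Rightarrow>
    (complex vec \<Rightarrow> fmat) \<Rightarrow> complex vec \<Rightarrow> fmat" where
  "avg \<sigma> \<sigma>' \<psi> \<xi> = inverse (of_nat (card G)) *\<^sub>F (\<Sum>g\<in>G. emb (\<sigma>' g) * \<psi> (transpose_mat g *\<^sub>v \<xi>) * emb (\<sigma> (gi g)))"

lemma card_G: "of_nat (card G) \<noteq> (0 :: complex)"
  using finite_G G_one by (auto simp: card_eq_0_iff)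

lemma transpose_mult_vec_assoc:
  assumes "g \<in> G" "h \<in> G" "\<xi> \<in> carrier_vec 2"
  shows "transpose_mat g *\<^sub>v (transpose_mat h *\<^sub>v \<xi>) = transpose_mat (h * g) *\<^sub>v \<xi>"
  using transpose_mult[OF G_mat(1)[OF assms(2)] G_mat(1)[OF assms(1)]]
    assoc_mult_mat_vec[of "transpose_mat g" 2 2 "transpose_mat h" 2 \<xi>] G_mat(1)[OF assms(1)] G_mat(1)[OF assms(2)] assms(3)
  by simp

lemma G_translate_bij: "h \<in> G \<Longrightarrow> bij_betw (\<lambda>g. h * g) G G"
proof (rule bij_betwI[where g = "\<lambda>g. gi h * g"])
  assume h: "h \<in> G"
  show "(*) h \<in> G \<rightarrow> G" "(*) (gi h) \<in> G \<rightarrow> G" using G_mult h gi_G by auto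
  fix g assume g: "g \<in> G"
  note c = G_mat(1)[OF h] G_mat(1)[OF gi_G[OF h]] G_mat(1)[OF g]
  show "gi h * (h * g) = g"
    using assoc_mult_mat[OF c(2,1,3)] gi_mult[OF h] c by simp
  show "h * (gi h * g) = g"
    using assoc_mult_mat[OF c(1,2,3)] gi_mult[OF h] c by simp
qed

text \<open>Left translation by \<open>h\<close> permutes the summands.\<close>

lemma avg_equivariant:
  assumes \<sigma>: "is_rep G d \<sigma>" and \<sigma>': "is_rep G d' \<sigma>'" and h: "h \<in> G" and \<xi>: "\<xi> \<in> carrier_vec 2"
  shows "emb (\<sigma>' h) * avg \<sigma> \<sigma>' \<psi> (transpose_mat h *\<^sub>v \<xi>) = avg \<sigma> \<sigma>' \<psi> \<xi> * emb (\<sigma> h)"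
proof -
  have *: "emb (\<sigma>' h) * (emb (\<sigma>' g) * \<psi> (transpose_mat g *\<^sub>v (transpose_mat h *\<^sub>v \<xi>)) * emb (\<sigma> (gi g))) =
      emb (\<sigma>' (h * g)) * \<psi> (transpose_mat (h * g) *\<^sub>v \<xi>) * emb (\<sigma> (gi (h * g))) * emb (\<sigma> h)" if g: "g \<in> G" for g
  proof -
    have "emb (\<sigma> (gi (h * g))) * emb (\<sigma> h) = emb (\<sigma> (gi g)) * (emb (\<sigma> (gi h)) * emb (\<sigma> h))"
      using g h by (simp add: gi_prod rep_mult[OF \<sigma>] gi_G mult.assoc)
    also have "\<dots> = emb (\<sigma> (gi g))"
      using mult_fid[OF rep_fits[OF \<sigma> gi_G[OF g]]] by (simp add: rep_inv[OF \<sigma> h])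
    finally show ?thesis
      using g h \<xi> by (simp add: rep_mult[OF \<sigma>'] transpose_mult_vec_assoc mult.assoc)
  qed
  have "emb (\<sigma>' h) * avg \<sigma> \<sigma>' \<psi> (transpose_mat h *\<^sub>v \<xi>) = inverse (of_nat (card G)) *\<^sub>F
      (\<Sum>g\<in>G. emb (\<sigma>' h) * (emb (\<sigma>' g) * \<psi> (transpose_mat g *\<^sub>v (transpose_mat h *\<^sub>v \<xi>)) * emb (\<sigma> (gi g))))"
    by (simp add: avg_def sum_distrib_left)
  also have "\<dots> = inverse (of_nat (card G)) *\<^sub>F
      (\<Sum>g\<in>G. emb (\<sigma>' (h * g)) * \<psi> (transpose_mat (h * g) *\<^sub>v \<xi>) * emb (\<sigma> (gi (h * g))) * emb (\<sigma> h))"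
    using * by simp
  also have "\<dots> = inverse (of_nat (card G)) *\<^sub>F
      (\<Sum>g\<in>G. emb (\<sigma>' g) * \<psi> (transpose_mat g *\<^sub>v \<xi>) * emb (\<sigma> (gi g)) * emb (\<sigma> h))"
    by (subst sum.reindex_bij_betw[OF G_translate_bij[OF h]]) simp
  also have "\<dots> = avg \<sigma> \<sigma>' \<psi> \<xi> * emb (\<sigma> h)"
    by (simp add: avg_def sum_distrib_right)
  finally show ?thesis .
qed

section \<open>Intertwiners between matrix representations\<close>

definition ihom :: "nat \<Rightarrow> (complex mat \<Rightarrow> complex mat) \<Rightarrow> nat \<Rightarrow> (complex mat \<Rightarrow> complex mat) \<Rightarrow> fmat set" where
  "ihom d \<sigma> d' \<sigma>' = {T. fits d' d T \<and> (\<forall>g\<in>G. T * emb (\<sigma> g) = emb (\<sigma>' g) * T)}"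

lemma ihom_mult: "T \<in> ihom d \<sigma> d' \<sigma>' \<Longrightarrow> S \<in> ihom d' \<sigma>' d'' \<sigma>'' \<Longrightarrow> S * T \<in> ihom d \<sigma> d'' \<sigma>''"
  unfolding ihom_def by (auto simp: fits_mult) (metis mult.assoc)

lemma ihom_fid: "is_rep G d \<sigma> \<Longrightarrow> fid d \<in> ihom d \<sigma> d \<sigma>"
  by (auto simp: ihom_def fid_mult[OF rep_fits] mult_fid[OF rep_fits])

lemma ihom_diff: "S \<in> ihom d \<sigma> d' \<sigma>' \<Longrightarrow> T \<in> ihom d \<sigma> d' \<sigma>' \<Longrightarrow> S - T \<in> ihom d \<sigma> d' \<sigma>'"
  by (auto simp: ihom_def algebra_simps)

lemma ihom_fsc: "T \<in> ihom d \<sigma> d' \<sigma>' \<Longrightarrow> c *\<^sub>F T \<in> ihom d \<sigma> d' \<sigma>'"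
  by (auto simp: ihom_def)

text \<open>The image of an equivariant idempotent is a subrepresentation, here with coordinates:
  \<open>W\<close> is the space of vectors fixed by \<open>P\<close>, and \<open>\<tau>\<close> is
  \<open>\<sigma>\<close> compressed to it. This smaller matrix representation is what complete
  reducibility recurses on.\<close>

lemma idempotent_split:
  assumes \<sigma>: "is_rep G d \<sigma>" and P: "P \<in> ihom d \<sigma> d \<sigma>" "P * P = P"
  obtains r \<tau> S T where "is_rep G r \<tau>" "S \<in> ihom r \<tau> d \<sigma>" "T \<in> ihom d \<sigma> r \<tau>" "S * T = P" "T * S = fid r"
proof -
  have fP: "fits d d P" using P by (simp add: ihom_def)
  define p where "p = unemb d d P"
  have p: "p \<in> carrier_mat d d" "emb p = P" using fP by (simp_all add: p_def emb_unemb)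
  have pp: "p * p = p"
    by (rule emb_inject[THEN iffD1, of _ d d]) (use p P in \<open>auto simp: emb_mult[of _ d d _ d]\<close>)
  define W where "W = {v \<in> carrier_vec d. p *\<^sub>v v = v}"
  have "VectorSpace.subspace class_ring W (module_vec TYPE(complex) d)"
    by (rule subspace_vecI) (use p in \<open>auto simp: W_def mult_add_distrib_mat_vec[of _ d d] mult_mat_vec[of _ d d] intro!: eq_vecI\<close>)
  then obtain r \<iota> \<pi> where \<iota>: "\<iota> \<in> carrier_mat d r" and \<pi>: "\<pi> \<in> carrier_mat r d" and \<pi>\<iota>: "\<pi> * \<iota> = 1\<^sub>m r"
    and \<iota>W': "\<forall>x\<in>carrier_vec r. \<iota> *\<^sub>v x \<in> W" and W\<iota>': "\<forall>w\<in>W. \<iota> *\<^sub>v (\<pi> *\<^sub>v w) = w"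
    by (rule subspace_split)
  note \<iota>W = \<iota>W'[rule_format] and W\<iota> = W\<iota>'[rule_format]
  have 1: "p * \<iota> = \<iota>"
  proof (rule mat_eq_by_vec[of _ d r])
    fix v :: "complex vec" assume v: "v \<in> carrier_vec r"
    then show "(p * \<iota>) *\<^sub>v v = \<iota> *\<^sub>v v"
      using \<iota>W[OF v] assoc_mult_mat_vec[OF p(1) \<iota> v] by (simp add: W_def)
  qed (use p \<iota> in auto)
  have 2: "\<iota> * (\<pi> * p) = p"
  proof (rule mat_eq_by_vec[of _ d d])
    fix v :: "complex vec" assume v: "v \<in> carrier_vec d"
    have pv: "p *\<^sub>v v \<in> W"
      using p v assoc_mult_mat_vec[OF p(1) p(1) v] pp by (auto simp: W_def)
    have "(\<iota> * (\<pi> * p)) *\<^sub>v v = \<iota> *\<^sub>v (\<pi> *\<^sub>v (p *\<^sub>v v))"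
      using p \<iota> \<pi> v by (simp add: assoc_mult_mat_vec[of _ d r _ d] assoc_mult_mat_vec[of _ r d _ d])
    then show "(\<iota> * (\<pi> * p)) *\<^sub>v v = p *\<^sub>v v" using W\<iota>[OF pv] by simp
  qed (use p \<iota> \<pi> in auto)
  define S where "S = emb \<iota>"
  \<comment> \<open>\<open>\<pi>\<close> alone is a left inverse of \<open>\<iota>\<close> but need
    not be equivariant; composing with \<open>P\<close> yields \<open>S * T = P\<close> and an
    intertwiner.\<close>
  define T where "T = emb \<pi> * P"
  have fS: "fits d r S" and f\<pi>: "fits r d (emb \<pi>)" using \<iota> \<pi> by (auto simp: S_def fits_emb)
  have fT: "fits r d T" unfolding T_def by (rule fits_mult[OF f\<pi> fP])
  have PS: "P * S = S" using 1 emb_mult[OF p(1) \<iota>] p(2) by (simp add: S_def)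
  have ST: "S * T = P"
    using 2 emb_mult[OF \<iota>, of "\<pi> * p" d] emb_mult[OF \<pi> p(1)] \<pi> p by (simp add: S_def T_def)
  have "emb \<pi> * S = fid r" using \<pi>\<iota> emb_mult[OF \<pi> \<iota>] by (simp add: S_def)
  then have TS: "T * S = fid r" using PS by (simp add: T_def mult.assoc)
  have TP: "T * P = T" using P by (simp add: T_def mult.assoc)
  define \<tau> where "\<tau> = (\<lambda>g. unemb r r (T * emb (\<sigma> g) * S))"
  have fTS: "fits r r (T * emb (\<sigma> g) * S)" if "g \<in> G" for g
    by (intro fits_mult[of r d _ r] fits_mult[of r d _ d] fT fS rep_fits[OF \<sigma> that])
  have e\<tau>: "emb (\<tau> g) = T * emb (\<sigma> g) * S" if "g \<in> G" for g
    unfolding \<tau>_def by (rule emb_unemb[OF fTS[OF that]])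
  have comm: "P * emb (\<sigma> g) = emb (\<sigma> g) * P" if "g \<in> G" for g
    using P that by (simp add: ihom_def)
  have S_hom: "S * emb (\<tau> g) = emb (\<sigma> g) * S" if "g \<in> G" for g
  proof -
    have "S * emb (\<tau> g) = P * emb (\<sigma> g) * S" by (simp add: e\<tau>[OF that] ST flip: mult.assoc)
    also have "\<dots> = emb (\<sigma> g) * (P * S)" by (simp add: comm[OF that] mult.assoc)
    finally show ?thesis by (simp add: PS)
  qed
  have T_hom: "T * emb (\<sigma> g) = emb (\<tau> g) * T" if "g \<in> G" for g
  proof -
    have "emb (\<tau> g) * T = T * (emb (\<sigma> g) * P)" by (simp add: e\<tau>[OF that] ST mult.assoc)
    also have "\<dots> = T * P * emb (\<sigma> g)" by (simp add: comm[OF that] mult.assoc)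
    finally show ?thesis by (simp add: TP)
  qed
  have "is_rep G r \<tau>"
    unfolding is_rep_iff
  proof (intro conjI ballI)
    show "\<tau> g \<in> carrier_mat r r" for g by (simp add: \<tau>_def)
    show "\<tau> (1\<^sub>m 2) = 1\<^sub>m r"
      using \<sigma> fT by (simp add: \<tau>_def is_rep_iff mult_fid TS)
    fix g h assume gh: "g \<in> G" "h \<in> G"
    have "emb (\<tau> (g * h)) = T * emb (\<sigma> g) * (emb (\<sigma> h) * S)"
      using gh by (simp add: e\<tau> G_mult rep_mult[OF \<sigma>] mult.assoc)
    also have "\<dots> = emb (\<tau> g) * (T * S) * emb (\<tau> h)"
      by (simp add: T_hom[OF gh(1)] S_hom[OF gh(2), symmetric] mult.assoc)
    also have "\<dots> = emb (\<tau> g) * emb (\<tau> h)"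
      using fTS[OF gh(1)] by (simp add: TS e\<tau>[OF gh(1)] mult_fid)
    finally show "\<tau> (g * h) = \<tau> g * \<tau> h"
      using emb_mult[of "\<tau> g" r r "\<tau> h" r] emb_inject[of "\<tau> (g * h)" r r "\<tau> g * \<tau> h"] mult_carrier_mat[of "\<tau> g" r r "\<tau> h" r]
      by (simp add: \<tau>_def)
  qed
  then show ?thesis
    using that[of r \<tau> S T] fS fT S_hom T_hom ST TS by (simp add: ihom_def)
qed

lemma irrep_rep: "irreducible_rep G d \<sigma> \<Longrightarrow> is_rep G d \<sigma>"
  by (simp add: irreducible_rep_def)

lemma emb_hom_iff:
  assumes "is_rep G d \<sigma>" "is_rep G d' \<sigma>'" "A \<in> carrier_mat d' d"
  shows "emb A \<in> ihom d \<sigma> d' \<sigma>' \<longleftrightarrow> (\<forall>g\<in>G. A * \<sigma> g = \<sigma>' g * A)"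
proof -
  have "emb A * emb (\<sigma> g) = emb (\<sigma>' g) * emb A \<longleftrightarrow> A * \<sigma> g = \<sigma>' g * A" if "g \<in> G" for g
    using rep_carrier[OF assms(1) that] rep_carrier[OF assms(2) that] assms(3)
      emb_inject[of "A * \<sigma> g" d' d "\<sigma>' g * A"] emb_mult[of A d' d "\<sigma> g" d] emb_mult[of "\<sigma>' g" d' d' A d]
    by simp
  then show ?thesis using fits_emb[OF assms(3)] by (simp add: ihom_def)
qed

text \<open>Kernel \<open>K\<close> and image \<open>R\<close> are invariant subspaces; as
  \<open>T\<close> is nonzero, irreducibility leaves only the zero kernel and the full image. The
  inverse is assembled from preimages of unit vectors.\<close>

lemma schur_iso:
  assumes \<sigma>: "irreducible_rep G d \<sigma>" and \<sigma>': "irreducible_rep G d' \<sigma>'"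
    and T: "T \<in> ihom d \<sigma> d' \<sigma>'" "T \<noteq> 0"
  obtains S where "S \<in> ihom d' \<sigma>' d \<sigma>" "S * T = fid d" "T * S = fid d'"
proof -
  have fT: "fits d' d T" using T by (simp add: ihom_def)
  define A where "A = unemb d' d T"
  have A: "A \<in> carrier_mat d' d" "emb A = T" using fT by (simp_all add: A_def emb_unemb)
  have eq: "A * \<sigma> g = \<sigma>' g * A" if "g \<in> G" for g
    using emb_hom_iff[OF irrep_rep[OF \<sigma>] irrep_rep[OF \<sigma>'] A(1)] A(2) T(1) that by simp
  have eqv: "A *\<^sub>v (\<sigma> g *\<^sub>v v) = \<sigma>' g *\<^sub>v (A *\<^sub>v v)" if "g \<in> G" "v \<in> carrier_vec d" for g v
    using eq[OF that(1)] assoc_mult_mat_vec[OF A(1) rep_carrier[OF irrep_rep[OF \<sigma>] that(1)] that(2)]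
      assoc_mult_mat_vec[OF rep_carrier[OF irrep_rep[OF \<sigma>'] that(1)] A(1) that(2)] by simp
  have A0: "A *\<^sub>v 0\<^sub>v d = 0\<^sub>v d'" using A(1) by (intro eq_vecI) (auto simp: scalar_prod_def)
  define K where "K = {v \<in> carrier_vec d. A *\<^sub>v v = 0\<^sub>v d'}"
  define R where "R = (\<lambda>v. A *\<^sub>v v) ` carrier_vec d"
  have K: "VectorSpace.subspace class_ring K (module_vec TYPE(complex) d)"
    by (rule subspace_vecI) (use A A0 in \<open>auto simp: K_def mult_add_distrib_mat_vec[of _ d' d] mult_mat_vec[of _ d' d] smult_zero_vec\<close>)
  have R: "VectorSpace.subspace class_ring R (module_vec TYPE(complex) d')"
  proof (rule subspace_vecI)
    show "0\<^sub>v d' \<in> R" unfolding R_def using A0 by (metis image_eqI zero_carrier_vec)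
    show "v + w \<in> R" if vw: "v \<in> R" "w \<in> R" for v w
    proof -
      obtain x y where "x \<in> carrier_vec d" "y \<in> carrier_vec d" "v = A *\<^sub>v x" "w = A *\<^sub>v y" using vw by (auto simp: R_def)
      then show ?thesis using mult_add_distrib_mat_vec[OF A(1), of x y] by (auto simp: R_def intro!: image_eqI[of _ _ "x + y"])
    qed
    show "c \<cdot>\<^sub>v v \<in> R" if v: "v \<in> R" for c v
    proof -
      obtain x where "x \<in> carrier_vec d" "v = A *\<^sub>v x" using v by (auto simp: R_def)
      then show ?thesis using mult_mat_vec[OF A(1), of x c] by (auto simp: R_def intro!: image_eqI[of _ _ "c \<cdot>\<^sub>v x"])
    qed
  qed (use A in \<open>auto simp: R_def\<close>)
  have z: "\<sigma>' g *\<^sub>v 0\<^sub>v d' = 0\<^sub>v d'" if "g \<in> G" for g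
    using rep_carrier[OF irrep_rep[OF \<sigma>'] that] by (intro eq_vecI) (auto simp: scalar_prod_def)
  have "\<forall>g\<in>G. \<forall>w\<in>K. \<sigma> g *\<^sub>v w \<in> K"
    using eqv z mult_mat_vec_carrier[OF rep_carrier[OF irrep_rep[OF \<sigma>]]] by (auto simp: K_def)
  then have K2: "K = {0\<^sub>v d} \<or> K = carrier_vec d"
    using \<sigma> K unfolding irreducible_rep_def by blast
  have "\<forall>g\<in>G. \<forall>w\<in>R. \<sigma>' g *\<^sub>v w \<in> R"
    using eqv[symmetric] mult_mat_vec_carrier[OF rep_carrier[OF irrep_rep[OF \<sigma>]]] by (auto simp: R_def)
  then have R2: "R = {0\<^sub>v d'} \<or> R = carrier_vec d'"
    using \<sigma>' R unfolding irreducible_rep_def by blast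
  have nz: "\<not> (\<forall>v\<in>carrier_vec d. A *\<^sub>v v = 0\<^sub>v d')"
  proof
    assume *: "\<forall>v\<in>carrier_vec d. A *\<^sub>v v = 0\<^sub>v d'"
    have "A = 0\<^sub>m d' d"
      by (rule mat_eq_by_vec[OF A(1)]) (use * in \<open>auto simp: scalar_prod_def intro!: eq_vecI\<close>)
    then show False using A(2) T(2) by simp
  qed
  then have K3: "K = {0\<^sub>v d}" using K2 by (auto simp: K_def)
  have R3: "R = carrier_vec d'" using R2 nz by (auto simp: R_def)
  have "\<forall>j<d'. \<exists>b. b \<in> carrier_vec d \<and> A *\<^sub>v b = unit_vec d' j"
  proof (intro allI impI)
    fix j assume "j < d'"
    have "unit_vec d' j \<in> R" unfolding R3 by simp
    then show "\<exists>b. b \<in> carrier_vec d \<and> A *\<^sub>v b = unit_vec d' j" by (auto simp: R_def)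
  qed
  then obtain b where b: "\<And>j. j < d' \<Longrightarrow> b j \<in> carrier_vec d" "\<And>j. j < d' \<Longrightarrow> A *\<^sub>v b j = unit_vec d' j"
    by metis
  define B where "B = mat d d' (\<lambda>(i, j). b j $ i)"
  have B: "B \<in> carrier_mat d d'" by (simp add: B_def)
  have colB: "col B j = b j" if "j < d'" for j
    using b(1)[OF that] that by (intro eq_vecI) (auto simp: B_def)
  have AB: "A * B = 1\<^sub>m d'"
  proof (rule mat_col_eqI)
    fix j assume "j < dim_col (1\<^sub>m d' :: complex mat)"
    then have j: "j < d'" by simp
    show "col (A * B) j = col (1\<^sub>m d') j"
      using j b colB col_mult2[OF A(1) B j] by simp
  qed (use A B in auto)
  have BA: "B * A = 1\<^sub>m d"
  proof (rule mat_eq_by_vec[of _ d d])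
    fix v :: "complex vec" assume v: "v \<in> carrier_vec d"
    define w where "w = B *\<^sub>v (A *\<^sub>v v)"
    have Av: "A *\<^sub>v v \<in> carrier_vec d'" and w: "w \<in> carrier_vec d"
      using A B v by (auto simp: w_def intro: mult_mat_vec_carrier)
    have "A *\<^sub>v w = A *\<^sub>v v"
      using assoc_mult_mat_vec[OF A(1) B Av] AB Av by (simp add: w_def)
    then have "A *\<^sub>v (w - v) = 0\<^sub>v d'"
      using mult_minus_distrib_mat_vec[OF A(1) w v] Av by simp
    then have "w - v \<in> K" using w v by (auto simp: K_def)
    then have *: "w - v = 0\<^sub>v d" using K3 by auto
    have "w = v"
    proof (rule eq_vecI)
      fix k assume k: "k < dim_vec v"
      then have "(w - v) $ k = 0" using * v by simp
      then show "w $ k = v $ k" using k by simp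
    qed (use w v in auto)
    then show "B * A *\<^sub>v v = 1\<^sub>m d *\<^sub>v v"
      using assoc_mult_mat_vec[OF B A(1) v] v by (simp add: w_def)
  qed (use A B in auto)
  define S where "S = emb B"
  have fS: "fits d d' S" using B by (simp add: S_def fits_emb)
  have ST: "S * T = fid d" using emb_mult[OF B A(1)] BA A(2) by (simp add: S_def)
  have TS: "T * S = fid d'" using emb_mult[OF A(1) B] AB A(2) by (simp add: S_def)
  have "S * emb (\<sigma>' g) = emb (\<sigma> g) * S" if g: "g \<in> G" for g
  proof -
    have "S * emb (\<sigma>' g) = S * (emb (\<sigma>' g) * T) * S"
      using mult_fid[OF rep_fits[OF irrep_rep[OF \<sigma>'] g]] by (simp add: mult.assoc TS)
    also have "\<dots> = (S * T) * emb (\<sigma> g) * S"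
      using T(1) g by (simp add: ihom_def mult.assoc)
    also have "\<dots> = emb (\<sigma> g) * S"
      using fid_mult[OF rep_fits[OF irrep_rep[OF \<sigma>] g]] by (simp add: ST)
    finally show ?thesis .
  qed
  then show ?thesis using that[of S] fS ST TS by (simp add: ihom_def)
qed

text \<open>Over the complex numbers \<open>T\<close> has an eigenvalue \<open>c\<close>. The
  intertwiner \<open>T - c\<close> kills a nonzero vector, so it is not invertible, and an
  intertwiner of irreducibles that is not invertible is zero.\<close>

lemma schur_scalar:
  assumes \<sigma>: "irreducible_rep G d \<sigma>" and T: "T \<in> ihom d \<sigma> d \<sigma>"
  obtains c where "T = c *\<^sub>F fid d"
proof -
  have fT: "fits d d T" using T by (simp add: ihom_def)
  define A where "A = unemb d d T"
  have A: "A \<in> carrier_mat d d" "emb A = T" using fT by (simp_all add: A_def emb_unemb)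
  have "d > 0" using \<sigma> by (simp add: irreducible_rep_def)
  then obtain c where "eigenvalue A c" using spectrum_non_empty[OF A(1)] by (auto simp: spectrum_def)
  then obtain v where v: "v \<in> carrier_vec d" "v \<noteq> 0\<^sub>v d" "A *\<^sub>v v = c \<cdot>\<^sub>v v"
    using A by (auto simp: eigenvalue_def eigenvector_def)
  define T' where "T' = T - c *\<^sub>F fid d"
  have T': "T' \<in> ihom d \<sigma> d \<sigma>"
    unfolding T'_def by (intro ihom_diff ihom_fsc T ihom_fid irrep_rep[OF \<sigma>])
  have "T' = 0"
  proof (rule ccontr)
    assume "T' \<noteq> 0"
    then obtain S where S: "S \<in> ihom d \<sigma> d \<sigma>" "S * T' = fid d" by (rule schur_iso[OF \<sigma> \<sigma> T'])
    have fT': "fits d d T'" "fits d d S" using T' S by (auto simp: ihom_def)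
    have u: "unemb d d T' *\<^sub>v v = 0\<^sub>v d"
    proof (rule eq_vecI)
      fix k assume "k < dim_vec (0\<^sub>v d :: complex vec)"
      then have k: "k < d" by simp
      have "(A *\<^sub>v v) $ k = c * v $ k" using v k by simp
      then have "(\<Sum>j<d. ent T k j * v $ j) = c * v $ k"
        using unemb_mult_vec[OF k v(1)] by (simp add: A_def)
      moreover have "(\<Sum>j<d. c * (if k = j \<and> k < d then 1 else 0) * v $ j) = (\<Sum>j<d. if j = k then c * v $ k else 0)"
        using k by (intro sum.cong) auto
      ultimately show "(unemb d d T' *\<^sub>v v) $ k = 0\<^sub>v d $ k"
        using k by (simp add: unemb_mult_vec[OF k v(1)] T'_def left_diff_distrib sum_subtractf)
    qed simp
    have "v = unemb d d (S * T') *\<^sub>v v" using v by (simp add: S)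
    also have "\<dots> = unemb d d S *\<^sub>v (unemb d d T' *\<^sub>v v)"
      using v by (simp add: unemb_mult[OF fT'(2,1)] assoc_mult_mat_vec[of _ d d _ d])
    also have "\<dots> = 0\<^sub>v d"
      unfolding u by (intro eq_vecI) (auto simp: scalar_prod_def unemb_def)
    finally show False using v by simp
  qed
  then show ?thesis using that[of c] by (simp add: T'_def)
qed

lemma rep_\<rho>: "i \<in> I \<Longrightarrow> is_rep G (dg i) (\<rho> i)"
  by (rule irrep_rep[OF irreps])

lemma dg_pos: "i \<in> I \<Longrightarrow> dg i \<noteq> 0"
  using irreps by (auto simp: irreducible_rep_def)

lemma rep_iso_ihom:
  assumes "is_rep G d \<sigma>" "is_rep G d' \<sigma>'" "T \<in> ihom d \<sigma> d' \<sigma>'" "S * T = fid d" "T * S = fid d'" "fits d d' S"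
  shows "rep_iso G d \<sigma> d' \<sigma>'"
proof -
  have fT: "fits d' d T" using assms by (simp add: ihom_def)
  \<comment> \<open>Traces of the two identities give equal dimensions, so the matrix is square, as
    \<open>invertible_mat\<close> demands.\<close>
  have "(of_nat d :: complex) = ftr d (S * T)" using assms by simp
  also have "\<dots> = of_nat d'" using ftr_mult[OF assms(6) fT] assms by simp
  finally have dd: "d = d'" by simp
  define A where "A = unemb d' d T"
  define B where "B = unemb d d' S"
  have A: "A \<in> carrier_mat d' d" "emb A = T" and B: "B \<in> carrier_mat d d'"
    using fT by (simp_all add: A_def B_def emb_unemb)
  have "A \<in> carrier (Hom_G G d \<sigma> d' \<sigma>')"
    using emb_hom_iff[OF assms(1,2) A(1)] A assms(3) by (simp add: Hom_G_def)
  moreover have "invertible_mat A"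
    unfolding invertible_mat_def inverts_mat_def
  proof (intro conjI exI[of _ B])
    show "A * B = 1\<^sub>m (dim_row A)" "B * A = 1\<^sub>m (dim_row B)"
      using unemb_mult[OF fT assms(6)] unemb_mult[OF assms(6) fT] assms(4,5) by (simp_all add: A_def B_def)
  qed (use A dd in auto)
  ultimately show ?thesis unfolding rep_iso_def by blast
qed

text \<open>A nonzero intertwiner would be invertible, and \<open>\<rho> i\<close> would be
  isomorphic to two indexed representations, against the uniqueness in
  \<open>irreps_complete\<close>.\<close>

lemma schur_zero:
  assumes "i \<in> I" "j \<in> I" "i \<noteq> j" "T \<in> ihom (dg i) (\<rho> i) (dg j) (\<rho> j)"
  shows "T = 0"
proof (rule ccontr)
  assume "T \<noteq> 0"
  then obtain S where S: "S \<in> ihom (dg j) (\<rho> j) (dg i) (\<rho> i)" "S * T = fid (dg i)" "T * S = fid (dg j)"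
    using schur_iso[OF irreps[OF assms(1)] irreps[OF assms(2)] assms(4)] by blast
  then have "rep_iso G (dg i) (\<rho> i) (dg j) (\<rho> j)"
    using rep_iso_ihom[OF rep_\<rho>[OF assms(1)] rep_\<rho>[OF assms(2)] assms(4)] by (simp add: ihom_def)
  moreover have "rep_iso G (dg i) (\<rho> i) (dg i) (\<rho> i)"
    by (rule rep_iso_ihom[OF rep_\<rho>[OF assms(1)] rep_\<rho>[OF assms(1)] ihom_fid[OF rep_\<rho>[OF assms(1)]], of "fid (dg i)"])
      (simp_all add: fid_mult[OF fits_fid])
  ultimately show False
    using irreps_complete[OF irreps[OF assms(1)]] assms(1-3) by blast
qed

text \<open>Maschke's theorem, recorded as a resolution of the identity through irreducible
  representations: later it is only inserted between two factors, so multiplicities need not be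
  tracked. If \<open>W\<close> is a proper nonzero invariant subspace, averaging a projection onto
  \<open>W\<close> gives an equivariant idempotent with the same image; it and its complement have
  smaller rank.\<close>

lemma complete_reducibility:
  "is_rep G d \<sigma> \<Longrightarrow> \<exists>L. (\<forall>(k, S, T)\<in>set L. k \<in> I \<and> S \<in> ihom (dg k) (\<rho> k) d \<sigma> \<and> T \<in> ihom d \<sigma> (dg k) (\<rho> k)) \<and>
     sum_list (map (\<lambda>(k, S, T). S * T) L) = fid d"
proof (induction d arbitrary: \<sigma> rule: less_induct)
  case (less d)
  note \<sigma> = less.prems
  consider "d = 0" | "irreducible_rep G d \<sigma>" | "d \<noteq> 0" "\<not> irreducible_rep G d \<sigma>" by blast
  then show ?case
  proof cases
    case 1
    have "fid 0 = 0" by (rule fmat_eqI) simp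
    then show ?thesis using 1 by (intro exI[of _ "[]"]) simp
  next
    case 2
    then obtain i where i: "i \<in> I" "rep_iso G d \<sigma> (dg i) (\<rho> i)" using irreps_complete by blast
    then obtain A where A: "A \<in> carrier_mat (dg i) d" "\<forall>g\<in>G. A * \<sigma> g = \<rho> i g * A" "invertible_mat A"
      by (auto simp: rep_iso_def Hom_G_def)
    have T: "emb A \<in> ihom d \<sigma> (dg i) (\<rho> i)" using emb_hom_iff[OF \<sigma> rep_\<rho>[OF i(1)] A(1)] A(2) by simp
    have "emb A \<noteq> 0"
    proof
      assume "emb A = 0"
      obtain B where B: "A * B = 1\<^sub>m (dim_row A)" "B * A = 1\<^sub>m (dim_row B)"
        using A(3) by (auto simp: invertible_mat_def inverts_mat_def)
      have "dim_col (A * B) = dg i" "dim_col (B * A) = dim_row B" unfolding B using A(1) by simp_all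
      then have "B \<in> carrier_mat d (dg i)" using A(1) by auto
      then have "emb (A * B) = 0"
        using emb_mult[OF A(1), of B "dg i"] \<open>emb A = 0\<close> by simp
      then have "ent (fid (dg i)) 0 0 = 0" using A(1) by (simp add: B)
      then show False using dg_pos[OF i(1)] by simp
    qed
    then obtain S where S: "S \<in> ihom (dg i) (\<rho> i) d \<sigma>" "S * emb A = fid d"
      using schur_iso[OF 2 irreps[OF i(1)] T] by blast
    then show ?thesis using T i by (intro exI[of _ "[(i, S, emb A)]"]) simp
  next
    case 3
    then obtain W where W: "VectorSpace.subspace class_ring W (module_vec TYPE(complex) d)"
      and stab: "\<And>g w. g \<in> G \<Longrightarrow> w \<in> W \<Longrightarrow> \<sigma> g *\<^sub>v w \<in> W" and W0: "W \<noteq> {0\<^sub>v d}" and W1: "W \<noteq> carrier_vec d"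
      using \<sigma> unfolding irreducible_rep_def by blast
    obtain r \<iota> \<pi> where \<iota>: "\<iota> \<in> carrier_mat d r" and \<pi>: "\<pi> \<in> carrier_mat r d" and \<pi>\<iota>: "\<pi> * \<iota> = 1\<^sub>m r"
      and \<iota>W': "\<forall>x\<in>carrier_vec r. \<iota> *\<^sub>v x \<in> W" and W\<iota>': "\<forall>w\<in>W. \<iota> *\<^sub>v (\<pi> *\<^sub>v w) = w"
      by (rule subspace_split[OF W])
    note \<iota>W = \<iota>W'[rule_format] and W\<iota> = W\<iota>'[rule_format]
    define p where "p = \<iota> * \<pi>"
    have p: "p \<in> carrier_mat d d" using \<iota> \<pi> by (simp add: p_def)
    have pv: "p *\<^sub>v v = \<iota> *\<^sub>v (\<pi> *\<^sub>v v)" if "v \<in> carrier_vec d" for v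
      unfolding p_def by (rule assoc_mult_mat_vec[OF \<iota> \<pi> that])
    have pW: "p *\<^sub>v v \<in> W" if "v \<in> carrier_vec d" for v
      unfolding pv[OF that] by (rule \<iota>W) (use \<pi> that in auto)
    have Wp: "p *\<^sub>v w = w" if "w \<in> W" for w
      using that W\<iota>[OF that] pv subspace_vecD(1)[OF W] by auto
    have stab': "p * (\<sigma> g * p) = \<sigma> g * p" if g: "g \<in> G" for g
    proof (rule mat_eq_by_vec[of _ d d])
      fix v :: "complex vec" assume v: "v \<in> carrier_vec d"
      note c = rep_carrier[OF \<sigma> g]
      have "(\<sigma> g * p) *\<^sub>v v = \<sigma> g *\<^sub>v (p *\<^sub>v v)" by (rule assoc_mult_mat_vec[OF c p v])
      then show "p * (\<sigma> g * p) *\<^sub>v v = \<sigma> g * p *\<^sub>v v"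
        using assoc_mult_mat_vec[OF p mult_carrier_mat[OF c p] v] Wp[OF stab[OF g pW[OF v]]] by simp
    qed (use p rep_carrier[OF \<sigma> g] in auto)
    define P0 where "P0 = emb p"
    have fP0: "fits d d P0" using p by (simp add: P0_def fits_emb)
    have stab0: "P0 * emb (\<sigma> g) * P0 = emb (\<sigma> g) * P0" if g: "g \<in> G" for g
      using arg_cong[OF stab'[OF g], of emb] p rep_carrier[OF \<sigma> g]
      by (simp add: P0_def emb_mult[of _ d d _ d] mult.assoc)
    have P0P0: "P0 * P0 = P0"
      using stab0[OF G_one] \<sigma> fP0 by (simp add: is_rep_iff mult_fid fid_mult)
    \<comment> \<open>\<open>avg\<close> expects a function of a point; for the constant function
      the result is the same at every point, and \<open>0\<^sub>v 2\<close> is a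
      placeholder.\<close>
    define P where "P = avg \<sigma> \<sigma> (\<lambda>_. P0) (0\<^sub>v 2)"
    have fP: "fits d d P"
      unfolding P_def avg_def
      by (intro fits_fsc fits_sum fits_mult[of d d _ d] fP0 rep_fits[OF \<sigma>] gi_G)
    have "P = avg \<sigma> \<sigma> (\<lambda>_. P0) \<xi>" for \<xi> by (simp add: P_def avg_def)
    then have "P \<in> ihom d \<sigma> d \<sigma>"
      using avg_equivariant[OF \<sigma> \<sigma>, of _ "0\<^sub>v 2" "\<lambda>_. P0"] fP by (simp add: ihom_def)
    have "P0 * (emb (\<sigma> g) * P0 * emb (\<sigma> (gi g))) = emb (\<sigma> g) * P0 * emb (\<sigma> (gi g))" if "g \<in> G" for g
      using stab0[OF that] by (simp flip: mult.assoc)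
    \<comment> \<open>Together with \<open>P * P0 = P0\<close> below, this says that
      \<open>P\<close> is an idempotent with the image of \<open>P0\<close>.\<close>
    then have P0P: "P0 * P = P" by (simp add: P_def avg_def sum_distrib_left)
    have "emb (\<sigma> g) * P0 * emb (\<sigma> (gi g)) * P0 = P0" if g: "g \<in> G" for g
    proof -
      have "emb (\<sigma> g) * P0 * emb (\<sigma> (gi g)) * P0 = emb (\<sigma> g) * (P0 * emb (\<sigma> (gi g)) * P0)"
        by (simp add: mult.assoc)
      also have "\<dots> = (emb (\<sigma> g) * emb (\<sigma> (gi g))) * P0"
        unfolding stab0[OF gi_G[OF g]] by (simp add: mult.assoc)
      finally show ?thesis using fP0 by (simp add: rep_inv[OF \<sigma> g] fid_mult)
    qed
    then have "P * P0 = inverse (of_nat (card G)) *\<^sub>F (\<Sum>g\<in>G. P0)"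
      by (simp add: P_def avg_def sum_distrib_right)
    also have "(\<Sum>g\<in>G. P0) = of_nat (card G) *\<^sub>F P0"
      by (rule fmat_eqI) simp
    finally have PP0: "P * P0 = P0" using card_G by simp
    have PP: "P * P = P" using PP0 P0P by (metis mult.assoc)
    define Q where "Q = fid d - P"
    have Q: "Q \<in> ihom d \<sigma> d \<sigma>" unfolding Q_def by (intro ihom_diff ihom_fid \<sigma> \<open>P \<in> ihom d \<sigma> d \<sigma>\<close>)
    have QQ: "Q * Q = Q"
      using fP by (simp add: Q_def algebra_simps PP fid_mult mult_fid fid_mult[OF fits_fid])
    obtain r1 \<tau>1 S1 T1 where 1: "is_rep G r1 \<tau>1" "S1 \<in> ihom r1 \<tau>1 d \<sigma>" "T1 \<in> ihom d \<sigma> r1 \<tau>1" "S1 * T1 = P" "T1 * S1 = fid r1"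
      using idempotent_split[OF \<sigma> \<open>P \<in> ihom d \<sigma> d \<sigma>\<close> PP] by blast
    obtain r2 \<tau>2 S2 T2 where 2: "is_rep G r2 \<tau>2" "S2 \<in> ihom r2 \<tau>2 d \<sigma>" "T2 \<in> ihom d \<sigma> r2 \<tau>2" "S2 * T2 = Q" "T2 * S2 = fid r2"
      using idempotent_split[OF \<sigma> Q QQ] by blast
    have fits: "fits d r1 S1" "fits r1 d T1" "fits d r2 S2" "fits r2 d T2" using 1 2 by (auto simp: ihom_def)
    \<comment> \<open>The rank of an idempotent is its trace, so the two ranks add up to
      \<open>d\<close>; since neither is zero, both are smaller than \<open>d\<close>.\<close>
    have "ftr d P = of_nat r1" using ftr_mult[OF fits(1,2)] 1 by simp
    moreover have "ftr d Q = of_nat r2" using ftr_mult[OF fits(3,4)] 2 by simp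
    moreover have "ftr d P + ftr d Q = of_nat d" by (simp add: Q_def ftr_diff)
    ultimately have "of_nat (r1 + r2) = (of_nat d :: complex)" by simp
    then have rd: "r1 + r2 = d" using of_nat_eq_iff by blast
    have f0: "A = 0" if "fits n 0 A" for n A using that by (intro fmat_eqI) (simp add: fits_def)
    have "P0 \<noteq> 0"
    proof
      assume "P0 = 0"
      then have "p = 0\<^sub>m d d" using emb_inject[OF p, of "0\<^sub>m d d"] by (simp add: P0_def)
      then have "p *\<^sub>v w = 0\<^sub>v d" if "w \<in> carrier_vec d" for w
        using that by (intro eq_vecI) (auto simp: scalar_prod_def)
      moreover have "w \<in> carrier_vec d" if "w \<in> W" for w
        using subspace_vecD(1)[OF W] that by blast
      ultimately have "w = 0\<^sub>v d" if "w \<in> W" for w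
        using Wp[OF that] that by simp
      then show False using W0 subspace_vecD(2)[OF W] by blast
    qed
    have "r1 \<noteq> 0"
    proof
      assume "r1 = 0"
      then have "S1 = 0" using f0 fits(1) by simp
      then show False using 1(4) PP0 \<open>P0 \<noteq> 0\<close> by auto
    qed
    have "P0 \<noteq> fid d"
    proof
      assume "P0 = fid d"
      then have "p = 1\<^sub>m d" using emb_inject[OF p, of "1\<^sub>m d"] by (simp add: P0_def)
      then have "carrier_vec d \<subseteq> W" using pW by auto
      then show False using W1 subspace_vecD(1)[OF W] by auto
    qed
    have "r2 \<noteq> 0"
    proof
      assume "r2 = 0"
      then have "S2 = 0" using f0 fits(3) by simp
      then have "P = fid d" using 2(4) by (simp add: Q_def)
      then show False using P0P mult_fid[OF fP0] \<open>P0 \<noteq> fid d\<close> by simp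
    qed
    have lt: "r1 < d" "r2 < d" using rd \<open>r1 \<noteq> 0\<close> \<open>r2 \<noteq> 0\<close> by simp_all
    obtain L1 where L1: "\<forall>(k, S, T)\<in>set L1. k \<in> I \<and> S \<in> ihom (dg k) (\<rho> k) r1 \<tau>1 \<and> T \<in> ihom r1 \<tau>1 (dg k) (\<rho> k)"
      "sum_list (map (\<lambda>(k, S, T). S * T) L1) = fid r1"
      using less.IH[OF _ 1(1)] lt by blast
    obtain L2 where L2: "\<forall>(k, S, T)\<in>set L2. k \<in> I \<and> S \<in> ihom (dg k) (\<rho> k) r2 \<tau>2 \<and> T \<in> ihom r2 \<tau>2 (dg k) (\<rho> k)"
      "sum_list (map (\<lambda>(k, S, T). S * T) L2) = fid r2"
      using less.IH[OF _ 2(1)] lt by blast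
    have sl: "sum_list (map (\<lambda>(k, S, T). S * T) (map (\<lambda>(k, S, T). (k, A * S, T * B)) L)) = A * sum_list (map (\<lambda>(k, S, T). S * T) L) * B"
      for A B and L :: "('i \<times> fmat \<times> fmat) list"
      by (induction L) (auto simp: algebra_simps)
    define L where "L = map (\<lambda>(k, S, T). (k, S1 * S, T * T1)) L1 @ map (\<lambda>(k, S, T). (k, S2 * S, T * T2)) L2"
    have "sum_list (map (\<lambda>(k, S, T). S * T) L) = S1 * fid r1 * T1 + S2 * fid r2 * T2"
      unfolding L_def map_append sum_list_append sl L1 L2 ..
    also have "\<dots> = fid d"
      using fits 1 2 by (simp add: mult_fid Q_def)
    finally have "sum_list (map (\<lambda>(k, S, T). S * T) L) = fid d" .
    moreover have "\<forall>(k, S, T)\<in>set L. k \<in> I \<and> S \<in> ihom (dg k) (\<rho> k) d \<sigma> \<and> T \<in> ihom d \<sigma> (dg k) (\<rho> k)"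
      using L1(1) L2(1)
      by (auto simp: L_def intro: ihom_mult[OF _ 1(2)] ihom_mult[OF 1(3)] ihom_mult[OF _ 2(2)] ihom_mult[OF 2(3)])
    ultimately show ?thesis by blast
  qed
qed

end

section \<open>Duality for linear equivariant matrices\<close>

abbreviation b0 :: "(complex vec \<Rightarrow> fmat) \<Rightarrow> fmat" where "b0 M \<equiv> M (v2 1 0)"

abbreviation b1 :: "(complex vec \<Rightarrow> fmat) \<Rightarrow> fmat" where "b1 M \<equiv> M (v2 0 1)"

text \<open>The composite of \<open>M\<close> and \<open>S\<close> with its two factors in
  \<open>V\<close> contracted by the invariant alternating form. Degree two becomes degree zero, so
  Schur's lemma applies to the result.\<close>

definition br :: "(complex vec \<Rightarrow> fmat) \<Rightarrow> (complex vec \<Rightarrow> fmat) \<Rightarrow> fmat" where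
  "br M S = b1 M * b0 S - b0 M * b1 S"

text \<open>Matrices of forms without equivariance: exactness is proved for these entrywise and
  averaged afterwards.\<close>

definition PM :: "int \<Rightarrow> nat \<Rightarrow> nat \<Rightarrow> (complex vec \<Rightarrow> fmat) set" where
  "PM N d d' = {M. (\<forall>\<xi>. \<xi> \<notin> PV \<longrightarrow> M \<xi> = 0) \<and> (\<forall>\<xi>. fits d' d (M \<xi>)) \<and> (\<forall>i j. hp N (\<lambda>\<xi>. ent (M \<xi>) i j))}"

lemma PM_I: "(\<And>\<xi>. \<xi> \<notin> PV \<Longrightarrow> M \<xi> = 0) \<Longrightarrow> (\<And>\<xi>. fits d' d (M \<xi>)) \<Longrightarrow> (\<And>i j. hp N (\<lambda>\<xi>. ent (M \<xi>) i j)) \<Longrightarrow> M \<in> PM N d d'"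
  by (simp add: PM_def)

lemma PM_D:
  assumes "M \<in> PM N d d'"
  shows "\<xi> \<notin> PV \<Longrightarrow> M \<xi> = 0" "fits d' d (M \<xi>)" "hp N (\<lambda>\<xi>. ent (M \<xi>) i j)"
  using assms by (simp_all add: PM_def)

lemma HM_PM: "HM G N d \<rho> d' \<rho>' = {M \<in> PM N d d'. \<forall>g\<in>G. \<forall>\<xi>\<in>PV. emb (\<rho>' g) * M (transpose_mat g *\<^sub>v \<xi>) = M \<xi> * emb (\<rho> g)}"
  by (auto simp: HM_def PM_def)

lemma PM_zero [simp]: "0 \<in> PM N d d'"
  by (rule PM_I) auto

lemma PM_add: "M \<in> PM N d d' \<Longrightarrow> M' \<in> PM N d d' \<Longrightarrow> M + M' \<in> PM N d d'"
  by (rule PM_I) (auto simp: PM_D intro: hp_add)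

lemma PM_fsc: "M \<in> PM N d d' \<Longrightarrow> (\<lambda>\<xi>. c *\<^sub>F M \<xi>) \<in> PM N d d'"
  by (rule PM_I) (auto simp: PM_D intro: hp_cmult)

lemma PM_sum:
  assumes M: "\<And>x. x \<in> A \<Longrightarrow> M x \<in> PM N d d'"
  shows "(\<lambda>\<xi>. \<Sum>x\<in>A. M x \<xi>) \<in> PM N d d'"
proof (rule PM_I)
  show "(\<Sum>x\<in>A. M x \<xi>) = 0" if "\<xi> \<notin> PV" for \<xi>
    by (rule sum.neutral) (use PM_D(1)[OF M that] in blast)
  show "fits d' d (\<Sum>x\<in>A. M x \<xi>)" for \<xi>
    by (rule fits_sum) (rule PM_D(2)[OF M])
  show "hp N (\<lambda>\<xi>. ent (\<Sum>x\<in>A. M x \<xi>) i j)" for i j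
    unfolding ent_sum by (rule hp_sum) (rule PM_D(3)[OF M])
qed

lemma PM_mult:
  assumes M: "M \<in> PM N d d'" and M': "M' \<in> PM N' d' d''"
  shows "(\<lambda>\<xi>. M' \<xi> * M \<xi>) \<in> PM (N + N') d d''"
proof (rule PM_I)
  fix i j
  have "hp (N' + N) (\<lambda>\<xi>. \<Sum>k<d'. ent (M' \<xi>) i k * ent (M \<xi>) k j)"
    by (intro hp_sum hp_mult PM_D(3)[OF M] PM_D(3)[OF M'])
  then show "hp (N + N') (\<lambda>\<xi>. ent (M' \<xi> * M \<xi>) i j)"
    by (simp add: ent_mult_fits[OF PM_D(2)[OF M']] add.commute)
qed (auto simp: PM_D(1)[OF M] intro: fits_mult PM_D(2)[OF M] PM_D(2)[OF M'])

lemma PM_const_mult: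
  assumes M: "M \<in> PM N d d'" and A: "fits d'' d' A" and B: "fits d d0 B"
  shows "(\<lambda>\<xi>. A * M \<xi> * B) \<in> PM N d0 d''"
proof (rule PM_I)
  fix i j
  have "hp N (\<lambda>\<xi>. \<Sum>l<d. ent B l j * (\<Sum>k<d'. ent A i k * ent (M \<xi>) k l))"
    by (intro hp_sum hp_cmult PM_D(3)[OF M])
  then show "hp N (\<lambda>\<xi>. ent (A * M \<xi> * B) i j)"
    by (simp add: ent_mult_fits[OF fits_mult[OF A PM_D(2)[OF M]]] ent_mult_fits[OF A] mult.commute)
qed (auto simp: PM_D(1)[OF M] intro!: fits_mult[OF fits_mult[OF A PM_D(2)[OF M]] B])

lemma PM_subst:
  assumes M: "M \<in> PM N d d'" and g: "g \<in> carrier_mat 2 2" "det g = 1"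
  shows "(\<lambda>\<xi>. if \<xi> \<in> PV then M (transpose_mat g *\<^sub>v \<xi>) else 0) \<in> PM N d d'"
proof (rule PM_I)
  fix i j
  show "hp N (\<lambda>\<xi>. ent (if \<xi> \<in> PV then M (transpose_mat g *\<^sub>v \<xi>) else 0) i j)"
    by (rule hp_cong[OF hp_subst[OF PM_D(3)[OF M, of i j] g]]) simp
qed (use PM_D(2)[OF M] in auto)

lemma PM_neg: "M \<in> PM N d d' \<Longrightarrow> N < 0 \<Longrightarrow> M = 0"
proof (rule ext, rule fmat_eqI)
  fix \<xi> i j assume M: "M \<in> PM N d d'" and "N < 0"
  then show "ent (M \<xi>) i j = ent (0 \<xi>) i j"
    using PM_D(3)[OF M, of i j] PM_D(1)[OF M, of \<xi>] by (cases "\<xi> \<in> PV") (auto simp: hp_neg)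
qed

lemma PM_0: "M \<in> PM 0 d d' \<Longrightarrow> \<xi> \<in> PV \<Longrightarrow> M \<xi> = b0 M"
proof (rule fmat_eqI)
  fix i j assume M: "M \<in> PM 0 d d'" and \<xi>: "\<xi> \<in> PV"
  obtain c where "\<forall>\<xi>\<in>PV. ent (M \<xi>) i j = c" using hp_0[OF PM_D(3)[OF M, of i j]] by auto
  then show "ent (M \<xi>) i j = ent (b0 M) i j" using \<xi> by simp
qed

lemma PM_1: "M \<in> PM 1 d d' \<Longrightarrow> \<xi> \<in> PV \<Longrightarrow> M \<xi> = \<xi> $ 0 *\<^sub>F b0 M + \<xi> $ 1 *\<^sub>F b1 M"
proof (rule fmat_eqI)
  fix i j assume M: "M \<in> PM 1 d d'" and \<xi>: "\<xi> \<in> PV"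
  show "ent (M \<xi>) i j = ent (\<xi> $ 0 *\<^sub>F b0 M + \<xi> $ 1 *\<^sub>F b1 M) i j"
    using hp_1[OF PM_D(3)[OF M, of i j] \<xi>] by simp
qed

definition lin :: "fmat \<Rightarrow> fmat \<Rightarrow> complex vec \<Rightarrow> fmat" where
  "lin A B = (\<lambda>\<xi>. if \<xi> \<in> PV then \<xi> $ 0 *\<^sub>F A + \<xi> $ 1 *\<^sub>F B else 0)"

lemma lin_b [simp]: "b0 (lin A B) = A" "b1 (lin A B) = B"
  by (simp_all add: lin_def)

lemma lin_PM: "fits d' d A \<Longrightarrow> fits d' d B \<Longrightarrow> lin A B \<in> PM 1 d d'"
proof (rule PM_I)
  fix i j
  show "hp 1 (\<lambda>\<xi>. ent (lin A B \<xi>) i j)"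
    by (rule hp_cong[OF hp_linear[of "ent A i j" "ent B i j"]]) (simp add: lin_def)
qed (auto simp: lin_def)

lemma PM_1_eq_lin:
  assumes M: "M \<in> PM 1 d d'"
  shows "M = lin (b0 M) (b1 M)"
proof
  fix \<xi>
  show "M \<xi> = lin (b0 M) (b1 M) \<xi>"
  proof (cases "\<xi> \<in> PV")
    case True
    then show ?thesis unfolding lin_def using PM_1[OF M True] by (simp only: if_True)
  qed (simp add: lin_def PM_D(1)[OF M])
qed

lemma PM_1_eqI: "M \<in> PM 1 d d' \<Longrightarrow> M' \<in> PM 1 d d' \<Longrightarrow> b0 M = b0 M' \<Longrightarrow> b1 M = b1 M' \<Longrightarrow> M = M'"
  by (subst (1) PM_1_eq_lin[of M], assumption, subst (1) PM_1_eq_lin[of M'], assumption, simp only:)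

lemma PM_split:
  assumes M: "M \<in> PM N d d'" and N: "N \<noteq> 0"
  obtains A B where "A \<in> PM (N - 1) d d'" "B \<in> PM (N - 1) d d'" "\<And>\<xi>. \<xi> \<in> PV \<Longrightarrow> M \<xi> = \<xi> $ 0 *\<^sub>F A \<xi> + \<xi> $ 1 *\<^sub>F B \<xi>"
proof -
  define Q where "Q = (\<lambda>i j a b. hp (N - 1) a \<and> hp (N - 1) b \<and> (\<forall>\<xi>\<in>PV. ent (M \<xi>) i j = \<xi> $ 0 * a \<xi> + \<xi> $ 1 * b \<xi>))"
  have "\<exists>a b. Q i j a b" for i j
    by (rule hp_split[OF PM_D(3)[OF M, of i j] N]) (unfold Q_def, blast)
  then obtain a b where Q: "\<And>i j. Q i j (a i j) (b i j)" by metis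
  then have ab: "hp (N - 1) (a i j)" "hp (N - 1) (b i j)"
    "\<xi> \<in> PV \<Longrightarrow> ent (M \<xi>) i j = \<xi> $ 0 * a i j \<xi> + \<xi> $ 1 * b i j \<xi>" for i j \<xi>
    unfolding Q_def by blast+
  define A where "A = (\<lambda>c \<xi>. if \<xi> \<in> PV then mk d' d (\<lambda>i j. c i j \<xi>) else 0)"
  have A: "A c \<in> PM (N - 1) d d'" if "\<And>i j. hp (N - 1) (c i j)" for c
  proof (rule PM_I)
    fix i j
    have "hp (N - 1) (\<lambda>\<xi>. if i < d' \<and> j < d then c i j \<xi> else 0)" using that by (cases "i < d' \<and> j < d") auto
    then show "hp (N - 1) (\<lambda>\<xi>. ent (A c \<xi>) i j)" by (rule hp_cong) (simp add: A_def)
  qed (auto simp: A_def)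
  show ?thesis
  proof (rule that[OF A A])
    fix \<xi> assume \<xi>: "\<xi> \<in> PV"
    show "M \<xi> = \<xi> $ 0 *\<^sub>F A a \<xi> + \<xi> $ 1 *\<^sub>F A b \<xi>"
    proof (rule fmat_eqI)
      fix i j
      show "ent (M \<xi>) i j = ent (\<xi> $ 0 *\<^sub>F A a \<xi> + \<xi> $ 1 *\<^sub>F A b \<xi>) i j"
        using PM_D(2)[OF M, of \<xi>] ab(3)[OF \<xi>, of i j] \<xi> by (auto simp: A_def fits_def)
    qed
  qed (use ab in auto)
qed

lemma PM_syzygy:
  assumes A: "A \<in> PM N d d'" and B: "B \<in> PM N d d'" and 0: "\<And>\<xi>. \<xi> \<in> PV \<Longrightarrow> \<xi> $ 0 *\<^sub>F A \<xi> + \<xi> $ 1 *\<^sub>F B \<xi> = 0"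
  obtains C where "C \<in> PM (N - 1) d d'" "\<And>\<xi>. \<xi> \<in> PV \<Longrightarrow> A \<xi> = \<xi> $ 1 *\<^sub>F C \<xi>" "\<And>\<xi>. \<xi> \<in> PV \<Longrightarrow> B \<xi> = - (\<xi> $ 0 *\<^sub>F C \<xi>)"
proof -
  define Q where "Q = (\<lambda>i j c. hp (N - 1) c \<and> (\<forall>\<xi>\<in>PV. ent (A \<xi>) i j = \<xi> $ 1 * c \<xi>) \<and> (\<forall>\<xi>\<in>PV. ent (B \<xi>) i j = - (\<xi> $ 0 * c \<xi>)))"
  have "\<exists>c. Q i j c" for i j
  proof -
    have z: "\<xi> $ 0 * ent (A \<xi>) i j + \<xi> $ 1 * ent (B \<xi>) i j = 0" if "\<xi> \<in> PV" for \<xi>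
      using arg_cong[OF 0[OF that], of "\<lambda>M. ent M i j"] by simp
    show ?thesis
    proof (rule hp_syzygy[OF PM_D(3)[OF A, of i j] PM_D(3)[OF B, of i j] z])
      fix c assume "hp (N - 1) c" "\<And>\<xi>. \<xi> \<in> PV \<Longrightarrow> ent (A \<xi>) i j = \<xi> $ 1 * c \<xi>"
        "\<And>\<xi>. \<xi> \<in> PV \<Longrightarrow> ent (B \<xi>) i j = - (\<xi> $ 0 * c \<xi>)"
      then have "Q i j c" by (simp add: Q_def)
      then show "\<exists>c. Q i j c" by blast
    qed
  qed
  then obtain c where Q: "\<And>i j. Q i j (c i j)" by metis
  then have c: "hp (N - 1) (c i j)"
    "\<xi> \<in> PV \<Longrightarrow> ent (A \<xi>) i j = \<xi> $ 1 * c i j \<xi>" "\<xi> \<in> PV \<Longrightarrow> ent (B \<xi>) i j = - (\<xi> $ 0 * c i j \<xi>)" for i j \<xi>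
    unfolding Q_def by blast+
  define C where "C = (\<lambda>\<xi>. if \<xi> \<in> PV then mk d' d (\<lambda>i j. c i j \<xi>) else 0)"
  show ?thesis
  proof (rule that[of C])
    show "C \<in> PM (N - 1) d d'"
    proof (rule PM_I)
      fix i j
      have "hp (N - 1) (\<lambda>\<xi>. if i < d' \<and> j < d then c i j \<xi> else 0)" using c(1) by (cases "i < d' \<and> j < d") auto
      then show "hp (N - 1) (\<lambda>\<xi>. ent (C \<xi>) i j)" by (rule hp_cong) (simp add: C_def)
    qed (auto simp: C_def)
    fix \<xi> assume \<xi>: "\<xi> \<in> PV"
    show "A \<xi> = \<xi> $ 1 *\<^sub>F C \<xi>"
      by (rule fmat_eqI) (use PM_D(2)[OF A, of \<xi>] c(2)[OF \<xi>] \<xi> in \<open>auto simp: C_def fits_def not_less\<close>)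
    show "B \<xi> = - (\<xi> $ 0 *\<^sub>F C \<xi>)"
      by (rule fmat_eqI) (use PM_D(2)[OF B, of \<xi>] c(3)[OF \<xi>] \<xi> in \<open>auto simp: C_def fits_def not_less\<close>)
  qed
qed

section \<open>Equivariant matrices of forms between the irreducible representations\<close>

context mckay
begin

definition hm :: "'i \<Rightarrow> 'i \<Rightarrow> int \<Rightarrow> (complex vec \<Rightarrow> fmat) set" where
  "hm i j N = HM G N (dg i) (\<rho> i) (dg j) (\<rho> j)"

lemma hm_PM: "M \<in> hm i j N \<Longrightarrow> M \<in> PM N (dg i) (dg j)"
  by (simp add: hm_def HM_PM)

lemma hm_eqv: "M \<in> hm i j N \<Longrightarrow> g \<in> G \<Longrightarrow> \<xi> \<in> PV \<Longrightarrow> emb (\<rho> j g) * M (transpose_mat g *\<^sub>v \<xi>) = M \<xi> * emb (\<rho> i g)"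
  by (simp add: hm_def HM_PM)

lemma hm_I: "M \<in> PM N (dg i) (dg j) \<Longrightarrow>
    (\<And>g \<xi>. g \<in> G \<Longrightarrow> \<xi> \<in> PV \<Longrightarrow> emb (\<rho> j g) * M (transpose_mat g *\<^sub>v \<xi>) = M \<xi> * emb (\<rho> i g)) \<Longrightarrow> M \<in> hm i j N"
  by (simp add: hm_def HM_PM)

lemma hm_off: "M \<in> hm i j N \<Longrightarrow> \<xi> \<notin> PV \<Longrightarrow> M \<xi> = 0"
  by (rule PM_D(1)[OF hm_PM])

lemma hm_fits: "M \<in> hm i j N \<Longrightarrow> fits (dg j) (dg i) (M \<xi>)"
  by (rule PM_D(2)[OF hm_PM])

lemma hm_zero [simp]: "0 \<in> hm i j N"
  by (rule hm_I) auto

lemma hm_add: "M \<in> hm i j N \<Longrightarrow> M' \<in> hm i j N \<Longrightarrow> M + M' \<in> hm i j N"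
  by (rule hm_I) (auto simp: hm_eqv distrib_left distrib_right intro: PM_add hm_PM)

lemma hm_fsc: "M \<in> hm i j N \<Longrightarrow> (\<lambda>\<xi>. c *\<^sub>F M \<xi>) \<in> hm i j N"
  by (rule hm_I) (auto simp: hm_eqv intro: PM_fsc hm_PM)

lemma hm_sum:
  assumes M: "\<And>x. x \<in> A \<Longrightarrow> M x \<in> hm i j N"
  shows "(\<lambda>\<xi>. \<Sum>x\<in>A. M x \<xi>) \<in> hm i j N"
proof (rule hm_I)
  show "(\<lambda>\<xi>. \<Sum>x\<in>A. M x \<xi>) \<in> PM N (dg i) (dg j)"
    by (rule PM_sum) (rule hm_PM[OF M])
  fix g \<xi> assume "g \<in> G" "\<xi> \<in> PV"
  then show "emb (\<rho> j g) * (\<Sum>x\<in>A. M x (transpose_mat g *\<^sub>v \<xi>)) = (\<Sum>x\<in>A. M x \<xi>) * emb (\<rho> i g)"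
    unfolding sum_distrib_left sum_distrib_right by (intro sum.cong refl hm_eqv[OF M])
qed

lemma hm_mult:
  assumes "M \<in> hm i j N" "M' \<in> hm j k N'"
  shows "(\<lambda>\<xi>. M' \<xi> * M \<xi>) \<in> hm i k (N + N')"
proof (rule hm_I)
  fix g \<xi> assume g: "g \<in> G" and \<xi>: "\<xi> \<in> PV"
  have "emb (\<rho> k g) * (M' (transpose_mat g *\<^sub>v \<xi>) * M (transpose_mat g *\<^sub>v \<xi>)) = M' \<xi> * (emb (\<rho> j g) * M (transpose_mat g *\<^sub>v \<xi>))"
    by (simp add: hm_eqv[OF assms(2) g \<xi>] flip: mult.assoc)
  then show "emb (\<rho> k g) * (M' (transpose_mat g *\<^sub>v \<xi>) * M (transpose_mat g *\<^sub>v \<xi>)) = M' \<xi> * M \<xi> * emb (\<rho> i g)"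
    by (simp add: hm_eqv[OF assms(1) g \<xi>] mult.assoc)
qed (rule PM_mult[OF hm_PM[OF assms(1)] hm_PM[OF assms(2)]])

lemma hm_neg: "M \<in> hm i j N \<Longrightarrow> N < 0 \<Longrightarrow> M = 0"
  by (rule PM_neg[OF hm_PM])

lemma g_PV: "g \<in> G \<Longrightarrow> \<xi> \<in> PV \<Longrightarrow> transpose_mat g *\<^sub>v \<xi> \<in> PV"
  by (rule transpose_mult_PV[OF G_mat])

lemma hm_0_ihom: "M \<in> hm i j 0 \<Longrightarrow> b0 M \<in> ihom (dg i) (\<rho> i) (dg j) (\<rho> j)"
proof -
  assume M: "M \<in> hm i j 0"
  have "b0 M * emb (\<rho> i g) = emb (\<rho> j g) * b0 M" if "g \<in> G" for g
    using hm_eqv[OF M that, of "v2 1 0"] PM_0[OF hm_PM[OF M] g_PV[OF that, of "v2 1 0"]] by simp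
  then show ?thesis using hm_fits[OF M] by (simp add: ihom_def)
qed

definition one_hm :: "'i \<Rightarrow> complex vec \<Rightarrow> fmat" where
  "one_hm i = (\<lambda>\<xi>. if \<xi> \<in> PV then fid (dg i) else 0)"

lemma one_hm: "i \<in> I \<Longrightarrow> one_hm i \<in> hm i i 0"
proof (rule hm_I)
  show "one_hm i \<in> PM 0 (dg i) (dg i)"
  proof (rule PM_I)
    fix k l
    have "hp 0 (\<lambda>\<xi>. ent (fid (dg i)) k l)"
      unfolding hp_def by (intro exI[of _ "\<lambda>_. ent (fid (dg i)) k l"]) auto
    then show "hp 0 (\<lambda>\<xi>. ent (one_hm i \<xi>) k l)" by (rule hp_cong) (simp add: one_hm_def)
  qed (auto simp: one_hm_def)
  fix g \<xi> assume "i \<in> I" "g \<in> G" "\<xi> \<in> PV"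
  then show "emb (\<rho> i g) * one_hm i (transpose_mat g *\<^sub>v \<xi>) = one_hm i \<xi> * emb (\<rho> i g)"
    using g_PV[of g \<xi>] rep_fits[OF rep_\<rho>, of i g] by (simp add: one_hm_def fid_mult mult_fid)
qed

lemma hm_0_eq:
  assumes "M \<in> hm i i 0" "i \<in> I"
  shows "\<exists>c. M = (\<lambda>\<xi>. c *\<^sub>F one_hm i \<xi>)"
proof -
  obtain c where "b0 M = c *\<^sub>F fid (dg i)" using schur_scalar[OF irreps[OF assms(2)] hm_0_ihom[OF assms(1)]] by blast
  then have "M \<xi> = c *\<^sub>F one_hm i \<xi>" for \<xi>
    using PM_0[OF hm_PM[OF assms(1)], of \<xi>] hm_off[OF assms(1), of \<xi>] by (auto simp: one_hm_def)
  then show ?thesis by blast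
qed

lemma hm_0_neq:
  assumes "M \<in> hm i j 0" "i \<in> I" "j \<in> I" "i \<noteq> j"
  shows "M = 0"
proof
  fix \<xi>
  have "b0 M = 0" using schur_zero[OF assms(2-4) hm_0_ihom[OF assms(1)]] .
  then show "M \<xi> = 0 \<xi>"
    using PM_0[OF hm_PM[OF assms(1)], of \<xi>] hm_off[OF assms(1), of \<xi>] by auto
qed

definition avgp :: "'i \<Rightarrow> 'i \<Rightarrow> (complex vec \<Rightarrow> fmat) \<Rightarrow> complex vec \<Rightarrow> fmat" where
  "avgp i j \<psi> = (\<lambda>\<xi>. if \<xi> \<in> PV then avg (\<rho> i) (\<rho> j) \<psi> \<xi> else 0)"

lemma avgp_hm:
  assumes "i \<in> I" "j \<in> I" "\<psi> \<in> PM N (dg i) (dg j)"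
  shows "avgp i j \<psi> \<in> hm i j N"
proof (rule hm_I)
  have *: "(\<lambda>\<xi>. emb (\<rho> j g) * (if \<xi> \<in> PV then \<psi> (transpose_mat g *\<^sub>v \<xi>) else 0) * emb (\<rho> i (gi g))) \<in> PM N (dg i) (dg j)"
    if "g \<in> G" for g
    by (rule PM_const_mult[OF PM_subst[OF assms(3) G_mat[OF that]] rep_fits[OF rep_\<rho>[OF assms(2)] that] rep_fits[OF rep_\<rho>[OF assms(1)] gi_G[OF that]]])
  have "avgp i j \<psi> = (\<lambda>\<xi>. inverse (of_nat (card G)) *\<^sub>F (\<Sum>g\<in>G. emb (\<rho> j g) * (if \<xi> \<in> PV then \<psi> (transpose_mat g *\<^sub>v \<xi>) else 0) * emb (\<rho> i (gi g))))"
    by (rule ext) (simp add: avgp_def avg_def)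
  then show "avgp i j \<psi> \<in> PM N (dg i) (dg j)"
    using PM_fsc[OF PM_sum[of G, OF *]] by simp
  fix g \<xi> assume "g \<in> G" "\<xi> \<in> PV"
  then show "emb (\<rho> j g) * avgp i j \<psi> (transpose_mat g *\<^sub>v \<xi>) = avgp i j \<psi> \<xi> * emb (\<rho> i g)"
    using avg_equivariant[OF rep_\<rho>[OF assms(1)] rep_\<rho>[OF assms(2)], of g \<xi> \<psi>] g_PV[of g \<xi>] PV_carrier[of \<xi>]
    by (simp add: avgp_def)
qed

text \<open>Averaging is linear over equivariant matrices: averaging a factorisation
  \<open>\<psi> * M\<close> changes only \<open>\<psi>\<close>. This is how factorisations found
  without regard to the group become equivariant.\<close>

lemma avgp_mult:
  assumes "i \<in> I" "k \<in> I" "M \<in> hm i k N"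
  shows "avgp i j (\<lambda>\<xi>. \<psi> \<xi> * M \<xi>) = (\<lambda>\<xi>. avgp k j \<psi> \<xi> * M \<xi>)"
proof
  fix \<xi>
  show "avgp i j (\<lambda>\<xi>. \<psi> \<xi> * M \<xi>) \<xi> = avgp k j \<psi> \<xi> * M \<xi>"
  proof (cases "\<xi> \<in> PV")
    case True
    have "M (transpose_mat g *\<^sub>v \<xi>) * emb (\<rho> i (gi g)) = emb (\<rho> k (gi g)) * M \<xi>" if g: "g \<in> G" for g
    proof -
      have "M (transpose_mat g *\<^sub>v \<xi>) * emb (\<rho> i (gi g)) = (emb (\<rho> k (gi g)) * emb (\<rho> k g)) * M (transpose_mat g *\<^sub>v \<xi>) * emb (\<rho> i (gi g))"
        by (simp add: rep_inv[OF rep_\<rho>[OF assms(2)] g] fid_mult[OF hm_fits[OF assms(3)]])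
      also have "\<dots> = emb (\<rho> k (gi g)) * (emb (\<rho> k g) * M (transpose_mat g *\<^sub>v \<xi>)) * emb (\<rho> i (gi g))"
        by (simp only: mult.assoc)
      also have "\<dots> = emb (\<rho> k (gi g)) * (M \<xi> * (emb (\<rho> i g) * emb (\<rho> i (gi g))))"
        by (simp only: hm_eqv[OF assms(3) g True] mult.assoc)
      finally show ?thesis
        by (simp add: rep_inv[OF rep_\<rho>[OF assms(1)] g] mult_fid[OF hm_fits[OF assms(3)]])
    qed
    then show ?thesis
      using True by (simp add: avgp_def avg_def sum_distrib_right mult.assoc)
  qed (simp add: avgp_def)
qed

lemma avgp_id:
  assumes "i \<in> I" "j \<in> I" "M \<in> hm i j N"
  shows "avgp i j M = M"
proof
  fix \<xi>
  show "avgp i j M \<xi> = M \<xi>"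
  proof (cases "\<xi> \<in> PV")
    case True
    have "emb (\<rho> j g) * M (transpose_mat g *\<^sub>v \<xi>) * emb (\<rho> i (gi g)) = M \<xi>" if g: "g \<in> G" for g
      by (simp add: hm_eqv[OF assms(3) g True] mult.assoc rep_inv[OF rep_\<rho>[OF assms(1)] g] mult_fid[OF hm_fits[OF assms(3)]])
    then have "avgp i j M \<xi> = inverse (of_nat (card G)) *\<^sub>F (\<Sum>g\<in>G. M \<xi>)"
      using True by (simp add: avgp_def avg_def)
    also have "(\<Sum>g\<in>G. M \<xi>) = of_nat (card G) *\<^sub>F M \<xi>"
      by (rule fmat_eqI) simp
    finally show ?thesis using card_G by simp
  qed (simp add: avgp_def hm_off[OF assms(3)])
qed

lemma avgp_sum: "avgp i j (\<lambda>\<xi>. \<Sum>x\<in>A. \<psi> x \<xi>) = (\<lambda>\<xi>. \<Sum>x\<in>A. avgp i j (\<psi> x) \<xi>)"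
proof
  fix \<xi>
  show "avgp i j (\<lambda>\<xi>. \<Sum>x\<in>A. \<psi> x \<xi>) \<xi> = (\<Sum>x\<in>A. avgp i j (\<psi> x) \<xi>)"
    unfolding avgp_def avg_def
    by (simp add: sum_distrib_left sum_distrib_right fsc.scale_sum_right sum.swap[of _ A G])
qed

text \<open>Equivariance at the two coordinate points is a linear system with matrix
  \<open>g\<close> for the two left-hand sides; determinant one gives the inverse matrix used
  here.\<close>

lemma hm_1_pencil:
  assumes M: "M \<in> hm i k 1" and g: "g \<in> G"
  shows "emb (\<rho> k g) * b0 M = g $$ (1,1) *\<^sub>F (b0 M * emb (\<rho> i g)) - g $$ (0,1) *\<^sub>F (b1 M * emb (\<rho> i g))"
    "emb (\<rho> k g) * b1 M = g $$ (0,0) *\<^sub>F (b1 M * emb (\<rho> i g)) - g $$ (1,0) *\<^sub>F (b0 M * emb (\<rho> i g))"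
proof -
  define R where "R = emb (\<rho> k g)"
  define a b c d where abcd: "a = g $$ (0,0)" "b = g $$ (0,1)" "c = g $$ (1,0)" "d = g $$ (1,1)"
  have det: "a * d - b * c = 1" using G_mat[OF g] det_mat_2[of g] by (simp add: abcd)
  have PM: "M \<in> PM 1 (dg i) (dg k)" by (rule hm_PM[OF M])
  have "transpose_mat g *\<^sub>v v2 1 0 = v2 a b" "transpose_mat g *\<^sub>v v2 0 1 = v2 c d"
    using G_mat(1)[OF g] by (simp_all add: transpose_mult_vec2 abcd)
  then have 0: "R * (a *\<^sub>F b0 M + b *\<^sub>F b1 M) = b0 M * emb (\<rho> i g)"
    and 1: "R * (c *\<^sub>F b0 M + d *\<^sub>F b1 M) = b1 M * emb (\<rho> i g)"
    using hm_eqv[OF M g, of "v2 1 0"] hm_eqv[OF M g, of "v2 0 1"]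
      PM_1[OF PM g_PV[OF g, of "v2 1 0"]] PM_1[OF PM g_PV[OF g, of "v2 0 1"]] by (simp_all add: R_def)
  have "d *\<^sub>F (b0 M * emb (\<rho> i g)) - b *\<^sub>F (b1 M * emb (\<rho> i g)) = (a * d - b * c) *\<^sub>F (R * b0 M)"
    unfolding 0[symmetric] 1[symmetric] by (rule fmat_eqI) (simp add: distrib_left algebra_simps)
  from this[unfolded det]
  show "emb (\<rho> k g) * b0 M = g $$ (1,1) *\<^sub>F (b0 M * emb (\<rho> i g)) - g $$ (0,1) *\<^sub>F (b1 M * emb (\<rho> i g))"
    by (simp add: R_def abcd)
  have "a *\<^sub>F (b1 M * emb (\<rho> i g)) - c *\<^sub>F (b0 M * emb (\<rho> i g)) = (a * d - b * c) *\<^sub>F (R * b1 M)"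
    unfolding 0[symmetric] 1[symmetric] by (rule fmat_eqI) (simp add: distrib_left algebra_simps)
  from this[unfolded det]
  show "emb (\<rho> k g) * b1 M = g $$ (0,0) *\<^sub>F (b1 M * emb (\<rho> i g)) - g $$ (1,0) *\<^sub>F (b0 M * emb (\<rho> i g))"
    by (simp add: R_def abcd)
qed

lemma lin_hm:
  assumes fits: "fits (dg k) (dg i) A" "fits (dg k) (dg i) B"
    and 0: "\<And>g. g \<in> G \<Longrightarrow> emb (\<rho> k g) * (g $$ (0,0) *\<^sub>F A + g $$ (0,1) *\<^sub>F B) = A * emb (\<rho> i g)"
    and 1: "\<And>g. g \<in> G \<Longrightarrow> emb (\<rho> k g) * (g $$ (1,0) *\<^sub>F A + g $$ (1,1) *\<^sub>F B) = B * emb (\<rho> i g)"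
  shows "lin A B \<in> hm i k 1"
proof (rule hm_I)
  show "lin A B \<in> PM 1 (dg i) (dg k)" by (rule lin_PM[OF fits])
  fix g \<xi> assume g: "g \<in> G" and \<xi>: "\<xi> \<in> PV"
  have "emb (\<rho> k g) * lin A B (transpose_mat g *\<^sub>v \<xi>) =
      \<xi> $ 0 *\<^sub>F (emb (\<rho> k g) * (g $$ (0,0) *\<^sub>F A + g $$ (0,1) *\<^sub>F B)) + \<xi> $ 1 *\<^sub>F (emb (\<rho> k g) * (g $$ (1,0) *\<^sub>F A + g $$ (1,1) *\<^sub>F B))"
    using g_PV[OF g \<xi>] unfolding transpose_mult_vec2[OF G_mat(1)[OF g] PV_carrier[OF \<xi>]]
    by (intro fmat_eqI) (simp add: lin_def distrib_left algebra_simps)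
  also have "\<dots> = lin A B \<xi> * emb (\<rho> i g)"
    unfolding 0[OF g] 1[OF g] using \<xi> by (simp add: lin_def distrib_right)
  finally show "emb (\<rho> k g) * lin A B (transpose_mat g *\<^sub>v \<xi>) = lin A B \<xi> * emb (\<rho> i g)" .
qed

text \<open>The contraction uses an alternating form, so \<open>g\<close> changes it by the
  determinant, which is one.\<close>

lemma br_ihom:
  assumes M: "M \<in> hm i k 1" and S: "S \<in> hm k' i 1"
  shows "br M S \<in> ihom (dg k') (\<rho> k') (dg k) (\<rho> k)"
proof -
  have "br M S * emb (\<rho> k' g) = emb (\<rho> k g) * br M S" if g: "g \<in> G" for g
  proof -
    define R R' R'' where R: "R = emb (\<rho> k g)" "R' = emb (\<rho> i g)" "R'' = emb (\<rho> k' g)"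
    define a b c d where abcd: "a = g $$ (0,0)" "b = g $$ (0,1)" "c = g $$ (1,0)" "d = g $$ (1,1)"
    have det: "a * d - b * c = 1" using G_mat[OF g] det_mat_2[of g] by (simp add: abcd)
    note m = hm_1_pencil[OF M g, folded R abcd] and s = hm_1_pencil[OF S g, folded R abcd]
    have "R * br M S = (R * b1 M) * b0 S - (R * b0 M) * b1 S"
      by (simp add: br_def right_diff_distrib mult.assoc)
    also have "\<dots> = a *\<^sub>F (b1 M * (R' * b0 S)) - c *\<^sub>F (b0 M * (R' * b0 S)) - (d *\<^sub>F (b0 M * (R' * b1 S)) - b *\<^sub>F (b1 M * (R' * b1 S)))"
      unfolding m by (simp add: left_diff_distrib mult.assoc)
    also have "\<dots> = (a * d - b * c) *\<^sub>F (br M S * R'')"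
      unfolding s by (rule fmat_eqI) (simp add: br_def left_diff_distrib right_diff_distrib mult.assoc algebra_simps)
    also have "\<dots> = br M S * R''" unfolding det by simp
    finally show ?thesis by (simp add: R)
  qed
  moreover have "fits (dg k) (dg k') (br M S)"
    unfolding br_def by (intro fits_diff fits_mult[OF hm_fits[OF M] hm_fits[OF S]])
  ultimately show ?thesis by (simp add: ihom_def)
qed

text \<open>Cyclicity of the trace; the minus sign is the antisymmetry of the contraction. This
  trades a scalar on \<open>X_k\<close> for one on \<open>X_i\<close>, which is where quotients of
  dimensions come from.\<close>

lemma ftr_br:
  assumes M: "M \<in> hm i k 1" and S: "S \<in> hm k i 1"
  shows "ftr (dg k) (br M S) = - ftr (dg i) (br S M)"
  unfolding br_def ftr_diff
  by (simp add: ftr_mult[OF hm_fits[OF M] hm_fits[OF S]])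

text \<open>The representation \<open>X\<^sub>i \<otimes> V\<^sup>*\<close> in block form. An intertwiner from it to \<open>X\<^sub>k\<close> is a linear
  equivariant matrix; an intertwiner from \<open>X\<^sub>k\<close> to it is one as well, by \<open>V \<cong> V\<^sup>*\<close>.\<close>

lemma pencil_resolution:
  assumes i: "i \<in> I"
  obtains L where "\<forall>(k, S, M)\<in>set L. k \<in> I \<and> S \<in> hm k i 1 \<and> M \<in> hm i k 1"
    "sum_list (map (\<lambda>(k, S, M). b0 S * b1 M) L) = fid (dg i)"
    "sum_list (map (\<lambda>(k, S, M). b1 S * b0 M) L) = - fid (dg i)"
    "sum_list (map (\<lambda>(k, S, M). b0 S * b0 M) L) = 0"
    "sum_list (map (\<lambda>(k, S, M). b1 S * b1 M) L) = 0"
proof -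
  define d where "d = dg i"
  \<comment> \<open>Two copies of \<open>X_i\<close> side by side: \<open>J0\<close> includes and
    projects the first copy, \<open>J1\<close> includes the second and \<open>J1'\<close> projects
    onto it. Padding by zeros lets one \<open>J0\<close> serve in every size.\<close>
  define J0 J1 J1' where J: "J0 = fid d" "J1 = mk (2 * d) d (\<lambda>x y. if x = y + d then 1 else 0)"
    "J1' = mk d (2 * d) (\<lambda>x y. if y = x + d then 1 else 0)"
  have fJ0: "fits n m J0" if "d \<le> n" "d \<le> m" for n m using that by (simp add: J fits_def)
  have fJ: "fits (2 * d) d J1" "fits d (2 * d) J1'" by (simp_all add: J)
  have J00: "J0 * J0 = fid d" by (simp add: J fid_mult[OF fits_fid])
  have J01: "J0 * J1 = 0"
    unfolding J by (rule fmat_eqI) (auto simp: ent_mult_fits[OF fits_fid] intro!: sum.neutral)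
  have J10: "J1' * J0 = 0"
    unfolding J by (rule fmat_eqI) (auto simp: ent_mult_fits[OF fits_mk] intro!: sum.neutral)
  have J11: "J1' * J1 = fid d"
  proof (rule fmat_eqI)
    fix x y
    have "ent (J1' * J1) x y = (\<Sum>z<2 * d. if z = x + d then (if x < d \<and> x = y then 1 else 0) else 0)"
      by (subst ent_mult_fits[OF fJ(2)], rule sum.cong) (auto simp: J)
    then show "ent (J1' * J1) x y = ent (fid d) x y" by auto
  qed
  have J_sum: "J0 * J0 + J1 * J1' = fid (2 * d)"
  proof (rule fmat_eqI)
    fix x y
    have "ent (J1 * J1') x y = (\<Sum>z<d. if z = x - d then (if d \<le> x \<and> x < 2 * d \<and> x = y then 1 else 0) else 0)"
      by (subst ent_mult_fits[OF fJ(1)], rule sum.cong) (auto simp: J)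
    then show "ent (J0 * J0 + J1 * J1') x y = ent (fid (2 * d)) x y" unfolding J00 by auto
  qed
  \<comment> \<open>In blocks, \<open>\<rho> i g\<close> tensored with the inverse transpose of
    \<open>g\<close>: if \<open>g\<close> has rows \<open>a, b\<close> and \<open>c, d'\<close> and
    determinant one, that matrix has rows \<open>d', -c\<close> and \<open>-b, a\<close>.\<close>
  define W where "W = (\<lambda>g. g $$ (1,1) *\<^sub>F (J0 * emb (\<rho> i g) * J0) - g $$ (1,0) *\<^sub>F (J0 * emb (\<rho> i g) * J1')
      - g $$ (0,1) *\<^sub>F (J1 * emb (\<rho> i g) * J0) + g $$ (0,0) *\<^sub>F (J1 * emb (\<rho> i g) * J1'))"
  have fR: "fits d d (emb (\<rho> i g))" if "g \<in> G" for g using rep_fits[OF rep_\<rho>[OF i] that] by (simp add: d_def)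
  have fW: "fits (2 * d) (2 * d) (W g)" if "g \<in> G" for g
    unfolding W_def by (intro fits_add fits_diff fits_fsc fits_mult[of _ d _ "2 * d"] fits_mult[of _ d _ d] fR that fJ fJ0) simp_all
  define \<sigma> where "\<sigma> = (\<lambda>g. unemb (2 * d) (2 * d) (W g))"
  have e\<sigma>: "emb (\<sigma> g) = W g" if "g \<in> G" for g unfolding \<sigma>_def by (rule emb_unemb[OF fW[OF that]])
  have R0: "emb (\<rho> i g) * J0 = emb (\<rho> i g)" "J0 * emb (\<rho> i g) = emb (\<rho> i g)" if "g \<in> G" for g
    using fR[OF that] by (simp_all add: J mult_fid fid_mult)
  have JR: "J0 * (J0 * X) = J0 * X" "J0 * (J1 * X) = 0" "J1' * (J0 * X) = 0" "J1' * (J1 * X) = J0 * X" for X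
    using J00 J01 J10 J11 by (simp_all flip: mult.assoc) (simp_all add: J fid_mult[OF fits_fid])
  have W_mult: "W (g * h) = W g * W h" if gh: "g \<in> G" "h \<in> G" for g h
  proof -
    define A B where AB: "A = emb (\<rho> i g)" "B = emb (\<rho> i h)"
    have AJB: "A * (J0 * X) = A * X" for X using R0(1)[OF gh(1)] by (simp add: AB flip: mult.assoc)
    have e: "(g * h) $$ (x, y) = g $$ (x, 0) * h $$ (0, y) + g $$ (x, 1) * h $$ (1, y)" if "x < 2" "y < 2" for x y
      using that G_mat(1)[OF gh(1)] G_mat(1)[OF gh(2)] by (simp add: scalar_prod_def numeral_2_eq_2)
    show ?thesis
      unfolding W_def rep_mult[OF rep_\<rho>[OF i] gh] AB[symmetric]
      by (rule fmat_eqI) (simp add: e distrib_left distrib_right left_diff_distrib right_diff_distrib mult.assoc JR AJB algebra_simps)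
  qed
  have W_one: "W (1\<^sub>m 2) = fid (2 * d)"
    using rep_\<rho>[OF i] J_sum[unfolded J00, folded J(1)]
    by (simp add: W_def is_rep_iff flip: d_def J(1)) (simp add: J00 mult_fid[OF fJ(1), folded J(1)] flip: J(1))
  have rep: "is_rep G (2 * d) \<sigma>"
    unfolding is_rep_iff
  proof (intro conjI ballI)
    show "\<sigma> g \<in> carrier_mat (2 * d) (2 * d)" for g by (simp add: \<sigma>_def)
    show "\<sigma> (1\<^sub>m 2) = 1\<^sub>m (2 * d)" by (simp add: \<sigma>_def W_one)
    show "\<sigma> (g * h) = \<sigma> g * \<sigma> h" if "g \<in> G" "h \<in> G" for g h
      unfolding \<sigma>_def W_mult[OF that] by (rule unemb_mult[OF fW[OF that(1)] fW[OF that(2)]])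
  qed
  obtain L where L: "\<forall>(k, S, T)\<in>set L. k \<in> I \<and> S \<in> ihom (dg k) (\<rho> k) (2 * d) \<sigma> \<and> T \<in> ihom (2 * d) \<sigma> (dg k) (\<rho> k)"
    and L_sum: "sum_list (map (\<lambda>(k, S, T). S * T) L) = fid (2 * d)"
    using complete_reducibility[OF rep] by blast
  \<comment> \<open>On the side of \<open>S\<close> the blocks are exchanged with a sign, which is
    the isomorphism of \<open>V^*\<close> with \<open>V\<close> given by the alternating form. This
    exchange also produces the alternating pattern of the four sums.\<close>
  define L' where "L' = map (\<lambda>(k, S, T). (k, lin (J1' * S) (- (J0 * S)), lin (T * J0) (T * J1))) L"
  have sums: "sum_list (map (\<lambda>(k, S, T). (A * S) * (T * B)) L) = A * B" if "fits (2 * d) m B" for A B m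
  proof -
    have "sum_list (map (\<lambda>(k, S, T). (A * S) * (T * B)) L) = A * sum_list (map (\<lambda>(k, S, T). S * T) L) * B"
      by (induction L) (auto simp: algebra_simps)
    then show ?thesis unfolding L_sum by (simp add: mult.assoc fid_mult[OF that])
  qed
  have sums': "sum_list (map (\<lambda>(k, S, T). - (A * S) * (T * B)) L) = - (A * B)" if "fits (2 * d) m B" for A B m
    using sums[OF that, of "- A"] by (simp add: case_prod_unfold)
  have fB: "fits (2 * d) d J0" "fits (2 * d) d J1" using fJ fJ0[of "2 * d" d] by simp_all
  have hmT: "lin (T * J0) (T * J1) \<in> hm i k 1" if k: "k \<in> I" and T: "T \<in> ihom (2 * d) \<sigma> (dg k) (\<rho> k)" for k T
  proof (rule lin_hm)
    have fT: "fits (dg k) (2 * d) T" using T by (simp add: ihom_def)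
    show "fits (dg k) (dg i) (T * J0)" "fits (dg k) (dg i) (T * J1)"
      using fits_mult[OF fT fB(1)] fits_mult[OF fT fB(2)] by (simp_all add: d_def)
    fix g assume g: "g \<in> G"
    define a b c d' where abcd: "a = g $$ (0,0)" "b = g $$ (0,1)" "c = g $$ (1,0)" "d' = g $$ (1,1)"
    have det: "a * d' - b * c = 1" using G_mat[OF g] det_mat_2[of g] by (simp add: abcd)
    define R where "R = emb (\<rho> i g)"
    note R0' = R0[OF g, folded R_def]
    have "T * emb (\<sigma> g) = emb (\<rho> k g) * T" using T g by (simp add: ihom_def)
    then have TW: "emb (\<rho> k g) * T = T * W g" by (simp add: e\<sigma>[OF g])
    have "R * (J0 * J1) = R * J1" using R0' by (simp flip: mult.assoc)
    then have R1: "R * J1 = 0" by (simp add: J01)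
    have W0: "W g * J0 = d' *\<^sub>F (J0 * R) - b *\<^sub>F (J1 * R)" and W1: "W g * J1 = a *\<^sub>F (J1 * R) - c *\<^sub>F (J0 * R)"
      unfolding W_def R_def[symmetric] abcd[symmetric]
      by (rule fmat_eqI, simp add: left_diff_distrib distrib_right mult.assoc J00 J10 J11 mult_fid[OF fR[OF g, folded R_def]] R0' R1)+
    have "emb (\<rho> k g) * (a *\<^sub>F (T * J0) + b *\<^sub>F (T * J1)) = T * (a *\<^sub>F (W g * J0) + b *\<^sub>F (W g * J1))"
      by (simp add: distrib_left TW flip: mult.assoc)
    also have "\<dots> = T * ((a * d' - b * c) *\<^sub>F (J0 * R))"
      unfolding W0 W1 by (rule arg_cong[of _ _ "\<lambda>x. T * x"], rule fmat_eqI) (simp add: algebra_simps)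
    also have "\<dots> = T * (J0 * R)" unfolding det by simp
    finally show "emb (\<rho> k g) * (g $$ (0,0) *\<^sub>F (T * J0) + g $$ (0,1) *\<^sub>F (T * J1)) = T * J0 * emb (\<rho> i g)"
      by (simp add: abcd R_def mult.assoc)
    have "emb (\<rho> k g) * (c *\<^sub>F (T * J0) + d' *\<^sub>F (T * J1)) = T * (c *\<^sub>F (W g * J0) + d' *\<^sub>F (W g * J1))"
      by (simp add: distrib_left TW flip: mult.assoc)
    also have "\<dots> = T * ((a * d' - b * c) *\<^sub>F (J1 * R))"
      unfolding W0 W1 by (rule arg_cong[of _ _ "\<lambda>x. T * x"], rule fmat_eqI) (simp add: algebra_simps)
    also have "\<dots> = T * (J1 * R)" unfolding det by simp
    finally show "emb (\<rho> k g) * (g $$ (1,0) *\<^sub>F (T * J0) + g $$ (1,1) *\<^sub>F (T * J1)) = T * J1 * emb (\<rho> i g)"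
      by (simp add: abcd R_def mult.assoc)
  qed
  have hmS: "lin (J1' * S) (- (J0 * S)) \<in> hm k i 1" if k: "k \<in> I" and S: "S \<in> ihom (dg k) (\<rho> k) (2 * d) \<sigma>" for k S
  proof (rule lin_hm)
    have fS: "fits (2 * d) (dg k) S" using S by (simp add: ihom_def)
    have "fits d (2 * d) J0" by (rule fJ0) simp_all
    from fits_mult[OF this fS] fits_mult[OF fJ(2) fS]
    show "fits (dg i) (dg k) (J1' * S)" "fits (dg i) (dg k) (- (J0 * S))"
      by (auto simp: d_def)
    fix g assume g: "g \<in> G"
    define a b c d' where abcd: "a = g $$ (0,0)" "b = g $$ (0,1)" "c = g $$ (1,0)" "d' = g $$ (1,1)"
    define R where "R = emb (\<rho> i g)"
    note R0' = R0[OF g, folded R_def]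
    have WS: "S * emb (\<rho> k g) = W g * S" using S g e\<sigma>[OF g] by (simp add: ihom_def)
    have RJ: "J0 * (R * X) = R * X" "R * (J0 * X) = R * X" for X using R0' by (simp_all flip: mult.assoc)
    have RJ': "J1' * (R * X) = 0" for X using JR(3)[of "R * X"] RJ by simp
    have "J1' * (S * emb (\<rho> k g)) = R * (a *\<^sub>F (J1' * S) - b *\<^sub>F (J0 * S))"
      unfolding WS unfolding W_def R_def[symmetric] abcd[symmetric]
      by (simp add: left_diff_distrib right_diff_distrib distrib_left distrib_right mult.assoc JR RJ RJ')
    then show "emb (\<rho> i g) * (g $$ (0,0) *\<^sub>F (J1' * S) + g $$ (0,1) *\<^sub>F - (J0 * S)) = J1' * S * emb (\<rho> k g)"
      by (simp add: R_def abcd mult.assoc)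
    have "J0 * (S * emb (\<rho> k g)) = R * (d' *\<^sub>F (J0 * S) - c *\<^sub>F (J1' * S))"
      unfolding WS unfolding W_def R_def[symmetric] abcd[symmetric]
      by (simp add: left_diff_distrib right_diff_distrib distrib_left distrib_right mult.assoc JR RJ RJ')
    then show "emb (\<rho> i g) * (g $$ (1,0) *\<^sub>F (J1' * S) + g $$ (1,1) *\<^sub>F - (J0 * S)) = - (J0 * S) * emb (\<rho> k g)"
      by (simp add: R_def abcd mult.assoc right_diff_distrib)
  qed
  show ?thesis
  proof (rule that[of L'])
    have "k \<in> I \<and> S \<in> hm k i 1 \<and> M \<in> hm i k 1" if kSM: "(k, S, M) \<in> set L'" for k S M
    proof -
    obtain S' T where "(k, S', T) \<in> set L" "S = lin (J1' * S') (- (J0 * S'))" "M = lin (T * J0) (T * J1)"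
      using kSM by (auto simp: L'_def)
    moreover have "k \<in> I" "S' \<in> ihom (dg k) (\<rho> k) (2 * d) \<sigma>" "T \<in> ihom (2 * d) \<sigma> (dg k) (\<rho> k)"
      using L \<open>(k, S', T) \<in> set L\<close> by auto
    ultimately show "k \<in> I \<and> S \<in> hm k i 1 \<and> M \<in> hm i k 1" using hmS hmT by auto
    qed
    then show "\<forall>(k, S, M)\<in>set L'. k \<in> I \<and> S \<in> hm k i 1 \<and> M \<in> hm i k 1" by blast
  next
    show "sum_list (map (\<lambda>(k, S, M). b0 S * b1 M) L') = fid (dg i)"
      using sums[OF fB(2), of J1'] by (simp add: L'_def comp_def case_prod_unfold J11 d_def)
    show "sum_list (map (\<lambda>(k, S, M). b1 S * b0 M) L') = - fid (dg i)"
      using sums'[OF fB(1), of J0] by (simp add: L'_def comp_def case_prod_unfold J00 d_def)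
    show "sum_list (map (\<lambda>(k, S, M). b0 S * b0 M) L') = 0"
      using sums[OF fB(1), of J1'] by (simp add: L'_def comp_def case_prod_unfold J10)
    show "sum_list (map (\<lambda>(k, S, M). b1 S * b1 M) L') = 0"
      using sums'[OF fB(2), of J0] by (simp add: L'_def comp_def case_prod_unfold J01)
  qed
qed

end

section \<open>Dual pencils for arbitrary bases, and the equivariant Koszul complex\<close>

context mckay
begin

text \<open>Expanding the pencils of the resolution in the bases \<open>B k\<close> and collecting
  coefficients gives a resolution indexed by basis elements. Inserted into a basis element
  \<open>P'\<close>, it writes \<open>P'\<close> as a combination of basis elements with
  coefficients \<open>br P' (S k P)\<close>, which are scalars by Schur's lemma, so independence
  makes them Kronecker deltas. The index set is finite because every basis element has to occur in
  the finite resolution.\<close>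

lemma dual_pencils:
  assumes i: "i \<in> I"
    and B: "\<And>k. k \<in> I \<Longrightarrow> B k \<subseteq> hm i k 1"
    and span: "\<And>k M. k \<in> I \<Longrightarrow> M \<in> hm i k 1 \<Longrightarrow> \<exists>F c. finite F \<and> F \<subseteq> B k \<and> M = (\<lambda>\<xi>. \<Sum>P\<in>F. c P *\<^sub>F P \<xi>)"
    and indep: "\<And>k F c P. k \<in> I \<Longrightarrow> finite F \<Longrightarrow> F \<subseteq> B k \<Longrightarrow> (\<lambda>\<xi>. \<Sum>P\<in>F. c P *\<^sub>F P \<xi>) = 0 \<Longrightarrow> P \<in> F \<Longrightarrow> c P = 0"
  obtains S where "finite (SIGMA k:I. B k)"
    "\<And>k P. k \<in> I \<Longrightarrow> P \<in> B k \<Longrightarrow> S k P \<in> hm k i 1"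
    "(\<Sum>(k, P)\<in>(SIGMA k:I. B k). b0 (S k P) * b1 P) = fid (dg i)"
    "(\<Sum>(k, P)\<in>(SIGMA k:I. B k). b1 (S k P) * b0 P) = - fid (dg i)"
    "(\<Sum>(k, P)\<in>(SIGMA k:I. B k). b0 (S k P) * b0 P) = 0"
    "(\<Sum>(k, P)\<in>(SIGMA k:I. B k). b1 (S k P) * b1 P) = 0"
    "\<And>k P k' P'. k \<in> I \<Longrightarrow> P \<in> B k \<Longrightarrow> k' \<in> I \<Longrightarrow> P' \<in> B k' \<Longrightarrow>
      br P' (S k P) = (if k = k' \<and> P = P' then fid (dg k) else 0)"
proof -
  obtain L where L': "\<forall>(k, S, M)\<in>set L. k \<in> I \<and> S \<in> hm k i 1 \<and> M \<in> hm i k 1"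
    and L01: "sum_list (map (\<lambda>(k, S, M). b0 S * b1 M) L) = fid (dg i)"
    and L10: "sum_list (map (\<lambda>(k, S, M). b1 S * b0 M) L) = - fid (dg i)"
    and L00: "sum_list (map (\<lambda>(k, S, M). b0 S * b0 M) L) = 0"
    and L11: "sum_list (map (\<lambda>(k, S, M). b1 S * b1 M) L) = 0"
    by (rule pencil_resolution[OF i])
  have L: "k \<in> I \<and> S \<in> hm k i 1 \<and> M \<in> hm i k 1" if "(k, S, M) \<in> set L" for k S M
    using L' that by blast
  define n where "n = length L"
  define kk where "kk = (\<lambda>l. fst (L ! l))"
  define SS where "SS = (\<lambda>l. fst (snd (L ! l)))"
  define MM where "MM = (\<lambda>l. snd (snd (L ! l)))"
  have Ll: "kk l \<in> I" "SS l \<in> hm (kk l) i 1" "MM l \<in> hm i (kk l) 1" if "l < n" for l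
    using L[of "kk l" "SS l" "MM l"] nth_mem[of l L] that by (simp_all add: kk_def SS_def MM_def n_def)
  have Lsum: "sum_list (map (\<lambda>(k, S, M). S u * M v) L) = (\<Sum>l<n. SS l u * MM l v)" for u v
    by (simp add: sum_list_sum_nth n_def SS_def MM_def case_prod_unfold atLeast0LessThan)
  define Q where "Q = (\<lambda>l F c. finite F \<and> F \<subseteq> B (kk l) \<and> MM l = (\<lambda>\<xi>. \<Sum>P\<in>F. c P *\<^sub>F P \<xi>))"
  have "\<exists>F c. Q l F c" if "l < n" for l
    unfolding Q_def by (rule span[OF Ll(1,3)[OF that]])
  then obtain F c where Q: "\<And>l. l < n \<Longrightarrow> Q l (F l) (c l)" by metis
  have F: "finite (F l)" "F l \<subseteq> B (kk l)" "MM l = (\<lambda>\<xi>. \<Sum>P\<in>F l. c l P *\<^sub>F P \<xi>)" if "l < n" for l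
    using Q[OF that] by (simp_all add: Q_def)
  \<comment> \<open>The basis elements occurring in the chosen expansions; in the end these are all
    of them.\<close>
  define A0 where "A0 = (\<Union>l<n. {kk l} \<times> F l)"
  have finA0: "finite A0" unfolding A0_def using F(1) by auto
  have A0B: "k \<in> I" "P \<in> B k" if "(k, P) \<in> A0" for k P
    using that F(2) Ll(1) by (auto simp: A0_def)
  \<comment> \<open>The transposed expansion: the coefficient of \<open>P\<close> in
    \<open>MM l\<close> now weights the partner \<open>SS l\<close>.\<close>
  define S where "S = (\<lambda>k P \<xi>. \<Sum>l<n. (if kk l = k \<and> P \<in> F l then c l P else 0) *\<^sub>F SS l \<xi>)"
  have S_hm: "S k P \<in> hm k i 1" for k P
    unfolding S_def
  proof (rule hm_sum)
    fix l assume "l \<in> {..<n}"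
    then have l: "l < n" by simp
    show "(\<lambda>\<xi>. (if kk l = k \<and> P \<in> F l then c l P else 0) *\<^sub>F SS l \<xi>) \<in> hm k i 1"
    proof (cases "kk l = k")
      case True
      then show ?thesis using hm_fsc[OF Ll(2)[OF l]] by simp
    next
      case False
      then show ?thesis using hm_zero[of k i 1] by (simp add: zero_fun_def)
    qed
  qed
  have sumA0: "(\<Sum>(k, P)\<in>A0. S k P u * P v) = (\<Sum>l<n. SS l u * MM l v)" for u v
  proof -
    have "(\<Sum>(k, P)\<in>A0. S k P u * P v) = (\<Sum>x\<in>A0. \<Sum>l<n. (if kk l = fst x \<and> snd x \<in> F l then c l (snd x) else 0) *\<^sub>F (SS l u * snd x v))"
      by (simp add: S_def case_prod_unfold sum_distrib_right)
    also have "\<dots> = (\<Sum>l<n. \<Sum>x\<in>A0. (if kk l = fst x \<and> snd x \<in> F l then c l (snd x) else 0) *\<^sub>F (SS l u * snd x v))"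
      by (rule sum.swap)
    also have "\<dots> = (\<Sum>l<n. SS l u * MM l v)"
    proof (rule sum.cong[OF refl])
      fix l assume "l \<in> {..<n}"
      then have l: "l < n" by simp
      have "(\<Sum>x\<in>A0. (if kk l = fst x \<and> snd x \<in> F l then c l (snd x) else 0) *\<^sub>F (SS l u * snd x v)) =
          (\<Sum>x\<in>Pair (kk l) ` F l. c l (snd x) *\<^sub>F (SS l u * snd x v))"
        using l by (intro sum.mono_neutral_cong_right finA0) (auto simp: A0_def)
      also have "\<dots> = (\<Sum>P\<in>F l. c l P *\<^sub>F (SS l u * P v))"
        by (subst sum.reindex) (auto simp: inj_on_def)
      also have "\<dots> = SS l u * MM l v"
        by (simp add: F(3)[OF l] sum_distrib_left)
      finally show "(\<Sum>x\<in>A0. (if kk l = fst x \<and> snd x \<in> F l then c l (snd x) else 0) *\<^sub>F (SS l u * snd x v)) = SS l u * MM l v" .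
    qed
    finally show ?thesis .
  qed
  have s01: "(\<Sum>(k, P)\<in>A0. b0 (S k P) * b1 P) = fid (dg i)"
    and s10: "(\<Sum>(k, P)\<in>A0. b1 (S k P) * b0 P) = - fid (dg i)"
    and s00: "(\<Sum>(k, P)\<in>A0. b0 (S k P) * b0 P) = 0"
    and s11: "(\<Sum>(k, P)\<in>A0. b1 (S k P) * b1 P) = 0"
    unfolding sumA0 Lsum[symmetric] L01 L10 L00 L11 by (rule refl)+
  \<comment> \<open>The four sums collapse to plus or minus an identity or to zero, so the
    contraction with \<open>P'\<close> leaves just its two coefficients.\<close>
  have expand: "(\<Sum>(k, P)\<in>A0. br P' (S k P) * b0 P) = b0 P'" "(\<Sum>(k, P)\<in>A0. br P' (S k P) * b1 P) = b1 P'"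
    if "P' \<in> hm i k' 1" for k' P'
  proof -
    have *: "(\<Sum>(k, P)\<in>A0. br P' (S k P) * P v) = b1 P' * (\<Sum>(k, P)\<in>A0. b0 (S k P) * P v) - b0 P' * (\<Sum>(k, P)\<in>A0. b1 (S k P) * P v)" for v
      by (simp add: br_def case_prod_unfold left_diff_distrib sum_subtractf sum_distrib_left mult.assoc)
    show "(\<Sum>(k, P)\<in>A0. br P' (S k P) * b0 P) = b0 P'" "(\<Sum>(k, P)\<in>A0. br P' (S k P) * b1 P) = b1 P'"
      unfolding * s01 s10 s00 s11 by (simp_all add: mult_fid[OF hm_fits[OF that]])
  qed
  have key: "(k', P') \<in> A0 \<and> (\<forall>k P. (k, P) \<in> A0 \<longrightarrow> br P' (S k P) = (if k = k' \<and> P = P' then fid (dg k) else 0))"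
    if k': "k' \<in> I" and P': "P' \<in> B k'" for k' P'
  proof -
    have P'hm: "P' \<in> hm i k' 1" using B[OF k'] P' by blast
    have "\<exists>\<beta>. br P' (S k' P) = \<beta> *\<^sub>F fid (dg k')" for P
      using schur_scalar[OF irreps[OF k'] br_ihom[OF P'hm S_hm]] by blast
    then obtain \<beta> where \<beta>: "\<And>P. br P' (S k' P) = \<beta> P *\<^sub>F fid (dg k')" by metis
    have other: "br P' (S k P) = 0" if "(k, P) \<in> A0" "k \<noteq> k'" for k P
      by (rule schur_zero[OF A0B(1)[OF that(1)] k' that(2) br_ihom[OF P'hm S_hm]])
    define F' where "F' = {P. (k', P) \<in> A0}"
    have finF': "finite F'"
      using finite_imageI[OF finA0, of snd] unfolding F'_def by (rule finite_subset[rotated]) force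
    have F'B: "F' \<subseteq> B k'" using A0B(2) by (auto simp: F'_def)
    have red: "(\<Sum>(k, P)\<in>A0. br P' (S k P) * P v) = (\<Sum>P\<in>F'. \<beta> P *\<^sub>F P v)" for v
    proof -
      have "(\<Sum>(k, P)\<in>A0. br P' (S k P) * P v) = (\<Sum>(k, P)\<in>Pair k' ` F'. br P' (S k P) * P v)"
      proof (rule sum.mono_neutral_right[OF finA0])
        show "Pair k' ` F' \<subseteq> A0" by (auto simp: F'_def)
        show "\<forall>x\<in>A0 - Pair k' ` F'. (case x of (k, P) \<Rightarrow> br P' (S k P) * P v) = 0"
        proof clarify
          fix k P assume "(k, P) \<in> A0" "(k, P) \<notin> Pair k' ` F'"
          then have "k \<noteq> k'" by (auto simp: F'_def)
          then show "br P' (S k P) * P v = 0" using other[OF \<open>(k, P) \<in> A0\<close>] by simp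
        qed
      qed
      also have "\<dots> = (\<Sum>P\<in>F'. br P' (S k' P) * P v)"
        by (subst sum.reindex) (auto simp: inj_on_def)
      also have "\<dots> = (\<Sum>P\<in>F'. \<beta> P *\<^sub>F P v)"
      proof (rule sum.cong[OF refl])
        fix P assume "P \<in> F'"
        then have "P \<in> hm i k' 1" using F'B B[OF k'] by blast
        then show "br P' (S k' P) * P v = \<beta> P *\<^sub>F P v" by (simp add: \<beta> fid_mult[OF hm_fits])
      qed
      finally show ?thesis .
    qed
    have F'hm: "P \<in> hm i k' 1" if "P \<in> F'" for P using that F'B B[OF k'] by blast
    have P'eq: "P' = (\<lambda>\<xi>. \<Sum>P\<in>F'. \<beta> P *\<^sub>F P \<xi>)"
    proof (rule PM_1_eqI)
      show "P' \<in> PM 1 (dg i) (dg k')" by (rule hm_PM[OF P'hm])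
      show "(\<lambda>\<xi>. \<Sum>P\<in>F'. \<beta> P *\<^sub>F P \<xi>) \<in> PM 1 (dg i) (dg k')"
        by (rule PM_sum, rule PM_fsc, rule hm_PM, rule F'hm)
      show "b0 P' = (\<Sum>P\<in>F'. \<beta> P *\<^sub>F b0 P)" "b1 P' = (\<Sum>P\<in>F'. \<beta> P *\<^sub>F b1 P)"
        unfolding red[symmetric] expand[OF P'hm] by (rule refl)+
    qed
    define F'' where "F'' = insert P' F'"
    \<comment> \<open>The coefficients of the relation expressing \<open>P'\<close> by the elements
      of \<open>F'\<close>. If \<open>P'\<close> were not in \<open>F'\<close>, its coefficient
      would be \<open>-1\<close>; so independence yields both the membership and the values of
      \<open>\<beta>\<close>.\<close>
    define x where "x = (\<lambda>P. (if P \<in> F' then \<beta> P else 0) - (if P = P' then 1 else 0))"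
    have "(\<Sum>P\<in>F''. x P *\<^sub>F P \<xi>) = 0" for \<xi>
    proof -
      have "(\<Sum>P\<in>F''. x P *\<^sub>F P \<xi>) = (\<Sum>P\<in>F''. (if P \<in> F' then \<beta> P else 0) *\<^sub>F P \<xi>) - (\<Sum>P\<in>F''. (if P = P' then 1 else 0) *\<^sub>F P \<xi>)"
        by (simp add: x_def fsc.scale_left_diff_distrib sum_subtractf)
      also have "(\<Sum>P\<in>F''. (if P \<in> F' then \<beta> P else 0) *\<^sub>F P \<xi>) = (\<Sum>P\<in>F'. \<beta> P *\<^sub>F P \<xi>)"
        using finF' by (intro sum.mono_neutral_cong_right) (auto simp: F''_def)
      also have "\<dots> = P' \<xi>" by (rule fun_cong[OF P'eq, symmetric])
      also have "(\<Sum>P\<in>F''. (if P = P' then 1 else 0) *\<^sub>F P \<xi>) = (\<Sum>P\<in>{P'}. 1 *\<^sub>F P \<xi>)"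
        using finF' by (intro sum.mono_neutral_cong_right) (auto simp: F''_def)
      finally show ?thesis by simp
    qed
    then have zero: "(\<lambda>\<xi>. \<Sum>P\<in>F''. x P *\<^sub>F P \<xi>) = 0" by (simp add: zero_fun_def)
    have x0: "x P = 0" if "P \<in> F''" for P
      by (rule indep[OF k' _ _ zero that]) (use finF' F'B P' in \<open>auto simp: F''_def\<close>)
    have P'F': "P' \<in> F'" using x0[of P'] by (auto simp: F''_def x_def split: if_splits)
    have \<beta>1: "\<beta> P = (if P = P' then 1 else 0)" if "P \<in> F'" for P
      using x0[of P] that by (auto simp: F''_def x_def split: if_splits)
    have "br P' (S k P) = (if k = k' \<and> P = P' then fid (dg k) else 0)" if kP: "(k, P) \<in> A0" for k P
    proof (cases "k = k'")
      case True
      then have "P \<in> F'" using kP by (simp add: F'_def)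
      then show ?thesis using True \<beta>[of P] \<beta>1[of P] by simp
    next
      case False
      then show ?thesis using other[OF kP False] by simp
    qed
    moreover have "(k', P') \<in> A0" using P'F' by (simp add: F'_def)
    ultimately show ?thesis by blast
  qed
  have A: "(SIGMA k:I. B k) = A0"
  proof (rule Set.set_eqI)
    fix x :: "'i \<times> (complex vec \<Rightarrow> fmat)"
    obtain k P where x: "x = (k, P)" by (cases x)
    show "x \<in> (SIGMA k:I. B k) \<longleftrightarrow> x \<in> A0"
      unfolding x using key[of k P] A0B[of k P] by blast
  qed
  show ?thesis
  proof (rule that[of S])
    show "finite (SIGMA k:I. B k)" unfolding A by (rule finA0)
    show "S k P \<in> hm k i 1" for k P by (rule S_hm)
    fix k P k' P' assume "k \<in> I" "P \<in> B k" "k' \<in> I" "P' \<in> B k'"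
    then have "(k, P) \<in> A0" using A by blast
    then show "br P' (S k P) = (if k = k' \<and> P = P' then fid (dg k) else 0)"
      using key[OF \<open>k' \<in> I\<close> \<open>P' \<in> B k'\<close>] by blast
  qed (use s01 s10 s00 s11 A in auto)
qed

text \<open>The Koszul complex of \<open>\<P>\<^sup>1\<close>, with \<open>X\<^sub>i \<otimes> V\<^sup>*\<close> decomposed by dual pencils: every equivariant
  matrix of nonzero degree factors through the pencils, and the relations between the factorizations
  come from degree two.\<close>

lemma hm_factor:
  assumes i: "i \<in> I" and j: "j \<in> I" and M: "M \<in> hm i j N" and N: "N \<noteq> 0" and fin: "finite A"
    and A: "\<And>k P. (k, P) \<in> A \<Longrightarrow> k \<in> I \<and> P \<in> hm i k 1 \<and> S k P \<in> hm k i 1"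
    and s01: "(\<Sum>(k, P)\<in>A. b0 (S k P) * b1 P) = fid (dg i)" and s10: "(\<Sum>(k, P)\<in>A. b1 (S k P) * b0 P) = - fid (dg i)"
    and s00: "(\<Sum>(k, P)\<in>A. b0 (S k P) * b0 P) = 0" and s11: "(\<Sum>(k, P)\<in>A. b1 (S k P) * b1 P) = 0"
  obtains \<psi> where "\<And>k P. (k, P) \<in> A \<Longrightarrow> \<psi> k P \<in> hm k j (N - 1)" "M = (\<lambda>\<xi>. \<Sum>(k, P)\<in>A. \<psi> k P \<xi> * P \<xi>)"
proof -
  obtain C D where C: "C \<in> PM (N - 1) (dg i) (dg j)" and D: "D \<in> PM (N - 1) (dg i) (dg j)"
    and CD: "\<And>\<xi>. \<xi> \<in> PV \<Longrightarrow> M \<xi> = \<xi> $ 0 *\<^sub>F C \<xi> + \<xi> $ 1 *\<^sub>F D \<xi>"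
    by (rule PM_split[OF hm_PM[OF M] N]) blast
  \<comment> \<open>The cofactors \<open>C\<close> and \<open>D\<close> contracted with
    \<open>S k P\<close> after the pattern of \<open>br\<close>; the four sums then reassemble
    \<open>M\<close>.\<close>
  define \<phi> where "\<phi> = (\<lambda>k P \<xi>. D \<xi> * b0 (S k P) - C \<xi> * b1 (S k P))"
  have \<phi>: "\<phi> k P \<in> PM (N - 1) (dg k) (dg j)" if "(k, P) \<in> A" for k P
  proof -
    have S: "S k P \<in> hm k i 1" using A[OF that] by blast
    have *: "(\<lambda>\<xi>. X \<xi> * S k P u) \<in> PM (N - 1) (dg k) (dg j)" if "X \<in> PM (N - 1) (dg i) (dg j)" for X u
      using PM_const_mult[OF that fits_fid[of "dg j"] hm_fits[OF S, of u]] fid_mult[OF PM_D(2)[OF that]] by simp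
    show ?thesis
      unfolding \<phi>_def using PM_add[OF *[OF D, of "v2 1 0"] PM_fsc[OF *[OF C, of "v2 0 1"], of "-1"]]
      by (simp add: plus_fun_def)
  qed
  have M_eq: "M \<xi> = (\<Sum>(k, P)\<in>A. \<phi> k P \<xi> * P \<xi>)" if "\<xi> \<in> PV" for \<xi>
  proof -
    have "(\<Sum>(k, P)\<in>A. \<phi> k P \<xi> * P \<xi>) = (\<Sum>x\<in>A. \<xi> $ 0 *\<^sub>F (D \<xi> * (b0 (S (fst x) (snd x)) * b0 (snd x))) + \<xi> $ 1 *\<^sub>F (D \<xi> * (b0 (S (fst x) (snd x)) * b1 (snd x)))
        - \<xi> $ 0 *\<^sub>F (C \<xi> * (b1 (S (fst x) (snd x)) * b0 (snd x))) - \<xi> $ 1 *\<^sub>F (C \<xi> * (b1 (S (fst x) (snd x)) * b1 (snd x))))"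
      unfolding case_prod_unfold
    proof (rule sum.cong[OF refl])
      fix x assume "x \<in> A"
      then have "snd x \<in> hm i (fst x) 1" using A[of "fst x" "snd x"] by simp
      from PM_1[OF hm_PM[OF this] that]
      show "\<phi> (fst x) (snd x) \<xi> * snd x \<xi> = \<xi> $ 0 *\<^sub>F (D \<xi> * (b0 (S (fst x) (snd x)) * b0 (snd x))) + \<xi> $ 1 *\<^sub>F (D \<xi> * (b0 (S (fst x) (snd x)) * b1 (snd x)))
        - \<xi> $ 0 *\<^sub>F (C \<xi> * (b1 (S (fst x) (snd x)) * b0 (snd x))) - \<xi> $ 1 *\<^sub>F (C \<xi> * (b1 (S (fst x) (snd x)) * b1 (snd x)))"
        by (simp add: \<phi>_def distrib_left left_diff_distrib mult.assoc fsc.scale_right_diff_distrib algebra_simps)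
    qed
    also have "\<dots> = \<xi> $ 0 *\<^sub>F (D \<xi> * (\<Sum>(k, P)\<in>A. b0 (S k P) * b0 P)) + \<xi> $ 1 *\<^sub>F (D \<xi> * (\<Sum>(k, P)\<in>A. b0 (S k P) * b1 P))
        - \<xi> $ 0 *\<^sub>F (C \<xi> * (\<Sum>(k, P)\<in>A. b1 (S k P) * b0 P)) - \<xi> $ 1 *\<^sub>F (C \<xi> * (\<Sum>(k, P)\<in>A. b1 (S k P) * b1 P))"
      by (simp add: case_prod_unfold sum.distrib sum_subtractf sum_distrib_left fsc.scale_sum_right)
    also have "\<dots> = M \<xi>"
      unfolding s01 s10 s00 s11 CD[OF that] by (simp add: mult_fid[OF PM_D(2)[OF C]] mult_fid[OF PM_D(2)[OF D]])
    finally show ?thesis by simp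
  qed
  have M_sum: "M = (\<lambda>\<xi>. \<Sum>x\<in>A. \<phi> (fst x) (snd x) \<xi> * snd x \<xi>)"
  proof
    fix \<xi>
    show "M \<xi> = (\<Sum>x\<in>A. \<phi> (fst x) (snd x) \<xi> * snd x \<xi>)"
    proof (cases "\<xi> \<in> PV")
      case True
      then show ?thesis using M_eq by (simp add: case_prod_unfold)
    next
      case False
      have "snd x \<xi> = 0" if "x \<in> A" for x
        using A[of "fst x" "snd x"] that hm_off[OF _ False] by auto
      then show ?thesis using hm_off[OF M False] by simp
    qed
  qed
  \<comment> \<open>Averaging fixes \<open>M\<close> and passes to the left factors, making the
    cofactors equivariant.\<close>
  have "M = avgp i j M" by (rule avgp_id[OF i j M, symmetric])
  also have "\<dots> = avgp i j (\<lambda>\<xi>. \<Sum>x\<in>A. \<phi> (fst x) (snd x) \<xi> * snd x \<xi>)"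
    by (rule arg_cong[OF M_sum])
  also have "avgp i j (\<lambda>\<xi>. \<Sum>x\<in>A. \<phi> (fst x) (snd x) \<xi> * snd x \<xi>) = (\<lambda>\<xi>. \<Sum>x\<in>A. avgp i j (\<lambda>\<xi>. \<phi> (fst x) (snd x) \<xi> * snd x \<xi>) \<xi>)"
    by (rule avgp_sum)
  also have "\<dots> = (\<lambda>\<xi>. \<Sum>x\<in>A. avgp (fst x) j (\<phi> (fst x) (snd x)) \<xi> * snd x \<xi>)"
  proof (rule ext, rule sum.cong[OF refl])
    fix \<xi> x assume "x \<in> A"
    then have "fst x \<in> I" "snd x \<in> hm i (fst x) 1" using A[of "fst x" "snd x"] by simp_all
    from avgp_mult[OF i this] show "avgp i j (\<lambda>\<xi>. \<phi> (fst x) (snd x) \<xi> * snd x \<xi>) \<xi> = avgp (fst x) j (\<phi> (fst x) (snd x)) \<xi> * snd x \<xi>"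
      by simp
  qed
  finally have M': "M = (\<lambda>\<xi>. \<Sum>(k, P)\<in>A. avgp k j (\<phi> k P) \<xi> * P \<xi>)" by (simp add: case_prod_unfold)
  show ?thesis
  proof (rule that[OF _ M'])
    fix k P assume "(k, P) \<in> A"
    then show "avgp k j (\<phi> k P) \<in> hm k j (N - 1)" using A by (intro avgp_hm[OF _ j \<phi>]) auto
  qed
qed

text \<open>Replacing each right factor by its two coefficients turns the relation into a syzygy of
  the two coordinates, so both sums are multiples of a single \<open>C\<close>. Contraction with
  \<open>S k P\<close> then isolates \<open>\<psi> k P\<close> by orthogonality.\<close>

lemma hm_syzygy:
  assumes i: "i \<in> I" and j: "j \<in> I" and fin: "finite A"
    and A: "\<And>k P. (k, P) \<in> A \<Longrightarrow> k \<in> I \<and> P \<in> hm i k 1 \<and> S k P \<in> hm k i 1"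
    and orth: "\<And>k P k' P'. (k, P) \<in> A \<Longrightarrow> (k', P') \<in> A \<Longrightarrow> br P' (S k P) = (if k = k' \<and> P = P' then fid (dg k) else 0)"
    and \<psi>: "\<And>k P. (k, P) \<in> A \<Longrightarrow> \<psi> k P \<in> hm k j N"
    and zero: "\<And>\<xi>. (\<Sum>(k, P)\<in>A. \<psi> k P \<xi> * P \<xi>) = 0"
  obtains C where "C \<in> hm i j (N - 1)" "\<And>k P. (k, P) \<in> A \<Longrightarrow> \<psi> k P = (\<lambda>\<xi>. C \<xi> * S k P \<xi>)"
proof -
  define T where "T = (\<lambda>v \<xi>. \<Sum>(k, P)\<in>A. \<psi> k P \<xi> * P v)"
  have T: "T v \<in> PM N (dg i) (dg j)" for v
    unfolding T_def case_prod_unfold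
  proof (rule PM_sum)
    fix x assume "x \<in> A"
    then have x: "snd x \<in> hm i (fst x) 1" and p: "\<psi> (fst x) (snd x) \<in> PM N (dg (fst x)) (dg j)"
      using A[of "fst x" "snd x"] hm_PM[OF \<psi>[of "fst x" "snd x"]] by simp_all
    show "(\<lambda>\<xi>. \<psi> (fst x) (snd x) \<xi> * snd x v) \<in> PM N (dg i) (dg j)"
      using PM_const_mult[OF p fits_fid[of "dg j"] hm_fits[OF x, of v]] fid_mult[OF PM_D(2)[OF p]] by simp
  qed
  have "\<xi> $ 0 *\<^sub>F T (v2 1 0) \<xi> + \<xi> $ 1 *\<^sub>F T (v2 0 1) \<xi> = 0" if "\<xi> \<in> PV" for \<xi>
  proof -
    have "\<xi> $ 0 *\<^sub>F T (v2 1 0) \<xi> + \<xi> $ 1 *\<^sub>F T (v2 0 1) \<xi> = (\<Sum>x\<in>A. \<psi> (fst x) (snd x) \<xi> * (\<xi> $ 0 *\<^sub>F b0 (snd x) + \<xi> $ 1 *\<^sub>F b1 (snd x)))"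
      by (simp add: T_def case_prod_unfold fsc.scale_sum_right distrib_left sum.distrib)
    also have "\<dots> = (\<Sum>x\<in>A. \<psi> (fst x) (snd x) \<xi> * snd x \<xi>)"
    proof (rule sum.cong[OF refl])
      fix x assume "x \<in> A"
      then have "snd x \<in> hm i (fst x) 1" using A[of "fst x" "snd x"] by simp
      from PM_1[OF hm_PM[OF this] that]
      show "\<psi> (fst x) (snd x) \<xi> * (\<xi> $ 0 *\<^sub>F b0 (snd x) + \<xi> $ 1 *\<^sub>F b1 (snd x)) = \<psi> (fst x) (snd x) \<xi> * snd x \<xi>" by simp
    qed
    finally show ?thesis using zero[of \<xi>] by (simp add: case_prod_unfold)
  qed
  from PM_syzygy[OF T T this] obtain C where C: "C \<in> PM (N - 1) (dg i) (dg j)"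
    and C0: "\<And>\<xi>. \<xi> \<in> PV \<Longrightarrow> T (v2 1 0) \<xi> = \<xi> $ 1 *\<^sub>F C \<xi>" and C1: "\<And>\<xi>. \<xi> \<in> PV \<Longrightarrow> T (v2 0 1) \<xi> = - (\<xi> $ 0 *\<^sub>F C \<xi>)"
    by blast
  have eq: "\<psi> k P = (\<lambda>\<xi>. (- 1) *\<^sub>F C \<xi> * S k P \<xi>)" if kP: "(k, P) \<in> A" for k P
  proof
    fix \<xi>
    have S: "S k P \<in> hm k i 1" using A[OF kP] by blast
    show "\<psi> k P \<xi> = (- 1) *\<^sub>F C \<xi> * S k P \<xi>"
    proof (cases "\<xi> \<in> PV")
      case True
      have "T (v2 0 1) \<xi> * b0 (S k P) - T (v2 1 0) \<xi> * b1 (S k P) = (\<Sum>x\<in>A. \<psi> (fst x) (snd x) \<xi> * br (snd x) (S k P))"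
        by (simp add: T_def case_prod_unfold sum_distrib_right br_def right_diff_distrib sum_subtractf mult.assoc)
      also have "\<dots> = (\<Sum>x\<in>A. if x = (k, P) then \<psi> k P \<xi> else 0)"
      proof (rule sum.cong[OF refl])
        fix x assume "x \<in> A"
        then show "\<psi> (fst x) (snd x) \<xi> * br (snd x) (S k P) = (if x = (k, P) then \<psi> k P \<xi> else 0)"
          using orth[OF kP, of "fst x" "snd x"] mult_fid[OF hm_fits[OF \<psi>[OF kP]]] by (auto simp: prod_eq_iff)
      qed
      also have "\<dots> = \<psi> k P \<xi>" using fin kP by simp
      finally have "\<psi> k P \<xi> = - (\<xi> $ 0 *\<^sub>F C \<xi>) * b0 (S k P) - \<xi> $ 1 *\<^sub>F C \<xi> * b1 (S k P)"
        unfolding C0[OF True] C1[OF True] by simp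
      also have "\<dots> = (- 1) *\<^sub>F C \<xi> * S k P \<xi>"
        unfolding PM_1[OF hm_PM[OF S] True] by (simp add: distrib_left)
      finally show ?thesis .
    qed (simp add: hm_off[OF \<psi>[OF kP]] hm_off[OF S])
  qed
  \<comment> \<open>The sign comes from the contraction with the Koszul pair. \<open>C\<close> need
    not be equivariant, but the \<open>\<psi> k P\<close> and \<open>S k P\<close> are, so its
    average serves equally well.\<close>
  define C' where "C' = avgp i j (\<lambda>\<xi>. (- 1) *\<^sub>F C \<xi>)"
  show ?thesis
  proof (rule that)
    show "C' \<in> hm i j (N - 1)" unfolding C'_def by (rule avgp_hm[OF i j PM_fsc[OF C]])
    fix k P assume kP: "(k, P) \<in> A"
    then have k: "k \<in> I" "S k P \<in> hm k i 1" using A by auto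
    have "\<psi> k P = avgp k j (\<psi> k P)" by (rule avgp_id[OF k(1) j \<psi>[OF kP], symmetric])
    also have "\<dots> = avgp k j (\<lambda>\<xi>. (- 1) *\<^sub>F C \<xi> * S k P \<xi>)" using eq[OF kP] by (rule arg_cong)
    also have "\<dots> = (\<lambda>\<xi>. C' \<xi> * S k P \<xi>)"
      unfolding C'_def by (rule avgp_mult[OF k(1) i k(2)])
    finally show "\<psi> k P = (\<lambda>\<xi>. C' \<xi> * S k P \<xi>)" .
  qed
qed

end

section \<open>Transport of vector space structures\<close>

text \<open>Connects the record-based vector spaces with type-class sums: \<open>W\<close> is the image of a subspace
  \<open>C\<close> of a space given by a type class.\<close>

locale vs_image =
  fixes sc :: "complex \<Rightarrow> 'a::ab_group_add \<Rightarrow> 'a" and C :: "'a set" and h :: "'a \<Rightarrow> 'b"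
    and W :: "(complex, 'b) module"
  assumes vsp: "vector_space sc"
    and C_zero: "0 \<in> C" and C_add: "\<And>a b. a \<in> C \<Longrightarrow> b \<in> C \<Longrightarrow> a + b \<in> C" and C_sc: "\<And>c a. a \<in> C \<Longrightarrow> sc c a \<in> C"
    and W_carrier: "carrier W = h ` C"
    and W_add: "\<And>a b. a \<in> C \<Longrightarrow> b \<in> C \<Longrightarrow> add W (h a) (h b) = h (a + b)"
    and W_sc: "\<And>c a. a \<in> C \<Longrightarrow> module.smult W c (h a) = h (sc c a)"
    and W_zero: "zero W = h 0"
begin

lemma vectorspace_W: "vectorspace class_ring W"
proof -
  interpret vector_space sc by (rule vsp)
  have ag: "abelian_group W"
  proof (rule abelian_groupI)
    fix x y z assume "x \<in> carrier W" "y \<in> carrier W" "z \<in> carrier W"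
    then obtain a b c where abc: "a \<in> C" "b \<in> C" "c \<in> C" "x = h a" "y = h b" "z = h c"
      by (auto simp: W_carrier)
    show "x \<oplus>\<^bsub>W\<^esub> y \<oplus>\<^bsub>W\<^esub> z = x \<oplus>\<^bsub>W\<^esub> (y \<oplus>\<^bsub>W\<^esub> z)"
      using abc by (simp add: W_add C_add add.assoc)
  next
    fix x y assume "x \<in> carrier W" "y \<in> carrier W"
    then obtain a b where ab: "a \<in> C" "b \<in> C" "x = h a" "y = h b"
      by (auto simp: W_carrier)
    show "x \<oplus>\<^bsub>W\<^esub> y \<in> carrier W" "x \<oplus>\<^bsub>W\<^esub> y = y \<oplus>\<^bsub>W\<^esub> x"
      using ab by (auto simp: W_add C_add add.commute W_carrier)
  next
    show "\<zero>\<^bsub>W\<^esub> \<in> carrier W" using C_zero by (simp add: W_zero W_carrier)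
  next
    fix x assume "x \<in> carrier W"
    then obtain a where a: "a \<in> C" "x = h a" by (auto simp: W_carrier)
    show "\<zero>\<^bsub>W\<^esub> \<oplus>\<^bsub>W\<^esub> x = x" using a C_zero by (simp add: W_zero W_add)
    have "h (sc (-1) a) \<oplus>\<^bsub>W\<^esub> x = \<zero>\<^bsub>W\<^esub>"
      using a C_sc[of a "-1"] by (simp add: W_add W_zero)
    then show "\<exists>y\<in>carrier W. y \<oplus>\<^bsub>W\<^esub> x = \<zero>\<^bsub>W\<^esub>"
      using a C_sc[of a "-1"] by (auto simp: W_carrier)
  qed
  have "Module.module class_ring W"
  proof (rule Module.module.intro)
    show "cring (class_ring :: complex ring)" by (rule class_cring.cring_axioms)
    show "abelian_group W" by (rule ag)
    show "Module.module_axioms class_ring W"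
    proof (rule Module.module_axioms.intro)
      fix c :: complex and x assume "x \<in> carrier W"
      then obtain a where a: "a \<in> C" "x = h a" by (auto simp: W_carrier)
      show "c \<odot>\<^bsub>W\<^esub> x \<in> carrier W" using a C_sc by (auto simp: W_carrier W_sc)
    next
      fix c e :: complex and x assume "x \<in> carrier W"
      then obtain a where a: "a \<in> C" "x = h a" by (auto simp: W_carrier)
      show "(c \<oplus>\<^bsub>class_ring\<^esub> e) \<odot>\<^bsub>W\<^esub> x = c \<odot>\<^bsub>W\<^esub> x \<oplus>\<^bsub>W\<^esub> e \<odot>\<^bsub>W\<^esub> x"
        using a by (simp add: W_add W_sc C_sc scale_left_distrib)
      show "(c \<otimes>\<^bsub>class_ring\<^esub> e) \<odot>\<^bsub>W\<^esub> x = c \<odot>\<^bsub>W\<^esub> (e \<odot>\<^bsub>W\<^esub> x)"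
        using a by (simp add: W_sc C_sc)
    next
      fix c :: complex and x y assume "x \<in> carrier W" "y \<in> carrier W"
      then obtain a b where ab: "a \<in> C" "b \<in> C" "x = h a" "y = h b"
        by (auto simp: W_carrier)
      show "c \<odot>\<^bsub>W\<^esub> (x \<oplus>\<^bsub>W\<^esub> y) = c \<odot>\<^bsub>W\<^esub> x \<oplus>\<^bsub>W\<^esub> c \<odot>\<^bsub>W\<^esub> y"
        using ab by (simp add: W_add W_sc C_sc C_add scale_right_distrib)
    next
      fix x assume "x \<in> carrier W"
      then obtain a where a: "a \<in> C" "x = h a" by (auto simp: W_carrier)
      show "\<one>\<^bsub>class_ring\<^esub> \<odot>\<^bsub>W\<^esub> x = x" using a by (simp add: W_sc)
    qed
  qed
  then show ?thesis
    by (rule vectorspace.intro) (rule class_field)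
qed

lemma C_sum: "(\<And>x. x \<in> F \<Longrightarrow> f x \<in> C) \<Longrightarrow> sum f F \<in> C"
  by (induction F rule: infinite_finite_induct) (auto intro: C_zero C_add)

end

text \<open>Injectivity is kept separate because the passage to cosets of an ideal is treated by the
  weaker locale.\<close>

locale vs_iso = vs_image +
  assumes h_inj: "inj_on h C"
begin

lemma lincomb_image:
  assumes "finite F" "F \<subseteq> C"
  shows "module.lincomb W a (h ` F) = h (\<Sum>x\<in>F. sc (a (h x)) x)"
  using assms
proof (induction F rule: finite_induct)
  case empty
  interpret V: vectorspace class_ring W by (rule vectorspace_W)
  show ?case by (simp add: V.lincomb_def W_zero)
next
  case (insert x F)
  interpret V: vectorspace class_ring W by (rule vectorspace_W)
  have nx: "h x \<notin> h ` F" using insert h_inj by (auto simp: inj_on_def)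
  have "h ` F \<subseteq> carrier W" "h x \<in> carrier W" using insert by (auto simp: W_carrier)
  then have "V.lincomb a (insert (h x) (h ` F)) = a (h x) \<odot>\<^bsub>W\<^esub> h x \<oplus>\<^bsub>W\<^esub> V.lincomb a (h ` F)"
    using insert.hyps(1) nx by (intro V.lincomb_insert2) auto
  also have "\<dots> = h (sc (a (h x)) x) \<oplus>\<^bsub>W\<^esub> h (\<Sum>x\<in>F. sc (a (h x)) x)"
    using insert by (simp add: W_sc)
  also have "\<dots> = h (\<Sum>x\<in>insert x F. sc (a (h x)) x)"
    using insert by (simp add: W_add C_sc C_sum subset_iff)
  finally show ?case by simp
qed

lemma gen_setD:
  assumes gen: "LinearCombinations.module.span class_ring W B = carrier W" and x: "x \<in> C" and B: "B \<subseteq> carrier W"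
  shows "\<exists>F c. finite F \<and> F \<subseteq> {y \<in> C. h y \<in> B} \<and> x = (\<Sum>y\<in>F. sc (c y) y)"
proof -
  interpret V: vectorspace class_ring W by (rule vectorspace_W)
  have "h x \<in> V.span B" using gen x by (simp add: W_carrier)
  then obtain a A where A: "finite A" "A \<subseteq> B" "h x = V.lincomb a A"
    unfolding V.span_def by blast
  define F where "F = {y \<in> C. h y \<in> A}"
  have hF: "h ` F = A" using A B by (auto simp: F_def W_carrier)
  have "inj_on h F" using h_inj by (rule inj_on_subset) (simp add: F_def)
  then have F: "finite F" using A(1) hF finite_image_iff by metis
  have FC: "F \<subseteq> C" by (auto simp: F_def)
  have "h x = h (\<Sum>y\<in>F. sc (a (h y)) y)"
    using A(3) lincomb_image[OF F FC, of a] hF by simp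
  then have "x = (\<Sum>y\<in>F. sc (a (h y)) y)"
    using h_inj x C_sum[of F "\<lambda>y. sc (a (h y)) y"] C_sc FC by (simp add: inj_on_eq_iff subset_iff)
  moreover have "F \<subseteq> {y \<in> C. h y \<in> B}" using A(2) by (auto simp: F_def)
  ultimately show ?thesis using F by (intro exI[of _ F] exI[of _ "\<lambda>y. a (h y)"]) simp
qed

lemma lin_indptD:
  assumes "\<not> LinearCombinations.module.lin_dep class_ring W B" "finite F" "F \<subseteq> {y \<in> C. h y \<in> B}" "(\<Sum>y\<in>F. sc (c y) y) = 0" "y \<in> F"
  shows "c y = 0"
proof (rule ccontr)
  interpret V: vectorspace class_ring W by (rule vectorspace_W)
  assume "c y \<noteq> 0"
  define a where "a = (\<lambda>z. c (inv_into C h z))"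
  have FC: "F \<subseteq> C" using assms by auto
  have a: "a (h x) = c x" if "x \<in> C" for x using inv_into_f_f[OF h_inj that] by (simp add: a_def)
  have "V.lincomb a (h ` F) = h (\<Sum>x\<in>F. sc (a (h x)) x)" by (rule lincomb_image[OF assms(2) FC])
  also have "(\<Sum>x\<in>F. sc (a (h x)) x) = (\<Sum>x\<in>F. sc (c x) x)"
    by (rule sum.cong) (use FC a in auto)
  finally have "V.lincomb a (h ` F) = \<zero>\<^bsub>W\<^esub>" using assms(4) by (simp add: W_zero)
  moreover have "a (h y) \<noteq> 0" using a FC assms(5) \<open>c y \<noteq> 0\<close> by auto
  moreover have "finite (h ` F)" "h ` F \<subseteq> B" "h y \<in> h ` F" using assms by auto
  ultimately have "V.lin_dep B" unfolding V.lin_dep_def by (intro exI[of _ "h ` F"] exI[of _ a] exI[of _ "h y"]) simp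
  then show False using assms(1) by simp
qed

text \<open>\<open>dim\<close> is the least size of a finite generating set, so it is zero exactly
  if the empty set generates; \<open>F\<close> ensures that such a size exists. This serves the
  condition on \<open>num_edges\<close> in \<open>\<theta>\<close>.\<close>

lemma dim_eq_0_iff:
  assumes F: "finite F" "F \<subseteq> C" "\<And>x. x \<in> C \<Longrightarrow> \<exists>c. x = (\<Sum>y\<in>F. sc (c y) y)"
  shows "vectorspace.dim class_ring W = 0 \<longleftrightarrow> C = {0}"
proof -
  interpret V: vectorspace class_ring W by (rule vectorspace_W)
  have span0: "V.span {} = {\<zero>\<^bsub>W\<^esub>}" by (auto simp: V.span_def V.lincomb_def)
  have hF: "h ` F \<subseteq> carrier W" using F by (auto simp: W_carrier)
  have "carrier W \<subseteq> V.span (h ` F)"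
  proof
    fix z assume "z \<in> carrier W"
    then obtain x where x: "x \<in> C" "z = h x" by (auto simp: W_carrier)
    obtain c where c: "x = (\<Sum>y\<in>F. sc (c y) y)" using F(3)[OF x(1)] by blast
    define a where "a = (\<lambda>z. c (inv_into C h z))"
    have "(\<Sum>y\<in>F. sc (a (h y)) y) = x"
      unfolding c by (rule sum.cong) (use F(2) inv_into_f_f[OF h_inj] in \<open>auto simp: a_def\<close>)
    then have "V.lincomb a (h ` F) = z" using lincomb_image[OF F(1,2), of a] x by simp
    then show "z \<in> V.span (h ` F)" unfolding V.span_def using F(1) by (intro CollectI exI[of _ a] exI[of _ "h ` F"]) simp
  qed
  then have gen: "V.span (h ` F) = carrier W"
    using V.span_is_subset2[OF hF] by blast
  have ex: "\<exists>n A. finite A \<and> card A = n \<and> A \<subseteq> carrier W \<and> V.span A = carrier W"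
    using F(1) hF gen by (intro exI[of _ "card (h ` F)"] exI[of _ "h ` F"]) simp
  have "V.dim = 0 \<longleftrightarrow> carrier W = {\<zero>\<^bsub>W\<^esub>}"
  proof
    assume "V.dim = 0"
    then obtain A where "finite A" "card A = 0" "V.span A = carrier W"
      using LeastI_ex[OF ex] unfolding V.dim_def by auto
    then show "carrier W = {\<zero>\<^bsub>W\<^esub>}" using span0 by auto
  next
    assume "carrier W = {\<zero>\<^bsub>W\<^esub>}"
    then have "\<exists>A. finite A \<and> card A = 0 \<and> A \<subseteq> carrier W \<and> V.span A = carrier W"
      using span0 by (intro exI[of _ "{}"]) simp
    then have "V.dim \<le> 0" unfolding V.dim_def by (rule Least_le)
    then show "V.dim = 0" by simp
  qed
  also have "\<dots> \<longleftrightarrow> C = {0}"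
    using h_inj C_zero unfolding W_carrier W_zero by (auto simp: inj_on_def)
  finally show ?thesis .
qed

end

lemma linear_mapI:
  assumes "vectorspace class_ring V" "vectorspace class_ring W" "\<And>x. x \<in> carrier V \<Longrightarrow> f x \<in> carrier W"
    "\<And>x y. x \<in> carrier V \<Longrightarrow> y \<in> carrier V \<Longrightarrow> f (add V x y) = add W (f x) (f y)"
    "\<And>c x. x \<in> carrier V \<Longrightarrow> f (module.smult V c x) = module.smult W (c :: complex) (f x)"
  shows "linear_map class_ring V W f"
proof -
  interpret V: vectorspace class_ring V by (rule assms)
  interpret W: vectorspace class_ring W by (rule assms)
  have "f \<in> LinearCombinations.module_hom class_ring V W"
    unfolding LinearCombinations.module_hom_def using assms(3-5) by simp
  then show ?thesis
    using assms(1,2) assms(1,2)[THEN vectorspace.axioms(1)]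
    by (simp add: linear_map_def mod_hom_def mod_hom_axioms_def)
qed

section \<open>Matrices of tensor products\<close>

lemma sum_double: "(\<Sum>z<n * 2. f z) = (\<Sum>w<n. f (2 * w) + f (Suc (2 * w)))" for f :: "nat \<Rightarrow> 'a :: comm_monoid_add"
  by (induction n) (auto simp: algebra_simps)

lemma div_mod_double [simp]: "(2 * w + b) div 2 = w" "(2 * w + b) mod 2 = b" if "b < 2" for b w :: nat
  using that by auto

lemma double_div_mod:
  "2 * w div 2 = w" "2 * w mod 2 = 0" "Suc (2 * w) div 2 = w" "Suc (2 * w) mod 2 = Suc 0" for w :: nat
  by presburger+

lemma quad_div_mod:
  "4 * w div 4 = w" "4 * w mod 4 = 0" "Suc (4 * w) div 4 = w" "Suc (4 * w) mod 4 = Suc 0"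
  "Suc (Suc (4 * w)) div 4 = w" "Suc (Suc (4 * w)) mod 4 = 2"
  "(4 * w + 3) div 4 = w" "(4 * w + 3) mod 4 = 3" for w :: nat
  by presburger+

text \<open>In the lexicographic basis of the tensor product the rows \<open>2 * x + b\<close>
  belong to the basis vector \<open>b\<close> of \<open>V\<close>, so \<open>tb 0\<close> and
  \<open>tb 1\<close> are the two components in \<open>V\<close>.\<close>

definition tb :: "nat \<Rightarrow> nat \<Rightarrow> nat \<Rightarrow> complex mat \<Rightarrow> fmat" where
  "tb b n m T = mk n m (\<lambda>x y. T $$ (2 * x + b, y))"

lemma fits_tb [simp]: "fits n m (tb b n m T)"
  by (simp add: tb_def)

lemma tb_eqI:
  assumes "S \<in> carrier_mat (n * 2) m" "T \<in> carrier_mat (n * 2) m" "tb 0 n m S = tb 0 n m T" "tb 1 n m S = tb 1 n m T"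
  shows "S = T"
proof (rule eq_matI)
  fix x y assume "x < dim_row T" "y < dim_col T"
  then have xy: "x < n * 2" "y < m" using assms by auto
  have "x mod 2 < 2" by simp
  then consider "x mod 2 = 0" | "x mod 2 = 1" by linarith
  then show "S $$ (x, y) = T $$ (x, y)"
  proof cases
    case 1
    then have "x = 2 * (x div 2) + 0" "x div 2 < n" using xy by auto
    then show ?thesis using arg_cong[OF assms(3), of "\<lambda>A. ent A (x div 2) y"] xy by (simp add: tb_def)
  next
    case 2
    then have "x = 2 * (x div 2) + 1" "x div 2 < n" using xy by (auto, presburger)
    then show ?thesis using arg_cong[OF assms(4), of "\<lambda>A. ent A (x div 2) y"] xy by (simp add: tb_def)
  qed
qed (use assms in auto)

lemma tb_mult:
  assumes "T \<in> carrier_mat (n * 2) m" "R \<in> carrier_mat m m" "b < 2"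
  shows "tb b n m (T * R) = tb b n m T * emb R"
proof (rule fmat_eqI)
  fix x y
  show "ent (tb b n m (T * R)) x y = ent (tb b n m T * emb R) x y"
    using assms by (auto simp: tb_def ent_mult_fits[OF fits_mk] emb_def scalar_prod_def atLeast0LessThan intro!: sum.cong)
qed

lemma tb_kron_mult:
  assumes "T \<in> carrier_mat (n * 2) m" "A \<in> carrier_mat n n" "g \<in> carrier_mat 2 2" "b < 2"
  shows "tb b n m (kron A g * T) = emb A * (g $$ (b, 0) *\<^sub>F tb 0 n m T + g $$ (b, 1) *\<^sub>F tb 1 n m T)"
proof (rule fmat_eqI)
  fix x y
  show "ent (tb b n m (kron A g * T)) x y = ent (emb A * (g $$ (b, 0) *\<^sub>F tb 0 n m T + g $$ (b, 1) *\<^sub>F tb 1 n m T)) x y"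
  proof (cases "x < n \<and> y < m")
    case True
    then have xb: "2 * x + b < n * 2" using assms(4) by auto
    have "(kron A g * T) $$ (2 * x + b, y) = (\<Sum>z<n * 2. A $$ (x, z div 2) * g $$ (b, z mod 2) * T $$ (z, y))"
      using True xb assms by (auto simp: kron_def scalar_prod_def atLeast0LessThan intro!: sum.cong)
    also have "\<dots> = (\<Sum>w<n. A $$ (x, w) * (g $$ (b, 0) * T $$ (2 * w, y) + g $$ (b, 1) * T $$ (2 * w + 1, y)))"
      unfolding sum_double double_div_mod by (intro sum.cong refl) (simp add: algebra_simps)
    finally show ?thesis
      using True assms by (simp add: ent_mult_fits[OF fits_emb[OF assms(2)]]) (simp add: tb_def emb_def)
  next
    case False
    have "fits n m (emb A * (g $$ (b, 0) *\<^sub>F tb 0 n m T + g $$ (b, 1) *\<^sub>F tb 1 n m T))"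
      by (intro fits_mult[OF fits_emb[OF assms(2)]] fits_add fits_fsc fits_tb)
    then show ?thesis using False by (auto simp: tb_def fits_def not_less)
  qed
qed

lemma emb_kron_row_mult:
  assumes "T \<in> carrier_mat (n * 2) m" "\<xi> \<in> carrier_vec 2"
  shows "emb (kron (1\<^sub>m n) (mat_of_rows 2 [\<xi>]) * T) = \<xi> $ 0 *\<^sub>F tb 0 n m T + \<xi> $ 1 *\<^sub>F tb 1 n m T"
proof (rule fmat_eqI)
  fix x y
  have dim: "dim_row (kron (1\<^sub>m n) (mat_of_rows 2 [\<xi>]) * T) = n" "dim_col (kron (1\<^sub>m n) (mat_of_rows 2 [\<xi>]) * T) = m"
    using assms by (auto simp: kron_def)
  show "ent (emb (kron (1\<^sub>m n) (mat_of_rows 2 [\<xi>]) * T)) x y = ent (\<xi> $ 0 *\<^sub>F tb 0 n m T + \<xi> $ 1 *\<^sub>F tb 1 n m T) x y"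
  proof (cases "x < n \<and> y < m")
    case True
    have "(kron (1\<^sub>m n) (mat_of_rows 2 [\<xi>]) * T) $$ (x, y) = (\<Sum>z<n * 2. (if x = z div 2 then 1 else 0) * \<xi> $ (z mod 2) * T $$ (z, y))"
      using True assms by (auto simp: kron_def scalar_prod_def atLeast0LessThan mat_of_rows_def intro!: sum.cong)
    also have "\<dots> = (\<Sum>w<n. if w = x then \<xi> $ 0 * T $$ (2 * x, y) + \<xi> $ 1 * T $$ (2 * x + 1, y) else 0)"
      unfolding sum_double by (intro sum.cong refl) auto
    also have "\<dots> = \<xi> $ 0 * T $$ (2 * x, y) + \<xi> $ 1 * T $$ (2 * x + 1, y)" using True by simp
    finally show ?thesis using True by (simp add: emb_def dim tb_def del: index_mult_mat)
  next
    case False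
    then show ?thesis by (auto simp: emb_def dim tb_def simp del: index_mult_mat)
  qed
qed

text \<open>The first factor of \<open>V \<otimes> V\<close> comes from \<open>\<psi>\<close> and
  the second from \<open>\<phi>\<close>, so the entry \<open>2 * a + b\<close> of \<open>ev\<close>
  meets block \<open>a\<close> of \<open>\<psi>\<close> and block \<open>b\<close> of
  \<open>\<phi>\<close>.\<close>

lemma emb_pairing:
  assumes \<phi>: "\<phi> \<in> carrier_mat (m * 2) n" and \<psi>: "\<psi> \<in> carrier_mat (n * 2) m" and ev: "ev \<in> carrier_mat 1 4"
  shows "emb (kron (1\<^sub>m n) ev * kron \<psi> (1\<^sub>m 2) * \<phi>) =
    ev $$ (0, 0) *\<^sub>F (tb 0 n m \<psi> * tb 0 m n \<phi>) + ev $$ (0, 1) *\<^sub>F (tb 0 n m \<psi> * tb 1 m n \<phi>)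
    + ev $$ (0, 2) *\<^sub>F (tb 1 n m \<psi> * tb 0 m n \<phi>) + ev $$ (0, 3) *\<^sub>F (tb 1 n m \<psi> * tb 1 m n \<phi>)" (is "_ = ?r")
proof -
  define K where "K = kron \<psi> (1\<^sub>m 2) * \<phi>"
  have c1: "kron (1\<^sub>m n) ev \<in> carrier_mat n (n * 4)" and c2: "kron \<psi> (1\<^sub>m 2) \<in> carrier_mat (n * 4) (m * 2)"
    using assms by (auto simp: kron_def)
  have K: "K \<in> carrier_mat (n * 4) n" unfolding K_def using c2 \<phi> by simp
  have K_ent: "K $$ (z, y) = (\<Sum>w<m. \<psi> $$ (z div 2, w) * \<phi> $$ (2 * w + z mod 2, y))" if "z < n * 4" "y < n" for z y
  proof -
    have "K $$ (z, y) = (\<Sum>w<m * 2. \<psi> $$ (z div 2, w div 2) * (if z mod 2 = w mod 2 then 1 else 0) * \<phi> $$ (w, y))"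
      unfolding K_def using that assms by (auto simp: kron_def scalar_prod_def atLeast0LessThan intro!: sum.cong)
    also have "\<dots> = (\<Sum>w<m. \<psi> $$ (z div 2, w) * \<phi> $$ (2 * w + z mod 2, y))"
      unfolding sum_double by (intro sum.cong refl, cases "z mod 2 = 0") auto
    finally show ?thesis .
  qed
  have quad: "(\<Sum>z<n * 4. f z) = (\<Sum>w<n. f (4 * w) + f (4 * w + 1) + f (4 * w + 2) + f (4 * w + 3))" for f :: "nat \<Rightarrow> complex"
    by (induction n) (auto simp: algebra_simps eval_nat_numeral)
  have assoc: "kron (1\<^sub>m n) ev * kron \<psi> (1\<^sub>m 2) * \<phi> = kron (1\<^sub>m n) ev * K"
    unfolding K_def by (rule assoc_mult_mat[OF c1 c2 \<phi>])
  show ?thesis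
    unfolding assoc
  proof (rule fmat_eqI)
    fix x y
    show "ent (emb (kron (1\<^sub>m n) ev * K)) x y = ent ?r x y"
    proof (cases "x < n \<and> y < n")
      case True
      have "(kron (1\<^sub>m n) ev * K) $$ (x, y) = (\<Sum>z<n * 4. (if x = z div 4 then 1 else 0) * ev $$ (0, z mod 4) * K $$ (z, y))"
        using True ev K by (auto simp: kron_def scalar_prod_def atLeast0LessThan intro!: sum.cong)
      also have "\<dots> = (\<Sum>w<n. if w = x then ev $$ (0, 0) * K $$ (4 * x, y) + ev $$ (0, 1) * K $$ (4 * x + 1, y)
          + ev $$ (0, 2) * K $$ (4 * x + 2, y) + ev $$ (0, 3) * K $$ (4 * x + 3, y) else 0)"
        unfolding quad by (intro sum.cong refl) (auto simp: quad_div_mod)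
      also have "\<dots> = ev $$ (0, 0) * K $$ (4 * x, y) + ev $$ (0, 1) * K $$ (4 * x + 1, y)
          + ev $$ (0, 2) * K $$ (4 * x + 2, y) + ev $$ (0, 3) * K $$ (4 * x + 3, y)"
        using True by simp
      finally have 1: "(kron (1\<^sub>m n) ev * K) $$ (x, y) = \<dots>" .
      have d: "4 * x div 2 = 2 * x" "(4 * x + 1) div 2 = 2 * x" "(4 * x + 2) div 2 = 2 * x + 1" "(4 * x + 3) div 2 = 2 * x + 1"
        "4 * x mod 2 = 0" "(4 * x + 1) mod 2 = 1" "(4 * x + 2) mod 2 = 0" "(4 * x + 3) mod 2 = 1"
        by presburger+
      have lt: "4 * x < n * 4" "4 * x + 1 < n * 4" "4 * x + 2 < n * 4" "4 * x + 3 < n * 4" using True by auto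
      have y: "y < n" using True by simp
      have "ent (emb (kron (1\<^sub>m n) ev * K)) x y = (kron (1\<^sub>m n) ev * K) $$ (x, y)"
        using True c1 K by (simp add: emb_def del: index_mult_mat(1))
      also have "\<dots> = ent ?r x y"
        unfolding 1 K_ent[OF lt(1) y] K_ent[OF lt(2) y] K_ent[OF lt(3) y] K_ent[OF lt(4) y] d
        using True by (simp add: ent_mult_fits[OF fits_tb]) (simp add: tb_def)
      finally show ?thesis .
    next
      case False
      have "fits n n ?r" by (intro fits_add fits_fsc fits_mult[of n m _ n] fits_tb)
      moreover have "fits n n (emb (kron (1\<^sub>m n) ev * K))" using c1 K by (intro fits_emb mult_carrier_mat)
      ultimately show ?thesis using False unfolding fits_def by (auto simp: not_less)
    qed
  qed
qed

section \<open>Morphisms of the quiver as linear equivariant matrices\<close>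

definition psc :: "complex \<Rightarrow> (complex vec \<Rightarrow> fmat) \<Rightarrow> complex vec \<Rightarrow> fmat" where
  "psc c M = (\<lambda>\<xi>. c *\<^sub>F M \<xi>)"

lemma psc_apply [simp]: "psc c M \<xi> = c *\<^sub>F M \<xi>"
  by (simp add: psc_def)

interpretation psc: vector_space psc
  by unfold_locales (simp_all add: fun_eq_iff fsc.scale_right_distrib fsc.scale_left_distrib)

context mckay
begin

definition mr :: "'i \<times> int \<Rightarrow> 'i \<times> int \<Rightarrow> (complex vec \<Rightarrow> fmat) \<Rightarrow> sheaf_mor" where
  "mr q q' M = mor (snd q) (dg (fst q)) (dg (fst q')) M"

abbreviation hq :: "'i \<times> int \<Rightarrow> 'i \<times> int \<Rightarrow> (complex vec \<Rightarrow> fmat) set" where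
  "hq q q' \<equiv> hm (fst q) (fst q') (snd q' - snd q)"

lemma hm_psc: "M \<in> hm i j N \<Longrightarrow> psc c M \<in> hm i j N"
  unfolding psc_def by (rule hm_fsc)

lemma HomC_iso:
  assumes "fst q \<in> I" "fst q' \<in> I"
  shows "vs_iso psc (hq q q') (mr q q') (HomC q q')"
proof -
  note r = rep_carrier[OF rep_\<rho>[OF assms(1)]] rep_carrier[OF rep_\<rho>[OF assms(2)]]
  have G: "\<And>g. g \<in> G \<Longrightarrow> g \<in> carrier_mat 2 2 \<and> det g = 1" using G_mat by blast
  show ?thesis
  proof
    show "carrier (HomC q q') = mr q q' ` hq q q'"
    proof
      show "mr q q' ` hq q q' \<subseteq> carrier (HomC q q')"
        using mor_equivariant[OF G r] by (auto simp: HomC_def Hom_eq_def mr_def hm_def)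
      show "carrier (HomC q q') \<subseteq> mr q q' ` hq q q'"
        using mor_surj[OF G r] by (fastforce simp: HomC_def Hom_eq_def mr_def hm_def)
    qed
    show "inj_on (mr q q') (hq q q')"
    proof (rule inj_onI)
      fix M M' assume M: "M \<in> hq q q'" "M' \<in> hq q q'" and eq: "mr q q' M = mr q q' M'"
      show "M = M'"
        by (rule mor_inject[OF hm_off[OF M(1)] hm_fits[OF M(1)] hm_off[OF M(2)] hm_fits[OF M(2)] eq[unfolded mr_def]])
    qed
    show "psc c a \<in> hq q q'" if "a \<in> hq q q'" for c a using that by (rule hm_psc)
  qed (auto simp: hm_add HomC_def Hom_eq_def mr_def mor_add mor_zero psc_def mor_smult)
qed

lemma hm_1_pencil':
  assumes M: "M \<in> hm i k 1" and g: "g \<in> G"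
  shows "emb (\<rho> k g) * (g $$ (0,0) *\<^sub>F b0 M + g $$ (0,1) *\<^sub>F b1 M) = b0 M * emb (\<rho> i g)"
    "emb (\<rho> k g) * (g $$ (1,0) *\<^sub>F b0 M + g $$ (1,1) *\<^sub>F b1 M) = b1 M * emb (\<rho> i g)"
proof -
  have PM: "M \<in> PM 1 (dg i) (dg k)" by (rule hm_PM[OF M])
  have "transpose_mat g *\<^sub>v v2 1 0 = v2 (g $$ (0,0)) (g $$ (0,1))" "transpose_mat g *\<^sub>v v2 0 1 = v2 (g $$ (1,0)) (g $$ (1,1))"
    using G_mat(1)[OF g] by (simp_all add: transpose_mult_vec2)
  then show "emb (\<rho> k g) * (g $$ (0,0) *\<^sub>F b0 M + g $$ (0,1) *\<^sub>F b1 M) = b0 M * emb (\<rho> i g)"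
    "emb (\<rho> k g) * (g $$ (1,0) *\<^sub>F b0 M + g $$ (1,1) *\<^sub>F b1 M) = b1 M * emb (\<rho> i g)"
    using hm_eqv[OF M g, of "v2 1 0"] hm_eqv[OF M g, of "v2 0 1"]
      PM_1[OF PM g_PV[OF g, of "v2 1 0"]] PM_1[OF PM g_PV[OF g, of "v2 0 1"]] by simp_all
qed

text \<open>Inverse to \<open>TV\<close>: the two components in \<open>V\<close> of an intertwiner
  are the two coefficients of a linear matrix.\<close>

definition pent :: "'i \<Rightarrow> 'i \<Rightarrow> complex mat \<Rightarrow> complex vec \<Rightarrow> fmat" where
  "pent i k T = lin (tb 0 (dg k) (dg i) T) (tb 1 (dg k) (dg i) T)"

definition TV :: "'i \<Rightarrow> 'i \<Rightarrow> (complex vec \<Rightarrow> fmat) \<Rightarrow> complex mat" where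
  "TV i k M = mat (dg k * 2) (dg i) (\<lambda>(x, y). ent (if x mod 2 = 0 then b0 M else b1 M) (x div 2) y)"

lemma TV_mat [simp]: "TV i k M \<in> carrier_mat (dg k * 2) (dg i)"
  by (simp add: TV_def)

lemma HomV_iff: "T \<in> carrier (HomV i k) \<longleftrightarrow>
    T \<in> carrier_mat (dg k * 2) (dg i) \<and> (\<forall>g\<in>G. T * \<rho> i g = kron (\<rho> k g) g * T)"
  by (simp add: HomV_def Hom_G_def)

lemma pent_hm:
  assumes i: "i \<in> I" and k: "k \<in> I" and T: "T \<in> carrier (HomV i k)"
  shows "pent i k T \<in> hm i k 1"
  unfolding pent_def
proof (rule lin_hm)
  have T': "T \<in> carrier_mat (dg k * 2) (dg i)" using T by (simp add: HomV_iff)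
  fix g assume g: "g \<in> G"
  have "tb b (dg k) (dg i) (T * \<rho> i g) = tb b (dg k) (dg i) (kron (\<rho> k g) g * T)" for b
    using T g by (simp add: HomV_iff)
  from this[of 0] this[of 1]
  show "emb (\<rho> k g) * (g $$ (0,0) *\<^sub>F tb 0 (dg k) (dg i) T + g $$ (0,1) *\<^sub>F tb 1 (dg k) (dg i) T) = tb 0 (dg k) (dg i) T * emb (\<rho> i g)"
    "emb (\<rho> k g) * (g $$ (1,0) *\<^sub>F tb 0 (dg k) (dg i) T + g $$ (1,1) *\<^sub>F tb 1 (dg k) (dg i) T) = tb 1 (dg k) (dg i) T * emb (\<rho> i g)"
    using tb_mult[OF T' rep_carrier[OF rep_\<rho>[OF i] g]] tb_kron_mult[OF T' rep_carrier[OF rep_\<rho>[OF k] g] G_mat(1)[OF g]]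
    by simp_all
qed simp_all

lemma tb_TV:
  assumes M: "M \<in> hm i k 1"
  shows "tb 0 (dg k) (dg i) (TV i k M) = b0 M" "tb 1 (dg k) (dg i) (TV i k M) = b1 M"
proof -
  have "ent (b0 M) x y = 0" "ent (b1 M) x y = 0" if "\<not> (x < dg k \<and> y < dg i)" for x y
    using that hm_fits[OF M, of "v2 1 0"] hm_fits[OF M, of "v2 0 1"] unfolding fits_def by (meson not_less)+
  then show "tb 0 (dg k) (dg i) (TV i k M) = b0 M" "tb 1 (dg k) (dg i) (TV i k M) = b1 M"
    by (intro fmat_eqI; auto simp: tb_def TV_def double_div_mod)+
qed

lemma pent_TV: "M \<in> hm i k 1 \<Longrightarrow> pent i k (TV i k M) = M"
  using PM_1_eq_lin[OF hm_PM, of M i k] by (simp add: pent_def tb_TV tb_TV(2)[unfolded One_nat_def])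

lemma TV_HomV:
  assumes i: "i \<in> I" and k: "k \<in> I" and M: "M \<in> hm i k 1"
  shows "TV i k M \<in> carrier (HomV i k)"
  unfolding HomV_iff
proof (intro conjI ballI)
  fix g assume g: "g \<in> G"
  note r = rep_carrier[OF rep_\<rho>[OF i] g] rep_carrier[OF rep_\<rho>[OF k] g]
  have c: "kron (\<rho> k g) g \<in> carrier_mat (dg k * 2) (dg k * 2)" using r G_mat(1)[OF g] by (auto simp: kron_def)
  show "TV i k M * \<rho> i g = kron (\<rho> k g) g * TV i k M"
  proof (rule tb_eqI)
    show "TV i k M * \<rho> i g \<in> carrier_mat (dg k * 2) (dg i)" by (rule mult_carrier_mat[OF TV_mat r(1)])
    show "kron (\<rho> k g) g * TV i k M \<in> carrier_mat (dg k * 2) (dg i)" by (rule mult_carrier_mat[OF c TV_mat])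
    show "tb 0 (dg k) (dg i) (TV i k M * \<rho> i g) = tb 0 (dg k) (dg i) (kron (\<rho> k g) g * TV i k M)"
      "tb 1 (dg k) (dg i) (TV i k M * \<rho> i g) = tb 1 (dg k) (dg i) (kron (\<rho> k g) g * TV i k M)"
      using hm_1_pencil'[OF M g] by (simp_all add: tb_mult[OF TV_mat r(1)] tb_kron_mult[OF TV_mat r(2) G_mat(1)[OF g]] tb_TV[OF M] tb_TV(2)[OF M, unfolded One_nat_def])
  qed
qed simp

lemma TV_pent: "T \<in> carrier (HomV i k) \<Longrightarrow> TV i k (pent i k T) = T"
proof (rule tb_eqI)
  assume T: "T \<in> carrier (HomV i k)"
  then show "T \<in> carrier_mat (dg k * 2) (dg i)" by (simp add: HomV_iff)
  show "tb 0 (dg k) (dg i) (TV i k (pent i k T)) = tb 0 (dg k) (dg i) T"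
    "tb 1 (dg k) (dg i) (TV i k (pent i k T)) = tb 1 (dg k) (dg i) T"
    by (rule fmat_eqI; auto simp: TV_def pent_def tb_def double_div_mod)+
qed simp

lemma HomV_iso:
  assumes i: "i \<in> I" and k: "k \<in> I"
  shows "vs_iso psc (hm i k 1) (TV i k) (HomV i k)"
proof
  show "carrier (HomV i k) = TV i k ` hm i k 1"
  proof
    show "TV i k ` hm i k 1 \<subseteq> carrier (HomV i k)" using TV_HomV[OF assms] by blast
    show "carrier (HomV i k) \<subseteq> TV i k ` hm i k 1"
    proof
      fix T assume T: "T \<in> carrier (HomV i k)"
      show "T \<in> TV i k ` hm i k 1"
        by (rule image_eqI[of _ _ "pent i k T"]) (simp_all add: TV_pent[OF T] pent_hm[OF assms T])
    qed
  qed
  show "inj_on (TV i k) (hm i k 1)"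
    by (rule inj_on_inverseI[where g = "pent i k"]) (rule pent_TV)
qed (auto simp: hm_add hm_psc HomV_def Hom_G_def module_mat_simps TV_def intro!: eq_matI)

lemma num_edges_eq_0_iff:
  assumes "i \<in> I" "k \<in> I" "finite F" "F \<subseteq> hm i k 1" "\<And>M. M \<in> hm i k 1 \<Longrightarrow> \<exists>c. M = (\<Sum>P\<in>F. psc (c P) P)"
  shows "num_edges i k = 0 \<longleftrightarrow> hm i k 1 = {0}"
  unfolding num_edges_def by (rule vs_iso.dim_eq_0_iff[OF HomV_iso[OF assms(1,2)] assms(3-5)])

lemma induced_mor_eq:
  assumes T: "T \<in> carrier (HomV (fst q) (fst q'))"
  shows "induced_mor q q' T = mr q q' (pent (fst q) (fst q') T)"
proof (intro ext)
  fix U s \<xi>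
  have T': "T \<in> carrier_mat (dg (fst q') * 2) (dg (fst q))" using T by (simp add: HomV_iff)
  show "induced_mor q q' T U s \<xi> = mr q q' (pent (fst q) (fst q') T) U s \<xi>"
  proof (cases "zariski_open U \<and> s \<in> sections (snd q) (dg (fst q)) U \<and> \<xi> \<in> U")
    case True
    then have \<xi>: "\<xi> \<in> PV" "\<xi> \<in> carrier_vec 2" using zariski_open_subset PV_carrier by blast+
    have c: "kron (1\<^sub>m (dg (fst q'))) (mat_of_rows 2 [\<xi>]) * T \<in> carrier_mat (dg (fst q')) (dg (fst q))"
      using T' by (auto simp: kron_def)
    have "kron (1\<^sub>m (dg (fst q'))) (mat_of_rows 2 [\<xi>]) * T = unemb (dg (fst q')) (dg (fst q)) (pent (fst q) (fst q') T \<xi>)"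
      using unemb_emb[OF c] \<xi> by (simp add: emb_kron_row_mult[OF T' \<xi>(2)] pent_def lin_def)
    then show ?thesis using True by (simp add: induced_mor_def mr_def mor_def)
  qed (auto simp: induced_mor_def mr_def mor_def)
qed

text \<open>\<open>pairingC\<close> reaches its arguments through \<open>the_inv_into\<close>; this
  makes the inverse explicit on the matrices of morphisms.\<close>

lemma the_inv_induced_mor:
  assumes "fst q \<in> I" "fst q' \<in> I" "snd q' = snd q + 1" and M: "M \<in> hm (fst q) (fst q') 1"
  shows "the_inv_into (carrier (HomV (fst q) (fst q'))) (induced_mor q q') (mr q q' M) = TV (fst q) (fst q') M"
proof (rule the_inv_into_f_eq)
  interpret C: vs_iso psc "hq q q'" "mr q q'" "HomC q q'" by (rule HomC_iso[OF assms(1,2)])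
  show "inj_on (induced_mor q q') (carrier (HomV (fst q) (fst q')))"
  proof (rule inj_onI)
    fix S T assume ST: "S \<in> carrier (HomV (fst q) (fst q'))" "T \<in> carrier (HomV (fst q) (fst q'))"
      and eq: "induced_mor q q' S = induced_mor q q' T"
    have eq': "mr q q' (pent (fst q) (fst q') S) = mr q q' (pent (fst q) (fst q') T)"
      using eq unfolding induced_mor_eq[OF ST(1)] induced_mor_eq[OF ST(2)] .
    have d: "snd q' - snd q = 1" using assms(3) by simp
    have "pent (fst q) (fst q') S = pent (fst q) (fst q') T"
    proof (rule inj_onD[OF C.h_inj, OF eq'])
      show "pent (fst q) (fst q') S \<in> hq q q'" unfolding d by (rule pent_hm[OF assms(1,2) ST(1)])
      show "pent (fst q) (fst q') T \<in> hq q q'" unfolding d by (rule pent_hm[OF assms(1,2) ST(2)])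
    qed
    from arg_cong[OF this, of "TV (fst q) (fst q')"] show "S = T" unfolding TV_pent[OF ST(1)] TV_pent[OF ST(2)] .
  qed
  show "induced_mor q q' (TV (fst q) (fst q') M) = mr q q' M"
    unfolding induced_mor_eq[OF TV_HomV[OF assms(1,2) M]] pent_TV[OF M] ..
  show "TV (fst q) (fst q') M \<in> carrier (HomV (fst q) (fst q'))" by (rule TV_HomV[OF assms(1,2) M])
qed

text \<open>\<open>- 1\<close> is central, so Schur's lemma makes it act by a scalar, whose square
  is one. As \<open>dg i\<close> is nonzero the two signs act differently, which makes the definite
  description in \<open>parity\<close> meaningful.\<close>

lemma parity_spec:
  assumes i: "i \<in> I"
  shows "parity i < 2 \<and> \<rho> i (- 1\<^sub>m 2) = (- 1) ^ parity i \<cdot>\<^sub>m 1\<^sub>m (dg i)"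
proof -
  define m where "m = (- 1\<^sub>m 2 :: complex mat)"
  have m: "m \<in> G" using minus_one by (simp add: m_def)
  have mc: "m \<in> carrier_mat 2 2" by (simp add: m_def)
  have mg: "m * g = g * m" if "g \<in> G" for g
    using G_mat(1)[OF that] by (simp add: m_def)
  have mm: "m * m = 1\<^sub>m 2" by (simp add: m_def)
  have R: "emb (\<rho> i m) \<in> ihom (dg i) (\<rho> i) (dg i) (\<rho> i)"
    using rep_fits[OF rep_\<rho>[OF i] m] by (simp add: ihom_def rep_mult[OF rep_\<rho>[OF i], symmetric] m mg)
  obtain c where c: "emb (\<rho> i m) = c *\<^sub>F fid (dg i)" using schur_scalar[OF irreps[OF i] R] by blast
  have "emb (\<rho> i m) * emb (\<rho> i m) = fid (dg i)"
    using rep_mult[OF rep_\<rho>[OF i] m m] rep_\<rho>[OF i] by (simp add: mm is_rep_iff)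
  then have "(c * c) *\<^sub>F fid (dg i) = fid (dg i)" by (simp add: c fid_mult[OF fits_fid])
  from arg_cong[OF this, of "\<lambda>A. ent A 0 0"] have "c * c = 1" using dg_pos[OF i] by simp
  then have c1: "c = 1 \<or> c = - 1" by (metis mult_1 square_eq_iff)
  have \<rho>m: "\<rho> i m = c \<cdot>\<^sub>m 1\<^sub>m (dg i)"
    by (rule emb_inject[THEN iffD1, of _ "dg i" "dg i"]) (use rep_carrier[OF rep_\<rho>[OF i] m] in \<open>auto simp: c emb_smult\<close>)
  have "\<exists>!p. p < 2 \<and> \<rho> i m = (- 1) ^ p \<cdot>\<^sub>m 1\<^sub>m (dg i)"
  proof (rule ex_ex1I)
    show "\<exists>p. p < 2 \<and> \<rho> i m = (- 1) ^ p \<cdot>\<^sub>m 1\<^sub>m (dg i)"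
      using c1
    proof
      assume "c = 1" then show ?thesis using \<rho>m by (intro exI[of _ "0::nat"]) simp
    next
      assume "c = - 1" then show ?thesis using \<rho>m by (intro exI[of _ "1::nat"]) simp
    qed
    fix p p' :: nat
    assume p: "p < 2 \<and> \<rho> i m = (- 1) ^ p \<cdot>\<^sub>m 1\<^sub>m (dg i)" and p': "p' < 2 \<and> \<rho> i m = (- 1) ^ p' \<cdot>\<^sub>m 1\<^sub>m (dg i)"
    have "(- 1) ^ p \<cdot>\<^sub>m 1\<^sub>m (dg i) = ((- 1) ^ p' \<cdot>\<^sub>m 1\<^sub>m (dg i) :: complex mat)"
      using p p' by (elim conjE) (rule trans[OF sym])
    from arg_cong[OF this, of "\<lambda>A. A $$ (0, 0)"] have "(- 1 :: complex) ^ p = (- 1) ^ p'" using dg_pos[OF i] by simp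
    then show "p = p'" using p p' by (auto simp: less_2_cases_iff)
  qed
  from theI'[OF this] show ?thesis unfolding parity_def m_def by blast
qed

text \<open>\<open>- 1\<close> changes the sign of linear forms, so a nonzero linear matrix joins
  representations of opposite parity. Hence confining arrows to the vertices of the quiver loses no
  pencil.\<close>

lemma hm_1_parity:
  assumes i: "i \<in> I" and k: "k \<in> I" and M: "M \<in> hm i k 1" and nz: "M \<noteq> 0" and n: "n mod 2 = int (parity i)"
  shows "(n + 1) mod 2 = int (parity k)"
proof -
  have m: "- 1\<^sub>m 2 \<in> G" by (rule minus_one)
  have r: "emb (\<rho> j (- 1\<^sub>m 2)) = (- 1) ^ parity j *\<^sub>F fid (dg j)" if "j \<in> I" for j
    using parity_spec[OF that] by (simp add: emb_smult)
  note p = hm_1_pencil'[OF M m, unfolded r[OF i] r[OF k]]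
  have e: "(- 1\<^sub>m 2 :: complex mat) $$ (0,0) = - 1" "(- 1\<^sub>m 2 :: complex mat) $$ (0,1) = 0"
    "(- 1\<^sub>m 2 :: complex mat) $$ (1,0) = 0" "(- 1\<^sub>m 2 :: complex mat) $$ (1,1) = - 1"
    by simp_all
  have fM: "fid (dg k) * M v = M v" "M v * fid (dg i) = M v" for v
    using fid_mult[OF hm_fits[OF M]] mult_fid[OF hm_fits[OF M]] by auto
  have 0: "(- ((- 1) ^ parity k) - (- 1) ^ parity i) *\<^sub>F b0 M = 0"
    using p(1) unfolding e by (simp add: fM fsc.scale_left_diff_distrib algebra_simps)
  have 1: "(- ((- 1) ^ parity k) - (- 1) ^ parity i) *\<^sub>F b1 M = 0"
    using p(2) unfolding e by (simp add: fM fsc.scale_left_diff_distrib algebra_simps)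
  have "\<not> (b0 M = 0 \<and> b1 M = 0)"
  proof
    assume "b0 M = 0 \<and> b1 M = 0"
    then have "M = lin 0 0" using PM_1_eq_lin[OF hm_PM[OF M]] by simp
    then show False using nz by (auto simp: lin_def fun_eq_iff fsc.scale_zero_right split: if_splits)
  qed
  then have "- ((- 1) ^ parity k) - (- 1) ^ parity i = (0 :: complex)"
    using 0 1 by auto
  then have "parity k \<noteq> parity i" by auto
  moreover have "parity i < 2" "parity k < 2" using parity_spec[OF i] parity_spec[OF k] by simp_all
  ultimately show ?thesis using n by presburger
qed

end

section \<open>The invariant form on \<open>V\<close> in coordinates\<close>

lemma SU2_I:
  assumes A: "A \<in> carrier_mat 2 2" and "det A = 1"
    and adj: "A * mat 2 2 (\<lambda>(i, j). cnj (A $$ (j, i))) = 1\<^sub>m 2"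
  shows "A \<in> SU2"
proof -
  have "mat_adjoint A = mat 2 2 (\<lambda>(i, j). cnj (A $$ (j, i)))"
    using A by (intro eq_matI) (auto simp: mat_adjoint_def mat_of_rows_def)
  then show ?thesis using assms by (simp add: SU2_def)
qed

context mckay_quiver
begin

definition lam :: complex where
  "lam = ev $$ (0, 1)"

text \<open>Two elements of \<open>SU2\<close> suffice: the diagonal matrix with entries
  \<open>\<i>\<close> and \<open>- \<i>\<close> kills the first and the last entry, and the quarter
  turn makes the middle ones opposite. So \<open>ev\<close> is the nonzero multiple
  \<open>lam\<close> of the alternating form.\<close>

lemma ev_entries: "ev $$ (0, 0) = 0" "ev $$ (0, 2) = - lam" "ev $$ (0, 3) = 0" "lam \<noteq> 0"
proof -
  have inv: "(\<Sum>z<4. ev $$ (0, z) * (g $$ (z div 2, j div 2) * g $$ (z mod 2, j mod 2))) = ev $$ (0, j)"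
    if "g \<in> SU2" "j < 4" for g j
  proof -
    have g: "g \<in> carrier_mat 2 2" using that by (simp add: SU2_def)
    have "(ev * kron g g) $$ (0, j) = (\<Sum>z<4. ev $$ (0, z) * (g $$ (z div 2, j div 2) * g $$ (z mod 2, j mod 2)))"
      using g that(2) ev_carrier by (auto simp: kron_def scalar_prod_def atLeast0LessThan intro!: sum.cong)
    moreover have "(ev * kron g g) $$ (0, j) = ev $$ (0, j)" using ev_invariant[OF that(1)] by simp
    ultimately show ?thesis by simp
  qed
  define g1 where "g1 = mat 2 2 (\<lambda>(i, j). if i = j then (if i = 0 then \<i> else - \<i>) else 0)"
  define g2 where "g2 = mat 2 2 (\<lambda>(i, j). if i = j then 0 else if i = 0 then 1 else - 1 :: complex)"
  have g1: "g1 \<in> SU2"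
  proof (rule SU2_I)
    show c: "g1 \<in> carrier_mat 2 2" by (simp add: g1_def)
    show "det g1 = 1" by (simp add: det_mat_2[OF c]) (simp add: g1_def)
    show "g1 * mat 2 2 (\<lambda>(i, j). cnj (g1 $$ (j, i))) = 1\<^sub>m 2"
      by (rule eq_matI) (auto simp: g1_def scalar_prod_def numeral_2_eq_2 less_Suc_eq)
  qed
  have g2: "g2 \<in> SU2"
  proof (rule SU2_I)
    show c: "g2 \<in> carrier_mat 2 2" by (simp add: g2_def)
    show "det g2 = 1" by (simp add: det_mat_2[OF c]) (simp add: g2_def)
    show "g2 * mat 2 2 (\<lambda>(i, j). cnj (g2 $$ (j, i))) = 1\<^sub>m 2"
      by (rule eq_matI) (auto simp: g2_def scalar_prod_def numeral_2_eq_2 less_Suc_eq)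
  qed
  have four: "{..<4} = {0, 1, 2, 3 :: nat}" by auto
  have dm: "(2::nat) div 2 = 1" "(3::nat) div 2 = 1" "(3::nat) mod 2 = 1" "(2::nat) mod 2 = 0" by simp_all
  have "ev $$ (0, 0) * (\<i> * \<i>) = ev $$ (0, 0)"
    using inv[OF g1, of 0] by (simp add: four dm) (simp add: g1_def)
  then show 0: "ev $$ (0, 0) = 0" by simp
  have "ev $$ (0, 3) * (\<i> * \<i>) = ev $$ (0, 3)"
    using inv[OF g1, of 3] by (simp add: four dm) (simp add: g1_def)
  then show 3: "ev $$ (0, 3) = 0" by simp
  have "- ev $$ (0, 2) = ev $$ (0, 1)"
    using inv[OF g2, of 1] by (simp add: four dm) (simp add: g2_def)
  then show 2: "ev $$ (0, 2) = - lam" by (simp add: lam_def) (metis minus_minus)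
  show "lam \<noteq> 0"
  proof
    assume l: "lam = 0"
    have "ev = 0\<^sub>m 1 4"
    proof (rule eq_matI)
      fix i j assume "i < dim_row (0\<^sub>m 1 4 :: complex mat)" "j < dim_col (0\<^sub>m 1 4 :: complex mat)"
      then have "i = 0" "j = 0 \<or> j = 1 \<or> j = 2 \<or> j = 3" "j < 4" by auto
      then show "ev $$ (i, j) = 0\<^sub>m 1 4 $$ (i, j)" using 0 2 3 l lam_def by auto
    qed (use ev_carrier in auto)
    then show False using ev_nonzero by simp
  qed
qed

text \<open>For the alternating \<open>ev\<close>, the tensor composition in \<open>pairing\<close>
  is the contraction \<open>br\<close> up to the factor \<open>- lam\<close>.\<close>

lemma pairing_TV:
  assumes i: "i \<in> I" and M: "M \<in> hm i k 1" and M': "M' \<in> hm k i 1" and x: "br M' M = x *\<^sub>F fid (dg i)"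
  shows "pairing i (TV i k M) (TV k i M') = - lam * x"
proof -
  have c: "kron (1\<^sub>m (dg i)) ev * kron (TV k i M') (1\<^sub>m 2) * TV i k M \<in> carrier_mat (dg i) (dg i)"
    using ev_carrier by (auto simp: kron_def TV_def)
  have "emb (kron (1\<^sub>m (dg i)) ev * kron (TV k i M') (1\<^sub>m 2) * TV i k M) =
      lam *\<^sub>F (b0 M' * b1 M) - lam *\<^sub>F (b1 M' * b0 M)"
    unfolding emb_pairing[OF TV_mat TV_mat ev_carrier] tb_TV[OF M] tb_TV[OF M'] by (simp add: ev_entries lam_def[symmetric] lam_def[unfolded One_nat_def, symmetric])
  also have "\<dots> = (- lam) *\<^sub>F br M' M"
    by (rule fmat_eqI) (simp add: br_def algebra_simps)
  also have "\<dots> = emb ((- lam * x) \<cdot>\<^sub>m 1\<^sub>m (dg i))" by (simp add: x emb_smult)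
  finally have eq: "kron (1\<^sub>m (dg i)) ev * kron (TV k i M') (1\<^sub>m 2) * TV i k M = (- lam * x) \<cdot>\<^sub>m 1\<^sub>m (dg i)"
    using emb_inject[OF c, of "(- lam * x) \<cdot>\<^sub>m 1\<^sub>m (dg i)"] by simp
  show ?thesis
    unfolding pairing_def eq
  proof (rule the_equality)
    fix y assume "(- lam * x) \<cdot>\<^sub>m 1\<^sub>m (dg i) = y \<cdot>\<^sub>m (1\<^sub>m (dg i) :: complex mat)"
    from arg_cong[OF this, of "\<lambda>A. A $$ (0, 0)"] show "y = - lam * x" using dg_pos[OF i] by simp
  qed (rule refl)
qed

section \<open>Arrows out of a vertex as pencils, and the dual basis\<close>

definition nxt :: "'i \<times> int \<Rightarrow> 'i \<Rightarrow> 'i \<times> int" where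
  "nxt q k = (k, snd q + 1)"

lemma nxt_simps [simp]: "fst (nxt q k) = k" "snd (nxt q k) = snd q + 1"
  by (simp_all add: nxt_def)

lemma shift2_simps [simp]: "fst (shift2 q) = fst q" "snd (shift2 q) = snd q + 2"
  by (simp_all add: shift2_def)

lemma vert_I: "q \<in> Qhat_verts \<Longrightarrow> fst q \<in> I"
  by (auto simp: Qhat_verts_def)

lemma shift2_vert: "q \<in> Qhat_verts \<Longrightarrow> shift2 q \<in> Qhat_verts"
  by (auto simp: Qhat_verts_def shift2_def)

text \<open>The pencils of the given basis of arrows. If \<open>nxt q k\<close> is not a vertex,
  nothing is assumed about \<open>E\<close>, and the empty set is the right value because parity
  excludes nonzero pencils.\<close>

definition Bp :: "'i \<times> int \<Rightarrow> 'i \<Rightarrow> (complex vec \<Rightarrow> fmat) set" where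
  "Bp q k = {M \<in> hm (fst q) k 1. nxt q k \<in> Qhat_verts \<and> mr q (nxt q k) M \<in> E q (nxt q k)}"

lemma HomC_nxt_iso:
  assumes "q \<in> Qhat_verts" "k \<in> I"
  shows "vs_iso psc (hm (fst q) k 1) (mr q (nxt q k)) (HomC q (nxt q k))"
  using HomC_iso[OF vert_I[OF assms(1)], of "nxt q k"] assms(2) by simp

lemma Bp_span:
  assumes q: "q \<in> Qhat_verts" and k: "k \<in> I" and M: "M \<in> hm (fst q) k 1"
  shows "\<exists>F c. finite F \<and> F \<subseteq> Bp q k \<and> M = (\<lambda>\<xi>. \<Sum>P\<in>F. c P *\<^sub>F P \<xi>)"
proof (cases "nxt q k \<in> Qhat_verts")
  case True
  interpret C: vs_iso psc "hm (fst q) k 1" "mr q (nxt q k)" "HomC q (nxt q k)" by (rule HomC_nxt_iso[OF q k])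
  have "vectorspace.basis class_ring (HomC q (nxt q k)) (E q (nxt q k))" by (rule E_basis[OF q True]) simp
  then have gen: "LinearCombinations.module.span class_ring (HomC q (nxt q k)) (E q (nxt q k)) = carrier (HomC q (nxt q k))"
    and sub: "E q (nxt q k) \<subseteq> carrier (HomC q (nxt q k))"
    unfolding vectorspace.basis_def[OF C.vectorspace_W] by blast+
  obtain F c where F: "finite F" "F \<subseteq> {y \<in> hm (fst q) k 1. mr q (nxt q k) y \<in> E q (nxt q k)}" "M = (\<Sum>y\<in>F. psc (c y) y)"
    using C.gen_setD[OF gen M sub] by blast
  have "M = (\<lambda>\<xi>. \<Sum>P\<in>F. c P *\<^sub>F P \<xi>)" unfolding F(3) by (rule ext) simp
  moreover have "F \<subseteq> Bp q k" using F(2) True by (auto simp: Bp_def)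
  ultimately show ?thesis using F(1) by blast
next
  case False
  have "M = 0"
  proof (rule ccontr)
    assume "M \<noteq> 0"
    then have "(snd q + 1) mod 2 = int (parity k)"
      using hm_1_parity[OF vert_I[OF q] k M] q by (auto simp: Qhat_verts_def)
    then show False using False k by (simp add: Qhat_verts_def nxt_def)
  qed
  then show ?thesis by (intro exI[of _ "{}"]) (simp add: zero_fun_def)
qed

lemma Bp_indep:
  assumes q: "q \<in> Qhat_verts" and k: "k \<in> I" and F: "finite F" "F \<subseteq> Bp q k" "(\<lambda>\<xi>. \<Sum>P\<in>F. c P *\<^sub>F P \<xi>) = 0" "P \<in> F"
  shows "c P = 0"
proof -
  interpret C: vs_iso psc "hm (fst q) k 1" "mr q (nxt q k)" "HomC q (nxt q k)" by (rule HomC_nxt_iso[OF q k])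
  have v: "nxt q k \<in> Qhat_verts" using F(2,4) by (auto simp: Bp_def)
  have "vectorspace.basis class_ring (HomC q (nxt q k)) (E q (nxt q k))" by (rule E_basis[OF q v]) simp
  then have "\<not> LinearCombinations.module.lin_dep class_ring (HomC q (nxt q k)) (E q (nxt q k))"
    unfolding vectorspace.basis_def[OF C.vectorspace_W] by blast
  moreover have "F \<subseteq> {y \<in> hm (fst q) k 1. mr q (nxt q k) y \<in> E q (nxt q k)}" using F(2) by (auto simp: Bp_def)
  moreover have "(\<Sum>P\<in>F. psc (c P) P) = 0" using F(3) by (simp add: fun_eq_iff)
  ultimately show ?thesis using C.lin_indptD[OF _ F(1)] F(4) by blast
qed

definition Ap :: "'i \<times> int \<Rightarrow> ('i \<times> (complex vec \<Rightarrow> fmat)) set" where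
  "Ap q = (SIGMA k:I. Bp q k)"

text \<open>The conclusions of \<open>dual_pencils\<close> at \<open>q\<close>, bundled so that the
  single choice \<open>sd q\<close> carries them all.\<close>

definition dual_data :: "'i \<times> int \<Rightarrow> ('i \<Rightarrow> (complex vec \<Rightarrow> fmat) \<Rightarrow> complex vec \<Rightarrow> fmat) \<Rightarrow> bool" where
  "dual_data q S \<longleftrightarrow> (\<forall>(k, P)\<in>Ap q. S k P \<in> hm k (fst q) 1) \<and>
     (\<Sum>(k, P)\<in>Ap q. b0 (S k P) * b1 P) = fid (dg (fst q)) \<and>
     (\<Sum>(k, P)\<in>Ap q. b1 (S k P) * b0 P) = - fid (dg (fst q)) \<and>
     (\<Sum>(k, P)\<in>Ap q. b0 (S k P) * b0 P) = 0 \<and>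
     (\<Sum>(k, P)\<in>Ap q. b1 (S k P) * b1 P) = 0 \<and>
     (\<forall>(k, P)\<in>Ap q. \<forall>(k', P')\<in>Ap q. br P' (S k P) = (if k = k' \<and> P = P' then fid (dg k) else 0))"

definition sd :: "'i \<times> int \<Rightarrow> 'i \<Rightarrow> (complex vec \<Rightarrow> fmat) \<Rightarrow> complex vec \<Rightarrow> fmat" where
  "sd q = (SOME S. dual_data q S)"

lemma Ap_D:
  assumes "(k, P) \<in> Ap q"
  shows "k \<in> I" "P \<in> hm (fst q) k 1" "nxt q k \<in> Qhat_verts" "mr q (nxt q k) P \<in> E q (nxt q k)"
  using assms by (auto simp: Ap_def Bp_def)

lemma dual_data_ex:
  assumes q: "q \<in> Qhat_verts"
  shows "finite (Ap q) \<and> (\<exists>S. dual_data q S)"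
proof (rule dual_pencils[of "fst q" "Bp q"])
  show "fst q \<in> I" by (rule vert_I[OF q])
  show "Bp q k \<subseteq> hm (fst q) k 1" for k by (auto simp: Bp_def)
  show "\<exists>F c. finite F \<and> F \<subseteq> Bp q k \<and> M = (\<lambda>\<xi>. \<Sum>P\<in>F. c P *\<^sub>F P \<xi>)" if "k \<in> I" "M \<in> hm (fst q) k 1" for k M
    by (rule Bp_span[OF q that])
  show "c P = 0" if "k \<in> I" "finite F" "F \<subseteq> Bp q k" "(\<lambda>\<xi>. \<Sum>P\<in>F. c P *\<^sub>F P \<xi>) = 0" "P \<in> F" for k F c P
    by (rule Bp_indep[OF q that])
next
  fix S
  assume fin: "finite (SIGMA k:I. Bp q k)"
    and S: "\<And>k P. k \<in> I \<Longrightarrow> P \<in> Bp q k \<Longrightarrow> S k P \<in> hm k (fst q) 1"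
    and sums: "(\<Sum>(k, P)\<in>(SIGMA k:I. Bp q k). b0 (S k P) * b1 P) = fid (dg (fst q))"
      "(\<Sum>(k, P)\<in>(SIGMA k:I. Bp q k). b1 (S k P) * b0 P) = - fid (dg (fst q))"
      "(\<Sum>(k, P)\<in>(SIGMA k:I. Bp q k). b0 (S k P) * b0 P) = 0"
      "(\<Sum>(k, P)\<in>(SIGMA k:I. Bp q k). b1 (S k P) * b1 P) = 0"
    and orth: "\<And>k P k' P'. k \<in> I \<Longrightarrow> P \<in> Bp q k \<Longrightarrow> k' \<in> I \<Longrightarrow> P' \<in> Bp q k' \<Longrightarrow>
      br P' (S k P) = (if k = k' \<and> P = P' then fid (dg k) else 0)"
  have "dual_data q S"
    unfolding dual_data_def Ap_def
  proof (intro conjI sums ballI)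
    fix x assume "x \<in> (SIGMA k:I. Bp q k)"
    then show "case x of (k, P) \<Rightarrow> S k P \<in> hm k (fst q) 1" using S by auto
  next
    fix x assume x: "x \<in> (SIGMA k:I. Bp q k)"
    show "case x of (k, P) \<Rightarrow> \<forall>(k', P')\<in>(SIGMA k:I. Bp q k). br P' (S k P) = (if k = k' \<and> P = P' then fid (dg k) else 0)"
      unfolding case_prod_unfold
    proof
      fix x' assume "x' \<in> (SIGMA k:I. Bp q k)"
      then show "br (snd x') (S (fst x) (snd x)) = (if fst x = fst x' \<and> snd x = snd x' then fid (dg (fst x)) else 0)"
        using x by (intro orth) auto
    qed
  qed
  then show ?thesis using fin by (auto simp: Ap_def)
qed

lemma finite_Ap: "q \<in> Qhat_verts \<Longrightarrow> finite (Ap q)"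
  using dual_data_ex by blast

lemma dual_data_sd: "q \<in> Qhat_verts \<Longrightarrow> dual_data q (sd q)"
  unfolding sd_def by (rule someI_ex[OF conjunct2[OF dual_data_ex]])

lemma sd_hm: "q \<in> Qhat_verts \<Longrightarrow> (k, P) \<in> Ap q \<Longrightarrow> sd q k P \<in> hm k (fst q) 1"
  using dual_data_sd[of q] by (auto simp: dual_data_def)

lemma sd_sums:
  assumes "q \<in> Qhat_verts"
  shows "(\<Sum>(k, P)\<in>Ap q. b0 (sd q k P) * b1 P) = fid (dg (fst q))"
    "(\<Sum>(k, P)\<in>Ap q. b1 (sd q k P) * b0 P) = - fid (dg (fst q))"
    "(\<Sum>(k, P)\<in>Ap q. b0 (sd q k P) * b0 P) = 0"
    "(\<Sum>(k, P)\<in>Ap q. b1 (sd q k P) * b1 P) = 0"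
  using dual_data_sd[OF assms] unfolding dual_data_def by blast+

lemma sd_orth:
  assumes "q \<in> Qhat_verts" "(k, P) \<in> Ap q" "(k', P') \<in> Ap q"
  shows "br P' (sd q k P) = (if k = k' \<and> P = P' then fid (dg k) else 0)"
proof -
  have "\<forall>(k, P)\<in>Ap q. \<forall>(k', P')\<in>Ap q. br P' (sd q k P) = (if k = k' \<and> P = P' then fid (dg k) else 0)"
    using dual_data_sd[OF assms(1)] unfolding dual_data_def by (elim conjE)
  from bspec[OF this assms(2)] show ?thesis using assms(3) by fast
qed

lemma pairingC_mr:
  assumes q: "q \<in> Qhat_verts" and P: "(k, P) \<in> Ap q" and M: "M \<in> hm k (fst q) 1" and x: "br M P = x *\<^sub>F fid (dg (fst q))"
  shows "pairingC q (nxt q k) (mr q (nxt q k) P) (mr (nxt q k) (shift2 q) M) = - lam * x"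
proof -
  note i = vert_I[OF q] and k = Ap_D[OF P]
  have "the_inv_into (carrier (HomV (fst q) (fst (nxt q k)))) (induced_mor q (nxt q k)) (mr q (nxt q k) P) = TV (fst q) k P"
    using the_inv_induced_mor[OF i, of "nxt q k" P] k by simp
  moreover have "the_inv_into (carrier (HomV (fst (nxt q k)) (fst q))) (induced_mor (nxt q k) (shift2 q)) (mr (nxt q k) (shift2 q) M) = TV k (fst q) M"
    using the_inv_induced_mor[of "nxt q k" "shift2 q" M] k(1) i M by simp
  ultimately show ?thesis
    unfolding pairingC_def using pairing_TV[OF i k(2) M x] by simp
qed

lemma E_Bp:
  assumes q: "q \<in> Qhat_verts" and q': "q' \<in> Qhat_verts" "snd q' = snd q + 1"
  shows "E q q' = mr q q' ` Bp q (fst q')" "inj_on (mr q q') (Bp q (fst q'))" "nxt q (fst q') = q'"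
proof -
  show n: "nxt q (fst q') = q'" using q'(2) by (simp add: nxt_def prod_eq_iff)
  interpret C: vs_iso psc "hm (fst q) (fst q') 1" "mr q (nxt q (fst q'))" "HomC q (nxt q (fst q'))"
    by (rule HomC_nxt_iso[OF q vert_I[OF q'(1)]])
  have "vectorspace.basis class_ring (HomC q q') (E q q')" by (rule E_basis[OF q q'])
  then have "E q q' \<subseteq> carrier (HomC q q')"
    using C.vectorspace_W unfolding n by (simp add: vectorspace.basis_def)
  then have "E q q' \<subseteq> mr q q' ` hm (fst q) (fst q') 1" using C.W_carrier unfolding n by simp
  then show "E q q' = mr q q' ` Bp q (fst q')" using q'(1) unfolding Bp_def n by blast
  show "inj_on (mr q q') (Bp q (fst q'))"
    using C.h_inj unfolding n by (rule inj_on_subset) (auto simp: Bp_def)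
qed

text \<open>Write \<open>i = fst q\<close>. Orthogonality makes \<open>br P (sd q k P)\<close> the
  identity on \<open>X_k\<close>. By \<open>ftr_br\<close> the contraction in the other order is the
  scalar \<open>- dg k / dg i\<close> on \<open>X_i\<close>, and the pairing multiplies it by
  \<open>- lam\<close>. The constant is the inverse of the resulting
  \<open>lam * dg k / dg i\<close>.\<close>

lemma dual_elem_mr:
  assumes q: "q \<in> Qhat_verts" and P: "(k, P) \<in> Ap q"
  shows "dual_elem q (nxt q k) (mr q (nxt q k) P) =
    mr (nxt q k) (shift2 q) (psc (of_nat (dg (fst q)) / (lam * of_nat (dg k))) (sd q k P))"
proof -
  define q' where "q' = nxt q k"
  define i where "i = fst q"
  have i: "i \<in> I" unfolding i_def by (rule vert_I[OF q])
  note k = Ap_D[OF P, folded q'_def i_def]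
  have q': "q' \<in> Qhat_verts" "snd q' = snd q + 1" "fst q' = k" using k by (simp_all add: q'_def)
  have di: "(of_nat (dg i) :: complex) \<noteq> 0" and dk: "(of_nat (dg k) :: complex) \<noteq> 0"
    using dg_pos[OF i] dg_pos[OF k(1)] by simp_all
  note sP = sd_hm[OF q P, folded i_def]
  interpret C: vs_iso psc "hm k i 1" "mr q' (shift2 q)" "HomC q' (shift2 q)"
    using HomC_iso[of q' "shift2 q"] k(1) i by (simp add: q'_def i_def)
  have scal: "\<exists>x. br M P' = x *\<^sub>F fid (dg i) \<and> x * of_nat (dg i) = - ftr (dg k) (br P' M)"
    if M: "M \<in> hm k i 1" and P': "P' \<in> hm i k 1" for M P'
  proof -
    obtain x where x: "br M P' = x *\<^sub>F fid (dg i)" using schur_scalar[OF irreps[OF i] br_ihom[OF M P']] by blast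
    then have "x * of_nat (dg i) = ftr (dg i) (br M P')" by simp
    then show ?thesis using x ftr_br[OF M P'] by (intro exI[of _ x]) simp
  qed
  have Ek: "E q q' = mr q q' ` Bp q k" "inj_on (mr q q') (Bp q k)"
    using E_Bp[OF q q'(1,2)] q'(3) by auto
  have ApB: "(k, P') \<in> Ap q \<longleftrightarrow> P' \<in> Bp q k" for P' using k(1) by (simp add: Ap_def)
  define c where "c = of_nat (dg i) / (lam * of_nat (dg k))"
  have good: "pairingC q q' e' (mr q' (shift2 q) (psc c (sd q k P))) = (if e' = mr q q' P then 1 else 0)" if e': "e' \<in> E q q'" for e'
  proof -
    obtain P' where P': "P' \<in> Bp q k" "e' = mr q q' P'" using e' Ek(1) by blast
    have P'A: "(k, P') \<in> Ap q" using P'(1) ApB by simp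
    have P'h: "P' \<in> hm i k 1" using P'(1) by (simp add: Bp_def i_def)
    obtain y where y: "br (sd q k P) P' = y *\<^sub>F fid (dg i)" "y * of_nat (dg i) = - ftr (dg k) (br P' (sd q k P))"
      using scal[OF sP P'h] by blast
    have "y * of_nat (dg i) = - (if P = P' then of_nat (dg k) else 0)"
      unfolding y(2) sd_orth[OF q P P'A] by simp
    moreover have "br (psc c (sd q k P)) P' = (c * y) *\<^sub>F fid (dg (fst q))"
      using y(1) by (simp add: br_def i_def flip: fsc.scale_right_diff_distrib)
    from pairingC_mr[OF q P'A _ this] have "pairingC q q' e' (mr q' (shift2 q) (psc c (sd q k P))) = - lam * (c * y)"
      using hm_psc[OF sP] P'(2) by (simp add: q'_def i_def)
    moreover have "- lam * (c * y) = - (y * of_nat (dg i)) / of_nat (dg k)"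
      using ev_entries(4) by (simp add: c_def)
    moreover have "e' = mr q q' P \<longleftrightarrow> P = P'"
      using P' inj_onD[OF Ek(2), of P' P] P ApB by auto
    ultimately show ?thesis using dk by auto
  qed
  have "dual_elem q q' (mr q q' P) = mr q' (shift2 q) (psc c (sd q k P))"
    unfolding dual_elem_def
  proof (rule the_equality, intro conjI ballI good)
    show "mr q' (shift2 q) (psc c (sd q k P)) \<in> carrier (HomC q' (shift2 q))"
      unfolding C.W_carrier by (intro imageI hm_psc sP)
    fix b assume b: "b \<in> carrier (HomC q' (shift2 q)) \<and> (\<forall>e'\<in>E q q'. pairingC q q' e' b = (if e' = mr q q' P then 1 else 0))"
    from conjunct1[OF b, unfolded C.W_carrier] obtain M where M: "b = mr q' (shift2 q) M" "M \<in> hm k i 1" by (rule imageE)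
    note M = M(2,1)
    \<comment> \<open>Uniqueness: the pairing conditions make \<open>br P' D\<close> zero for
      \<open>P'\<close> with target \<open>k\<close>, Schur's lemma does so for the other targets,
      and inserting the resolution then gives \<open>D = 0\<close>.\<close>
    define D where "D = M - psc c (sd q k P)"
    have D: "D \<in> hm k i 1"
      using hm_add[OF M(1) hm_psc[OF hm_psc[OF sP, of c], of "-1"]] by (simp add: D_def fun_eq_iff plus_fun_def fun_diff_def psc_def)
    have zero: "br P' D = 0" if P'A: "(k', P') \<in> Ap q" for k' P'
    proof (cases "k' = k")
      case True
      then have P'B: "P' \<in> Bp q k" using P'A ApB by simp
      have P'h: "P' \<in> hm i k 1" using P'B by (simp add: Bp_def i_def)
      have kP': "(k, P') \<in> Ap q" using P'B ApB by simp
      have e': "mr q q' P' \<in> E q q'" using P'B Ek by blast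
      obtain x where x: "br M P' = x *\<^sub>F fid (dg i)" using scal[OF M(1) P'h] by blast
      obtain y where y: "br (psc c (sd q k P)) P' = y *\<^sub>F fid (dg i)" using scal[OF hm_psc[OF sP] P'h] by blast
      have "- lam * x = - lam * y"
        using pairingC_mr[OF q kP' M(1)[unfolded i_def] x[unfolded i_def]]
          pairingC_mr[OF q kP' hm_psc[OF sP, unfolded i_def] y[unfolded i_def]]
          bspec[OF conjunct2[OF b] e'] good[OF e'] M(2) by (simp add: q'_def)
      then have "x = y" using ev_entries(4) by simp
      have "br D P' = br M P' - br (psc c (sd q k P)) P'"
        by (rule fmat_eqI) (simp add: D_def br_def fun_diff_def left_diff_distrib)
      then have "br D P' = 0" using x y \<open>x = y\<close> by simp
      then have "ftr (dg k) (br P' D) = 0" using ftr_br[OF P'h D] by simp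
      moreover obtain \<beta> where \<beta>: "br P' D = \<beta> *\<^sub>F fid (dg k)" using schur_scalar[OF irreps[OF k(1)] br_ihom[OF P'h D]] by blast
      ultimately show ?thesis using dk by simp
    next
      case False
      have "P' \<in> hm i k' 1" "k' \<in> I" using Ap_D[OF P'A] by (simp_all add: i_def)
      then show ?thesis using schur_zero[OF k(1) _ _ br_ihom[OF _ D]] False by metis
    qed
    have z: "(\<Sum>(k', P')\<in>Ap q. X k' P' * br P' D) = 0" for X
      by (rule sum.neutral) (use zero in auto)
    have fD: "fid (dg i) * D v = D v" for v by (rule fid_mult[OF hm_fits[OF D]])
    have ex: "(\<Sum>(k', P')\<in>Ap q. X k' P' * br P' D) = (\<Sum>(k', P')\<in>Ap q. X k' P' * b1 P') * b0 D - (\<Sum>(k', P')\<in>Ap q. X k' P' * b0 P') * b1 D" for X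
      by (simp add: br_def case_prod_unfold sum_distrib_right right_diff_distrib sum_subtractf mult.assoc)
    have "b0 D = 0" using z[of "\<lambda>k' P'. b0 (sd q k' P')"] unfolding ex sd_sums[OF q] by (simp add: fD flip: i_def)
    moreover have "b1 D = 0" using z[of "\<lambda>k' P'. b1 (sd q k' P')"] unfolding ex sd_sums[OF q] by (simp add: fD flip: i_def)
    ultimately have "D = lin 0 0" using PM_1_eq_lin[OF hm_PM[OF D]] by simp
    then have "D = 0" by (simp add: lin_def fun_eq_iff)
    then show "b = mr q' (shift2 q) (psc c (sd q k P))" using M(2) by (simp add: D_def)
  qed
  then show ?thesis by (simp add: q'_def c_def i_def)
qed

lemma finite_Bp:
  assumes q: "q \<in> Qhat_verts" and k: "k \<in> I"
  shows "finite (Bp q k)"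
proof -
  have "Bp q k \<subseteq> snd ` Ap q"
  proof
    fix P assume "P \<in> Bp q k"
    then have "(k, P) \<in> Ap q" using k by (simp add: Ap_def)
    then show "P \<in> snd ` Ap q" by (rule rev_image_eqI) simp
  qed
  then show ?thesis by (rule finite_subset) (rule finite_imageI[OF finite_Ap[OF q]])
qed

lemma Bp_span_all:
  assumes q: "q \<in> Qhat_verts" and k: "k \<in> I" and M: "M \<in> hm (fst q) k 1"
  shows "\<exists>c. M = (\<Sum>P\<in>Bp q k. psc (c P) P)"
proof -
  obtain F c where F: "finite F" "F \<subseteq> Bp q k" "M = (\<lambda>\<xi>. \<Sum>P\<in>F. c P *\<^sub>F P \<xi>)"
    using Bp_span[OF q k M] by blast
  have "(\<Sum>P\<in>Bp q k. (if P \<in> F then c P else 0) *\<^sub>F P \<xi>) = (\<Sum>P\<in>F. c P *\<^sub>F P \<xi>)" for \<xi>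
    using F(1,2) finite_Bp[OF q k] by (intro sum.mono_neutral_cong_right) auto
  then have "M = (\<Sum>P\<in>Bp q k. psc (if P \<in> F then c P else 0) P)" using F(3) by (simp add: fun_eq_iff)
  then show ?thesis by (rule exI[of _ "\<lambda>P. if P \<in> F then c P else 0"])
qed

lemma num_edges_nonzero:
  assumes q: "q \<in> Qhat_verts" and q': "q' \<in> Qhat_verts" "snd q' = snd q + 1"
  shows "num_edges (fst q) (fst q') \<noteq> 0 \<longleftrightarrow> Bp q (fst q') \<noteq> {}"
proof -
  define i k where ik: "i = fst q" "k = fst q'"
  have I: "i \<in> I" "k \<in> I" using vert_I q q' by (auto simp: ik)
  have fin: "finite (Bp q k)" by (rule finite_Bp[OF q I(2)])
  have sub: "Bp q k \<subseteq> hm i k 1" by (auto simp: Bp_def ik)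
  have span: "\<exists>c. M = (\<Sum>P\<in>Bp q k. psc (c P) P)" if "M \<in> hm i k 1" for M
    by (rule Bp_span_all[OF q I(2)]) (use that in \<open>simp add: ik\<close>)
  have "num_edges i k = 0 \<longleftrightarrow> hm i k 1 = {0}" 
  proof (rule num_edges_eq_0_iff[OF I fin sub])
    fix M assume "M \<in> hm i k 1" then show "\<exists>c. M = (\<Sum>P\<in>Bp q k. psc (c P) P)" by (rule span)
  qed
  also have "\<dots> \<longleftrightarrow> Bp q k = {}"
  proof
    assume h0: "hm i k 1 = {0}"
    show "Bp q k = {}"
    proof (rule ccontr)
      assume "Bp q k \<noteq> {}"
      then have "Bp q k = {0}" using subset_singletonD[OF sub[unfolded h0]] by simp
      have "(\<lambda>_. 1 :: complex) 0 = (0 :: complex)"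
      proof (rule Bp_indep[OF q I(2)])
        show "{0} \<subseteq> Bp q k" using \<open>Bp q k = {0}\<close> by simp
        show "(\<lambda>\<xi>. \<Sum>P\<in>{0}. 1 *\<^sub>F P \<xi>) = 0" by (simp add: fun_eq_iff)
      qed simp_all
      then show False by simp
    qed
  next
    assume e: "Bp q k = {}"
    have "M = 0" if "M \<in> hm i k 1" for M
    proof -
      from span[OF that] obtain c where "M = (\<Sum>P\<in>Bp q k. psc (c P) P)" by (rule exE)
      then show ?thesis unfolding e by simp
    qed
    then show "hm i k 1 = {0}" using hm_zero by blast
  qed
  finally show ?thesis by (simp add: ik)
qed

end

section \<open>The path algebra\<close>

definition ps :: "complex \<Rightarrow> ('a \<Rightarrow>\<^sub>0 complex) \<Rightarrow> 'a \<Rightarrow>\<^sub>0 complex" where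
  "ps c = Poly_Mapping.map ((*) c)"

lemma lookup_ps [simp]: "Poly_Mapping.lookup (ps c a) x = c * Poly_Mapping.lookup a x"
  by (simp add: ps_def map.rep_eq when_def)

interpretation ps: vector_space ps
  by unfold_locales (auto intro!: poly_mapping_eqI simp: lookup_add algebra_simps)

lemma keys_ps: "Poly_Mapping.keys (ps c a) \<subseteq> Poly_Mapping.keys a"
  by (auto simp: in_keys_iff)

lemma ps_single [simp]: "ps c (Poly_Mapping.single x d) = Poly_Mapping.single x (c * d)"
  by (rule poly_mapping_eqI) (simp add: lookup_single when_def)

lemma pm_sum_single: "a = (\<Sum>x\<in>Poly_Mapping.keys a. Poly_Mapping.single x (Poly_Mapping.lookup a x :: complex))"
proof (rule poly_mapping_eqI)
  fix y
  have "(\<Sum>x\<in>Poly_Mapping.keys a. Poly_Mapping.lookup a x when x = y) = Poly_Mapping.lookup a y"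
    by (cases "y \<in> Poly_Mapping.keys a") (auto simp: when_def in_keys_iff)
  then show "Poly_Mapping.lookup a y = Poly_Mapping.lookup (\<Sum>x\<in>Poly_Mapping.keys a. Poly_Mapping.single x (Poly_Mapping.lookup a x)) y"
    by (simp add: lookup_sum lookup_single)
qed

lemma pm_induct [case_names zero add single]:
  assumes "P 0" "\<And>a b. P a \<Longrightarrow> P b \<Longrightarrow> P (a + b)" "\<And>x c. x \<in> Poly_Mapping.keys a \<Longrightarrow> P (Poly_Mapping.single x (c :: complex))"
  shows "P a"
proof -
  have "P (\<Sum>x\<in>F. Poly_Mapping.single x (Poly_Mapping.lookup a x))" if "finite F" "F \<subseteq> Poly_Mapping.keys a" for F
    using that by (induction F rule: finite_induct) (simp_all add: assms)
  then have "P (\<Sum>x\<in>Poly_Mapping.keys a. Poly_Mapping.single x (Poly_Mapping.lookup a x))" by simp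
  then show ?thesis unfolding pm_sum_single[symmetric] .
qed

definition lext :: "('a \<Rightarrow> complex vec \<Rightarrow> fmat) \<Rightarrow> ('a \<Rightarrow>\<^sub>0 complex) \<Rightarrow> complex vec \<Rightarrow> fmat" where
  "lext f a = (\<Sum>x\<in>Poly_Mapping.keys a. psc (Poly_Mapping.lookup a x) (f x))"

lemma lext_super:
  "finite F \<Longrightarrow> Poly_Mapping.keys a \<subseteq> F \<Longrightarrow> lext f a = (\<Sum>x\<in>F. psc (Poly_Mapping.lookup a x) (f x))"
  unfolding lext_def by (rule sum.mono_neutral_left) (auto simp: in_keys_iff)

lemma lext_zero [simp]: "lext f 0 = 0"
  by (simp add: lext_def)

lemma lext_single [simp]: "lext f (Poly_Mapping.single x c) = psc c (f x)"
  by (subst lext_super[of "{x}"]) auto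

lemma lext_add: "lext f (a + b) = lext f a + lext f b"
proof -
  let ?F = "Poly_Mapping.keys a \<union> Poly_Mapping.keys b"
  have "lext f (a + b) = (\<Sum>x\<in>?F. psc (Poly_Mapping.lookup (a + b) x) (f x))"
    by (rule lext_super) (auto dest: subsetD[OF Poly_Mapping.keys_add])
  also have "\<dots> = lext f a + lext f b"
    by (simp add: lext_super[of ?F a] lext_super[of ?F b] lookup_add psc.scale_left_distrib sum.distrib)
  finally show ?thesis .
qed

lemma lext_ps: "lext f (ps c a) = psc c (lext f a)"
  by (subst lext_super[OF _ keys_ps]) (simp_all add: lext_def psc.scale_sum_right)

lemma lext_sum: "lext f (\<Sum>i\<in>F. a i) = (\<Sum>i\<in>F. lext f (a i))"
  by (induction F rule: infinite_finite_induct) (simp_all add: lext_add)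

lemma lext_minus: "lext f (a - b) = lext f a - lext f b"
  using lext_add[of f "a - b" b] by simp

section \<open>Walks in the quiver and the product of paths\<close>

context mckay_quiver
begin

abbreviation aw :: "'i \<times> int \<Rightarrow> (('i \<times> int) \<times> sheaf_mor \<times> ('i \<times> int)) list \<Rightarrow> 'i \<times> int \<Rightarrow> bool" where
  "aw \<equiv> pre_digraph.awalk Qhat"

lemma arcs_Qhat: "(u, e, v) \<in> arcs Qhat \<longleftrightarrow> u \<in> Qhat_verts \<and> v \<in> Qhat_verts \<and> snd v = snd u + 1 \<and> e \<in> E u v"
  by (simp add: Qhat_def)

lemma aw_Nil: "aw u [] v \<longleftrightarrow> u = v \<and> u \<in> Qhat_verts"
  by (auto simp: pre_digraph.awalk_def pre_digraph.cas.simps Qhat_def)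

lemma aw_Cons: "aw u ((t, e, w) # p) v \<longleftrightarrow> t = u \<and> (u, e, w) \<in> arcs Qhat \<and> aw w p v"
  by (auto simp: pre_digraph.awalk_def pre_digraph.cas.simps Qhat_def)

lemma aw_append: "aw u p v \<Longrightarrow> aw v p' w \<Longrightarrow> aw u (p @ p') w"
  by (induction p arbitrary: u) (auto simp: aw_Nil aw_Cons)

lemma aw_length: "aw u p v \<Longrightarrow> snd v = snd u + int (length p)"
  by (induction p arbitrary: u) (auto simp: aw_Nil aw_Cons arcs_Qhat)

lemma paths_iff: "(s, p, t) \<in> paths u v \<longleftrightarrow> s = u \<and> t = v \<and> aw u p v"
  by (auto simp: paths_def)

lemma Path_iff: "a \<in> Path u v \<longleftrightarrow> (\<forall>x\<in>Poly_Mapping.keys a. fst x = u \<and> snd (snd x) = v \<and> aw u (fst (snd x)) v)"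
proof -
  have "x \<in> paths u v \<longleftrightarrow> fst x = u \<and> snd (snd x) = v \<and> aw u (fst (snd x)) v" for x
    by (cases x) (simp add: paths_iff)
  then show ?thesis by (auto simp: Path_def)
qed

lemma Path_zero [simp]: "0 \<in> Path u v"
  by (simp add: Path_def)

lemma Path_add: "a \<in> Path u v \<Longrightarrow> b \<in> Path u v \<Longrightarrow> a + b \<in> Path u v"
  using Poly_Mapping.keys_add[of a b] by (auto simp: Path_def)

lemma Path_ps: "a \<in> Path u v \<Longrightarrow> ps c a \<in> Path u v"
  using keys_ps[of c a] by (auto simp: Path_def)

lemma Path_sum: "(\<And>i. i \<in> F \<Longrightarrow> a i \<in> Path u v) \<Longrightarrow> (\<Sum>i\<in>F. a i) \<in> Path u v"
  by (induction F rule: infinite_finite_induct) (simp_all add: Path_add)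

lemma Path_diff: "a \<in> Path u v \<Longrightarrow> b \<in> Path u v \<Longrightarrow> a - b \<in> Path u v"
  using Path_add[of a u v "ps (-1) b"] Path_ps[of b u v "-1"] by simp

lemma Path_single: "aw u p v \<Longrightarrow> Poly_Mapping.single (u, p, v) c \<in> Path u v"
  by (auto simp: Path_def paths_def)

definition path_space :: "(('i \<times> int) qpath \<Rightarrow>\<^sub>0 complex) set" where
  "path_space = {a. \<forall>x\<in>Poly_Mapping.keys a. aw (fst x) (fst (snd x)) (snd (snd x))}"

lemma path_algebra_simps [simp]:
  "carrier path_algebra = path_space" "zero path_algebra = 0" "add path_algebra = (+)" "module.smult path_algebra = ps"
proof -
  have "x \<in> (\<Union>q. \<Union>q'. paths q q') \<longleftrightarrow> aw (fst x) (fst (snd x)) (snd (snd x))" for x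
    by (cases x) (simp only: UN_iff paths_iff, simp)
  then show "carrier path_algebra = path_space"
    unfolding path_algebra_def path_space_def partial_object.select_convs subset_iff Ball_def by (simp only:)
qed (simp_all add: path_algebra_def ps_def fun_eq_iff)

lemma Path_path_space: "Path u v \<subseteq> path_space"
proof
  fix a assume "a \<in> Path u v"
  then have h: "\<forall>x\<in>Poly_Mapping.keys a. fst x = u \<and> snd (snd x) = v \<and> aw u (fst (snd x)) v" by (simp only: Path_iff)
  show "a \<in> path_space"
    unfolding path_space_def mem_Collect_eq
  proof
    fix x assume "x \<in> Poly_Mapping.keys a"
    from bspec[OF h this] show "aw (fst x) (fst (snd x)) (snd (snd x))" by simp
  qed
qed

lemma path_space_zero [simp]: "0 \<in> path_space"
  by (simp add: path_space_def)

lemma path_space_add: "a \<in> path_space \<Longrightarrow> b \<in> path_space \<Longrightarrow> a + b \<in> path_space"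
  using Poly_Mapping.keys_add[of a b] unfolding path_space_def by blast

lemma path_space_ps: "a \<in> path_space \<Longrightarrow> ps c a \<in> path_space"
  using keys_ps[of c a] unfolding path_space_def by blast

lemma vs_path_algebra: "vs_iso ps path_space (\<lambda>a. a) path_algebra"
  by unfold_locales (auto simp: path_space_add path_space_ps)

definition path_mult1 :: "('i \<times> int) qpath \<Rightarrow> ('i \<times> int) qpath \<Rightarrow> complex \<Rightarrow> ('i \<times> int) qpath \<Rightarrow>\<^sub>0 complex" where
  "path_mult1 y x c = (if snd (snd x) = fst y then Poly_Mapping.single (fst x, fst (snd x) @ fst (snd y), snd (snd y)) c else 0)"

lemma path_mult1_simps [simp]: "path_mult1 y x 0 = 0"
  by (simp add: path_mult1_def)

lemma path_mult1_add: "path_mult1 y x (c + d) = path_mult1 y x c + path_mult1 y x d"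
  by (simp add: path_mult1_def single_add)

text \<open>Larger finite index sets give several elements a common support, from which bilinearity
  follows termwise.\<close>

lemma path_mult_super:
  assumes "finite F" "Poly_Mapping.keys b \<subseteq> F" "finite H" "Poly_Mapping.keys a \<subseteq> H"
  shows "path_mult b a = (\<Sum>(y, x)\<in>F \<times> H. path_mult1 y x (Poly_Mapping.lookup b y * Poly_Mapping.lookup a x))"
proof -
  have "path_mult b a = (\<Sum>(y, x)\<in>Poly_Mapping.keys b \<times> Poly_Mapping.keys a. path_mult1 y x (Poly_Mapping.lookup b y * Poly_Mapping.lookup a x))"
    unfolding path_mult_def path_mult1_def ..
  also have "\<dots> = (\<Sum>(y, x)\<in>F \<times> H. path_mult1 y x (Poly_Mapping.lookup b y * Poly_Mapping.lookup a x))"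
    by (rule sum.mono_neutral_left) (use assms in \<open>auto simp: in_keys_iff\<close>)
  finally show ?thesis .
qed

lemma path_mult_zero [simp]: "path_mult 0 a = 0" "path_mult b 0 = 0"
  by (simp_all add: path_mult_def)

lemma path_mult_single: "path_mult (Poly_Mapping.single y c) (Poly_Mapping.single x d) = path_mult1 y x (c * d)"
  by (subst path_mult_super[of "{y}" _ "{x}"]) auto

lemma path_mult_add_left: "path_mult (b + b') a = path_mult b a + path_mult b' a"
proof -
  let ?F = "Poly_Mapping.keys b \<union> Poly_Mapping.keys b'" and ?H = "Poly_Mapping.keys a"
  have "Poly_Mapping.keys (b + b') \<subseteq> ?F" by (rule Poly_Mapping.keys_add)
  then show ?thesis
    by (subst (1 2 3) path_mult_super[of ?F _ ?H])
      (simp_all add: case_prod_unfold lookup_add distrib_right path_mult1_add sum.distrib)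
qed

lemma path_mult_add_right: "path_mult b (a + a') = path_mult b a + path_mult b a'"
proof -
  let ?H = "Poly_Mapping.keys a \<union> Poly_Mapping.keys a'" and ?F = "Poly_Mapping.keys b"
  have "Poly_Mapping.keys (a + a') \<subseteq> ?H" by (rule Poly_Mapping.keys_add)
  then show ?thesis
    by (subst (1 2 3) path_mult_super[of ?F _ ?H])
      (simp_all add: case_prod_unfold lookup_add distrib_left path_mult1_add sum.distrib)
qed

lemma path_mult_sum_right: "path_mult b (\<Sum>i\<in>F. a i) = (\<Sum>i\<in>F. path_mult b (a i))"
  by (induction F rule: infinite_finite_induct) (simp_all add: path_mult_add_right)

lemma path_mult_diff_left: "path_mult (b - b') a = path_mult b a - path_mult b' a"
  using path_mult_add_left[of "b - b'" b' a] by simp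

lemma path_mult_assoc: "path_mult (path_mult c b) a = path_mult c (path_mult b a)"
proof (induction c rule: pm_induct)
  case (single z r)
  show ?case
  proof (induction b rule: pm_induct)
    case (single y s)
    show ?case
    proof (induction a rule: pm_induct)
      case (single x t)
      show ?case by (auto simp: path_mult_single path_mult1_def mult.assoc)
    qed (simp_all add: path_mult_add_right)
  qed (simp_all add: path_mult_add_right path_mult_add_left)
qed (simp_all add: path_mult_add_left)

lemma path_mult_path_space: "b \<in> path_space \<Longrightarrow> a \<in> path_space \<Longrightarrow> path_mult b a \<in> path_space"
proof -
  have path_space_sum: "(\<And>i. i \<in> F \<Longrightarrow> f i \<in> path_space) \<Longrightarrow> sum f F \<in> path_space" for f :: "_ \<Rightarrow> ('i \<times> int) qpath \<Rightarrow>\<^sub>0 complex" and F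
    by (induction F rule: infinite_finite_induct) (simp_all add: path_space_add)
  assume b: "b \<in> path_space" and a: "a \<in> path_space"
  show ?thesis
    unfolding path_mult_def
  proof (rule path_space_sum, clarify)
    fix s p t s' p' t' assume yx: "(s, p, t) \<in> Poly_Mapping.keys b" "(s', p', t') \<in> Poly_Mapping.keys a"
    then have "aw s p t" "aw s' p' t'"
      using bspec[OF CollectD[OF b[unfolded path_space_def]] yx(1)] bspec[OF CollectD[OF a[unfolded path_space_def]] yx(2)] by simp_all
    then have "aw s' (p' @ p) t" if "t' = s" using aw_append[of s' p' s p t] that by simp
    then show "(if snd (snd (s', p', t')) = fst (s, p, t) then Poly_Mapping.single (fst (s', p', t'), fst (snd (s', p', t')) @ fst (snd (s, p, t)), snd (snd (s, p, t)))
        (Poly_Mapping.lookup b (s, p, t) * Poly_Mapping.lookup a (s', p', t')) else 0) \<in> path_space"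
      by (auto simp: path_space_def)
  qed
qed

lemma path_mult_Path: "b \<in> Path v w \<Longrightarrow> a \<in> Path u v \<Longrightarrow> path_mult b a \<in> Path u w"
  unfolding path_mult_def
proof (rule Path_sum)
  fix yx assume b: "b \<in> Path v w" and a: "a \<in> Path u v" and yx: "yx \<in> Poly_Mapping.keys b \<times> Poly_Mapping.keys a"
  then have "fst (fst yx) = v" "snd (snd (fst yx)) = w" "aw v (fst (snd (fst yx))) w" "fst (snd yx) = u" "aw u (fst (snd (snd yx))) v"
    by (auto simp: Path_iff)
  then show "(case yx of (y, x) \<Rightarrow> if snd (snd x) = fst y then Poly_Mapping.single (fst x, fst (snd x) @ fst (snd y), snd (snd y))
      (Poly_Mapping.lookup b y * Poly_Mapping.lookup a x) else 0) \<in> Path u w"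
    by (simp add: case_prod_unfold Path_single aw_append)
qed

section \<open>The evaluation of paths\<close>

definition pencil :: "('i \<times> int) \<times> sheaf_mor \<times> ('i \<times> int) \<Rightarrow> complex vec \<Rightarrow> fmat" where
  "pencil = (\<lambda>(u, e, v). the_inv_into (Bp u (fst v)) (mr u v) e)"

lemma pencil_arc:
  assumes "(u, e, v) \<in> arcs Qhat"
  shows "(fst v, pencil (u, e, v)) \<in> Ap u" "mr u v (pencil (u, e, v)) = e" "nxt u (fst v) = v"
proof -
  have a: "u \<in> Qhat_verts" "v \<in> Qhat_verts" "snd v = snd u + 1" "e \<in> E u v" using assms by (simp_all add: arcs_Qhat)
  note E = E_Bp[OF a(1-3)]
  show "nxt u (fst v) = v" by (rule E(3))
  show "mr u v (pencil (u, e, v)) = e"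
    unfolding pencil_def case_prod_conv by (rule f_the_inv_into_f[OF E(2)]) (use a(4) E(1) in simp)
  have "pencil (u, e, v) \<in> Bp u (fst v)"
    unfolding pencil_def case_prod_conv by (rule the_inv_into_into[OF E(2)]) (use a(4) E(1) in simp_all)
  then show "(fst v, pencil (u, e, v)) \<in> Ap u" using vert_I[OF a(2)] by (simp add: Ap_def)
qed

definition arc :: "'i \<times> int \<Rightarrow> 'i \<Rightarrow> (complex vec \<Rightarrow> fmat) \<Rightarrow> ('i \<times> int) \<times> sheaf_mor \<times> ('i \<times> int)" where
  "arc u k P = (u, mr u (nxt u k) P, nxt u k)"

lemma arc_arcs: "u \<in> Qhat_verts \<Longrightarrow> (k, P) \<in> Ap u \<Longrightarrow> arc u k P \<in> arcs Qhat"
  using Ap_D[of k P u] by (simp add: arc_def arcs_Qhat)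

lemma pencil_arc_eq: "u \<in> Qhat_verts \<Longrightarrow> (k, P) \<in> Ap u \<Longrightarrow> pencil (arc u k P) = P"
  using E_Bp(2)[of u "nxt u k"] Ap_D[of k P u] by (simp add: pencil_def arc_def the_inv_into_f_f Ap_def)

text \<open>Every arrow is weighted by the dimension of its target. With this normalisation the
  evaluation kills the elements \<open>\<theta> u\<close>, because the pairing dual to a pencil is proportional to
  \<open>dg i / dg k\<close> times its dual pencil.\<close>

primrec cmp :: "'i \<times> int \<Rightarrow> (('i \<times> int) \<times> sheaf_mor \<times> ('i \<times> int)) list \<Rightarrow> complex vec \<Rightarrow> fmat" where
  "cmp u [] = one_hm (fst u)"
| "cmp u (a # p) = (\<lambda>\<xi>. cmp (snd (snd a)) p \<xi> * (of_nat (dg (fst (snd (snd a)))) *\<^sub>F pencil a \<xi>))"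

lemma cmp_hm: "aw u p v \<Longrightarrow> cmp u p \<in> hm (fst u) (fst v) (snd v - snd u)"
proof (induction p arbitrary: u)
  case Nil
  then show ?case using one_hm[OF vert_I[of u]] by (auto simp: aw_Nil)
next
  case (Cons a p)
  obtain t e w where a: "a = (t, e, w)" by (cases a)
  have *: "(u, e, w) \<in> arcs Qhat" "aw w p v" "t = u" using Cons.prems by (simp_all add: a aw_Cons)
  then have w: "snd w = snd u + 1" by (simp add: arcs_Qhat)
  have "pencil (u, e, w) \<in> hm (fst u) (fst w) 1" using Ap_D(2)[OF pencil_arc(1)[OF *(1)]] .
  from hm_mult[OF hm_fsc[OF this] Cons.IH[OF *(2)]]
  show ?case using w *(3) by (simp add: a algebra_simps)
qed

lemma cmp_append: "aw u p v \<Longrightarrow> aw v p' w \<Longrightarrow> cmp u (p @ p') \<xi> = cmp v p' \<xi> * cmp u p \<xi>"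
proof (induction p arbitrary: u)
  case Nil
  have h: "cmp v p' \<in> hm (fst v) (fst w) (snd w - snd v)" by (rule cmp_hm[OF Nil(2)])
  show ?case using Nil(1) mult_fid[OF hm_fits[OF h, of \<xi>]] hm_off[OF h, of \<xi>] by (auto simp: aw_Nil one_hm_def)
next
  case (Cons a p)
  obtain t e x where a: "a = (t, e, x)" by (cases a)
  then show ?case using Cons by (simp add: aw_Cons mult.assoc)
qed

text \<open>One component of the evaluation, defined on the whole path algebra and zero on paths
  with other ends. An ideal may contain sums of paths with different ends, so its elements are
  tested on all components.\<close>

definition path_eval :: "'i \<times> int \<Rightarrow> 'i \<times> int \<Rightarrow> (('i \<times> int) qpath \<Rightarrow>\<^sub>0 complex) \<Rightarrow> complex vec \<Rightarrow> fmat" where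
  "path_eval u v = lext (\<lambda>(s, p, t). if s = u \<and> t = v then cmp s p else 0)"

lemma path_eval_simps [simp]: "path_eval u v 0 = 0" "path_eval u v (a + b) = path_eval u v a + path_eval u v b" "path_eval u v (a - b) = path_eval u v a - path_eval u v b"
  "path_eval u v (ps c a) = psc c (path_eval u v a)" "path_eval u v (\<Sum>i\<in>F. f i) = (\<Sum>i\<in>F. path_eval u v (f i))"
  by (simp_all add: path_eval_def lext_add lext_minus lext_ps lext_sum)

lemma path_eval_single: "path_eval u v (Poly_Mapping.single (s, p, t) c) = (if s = u \<and> t = v then psc c (cmp s p) else 0)"
  by (simp add: path_eval_def)

lemma path_eval_hm:
  assumes a: "a \<in> Path u v"
  shows "path_eval u v a \<in> hq u v"
proof (rule pm_induct[of "\<lambda>a. path_eval u v a \<in> hq u v" a])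
  fix x c assume x: "x \<in> Poly_Mapping.keys a"
  obtain s p t where [simp]: "x = (s, p, t)" by (cases x)
  have "s = u" "t = v" "aw u p v" using a x by (auto simp: Path_iff)
  then show "path_eval u v (Poly_Mapping.single x c) \<in> hq u v" by (simp add: path_eval_single hm_psc cmp_hm)
qed (simp_all add: hm_add)

lemma path_eval_off:
  assumes a: "a \<in> Path u v" and st: "\<not> (s = u \<and> t = v)"
  shows "path_eval s t a = 0"
proof (rule pm_induct[of "\<lambda>a. path_eval s t a = 0" a])
  fix x c assume x: "x \<in> Poly_Mapping.keys a"
  obtain s' p t' where [simp]: "x = (s', p, t')" by (cases x)
  have "s' = u" "t' = v" using a x by (auto simp: Path_iff)
  then show "path_eval s t (Poly_Mapping.single x c) = 0" using st by (auto simp: path_eval_single)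
qed simp_all

lemma path_eval_mult_single:
  assumes "aw s p t" "aw s' p' t'"
  shows "path_eval u v (path_mult (Poly_Mapping.single (s, p, t) c) (Poly_Mapping.single (s', p', t') d)) \<xi> =
    (if t' = s \<and> s' = u \<and> t = v then (c *\<^sub>F cmp s p \<xi>) * (d *\<^sub>F cmp s' p' \<xi>) else 0)"
  using cmp_append[OF assms(2), of p t \<xi>] assms(1)
  by (auto simp: path_mult_single path_mult1_def path_eval_single)

lemma path_eval_mult_left:
  assumes b: "b \<in> Path v w" and a: "a \<in> path_space"
  shows "path_eval s t (path_mult b a) \<xi> = (if t = w then path_eval v w b \<xi> * path_eval s v a \<xi> else 0)"
proof (rule pm_induct[of "\<lambda>b. path_eval s t (path_mult b a) \<xi> = (if t = w then path_eval v w b \<xi> * path_eval s v a \<xi> else 0)" b])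
  fix y c assume y: "y \<in> Poly_Mapping.keys b"
  obtain p where p: "y = (v, p, w)" "aw v p w"
    by (rule that[of "fst (snd y)"]) (use b y in \<open>auto simp: Path_iff prod_eq_iff\<close>)
  show "path_eval s t (path_mult (Poly_Mapping.single y c) a) \<xi> = (if t = w then path_eval v w (Poly_Mapping.single y c) \<xi> * path_eval s v a \<xi> else 0)"
  proof (rule pm_induct[of "\<lambda>a. path_eval s t (path_mult (Poly_Mapping.single y c) a) \<xi> = (if t = w then path_eval v w (Poly_Mapping.single y c) \<xi> * path_eval s v a \<xi> else 0)" a])
    fix x d assume x: "x \<in> Poly_Mapping.keys a"
    obtain s' p' t' where p': "x = (s', p', t')" "aw s' p' t'"
      by (rule that[of "fst x" "fst (snd x)" "snd (snd x)"]) (use a x in \<open>auto simp: path_space_def\<close>)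
    show "path_eval s t (path_mult (Poly_Mapping.single y c) (Poly_Mapping.single x d)) \<xi> = (if t = w then path_eval v w (Poly_Mapping.single y c) \<xi> * path_eval s v (Poly_Mapping.single x d) \<xi> else 0)"
      unfolding p(1) p'(1) path_eval_mult_single[OF p(2) p'(2)] by (auto simp: path_eval_single)
  qed (simp_all add: path_mult_add_right distrib_left)
qed (simp_all add: path_mult_add_left distrib_right)

lemma path_eval_mult_right:
  assumes b: "b \<in> path_space" and a: "a \<in> Path u v"
  shows "path_eval s t (path_mult b a) \<xi> = (if s = u then path_eval v t b \<xi> * path_eval u v a \<xi> else 0)"
proof (rule pm_induct[of "\<lambda>b. path_eval s t (path_mult b a) \<xi> = (if s = u then path_eval v t b \<xi> * path_eval u v a \<xi> else 0)" b])
  fix y c assume y: "y \<in> Poly_Mapping.keys b"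
  obtain s' p t' where p: "y = (s', p, t')" "aw s' p t'"
    by (rule that[of "fst y" "fst (snd y)" "snd (snd y)"]) (use b y in \<open>auto simp: path_space_def\<close>)
  have "path_eval s t (path_mult (Poly_Mapping.single y c) a) \<xi> = (if t = t' then path_eval s' t' (Poly_Mapping.single y c) \<xi> * path_eval s s' a \<xi> else 0)"
    unfolding p(1) by (rule path_eval_mult_left[OF Path_single[OF p(2)] subsetD[OF Path_path_space a]])
  also have "\<dots> = (if s = u then path_eval v t (Poly_Mapping.single y c) \<xi> * path_eval u v a \<xi> else 0)"
    using path_eval_off[OF a, of s s'] by (auto simp: p(1) path_eval_single)
  finally show "path_eval s t (path_mult (Poly_Mapping.single y c) a) \<xi> = (if s = u then path_eval v t (Poly_Mapping.single y c) \<xi> * path_eval u v a \<xi> else 0)" .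
qed (simp_all add: path_mult_add_left distrib_right)

section \<open>The relations are killed\<close>

text \<open>The coefficients in \<open>as_path\<close> are some solution of the expansion in the
  basis, and this already fixes the evaluation; \<open>dg (fst q')\<close> is the weight of a single
  arrow.\<close>

lemma as_path_arc:
  assumes q: "q \<in> Qhat_verts" and q': "q' \<in> Qhat_verts" "snd q' = snd q + 1" and M: "M \<in> hm (fst q) (fst q') 1"
  shows "as_path q q' (mr q q' M) \<in> Path q q'" "path_eval q q' (as_path q q' (mr q q' M)) = psc (of_nat (dg (fst q'))) M"
proof -
  note E = E_Bp[OF q q'] and k = vert_I[OF q'(1)]
  interpret C: vs_iso psc "hm (fst q) (fst q') 1" "mr q q'" "HomC q q'"
    using HomC_nxt_iso[OF q k] unfolding E(3) .
  have fin: "finite (Bp q (fst q'))" by (rule finite_Bp[OF q k])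
  have sub: "Bp q (fst q') \<subseteq> hm (fst q) (fst q') 1" by (auto simp: Bp_def)
  have lc: "module.lincomb (HomC q q') c (E q q') = mr q q' (\<Sum>P\<in>Bp q (fst q'). psc (c (mr q q' P)) P)" for c
    unfolding E(1) by (rule C.lincomb_image[OF fin sub])
  obtain c0 where c0: "M = (\<Sum>P\<in>Bp q (fst q'). psc (c0 P) P)" using Bp_span_all[OF q k M] by (rule exE)
  define c where "c = (SOME c. mr q q' M = module.lincomb (HomC q q') c (E q q'))"
  have "M = (\<Sum>P\<in>Bp q (fst q'). psc ((c0 \<circ> the_inv_into (Bp q (fst q')) (mr q q')) (mr q q' P)) P)"
    unfolding c0 by (rule sum.cong) (simp_all add: the_inv_into_f_f[OF E(2)])
  then have "mr q q' M = module.lincomb (HomC q q') (c0 \<circ> the_inv_into (Bp q (fst q')) (mr q q')) (E q q')"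
    unfolding lc by (rule arg_cong)
  then have "mr q q' M = module.lincomb (HomC q q') c (E q q')"
    unfolding c_def by (rule someI[of "\<lambda>c. mr q q' M = module.lincomb (HomC q q') c (E q q')"])
  then have "M = (\<Sum>P\<in>Bp q (fst q'). psc (c (mr q q' P)) P)"
    unfolding lc by (rule inj_onD[OF C.h_inj]) (use M sub in \<open>auto intro!: C.C_sum C.C_sc\<close>)
  note M_eq = this
  have e: "as_path q q' (mr q q' M) = (\<Sum>P\<in>Bp q (fst q'). Poly_Mapping.single (q, [arc q (fst q') P], q') (c (mr q q' P)))"
    unfolding as_path_def Let_def unfolding c_def[symmetric] unfolding E(1) sum.reindex[OF E(2)] by (simp add: arc_def E(3))
  have A: "(fst q', P) \<in> Ap q" if "P \<in> Bp q (fst q')" for P using that k by (simp add: Ap_def)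
  have w: "aw q [arc q (fst q') P] q'" if "P \<in> Bp q (fst q')" for P
    using arc_arcs[OF q A[OF that]] q'(1) by (simp add: arc_def aw_Cons aw_Nil E(3))
  show "as_path q q' (mr q q' M) \<in> Path q q'"
    unfolding e by (rule Path_sum) (rule Path_single[OF w])
  have one: "one_hm (fst q') \<xi> * P \<xi> = P \<xi>" if "P \<in> Bp q (fst q')" for P \<xi>
    using fid_mult[OF hm_fits[OF subsetD[OF sub that], of \<xi>]] hm_off[OF subsetD[OF sub that], of \<xi>] by (simp add: one_hm_def)
  have "path_eval q q' (as_path q q' (mr q q' M)) = (\<Sum>P\<in>Bp q (fst q'). psc (c (mr q q' P)) (psc (of_nat (dg (fst q'))) P))"
    unfolding e path_eval_simps
  proof (rule sum.cong)
    fix P assume P: "P \<in> Bp q (fst q')"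
    have "pencil (arc q (fst q') P) = P" by (rule pencil_arc_eq[OF q A[OF P]])
    moreover have "snd (snd (arc q (fst q') P)) = q'" by (simp add: arc_def E(3))
    ultimately have "cmp q [arc q (fst q') P] = psc (of_nat (dg (fst q'))) P"
      using one[OF P] by (simp add: fun_eq_iff)
    then show "path_eval q q' (Poly_Mapping.single (q, [arc q (fst q') P], q') (c (mr q q' P))) = psc (c (mr q q' P)) (psc (of_nat (dg (fst q'))) P)"
      by (simp add: path_eval_single)
  qed simp
  also have "\<dots> = psc (of_nat (dg (fst q'))) (\<Sum>P\<in>Bp q (fst q'). psc (c (mr q q' P)) P)"
    by (simp add: psc.scale_sum_right mult.commute)
  also have "\<dots> = psc (of_nat (dg (fst q'))) M" by (rule arg_cong[OF M_eq[symmetric]])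
  finally show "path_eval q q' (as_path q q' (mr q q' M)) = psc (of_nat (dg (fst q'))) M" .
qed

text \<open>Independence of the basis forces the coefficients picked by \<open>SOME\<close> to be
  one at \<open>P\<close> and zero elsewhere, so a basis morphism becomes its own arrow.\<close>

lemma as_path_basis:
  assumes q: "q \<in> Qhat_verts" and P: "(k, P) \<in> Ap q"
  shows "as_path q (nxt q k) (mr q (nxt q k) P) = Poly_Mapping.single (q, [arc q k P], nxt q k) 1"
proof -
  note kP = Ap_D[OF P]
  have PB: "P \<in> Bp q k" using P by (simp add: Ap_def)
  have q': "nxt q k \<in> Qhat_verts" "snd (nxt q k) = snd q + 1" using kP(3) by simp_all
  note E = E_Bp[OF q q', unfolded nxt_simps]
  interpret C: vs_iso psc "hm (fst q) k 1" "mr q (nxt q k)" "HomC q (nxt q k)" by (rule HomC_nxt_iso[OF q kP(1)])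
  have fin: "finite (Bp q k)" by (rule finite_Bp[OF q kP(1)])
  have sub: "Bp q k \<subseteq> hm (fst q) k 1" by (auto simp: Bp_def)
  have lc: "module.lincomb (HomC q (nxt q k)) c (E q (nxt q k)) = mr q (nxt q k) (\<Sum>P\<in>Bp q k. psc (c (mr q (nxt q k) P)) P)" for c
    unfolding E(1) by (rule C.lincomb_image[OF fin sub])
  define c where "c = (SOME c. mr q (nxt q k) P = module.lincomb (HomC q (nxt q k)) c (E q (nxt q k)))"
  define \<delta> where "\<delta> = (\<lambda>e. if e = mr q (nxt q k) P then 1 else 0 :: complex)"
  have d: "\<delta> (mr q (nxt q k) P') = (if P' = P then 1 else 0)" if "P' \<in> Bp q k" for P'
    using inj_on_eq_iff[OF E(2) that PB] by (simp add: \<delta>_def)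
  have Pd: "(\<Sum>P'\<in>Bp q k. psc (\<delta> (mr q (nxt q k) P')) P') = P"
  proof -
    have "(\<Sum>P'\<in>Bp q k. psc (\<delta> (mr q (nxt q k) P')) P') = (\<Sum>P'\<in>Bp q k. if P' = P then P' else 0)"
      by (rule sum.cong) (simp_all add: d)
    then show ?thesis using fin PB by simp
  qed
  have "mr q (nxt q k) P = module.lincomb (HomC q (nxt q k)) c (E q (nxt q k))"
    unfolding c_def by (rule someI[of _ \<delta>]) (simp only: lc Pd)
  then have "P = (\<Sum>P\<in>Bp q k. psc (c (mr q (nxt q k) P)) P)"
    unfolding lc by (rule inj_onD[OF C.h_inj]) (use PB sub in \<open>auto intro!: C.C_sum C.C_sc\<close>)
  then have "(\<Sum>P'\<in>Bp q k. psc (c (mr q (nxt q k) P')) P') - (\<Sum>P'\<in>Bp q k. psc (\<delta> (mr q (nxt q k) P')) P') = 0"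
    unfolding Pd by simp
  then have z: "(\<Sum>P'\<in>Bp q k. psc (c (mr q (nxt q k) P') - \<delta> (mr q (nxt q k) P')) P') = 0"
    by (simp add: sum_subtractf psc.scale_left_diff_distrib)
  have c: "c (mr q (nxt q k) P') = \<delta> (mr q (nxt q k) P')" if "P' \<in> Bp q k" for P'
  proof -
    have "(\<lambda>P'. c (mr q (nxt q k) P') - \<delta> (mr q (nxt q k) P')) P' = 0"
    proof (rule Bp_indep[OF q kP(1) fin order_refl _ that])
      show "(\<lambda>\<xi>. \<Sum>P\<in>Bp q k. (c (mr q (nxt q k) P) - \<delta> (mr q (nxt q k) P)) *\<^sub>F P \<xi>) = 0"
        unfolding z[symmetric] by (rule ext) simp
    qed
    then show ?thesis by simp
  qed
  have "as_path q (nxt q k) (mr q (nxt q k) P) = (\<Sum>P'\<in>Bp q k. Poly_Mapping.single (q, [arc q k P'], nxt q k) (c (mr q (nxt q k) P')))"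
    unfolding as_path_def Let_def unfolding c_def[symmetric] unfolding E(1) sum.reindex[OF E(2)] by (simp add: arc_def)
  also have "\<dots> = (\<Sum>P'\<in>Bp q k. if P' = P then Poly_Mapping.single (q, [arc q k P'], nxt q k) 1 else 0)"
    by (rule sum.cong) (simp_all add: c d)
  finally show ?thesis using fin PB by simp
qed

definition dual_path :: "'i \<times> int \<Rightarrow> 'i \<Rightarrow> (complex vec \<Rightarrow> fmat) \<Rightarrow> (('i \<times> int) qpath \<Rightarrow>\<^sub>0 complex)" where
  "dual_path q k P = as_path (nxt q k) (shift2 q) (dual_elem q (nxt q k) (mr q (nxt q k) P))"

lemma dual_path_props:
  assumes q: "q \<in> Qhat_verts" and P: "(k, P) \<in> Ap q"
  shows "dual_path q k P \<in> Path (nxt q k) (shift2 q)"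
    "path_eval (nxt q k) (shift2 q) (dual_path q k P) = psc (of_nat (dg (fst q)) * (of_nat (dg (fst q)) / (lam * of_nat (dg k)))) (sd q k P)"
proof -
  have v: "nxt q k \<in> Qhat_verts" "snd (shift2 q) = snd (nxt q k) + 1" using Ap_D[OF P] by simp_all
  have h: "psc (of_nat (dg (fst q)) / (lam * of_nat (dg k))) (sd q k P) \<in> hm (fst (nxt q k)) (fst (shift2 q)) 1"
    using hm_psc[OF sd_hm[OF q P]] by simp
  note r = as_path_arc[OF v(1) shift2_vert[OF q] v(2) h]
  show "dual_path q k P \<in> Path (nxt q k) (shift2 q)" unfolding dual_path_def dual_elem_mr[OF q P] by (rule r(1))
  show "path_eval (nxt q k) (shift2 q) (dual_path q k P) = psc (of_nat (dg (fst q)) * (of_nat (dg (fst q)) / (lam * of_nat (dg k)))) (sd q k P)"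
    unfolding dual_path_def dual_elem_mr[OF q P] r(2) by simp
qed

definition arrow :: "'i \<times> int \<Rightarrow> 'i \<Rightarrow> (complex vec \<Rightarrow> fmat) \<Rightarrow> (('i \<times> int) qpath \<Rightarrow>\<^sub>0 complex)" where
  "arrow q k P = Poly_Mapping.single (q, [arc q k P], nxt q k) 1"

lemma arrow_props:
  assumes q: "q \<in> Qhat_verts" and P: "(k, P) \<in> Ap q"
  shows "arrow q k P \<in> Path q (nxt q k)" "path_eval q (nxt q k) (arrow q k P) = psc (of_nat (dg k)) P"
  using as_path_arc[OF q Ap_D(3)[OF P], of P] Ap_D[OF P] as_path_basis[OF q P] by (simp_all add: arrow_def)

text \<open>The neighbours with nonzero \<open>num_edges\<close> are exactly the targets occurring
  in \<open>Ap q\<close>, so the double sum can be reindexed by \<open>Ap q\<close>.\<close>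

lemma theta_eq:
  assumes q: "q \<in> Qhat_verts"
  shows "\<theta> q = (\<Sum>(k, P)\<in>Ap q. path_mult (dual_path q k P) (arrow q k P))"
proof -
  define S where "S = {q'. q' \<in> Qhat_verts \<and> snd q' = snd q + 1 \<and> num_edges (fst q) (fst q') \<noteq> 0}"
  define T where "T = (\<lambda>q' e. path_mult (as_path q' (shift2 q) (dual_elem q q' e)) (as_path q q' e))"
  have S: "S = nxt q ` fst ` Ap q"
  proof
    show "S \<subseteq> nxt q ` fst ` Ap q"
    proof
      fix q' assume "q' \<in> S"
      then have q': "q' \<in> Qhat_verts" "snd q' = snd q + 1" and n: "num_edges (fst q) (fst q') \<noteq> 0" by (simp_all add: S_def)
      obtain P where "P \<in> Bp q (fst q')" using num_edges_nonzero[OF q q'] n by blast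
      then have "(fst q', P) \<in> Ap q" using vert_I[OF q'(1)] by (simp add: Ap_def)
      then have "fst q' \<in> fst ` Ap q" by (rule rev_image_eqI) simp
      then show "q' \<in> nxt q ` fst ` Ap q" by (rule rev_image_eqI) (simp add: E_Bp(3)[OF q q'])
    qed
    show "nxt q ` fst ` Ap q \<subseteq> S"
    proof
      fix q' assume "q' \<in> nxt q ` fst ` Ap q"
      then obtain k P where P: "(k, P) \<in> Ap q" and q': "q' = nxt q k" by auto
      have v: "nxt q k \<in> Qhat_verts" using Ap_D[OF P] by simp
      have "Bp q k \<noteq> {}" using P by (auto simp: Ap_def)
      then show "q' \<in> S" using num_edges_nonzero[OF q v] v by (simp add: S_def q')
    qed
  qed
  have fS: "finite S" unfolding S using finite_Ap[OF q] by simp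
  have EB: "E q q' = mr q q' ` Bp q (fst q')" "finite (E q q')" if "q' \<in> S" for q'
  proof -
    have q': "q' \<in> Qhat_verts" "snd q' = snd q + 1" using that by (simp_all add: S_def)
    show "E q q' = mr q q' ` Bp q (fst q')" by (rule E_Bp[OF q q'])
    then show "finite (E q q')" using finite_Bp[OF q vert_I[OF q'(1)]] by simp
  qed
  have "\<theta> q = (\<Sum>q'\<in>S. \<Sum>e\<in>E q q'. T q' e)" unfolding \<theta>_def S_def T_def ..
  also have "\<dots> = (\<Sum>(q', e)\<in>Sigma S (E q). T q' e)" using fS EB(2) by (intro sum.Sigma) auto
  also have "\<dots> = (\<Sum>x\<in>Ap q. case (nxt q (fst x), mr q (nxt q (fst x)) (snd x)) of (q', e) \<Rightarrow> T q' e)"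
  proof (rule sum.reindex_bij_betw[symmetric])
    show "bij_betw (\<lambda>x. (nxt q (fst x), mr q (nxt q (fst x)) (snd x))) (Ap q) (Sigma S (E q))"
      unfolding bij_betw_def
    proof
      show "inj_on (\<lambda>x. (nxt q (fst x), mr q (nxt q (fst x)) (snd x))) (Ap q)"
      proof (rule inj_onI, clarify)
        fix k P k' P' assume A: "(k, P) \<in> Ap q" "(k', P') \<in> Ap q" and n: "nxt q (fst (k, P)) = nxt q (fst (k', P'))"
          and m: "mr q (nxt q (fst (k, P))) (snd (k, P)) = mr q (nxt q (fst (k', P'))) (snd (k', P'))"
        have k: "k = k'" using n by (simp add: nxt_def)
        have v: "nxt q k \<in> Qhat_verts" "snd (nxt q k) = snd q + 1" using Ap_D[OF A(1)] by simp_all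
        have "P = P'"
          by (rule inj_onD[OF E_Bp(2)[OF q v]]) (use m A k in \<open>simp_all add: Ap_def\<close>)
        then show "k = k' \<and> P = P'" using k by simp
      qed
      show "(\<lambda>x. (nxt q (fst x), mr q (nxt q (fst x)) (snd x))) ` Ap q = Sigma S (E q)"
      proof
        show "(\<lambda>x. (nxt q (fst x), mr q (nxt q (fst x)) (snd x))) ` Ap q \<subseteq> Sigma S (E q)"
          using Ap_D(4)[of _ _ q] by (auto simp: S)
        show "Sigma S (E q) \<subseteq> (\<lambda>x. (nxt q (fst x), mr q (nxt q (fst x)) (snd x))) ` Ap q"
        proof clarify
          fix q' e assume q'S: "q' \<in> S" and e: "e \<in> E q q'"
          then have q': "q' \<in> Qhat_verts" "snd q' = snd q + 1" by (simp_all add: S_def)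
          obtain P where P: "P \<in> Bp q (fst q')" "e = mr q q' P" using e EB(1)[OF q'S] by blast
          have "(fst q', P) \<in> Ap q" using P(1) vert_I[OF q'(1)] by (simp add: Ap_def)
          then show "(q', e) \<in> (\<lambda>x. (nxt q (fst x), mr q (nxt q (fst x)) (snd x))) ` Ap q"
            by (rule rev_image_eqI) (simp add: E_Bp(3)[OF q q'] P(2))
        qed
      qed
    qed
  qed
  also have "\<dots> = (\<Sum>(k, P)\<in>Ap q. path_mult (dual_path q k P) (arrow q k P))"
  proof (rule sum.cong)
    fix x assume "x \<in> Ap q"
    then show "(case (nxt q (fst x), mr q (nxt q (fst x)) (snd x)) of (q', e) \<Rightarrow> T q' e) = (case x of (k, P) \<Rightarrow> path_mult (dual_path q k P) (arrow q k P))"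
      by (cases x) (simp add: T_def dual_path_def arrow_def as_path_basis[OF q])
  qed simp
  finally show ?thesis .
qed

text \<open>Consecutive Koszul maps compose to zero: the coefficients of the squares of the
  coordinates vanish, and in the mixed term an identity cancels against its negative.\<close>

lemma sd_sum_zero:
  assumes q: "q \<in> Qhat_verts"
  shows "(\<Sum>(k, P)\<in>Ap q. sd q k P \<xi> * P \<xi>) = 0"
proof (cases "\<xi> \<in> PV")
  case True
  have "(\<Sum>(k, P)\<in>Ap q. sd q k P \<xi> * P \<xi>) = (\<Sum>(k, P)\<in>Ap q.
      (\<xi> $ 0 * \<xi> $ 0) *\<^sub>F (b0 (sd q k P) * b0 P) + (\<xi> $ 0 * \<xi> $ 1) *\<^sub>F (b0 (sd q k P) * b1 P + b1 (sd q k P) * b0 P)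
      + (\<xi> $ 1 * \<xi> $ 1) *\<^sub>F (b1 (sd q k P) * b1 P))"
  proof (rule sum.cong, simp, clarify)
    fix k P assume P: "(k, P) \<in> Ap q"
    show "sd q k P \<xi> * P \<xi> = (\<xi> $ 0 * \<xi> $ 0) *\<^sub>F (b0 (sd q k P) * b0 P) + (\<xi> $ 0 * \<xi> $ 1) *\<^sub>F (b0 (sd q k P) * b1 P + b1 (sd q k P) * b0 P)
      + (\<xi> $ 1 * \<xi> $ 1) *\<^sub>F (b1 (sd q k P) * b1 P)"
      unfolding PM_1[OF hm_PM[OF sd_hm[OF q P]] True] PM_1[OF hm_PM[OF Ap_D(2)[OF P]] True]
      by (simp add: distrib_left distrib_right fsc.scale_right_distrib mult.commute add_ac)
  qed
  also have "\<dots> = (\<xi> $ 0 * \<xi> $ 0) *\<^sub>F (\<Sum>(k, P)\<in>Ap q. b0 (sd q k P) * b0 P)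
      + (\<xi> $ 0 * \<xi> $ 1) *\<^sub>F ((\<Sum>(k, P)\<in>Ap q. b0 (sd q k P) * b1 P) + (\<Sum>(k, P)\<in>Ap q. b1 (sd q k P) * b0 P))
      + (\<xi> $ 1 * \<xi> $ 1) *\<^sub>F (\<Sum>(k, P)\<in>Ap q. b1 (sd q k P) * b1 P)"
    by (simp add: case_prod_unfold sum.distrib fsc.scale_sum_right fsc.scale_right_distrib)
  also have "\<dots> = 0" by (simp add: sd_sums[OF q])
  finally show ?thesis .
next
  case False
  show ?thesis
  proof (rule sum.neutral, clarify)
    fix k P assume "(k, P) \<in> Ap q"
    from hm_off[OF Ap_D(2)[OF this] False] show "sd q k P \<xi> * P \<xi> = 0" by simp
  qed
qed

lemma theta_Path: "q \<in> Qhat_verts \<Longrightarrow> \<theta> q \<in> Path q (shift2 q)"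
  unfolding theta_eq by (rule Path_sum) (auto intro: path_mult_Path dual_path_props arrow_props)

lemma path_eval_theta:
  assumes q: "q \<in> Qhat_verts"
  shows "path_eval s t (\<theta> q) = 0"
proof (cases "s = q \<and> t = shift2 q")
  case True
  \<comment> \<open>With \<open>i = fst q\<close>, the dual path contributes
    \<open>dg i * dg i / (lam * dg k)\<close> and the arrow \<open>dg k\<close>. The dimension of
    the neighbour cancels, so all summands share the factor \<open>d\<close>.\<close>
  define d where "d = (of_nat (dg (fst q)) * of_nat (dg (fst q)) / lam :: complex)"
  have "path_eval q (shift2 q) (\<theta> q) \<xi> = d *\<^sub>F (\<Sum>(k, P)\<in>Ap q. sd q k P \<xi> * P \<xi>)" for \<xi>
  proof -
    have "path_eval q (shift2 q) (\<theta> q) \<xi> = (\<Sum>x\<in>Ap q. path_eval q (shift2 q) (path_mult (dual_path q (fst x) (snd x)) (arrow q (fst x) (snd x))) \<xi>)"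
      unfolding theta_eq[OF q] case_prod_unfold by simp
    also have "\<dots> = (\<Sum>x\<in>Ap q. d *\<^sub>F (sd q (fst x) (snd x) \<xi> * snd x \<xi>))"
    proof (rule sum.cong, simp, clarify)
      fix k P assume P: "(k, P) \<in> Ap q"
      have dk: "(of_nat (dg k) :: complex) \<noteq> 0" using dg_pos[OF Ap_D(1)[OF P]] by simp
      show "path_eval q (shift2 q) (path_mult (dual_path q (fst (k, P)) (snd (k, P))) (arrow q (fst (k, P)) (snd (k, P)))) \<xi> = d *\<^sub>F (sd q (fst (k, P)) (snd (k, P)) \<xi> * snd (k, P) \<xi>)"
        using dk by (simp add: path_eval_mult_left[OF dual_path_props(1)[OF q P] subsetD[OF Path_path_space arrow_props(1)[OF q P]]] dual_path_props[OF q P] arrow_props[OF q P] d_def)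
    qed
    finally show ?thesis by (simp add: case_prod_unfold fsc.scale_sum_right)
  qed
  then show ?thesis using True sd_sum_zero[OF q] by (simp add: fun_eq_iff)
qed (rule path_eval_off[OF theta_Path[OF q]])


section \<open>Paths modulo the relations\<close>

lemma path_eval_arrow:
  assumes u: "u \<in> Qhat_verts" and P: "(k, P) \<in> Ap u" and b: "b \<in> Path (nxt u k) v"
  shows "path_eval u v (path_mult b (arrow u k P)) \<xi> = of_nat (dg k) *\<^sub>F (path_eval (nxt u k) v b \<xi> * P \<xi>)"
  using path_eval_mult_left[OF b subsetD[OF Path_path_space arrow_props(1)[OF u P]], of u v \<xi>] by (simp add: arrow_props(2)[OF u P])

text \<open>Induction on the degree. In degree zero Schur's lemma leaves multiples of the trivial
  path; in positive degree the matrix is factored through the arrows out of \<open>u\<close>, and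
  the cofactors are lifted by induction. In negative degree the matrix is zero.\<close>

lemma path_eval_surj:
  assumes v: "v \<in> Qhat_verts" and "u \<in> Qhat_verts" "M \<in> hq u v"
  shows "\<exists>a. a \<in> Path u v \<and> path_eval u v a = M"
proof (cases "snd u \<le> snd v")
  case True
  have "\<exists>a. a \<in> Path u v \<and> path_eval u v a = M" if "snd v = snd u + int n" "u \<in> Qhat_verts" "M \<in> hq u v" for n u M
    using that
  proof (induction n arbitrary: u M)
    case 0
    then have M: "M \<in> hm (fst u) (fst v) 0" by simp
    show ?case
    proof (cases "fst u = fst v")
      case True
      then have uv: "u = v" using 0 by (simp add: prod_eq_iff)
      have "M \<in> hm (fst v) (fst v) 0" using M uv by simp
      from hm_0_eq[OF this vert_I[OF v]] obtain c where c: "M = (\<lambda>\<xi>. c *\<^sub>F one_hm (fst v) \<xi>)" by (rule exE)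
      have "aw v [] v" using v by (simp add: aw_Nil)
      then have "Poly_Mapping.single (v, [], v) c \<in> Path u v" unfolding uv by (rule Path_single)
      moreover have "path_eval u v (Poly_Mapping.single (v, [], v) c) = M" by (simp add: uv c path_eval_single psc_def)
      ultimately show ?thesis by (intro exI conjI)
    next
      case False
      then have "M = 0" by (rule hm_0_neq[OF M vert_I[OF 0(2)] vert_I[OF v]])
      then show ?thesis by (intro exI[of _ 0]) simp
    qed
  next
    case (Suc n)
    have N: "snd v - snd u \<noteq> 0" using Suc.prems(1) by simp
    show ?case
    proof (rule hm_factor[OF vert_I[OF Suc.prems(2)] vert_I[OF v] Suc.prems(3) N finite_Ap[OF Suc.prems(2)], where S = "sd u"])
      show "k \<in> I \<and> P \<in> hm (fst u) k 1 \<and> sd u k P \<in> hm k (fst u) 1" if "(k, P) \<in> Ap u" for k P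
        using Ap_D[OF that] sd_hm[OF Suc.prems(2) that] by simp
      fix \<psi> assume \<psi>: "\<And>k P. (k, P) \<in> Ap u \<Longrightarrow> \<psi> k P \<in> hm k (fst v) (snd v - snd u - 1)"
        and M: "M = (\<lambda>\<xi>. \<Sum>(k, P)\<in>Ap u. \<psi> k P \<xi> * P \<xi>)"
      \<comment> \<open>The division by \<open>dg (fst x)\<close> offsets the weight of the arrow
        multiplied on the right.\<close>
      have "\<forall>x\<in>Ap u. \<exists>b. b \<in> Path (nxt u (fst x)) v \<and> path_eval (nxt u (fst x)) v b = psc (1 / of_nat (dg (fst x))) (\<psi> (fst x) (snd x))"
      proof
        fix x assume "x \<in> Ap u"
        then have x: "(fst x, snd x) \<in> Ap u" by simp
        have "psc (1 / of_nat (dg (fst x))) (\<psi> (fst x) (snd x)) \<in> hq (nxt u (fst x)) v"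
          using hm_psc[OF \<psi>[OF x]] by (simp add: diff_diff_eq)
        moreover have "snd v = snd (nxt u (fst x)) + int n" using Suc.prems(1) by simp
        ultimately show "\<exists>b. b \<in> Path (nxt u (fst x)) v \<and> path_eval (nxt u (fst x)) v b = psc (1 / of_nat (dg (fst x))) (\<psi> (fst x) (snd x))"
          by (intro Suc.IH Ap_D(3)[OF x])
      qed
      from bchoice[OF this] obtain b where b: "\<forall>x\<in>Ap u. b x \<in> Path (nxt u (fst x)) v \<and> path_eval (nxt u (fst x)) v (b x) = psc (1 / of_nat (dg (fst x))) (\<psi> (fst x) (snd x))"
        by (rule exE)
      let ?a = "\<Sum>x\<in>Ap u. path_mult (b x) (arrow u (fst x) (snd x))"
      have "?a \<in> Path u v"
        by (rule Path_sum) (use b arrow_props(1)[OF Suc.prems(2)] in \<open>auto intro!: path_mult_Path\<close>)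
      moreover have "path_eval u v ?a = M"
      proof
        fix \<xi>
        have "path_eval u v ?a \<xi> = (\<Sum>x\<in>Ap u. path_eval u v (path_mult (b x) (arrow u (fst x) (snd x))) \<xi>)" by simp
        also have "\<dots> = (\<Sum>x\<in>Ap u. \<psi> (fst x) (snd x) \<xi> * snd x \<xi>)"
        proof (rule sum.cong)
          fix x assume xA: "x \<in> Ap u"
          then have x: "(fst x, snd x) \<in> Ap u" by simp
          have dk: "(of_nat (dg (fst x)) :: complex) \<noteq> 0" using dg_pos[OF Ap_D(1)[OF x]] by simp
          show "path_eval u v (path_mult (b x) (arrow u (fst x) (snd x))) \<xi> = \<psi> (fst x) (snd x) \<xi> * snd x \<xi>"
            using path_eval_arrow[OF Suc.prems(2) x conjunct1[OF bspec[OF b xA]], of \<xi>] bspec[OF b xA] dk by simp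
        qed simp
        finally show "path_eval u v ?a \<xi> = M \<xi>" by (simp add: M case_prod_unfold)
      qed
      ultimately show ?thesis by (intro exI conjI)
    qed (rule sd_sums[OF Suc.prems(2)])+
  qed
  from this[OF _ assms(2,3), of "nat (snd v - snd u)"] show ?thesis using True by simp
next
  case False
  then have "M = 0" using hm_neg[OF assms(3)] by simp
  then show ?thesis by (intro exI[of _ 0]) simp
qed

text \<open>Every path between vertices of different degree starts with an arrow, and the terms are
  sorted by this arrow.\<close>

lemma path_decomposition:
  assumes u: "u \<in> Qhat_verts" and a: "a \<in> Path u v" and uv: "snd v \<noteq> snd u"
  shows "\<exists>b. (\<forall>x\<in>Ap u. b x \<in> Path (nxt u (fst x)) v) \<and> a = (\<Sum>x\<in>Ap u. path_mult (b x) (arrow u (fst x) (snd x)))"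
proof -
  define Q where "Q = (\<lambda>a b. (\<forall>x\<in>Ap u. b x \<in> Path (nxt u (fst x)) v) \<and> a = (\<Sum>x\<in>Ap u. path_mult (b x) (arrow u (fst x) (snd x))))"
  have "\<exists>b. Q a b"
  proof (rule pm_induct[of "\<lambda>a. \<exists>b. Q a b" a])
    show "\<exists>b. Q 0 b" by (rule exI[of _ "\<lambda>_. 0"]) (simp add: Q_def)
    fix a a' assume "\<exists>b. Q a b" "\<exists>b. Q a' b"
    then obtain b b' where b: "Q a b" "Q a' b'" by (elim exE)
    have "Q (a + a') (\<lambda>x. b x + b' x)"
      using b by (simp add: Q_def Path_add path_mult_add_left sum.distrib)
    then show "\<exists>b. Q (a + a') b" by (rule exI[of "Q (a + a')"])
  next
    fix x and c :: complex assume x: "x \<in> Poly_Mapping.keys a"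
    obtain p where p: "x = (u, p, v)" "aw u p v"
      by (rule that[of "fst (snd x)"]) (use a x in \<open>auto simp: Path_iff prod_eq_iff\<close>)
    obtain e w p' where p': "p = (u, e, w) # p'" "(u, e, w) \<in> arcs Qhat" "aw w p' v"
    proof (cases p)
      case Nil
      then show ?thesis using p(2) uv by (simp add: aw_Nil)
    next
      case (Cons a p')
      obtain t e w where "a = (t, e, w)" by (cases a)
      then show ?thesis using that[of e w p'] p(2) by (simp add: Cons aw_Cons)
    qed
    define x0 where "x0 = (fst w, pencil (u, e, w))"
    have x0: "x0 \<in> Ap u" "nxt u (fst x0) = w" "arc u (fst x0) (snd x0) = (u, e, w)"
      using pencil_arc[OF p'(2)] by (simp_all add: x0_def arc_def)
    define b where "b = (\<lambda>y. if y = x0 then Poly_Mapping.single (w, p', v) c else 0)"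
    have "(\<Sum>y\<in>Ap u. path_mult (b y) (arrow u (fst y) (snd y))) =
        (\<Sum>y\<in>Ap u. if y = x0 then path_mult (Poly_Mapping.single (w, p', v) c) (arrow u (fst y) (snd y)) else 0)"
      by (rule sum.cong) (simp_all add: b_def)
    also have "\<dots> = Poly_Mapping.single x c"
      using finite_Ap[OF u] x0 by (simp add: arrow_def path_mult_single path_mult1_def p(1) p'(1))
    finally have "Q (Poly_Mapping.single x c) b"
      using Path_single[OF p'(3)] x0 by (simp add: Q_def b_def)
    then show "\<exists>b. Q (Poly_Mapping.single x c) b" by (rule exI[of "Q (Poly_Mapping.single x c)"])
  qed
  then show ?thesis unfolding Q_def .
qed

section \<open>Two-sided ideals and the kernel of the evaluation\<close>

lemma two_sided_ideal_iff:
  "two_sided_ideal T \<longleftrightarrow> T \<subseteq> path_space \<and> 0 \<in> T \<and> (\<forall>a\<in>T. \<forall>b\<in>T. a + b \<in> T) \<and> (\<forall>c. \<forall>a\<in>T. ps c a \<in> T) \<and>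
    (\<forall>a\<in>path_space. \<forall>x\<in>T. path_mult a x \<in> T \<and> path_mult x a \<in> T)"
proof -
  interpret A: vs_iso ps path_space "\<lambda>a. a" path_algebra by (rule vs_path_algebra)
  have m: "Module.module class_ring path_algebra" using A.vectorspace_W by (rule vectorspace.axioms(1))
  show ?thesis
    unfolding two_sided_ideal_def VectorSpace.subspace_def submodule_def
    by (simp add: A.vectorspace_W m class_ring_simps Ball_def) iprover
qed

definition eval_kernel :: "(('i \<times> int) qpath \<Rightarrow>\<^sub>0 complex) set" where
  "eval_kernel = {a \<in> path_space. \<forall>s t. path_eval s t a = 0}"

lemma eval_kernel_D: "x \<in> eval_kernel \<Longrightarrow> x \<in> path_space" "x \<in> eval_kernel \<Longrightarrow> path_eval s t x = 0"
  unfolding eval_kernel_def by blast+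

text \<open>The evaluation is multiplicative. As the \<open>\<theta> q\<close> evaluate to zero,
  minimality of the hull will put \<open>preproj_ideal\<close> inside this kernel.\<close>

lemma eval_kernel_ideal: "two_sided_ideal eval_kernel"
  unfolding two_sided_ideal_iff
proof (intro conjI ballI allI)
  fix a x assume a: "a \<in> path_space" and x: "x \<in> eval_kernel"
  have xp: "x \<in> path_space" "path_eval s t x = 0" for s t by (rule eval_kernel_D[OF x])+
  have "path_eval s t (path_mult a x) = 0" for s t
  proof (rule pm_induct[of "\<lambda>a. path_eval s t (path_mult a x) = 0" a])
    fix y c assume y: "y \<in> Poly_Mapping.keys a"
    have "aw (fst y) (fst (snd y)) (snd (snd y))" using a y by (simp add: path_space_def)
    from Path_single[OF this, of c] have y: "Poly_Mapping.single y c \<in> Path (fst y) (snd (snd y))" by simp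
    show "path_eval s t (path_mult (Poly_Mapping.single y c) x) = 0"
      by (rule ext) (simp add: path_eval_mult_left[OF y xp(1)] xp(2))
  qed (simp_all add: path_mult_add_left)
  then show "path_mult a x \<in> eval_kernel" using path_mult_path_space[OF a xp(1)] by (simp add: eval_kernel_def)
  have "path_eval s t (path_mult x a) = 0" for s t
  proof (rule pm_induct[of "\<lambda>a. path_eval s t (path_mult x a) = 0" a])
    fix y c assume y: "y \<in> Poly_Mapping.keys a"
    have "aw (fst y) (fst (snd y)) (snd (snd y))" using a y by (simp add: path_space_def)
    from Path_single[OF this, of c] have y: "Poly_Mapping.single y c \<in> Path (fst y) (snd (snd y))" by simp
    show "path_eval s t (path_mult x (Poly_Mapping.single y c)) = 0"
      by (rule ext) (simp add: path_eval_mult_right[OF xp(1) y] xp(2))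
  qed (simp_all add: path_mult_add_right)
  then show "path_mult x a \<in> eval_kernel" using path_mult_path_space[OF xp(1) a] by (simp add: eval_kernel_def)
qed (auto simp: eval_kernel_def path_space_add path_space_ps)

lemma theta_eval_kernel: "\<theta> ` Qhat_verts \<subseteq> eval_kernel"
proof clarify
  fix i n assume q: "(i, n) \<in> Qhat_verts"
  show "\<theta> (i, n) \<in> eval_kernel" unfolding eval_kernel_def using subsetD[OF Path_path_space theta_Path[OF q]] path_eval_theta[OF q] by blast
qed

lemma preproj_eval_kernel: "preproj_ideal \<subseteq> eval_kernel"
  unfolding preproj_ideal_def by (rule hull_minimal[of "\<theta> ` Qhat_verts" eval_kernel two_sided_ideal, OF theta_eval_kernel eval_kernel_ideal])

text \<open>The closure conditions pass to intersections of ideals; the ideal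
  \<open>eval_kernel\<close> keeps the intersection inside \<open>path_space\<close>.\<close>

lemma preproj_ideal: "two_sided_ideal preproj_ideal"
proof -
  have m: "x \<in> preproj_ideal \<longleftrightarrow> (\<forall>T. two_sided_ideal T \<and> \<theta> ` Qhat_verts \<subseteq> T \<longrightarrow> x \<in> T)" for x
    by (simp add: preproj_ideal_def hull_def)
  have T: "T \<subseteq> path_space" "0 \<in> T" "\<And>a b. a \<in> T \<Longrightarrow> b \<in> T \<Longrightarrow> a + b \<in> T" "\<And>c a. a \<in> T \<Longrightarrow> ps c a \<in> T"
    "\<And>a x. a \<in> path_space \<Longrightarrow> x \<in> T \<Longrightarrow> path_mult a x \<in> T" "\<And>a x. a \<in> path_space \<Longrightarrow> x \<in> T \<Longrightarrow> path_mult x a \<in> T"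
    if "two_sided_ideal T \<and> \<theta> ` Qhat_verts \<subseteq> T" for T
    using conjunct1[OF that] unfolding two_sided_ideal_iff by (elim conjE, simp)+
  show ?thesis
    unfolding two_sided_ideal_iff
  proof (intro conjI ballI allI)
    show "preproj_ideal \<subseteq> path_space" using preproj_eval_kernel by (auto simp: eval_kernel_def)
    show "0 \<in> preproj_ideal" using T(2) by (simp add: m)
    show "a + b \<in> preproj_ideal" if "a \<in> preproj_ideal" "b \<in> preproj_ideal" for a b using that T(3) by (simp add: m)
    show "ps c a \<in> preproj_ideal" if "a \<in> preproj_ideal" for c a using that T(4) by (simp add: m)
    show "path_mult a x \<in> preproj_ideal" "path_mult x a \<in> preproj_ideal" if "a \<in> path_space" "x \<in> preproj_ideal" for a x
      using that T(5,6) by (simp_all add: m)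
  qed
qed

lemma theta_preproj: "q \<in> Qhat_verts \<Longrightarrow> \<theta> q \<in> preproj_ideal"
  unfolding preproj_ideal_def using hull_subset[of "\<theta> ` Qhat_verts" two_sided_ideal] by blast

lemma
  shows preproj_zero: "0 \<in> preproj_ideal" and preproj_add: "a \<in> preproj_ideal \<Longrightarrow> b \<in> preproj_ideal \<Longrightarrow> a + b \<in> preproj_ideal"
    and preproj_ps: "a \<in> preproj_ideal \<Longrightarrow> ps c a \<in> preproj_ideal"
    and preproj_left: "r \<in> path_space \<Longrightarrow> a \<in> preproj_ideal \<Longrightarrow> path_mult r a \<in> preproj_ideal"
    and preproj_right: "r \<in> path_space \<Longrightarrow> a \<in> preproj_ideal \<Longrightarrow> path_mult a r \<in> preproj_ideal"
  using preproj_ideal unfolding two_sided_ideal_iff by (elim conjE, simp)+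

lemma preproj_sum: "(\<And>i. i \<in> F \<Longrightarrow> f i \<in> preproj_ideal) \<Longrightarrow> sum f F \<in> preproj_ideal"
  by (induction F rule: infinite_finite_induct) (simp_all add: preproj_zero preproj_add)

lemma preproj_uminus: "a \<in> preproj_ideal \<Longrightarrow> - a \<in> preproj_ideal"
  using preproj_ps[of a "-1"] by simp

lemma preproj_diff: "a \<in> preproj_ideal \<Longrightarrow> b \<in> preproj_ideal \<Longrightarrow> a - b \<in> preproj_ideal"
  using preproj_add[OF _ preproj_uminus, of a b] by simp

text \<open>Write \<open>a\<close> as a sum of products of cofactors \<open>b x\<close> with arrows.
  As \<open>a\<close> evaluates to zero, the weighted values of the cofactors form a syzygy, so they
  are \<open>C * sd u k P\<close> for one matrix \<open>C\<close>. Lift a multiple of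
  \<open>C\<close> to a combination of paths \<open>d\<close>. Subtracting \<open>d\<close> times
  \<open>\<theta> u\<close> leaves cofactors that evaluate to zero and start one degree later, so
  they lie in the ideal by induction.\<close>

lemma path_eval_kernel:
  assumes v: "v \<in> Qhat_verts" and u: "u \<in> Qhat_verts" and a: "a \<in> Path u v" and 0: "path_eval u v a = 0"
  shows "a \<in> preproj_ideal"
proof -
  have neg: "a = 0" if "a \<in> Path u v" "snd v < snd u" for a u
  proof -
    have "Poly_Mapping.keys a = {}"
    proof (rule equals0I)
      fix x assume "x \<in> Poly_Mapping.keys a"
      then have "aw u (fst (snd x)) v" using that(1) by (simp add: Path_iff)
      from aw_length[OF this] show False using that(2) by simp
    qed
    then show ?thesis by simp
  qed
  \<comment> \<open>The strict bound makes \<open>n = 0\<close> the range where no path exists, so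
    trivial paths are handled inside the induction step.\<close>
  have "a \<in> preproj_ideal" if "snd v < snd u + int n" "u \<in> Qhat_verts" "a \<in> Path u v" "path_eval u v a = 0" for n u a
    using that
  proof (induction n arbitrary: u a)
    case 0
    then show ?case using neg[of a u] preproj_zero by simp
  next
    case (Suc n)
    note u = Suc.prems(2) and a = Suc.prems(3)
    consider "snd v < snd u" | "snd v = snd u" | "snd v > snd u" by linarith
    then show ?case
    proof cases
      case 1
      then show ?thesis using neg[OF a] preproj_zero by simp
    next
      case 2
      \<comment> \<open>Between vertices of equal degree there are only trivial paths, which
        evaluate to multiples of an identity matrix of nonzero size.\<close>
      have x: "x = (u, [], u) \<and> u = v" if "x \<in> Poly_Mapping.keys a" for x
      proof -
        have x: "fst x = u" "snd (snd x) = v" "aw u (fst (snd x)) v" using a that by (simp_all add: Path_iff)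
        have "fst (snd x) = []" using aw_length[OF x(3)] 2 by simp
        then show ?thesis using x by (simp add: aw_Nil prod_eq_iff)
      qed
      have "Poly_Mapping.keys a = {}"
      proof (rule ccontr)
        assume "Poly_Mapping.keys a \<noteq> {}"
        then obtain y where "y \<in> Poly_Mapping.keys a" by blast
        then have uv: "u = v" and y: "(u, [], u) \<in> Poly_Mapping.keys a" using x[of y] by simp_all
        define c where "c = Poly_Mapping.lookup a (u, [], u)"
        have a_eq: "a = Poly_Mapping.single (u, [], u) c"
        proof (rule poly_mapping_eqI)
          fix z show "Poly_Mapping.lookup a z = Poly_Mapping.lookup (Poly_Mapping.single (u, [], u) c) z"
            using x[of z] by (cases "z = (u, [], u)") (auto simp: c_def lookup_single in_keys_iff)
        qed
        have "path_eval u u (Poly_Mapping.single (u, [], u) c) = psc c (one_hm (fst u))" by (simp add: path_eval_single)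
        then have "psc c (one_hm (fst u)) = 0" using Suc.prems(4) unfolding uv[symmetric] a_eq by (simp only:)
        from arg_cong[OF fun_cong[OF this, of "v2 1 0"], of "\<lambda>A. ent A 0 0"]
        have "c = 0" using dg_pos[OF vert_I[OF u]] by (simp add: one_hm_def)
        then show False using y by (simp add: c_def in_keys_iff)
      qed
      then show ?thesis using preproj_zero by simp
    next
      case 3
      obtain b where b: "\<forall>x\<in>Ap u. b x \<in> Path (nxt u (fst x)) v"
        and ab: "a = (\<Sum>x\<in>Ap u. path_mult (b x) (arrow u (fst x) (snd x)))"
        using path_decomposition[OF u a not_sym[OF less_imp_neq[OF 3]]] by (elim exE conjE)
      define \<psi> where "\<psi> = (\<lambda>k P. psc (of_nat (dg k)) (path_eval (nxt u k) v (b (k, P))))"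
      show ?thesis
      proof (rule hm_syzygy[OF vert_I[OF u] vert_I[OF v] finite_Ap[OF u], where S = "sd u" and \<psi> = \<psi> and N = "snd v - snd u - 1"])
        show "k \<in> I \<and> P \<in> hm (fst u) k 1 \<and> sd u k P \<in> hm k (fst u) 1" if "(k, P) \<in> Ap u" for k P
          using Ap_D[OF that] sd_hm[OF u that] by simp
        show "br P' (sd u k P) = (if k = k' \<and> P = P' then fid (dg k) else 0)" if "(k, P) \<in> Ap u" "(k', P') \<in> Ap u" for k P k' P'
          by (rule sd_orth[OF u that])
        show "\<psi> k P \<in> hm k (fst v) (snd v - snd u - 1)" if "(k, P) \<in> Ap u" for k P
          using hm_psc[OF path_eval_hm[OF bspec[OF b that]]] by (simp add: \<psi>_def diff_diff_eq)
        show "(\<Sum>(k, P)\<in>Ap u. \<psi> k P \<xi> * P \<xi>) = 0" for \<xi>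
        proof -
          have "(\<Sum>x\<in>Ap u. \<psi> (fst x) (snd x) \<xi> * snd x \<xi>) = (\<Sum>x\<in>Ap u. path_eval u v (path_mult (b x) (arrow u (fst x) (snd x))) \<xi>)"
          proof (rule sum.cong)
            fix x assume xA: "x \<in> Ap u"
            then have x: "(fst x, snd x) \<in> Ap u" by simp
            show "\<psi> (fst x) (snd x) \<xi> * snd x \<xi> = path_eval u v (path_mult (b x) (arrow u (fst x) (snd x))) \<xi>"
              unfolding path_eval_arrow[OF u x bspec[OF b xA]] by (simp add: \<psi>_def)
          qed simp
          also have "\<dots> = path_eval u v a \<xi>" unfolding ab by simp
          finally show ?thesis using Suc.prems(4) by (simp add: case_prod_unfold)
        qed
        fix C assume C: "C \<in> hm (fst u) (fst v) (snd v - snd u - 1 - 1)" and \<psi>C: "\<And>k P. (k, P) \<in> Ap u \<Longrightarrow> \<psi> k P = (\<lambda>\<xi>. C \<xi> * sd u k P \<xi>)"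
        \<comment> \<open>The inverse of the common factor of the summands of
          \<open>\<theta> u\<close>: with it, \<open>d\<close> times the dual path to
          \<open>k\<close> evaluates to \<open>C * sd u k P\<close> divided by \<open>dg k\<close>,
          exactly like the cofactor \<open>b x\<close>.\<close>
        define s where "s = lam / (of_nat (dg (fst u)) * of_nat (dg (fst u)))"
        have n: "snd v - snd u - 1 - 1 = snd v - snd (shift2 u)" by simp
        have "psc s C \<in> hq (shift2 u) v" using hm_psc[OF C, unfolded n] by simp
        from path_eval_surj[OF v shift2_vert[OF u] this] obtain d where d: "d \<in> Path (shift2 u) v" "path_eval (shift2 u) v d = psc s C"
          by (elim exE conjE)
        define e where "e = (\<lambda>x. b x - path_mult d (dual_path u (fst x) (snd x)))"
        have e: "e x \<in> preproj_ideal" if xA: "x \<in> Ap u" for x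
        proof (rule Suc.IH)
          have x: "(fst x, snd x) \<in> Ap u" using xA by simp
          have bx: "b x \<in> Path (nxt u (fst x)) v" using b xA by simp
          show "snd v < snd (nxt u (fst x)) + int n" using Suc.prems(1) by simp
          show "nxt u (fst x) \<in> Qhat_verts" by (rule Ap_D[OF x])
          show "e x \<in> Path (nxt u (fst x)) v"
            unfolding e_def by (rule Path_diff[OF bx path_mult_Path[OF d(1) dual_path_props(1)[OF u x]]])
          have di: "(of_nat (dg (fst u)) :: complex) \<noteq> 0" and dk: "(of_nat (dg (fst x)) :: complex) \<noteq> 0"
            using dg_pos[OF vert_I[OF u]] dg_pos[OF Ap_D(1)[OF x]] by simp_all
          have "path_eval (nxt u (fst x)) v (path_mult d (dual_path u (fst x) (snd x))) \<xi> = path_eval (nxt u (fst x)) v (b x) \<xi>" for \<xi>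
          proof -
            have "of_nat (dg (fst x)) *\<^sub>F path_eval (nxt u (fst x)) v (b x) \<xi> = C \<xi> * sd u (fst x) (snd x) \<xi>"
              using fun_cong[OF \<psi>C[OF x], of \<xi>] by (simp add: \<psi>_def)
            then have "(1 / of_nat (dg (fst x))) *\<^sub>F (of_nat (dg (fst x)) *\<^sub>F path_eval (nxt u (fst x)) v (b x) \<xi>) = (1 / of_nat (dg (fst x))) *\<^sub>F (C \<xi> * sd u (fst x) (snd x) \<xi>)"
              by (rule arg_cong)
            then have "path_eval (nxt u (fst x)) v (b x) \<xi> = (1 / of_nat (dg (fst x))) *\<^sub>F (C \<xi> * sd u (fst x) (snd x) \<xi>)"
              using dk by simp
            moreover have "s * (of_nat (dg (fst u)) * (of_nat (dg (fst u)) / (lam * of_nat (dg (fst x))))) = 1 / of_nat (dg (fst x))"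
              using di ev_entries(4) by (simp add: s_def)
            ultimately show ?thesis
              using path_eval_mult_left[OF d(1) subsetD[OF Path_path_space dual_path_props(1)[OF u x]], of "nxt u (fst x)" v \<xi>] by (simp add: d(2) dual_path_props(2)[OF u x] mult.commute)
          qed
          then have "path_eval (nxt u (fst x)) v (path_mult d (dual_path u (fst x) (snd x))) = path_eval (nxt u (fst x)) v (b x)" by (rule ext)
          then show "path_eval (nxt u (fst x)) v (e x) = 0" by (simp add: e_def)
        qed
        have "path_mult d (\<theta> u) = (\<Sum>x\<in>Ap u. path_mult (path_mult d (dual_path u (fst x) (snd x))) (arrow u (fst x) (snd x)))"
          unfolding theta_eq[OF u] case_prod_unfold path_mult_sum_right path_mult_assoc ..
        then have "a = (\<Sum>x\<in>Ap u. path_mult (e x) (arrow u (fst x) (snd x))) + path_mult d (\<theta> u)"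
          by (simp add: ab e_def path_mult_diff_left sum_subtractf)
        moreover have "(\<Sum>x\<in>Ap u. path_mult (e x) (arrow u (fst x) (snd x))) \<in> preproj_ideal"
        proof (rule preproj_sum)
          fix x assume xA: "x \<in> Ap u"
          then have x: "(fst x, snd x) \<in> Ap u" by simp
          show "path_mult (e x) (arrow u (fst x) (snd x)) \<in> preproj_ideal"
            by (rule preproj_right[OF subsetD[OF Path_path_space arrow_props(1)[OF u x]] e[OF xA]])
        qed
        moreover have "path_mult d (\<theta> u) \<in> preproj_ideal"
          by (rule preproj_left[OF subsetD[OF Path_path_space d(1)] theta_preproj[OF u]])
        ultimately show "a \<in> preproj_ideal" using preproj_add by simp
      qed
    qed
  qed
  from this[OF _ u a 0, of "nat (snd v - snd u + 1)"] show ?thesis by simp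
qed

section \<open>The isomorphism\<close>

abbreviation coset :: "(('i \<times> int) qpath \<Rightarrow>\<^sub>0 complex) \<Rightarrow> (('i \<times> int) qpath \<Rightarrow>\<^sub>0 complex) set" where
  "coset a \<equiv> preproj_ideal +>\<^bsub>path_algebra\<^esub> a"

lemma coset_eq: "coset a = (\<lambda>h. h + a) ` preproj_ideal"
  by (auto simp: a_r_coset_def')

lemma coset_iff: "x \<in> coset a \<longleftrightarrow> x - a \<in> preproj_ideal"
proof
  assume "x - a \<in> preproj_ideal"
  then show "x \<in> coset a" unfolding coset_eq by (rule rev_image_eqI) simp
qed (auto simp: coset_eq)

lemma coset_eq_iff: "coset a = coset b \<longleftrightarrow> a - b \<in> preproj_ideal"
proof
  assume "coset a = coset b"
  moreover have "a \<in> coset a" by (simp add: coset_iff preproj_zero)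
  ultimately show "a - b \<in> preproj_ideal" using coset_iff by simp
next
  assume ab: "a - b \<in> preproj_ideal"
  show "coset a = coset b"
  proof (rule Set.set_eqI)
    fix x
    show "x \<in> coset a \<longleftrightarrow> x \<in> coset b"
      unfolding coset_iff using preproj_add[OF _ ab, of "x - a"] preproj_diff[OF _ ab, of "x - b"] by auto
  qed
qed

lemma coset_add: "coset a <+>\<^bsub>path_algebra\<^esub> coset b = coset (a + b)"
proof (rule Set.set_eqI)
  fix x
  have "x \<in> coset a <+>\<^bsub>path_algebra\<^esub> coset b \<longleftrightarrow> (\<exists>h\<in>coset a. \<exists>k\<in>coset b. x = h + k)"
    by (simp add: set_add_def')
  also have "\<dots> \<longleftrightarrow> x \<in> coset (a + b)"
  proof
    assume "\<exists>h\<in>coset a. \<exists>k\<in>coset b. x = h + k"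
    then obtain h k where h: "h - a \<in> preproj_ideal" "k - b \<in> preproj_ideal" "x = h + k" by (auto simp: coset_iff)
    from preproj_add[OF h(1,2)] show "x \<in> coset (a + b)" by (simp add: coset_iff h(3) algebra_simps)
  next
    assume x: "x \<in> coset (a + b)"
    show "\<exists>h\<in>coset a. \<exists>k\<in>coset b. x = h + k"
    proof (intro bexI)
      show "x = (x - b) + b" by simp
      show "b \<in> coset b" by (simp add: coset_iff preproj_zero)
      show "x - b \<in> coset a" using x by (simp add: coset_iff algebra_simps)
    qed
  qed
  finally show "x \<in> coset a <+>\<^bsub>path_algebra\<^esub> coset b \<longleftrightarrow> x \<in> coset (a + b)" .
qed

text \<open>The scalar multiplication of \<open>Pi_Qhat\<close> is a union over all representatives;
  since the ideal is a subspace, the cosets in the union coincide.\<close>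

lemma coset_smult: "(\<Union>x\<in>coset a. coset (ps c x)) = coset (ps c a)"
proof (rule equalityI)
  have "coset (ps c x) = coset (ps c a)" if "x \<in> coset a" for x
    using preproj_ps[OF that[unfolded coset_iff], of c] by (simp add: coset_eq_iff ps.scale_right_diff_distrib)
  then show "(\<Union>x\<in>coset a. coset (ps c x)) \<subseteq> coset (ps c a)" by (intro UN_least) (rule equalityD1)
  have "a \<in> coset a" by (simp add: coset_iff preproj_zero)
  from UN_upper[OF this, of "\<lambda>x. coset (ps c x)"] show "coset (ps c a) \<subseteq> (\<Union>x\<in>coset a. coset (ps c x))" .
qed

lemma vs_Pi: "vs_image ps (Path q q') coset (Pi_Qhat q q')"
proof
  show "zero (Pi_Qhat q q') = coset 0" by (auto simp: Pi_Qhat_def coset_iff)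
qed (simp_all add: Pi_Qhat_def Path_add Path_ps coset_add coset_smult)

text \<open>Two elements of \<open>Path q q'\<close> have the same coset exactly if they evaluate to
  the same morphism. Sending a morphism to the coset of a lift is therefore linear and
  bijective.\<close>

lemma HomC_Pi_iso:
  assumes q: "q \<in> Qhat_verts" and q': "q' \<in> Qhat_verts"
  shows "\<exists>f. linear_map class_ring (HomC q q') (Pi_Qhat q q') f \<and> bij_betw f (carrier (HomC q q')) (carrier (Pi_Qhat q q'))"
proof -
  interpret H: vs_iso psc "hq q q'" "mr q q'" "HomC q q'" by (rule HomC_iso[OF vert_I[OF q] vert_I[OF q']])
  interpret P: vs_image ps "Path q q'" coset "Pi_Qhat q q'" by (rule vs_Pi)
  define ev' where "ev' = (\<lambda>a. mr q q' (path_eval q q' a))"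
  \<comment> \<open>An arbitrary lift of a morphism to paths; it need not be linear, but its coset
    depends linearly on the morphism.\<close>
  define g where "g = (\<lambda>\<phi>. SOME a. a \<in> Path q q' \<and> ev' a = \<phi>)"
  have g: "g \<phi> \<in> Path q q' \<and> ev' (g \<phi>) = \<phi>" if \<phi>: "\<phi> \<in> carrier (HomC q q')" for \<phi>
  proof -
    from \<phi>[unfolded H.W_carrier] obtain M where M: "\<phi> = mr q q' M" "M \<in> hq q q'" by (rule imageE)
    from path_eval_surj[OF q' q M(2)] obtain a where "a \<in> Path q q'" "path_eval q q' a = M" by (elim exE conjE)
    then have "a \<in> Path q q' \<and> ev' a = \<phi>" by (simp add: ev'_def M(1))
    then show ?thesis unfolding g_def by (rule someI)
  qed
  have ev_carrier': "ev' a \<in> carrier (HomC q q')" if "a \<in> Path q q'" for a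
    unfolding ev'_def H.W_carrier by (rule imageI[OF path_eval_hm[OF that]])
  have eqv: "coset a = coset b \<longleftrightarrow> ev' a = ev' b" if a: "a \<in> Path q q'" and b: "b \<in> Path q q'" for a b
  proof
    assume "coset a = coset b"
    then have "a - b \<in> eval_kernel" unfolding coset_eq_iff by (rule subsetD[OF preproj_eval_kernel])
    from eval_kernel_D(2)[OF this] have "path_eval q q' a - path_eval q q' b = 0" unfolding path_eval_simps(3) .
    then show "ev' a = ev' b" by (simp add: ev'_def)
  next
    assume "ev' a = ev' b"
    then have "path_eval q q' a = path_eval q q' b"
      unfolding ev'_def by (rule inj_onD[OF H.h_inj]) (rule path_eval_hm[OF a], rule path_eval_hm[OF b])
    then have "path_eval q q' (a - b) = 0" by simp
    then show "coset a = coset b" unfolding coset_eq_iff by (rule path_eval_kernel[OF q' q Path_diff[OF a b]])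
  qed
  have lin: "linear_map class_ring (HomC q q') (Pi_Qhat q q') (\<lambda>\<phi>. coset (g \<phi>))"
  proof (rule linear_mapI[OF H.vectorspace_W P.vectorspace_W])
    fix \<phi> assume \<phi>: "\<phi> \<in> carrier (HomC q q')"
    show "coset (g \<phi>) \<in> carrier (Pi_Qhat q q')" unfolding P.W_carrier using g[OF \<phi>] by simp
    show "coset (g (c \<odot>\<^bsub>HomC q q'\<^esub> \<phi>)) = c \<odot>\<^bsub>Pi_Qhat q q'\<^esub> coset (g \<phi>)" for c
    proof -
      have c: "ev' (ps c (g \<phi>)) = c \<odot>\<^bsub>HomC q q'\<^esub> \<phi>"
        using H.W_sc[OF path_eval_hm[OF conjunct1[OF g[OF \<phi>]]], of c] g[OF \<phi>] by (simp add: ev'_def)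
      have h: "c \<odot>\<^bsub>HomC q q'\<^esub> \<phi> \<in> carrier (HomC q q')"
        using ev_carrier'[OF Path_ps[OF conjunct1[OF g[OF \<phi>]]], of c] unfolding c .
      show ?thesis
        using P.W_sc[of "g \<phi>" c] eqv[of "g (c \<odot>\<^bsub>HomC q q'\<^esub> \<phi>)" "ps c (g \<phi>)"] g[OF \<phi>] g[OF h] c Path_ps by simp
    qed
    fix \<psi> assume \<psi>: "\<psi> \<in> carrier (HomC q q')"
    have c: "ev' (g \<phi> + g \<psi>) = \<phi> \<oplus>\<^bsub>HomC q q'\<^esub> \<psi>"
      using H.W_add[OF path_eval_hm[OF conjunct1[OF g[OF \<phi>]]] path_eval_hm[OF conjunct1[OF g[OF \<psi>]]]] g[OF \<phi>] g[OF \<psi>] by (simp add: ev'_def)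
    have p: "g \<phi> + g \<psi> \<in> Path q q'" using g[OF \<phi>] g[OF \<psi>] by (simp add: Path_add)
    have h: "\<phi> \<oplus>\<^bsub>HomC q q'\<^esub> \<psi> \<in> carrier (HomC q q')" using ev_carrier'[OF p] unfolding c .
    show "coset (g (\<phi> \<oplus>\<^bsub>HomC q q'\<^esub> \<psi>)) = coset (g \<phi>) \<oplus>\<^bsub>Pi_Qhat q q'\<^esub> coset (g \<psi>)"
      using P.W_add[of "g \<phi>" "g \<psi>"] eqv[of "g (\<phi> \<oplus>\<^bsub>HomC q q'\<^esub> \<psi>)" "g \<phi> + g \<psi>"] g[OF \<phi>] g[OF \<psi>] g[OF h] c p by simp
  qed
  have "bij_betw (\<lambda>\<phi>. coset (g \<phi>)) (carrier (HomC q q')) (carrier (Pi_Qhat q q'))"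
    unfolding bij_betw_def
  proof
    show "inj_on (\<lambda>\<phi>. coset (g \<phi>)) (carrier (HomC q q'))"
    proof (rule inj_onI)
      fix \<phi> \<psi> assume h: "\<phi> \<in> carrier (HomC q q')" "\<psi> \<in> carrier (HomC q q')" and "coset (g \<phi>) = coset (g \<psi>)"
      then show "\<phi> = \<psi>" using eqv[of "g \<phi>" "g \<psi>"] g[OF h(1)] g[OF h(2)] by simp
    qed
    show "(\<lambda>\<phi>. coset (g \<phi>)) ` carrier (HomC q q') = carrier (Pi_Qhat q q')"
    proof
      show "(\<lambda>\<phi>. coset (g \<phi>)) ` carrier (HomC q q') \<subseteq> carrier (Pi_Qhat q q')"
        unfolding P.W_carrier using g by blast
      show "carrier (Pi_Qhat q q') \<subseteq> (\<lambda>\<phi>. coset (g \<phi>)) ` carrier (HomC q q')"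
      proof
        fix A assume "A \<in> carrier (Pi_Qhat q q')"
        from this[unfolded P.W_carrier] obtain a where a: "A = coset a" "a \<in> Path q q'" by (rule imageE)
        have h: "ev' a \<in> carrier (HomC q q')" by (rule ev_carrier'[OF a(2)])
        show "A \<in> (\<lambda>\<phi>. coset (g \<phi>)) ` carrier (HomC q q')"
          by (rule image_eqI[OF _ h]) (use eqv[OF a(2), of "g (ev' a)"] g[OF h] a(1) in simp)
      qed
    qed
  qed
  then show ?thesis using lin by (intro exI conjI)
qed

end

theorem theorem7p3:
  fixes G :: "complex mat set"
    and I :: "'i set"
    and dg :: "'i \<Rightarrow> nat"
    and \<rho> :: "'i \<Rightarrow> complex mat \<Rightarrow> complex mat"
    and ev :: "complex mat"
    and E :: "'i \<times> int \<Rightarrow> 'i \<times> int \<Rightarrow> sheaf_mor set"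
    and q q' :: "'i \<times> int"
  assumes "mckay_quiver G I dg \<rho> ev E"
    and "q \<in> mckay.Qhat_verts I dg \<rho>"
    and "q' \<in> mckay.Qhat_verts I dg \<rho>"
  shows "\<exists>f. linear_map class_ring (mckay.HomC G dg \<rho> q q')
                 (mckay_quiver.Pi_Qhat G I dg \<rho> ev E q q') f \<and>
             bij_betw f (carrier (mckay.HomC G dg \<rho> q q'))
                 (carrier (mckay_quiver.Pi_Qhat G I dg \<rho> ev E q q'))"
  by (rule mckay_quiver.HomC_Pi_iso[OF assms])

end
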